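(* Let $P=(p_{ij})_{i,j=1}^K$ with $p_{ij}\in[0,1)$ be the matrix of connection probabilities of a directed stochastic block model, and assume that $P$ is irreducible and has support. Let $S=(s_{ij})$ with $s_{ij}=p_{ij}(1-p_{ij})$ be the variance profile, let $\sigma$ be the self-consistent density of states associated with $S$, and let $\kappa=\min_\gamma\frac{\langle\gamma\rangle}{|\gamma|}$, the minimum being over all cycles $\gamma$ in the edge-labeled directed graph associated with a normal form of $S$. Then the planar Novikov–Shubin invariant $$c_{\rm NS}:=\lim_{t\downarrow0}\frac{\log\int_{|z|\le t}\sigma(z)\,d^2z}{\log t}$$ (with the integral over $z\in\mathbb{C}$ with respect to Lebesgue measure) is $$c_{\rm NS}=2\kappa .$$ In particular, $c_{\rm NS}=2\,\frac{1+\ell_1}{1+\ell_1+\ell_2}$ for two non-negative integers $\ell_1,\ell_2$.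
   Context: Vectors in $\mathbb{C}^K$ form an algebra with entrywise operations (products, quotients, functions of vectors are entrywise; scalars are identified with constant vectors), and $\langle x\rangle:=\frac1K\sum_{i=1}^K x_i$ for $x \in \mathbb{C}^K$. Directed stochastic block model: the adjacency matrix $A=(a^{ij}_{\alpha\beta})$, $i,j\in\{1,\dots,K\}$, $\alpha,\beta\in\{1,\dots,n\}$, has independent entries, $a^{ij}_{\alpha\beta}$ being Bernoulli with parameter $p_{ij}$; thus $s_{ij}=\mathrm{Var}(a^{ij}_{\alpha\beta})$. Support: a non-negative $K\times K$ matrix $R=(r_{ij})$ has support if there is a permutation $\pi$ of $\{1,\dots,K\}$ with $r_{i\pi(i)}>0$ for all $i$. Self-consistent density of states: for $\eta,\tau>0$ let $v=v(\tau,\eta)\in(0,\infty)^K$ and $w=w(\tau,\eta)\in(0,\infty)^K$ be the unique positive solution of the coupled system $$\frac1v=\eta+Sw+\frac{\tau}{\eta+S^tv},\qquad \frac1w=\eta+S^tv+\frac{\tau}{\eta+Sw}.$$ For $z\in\mathbb{C}\setminus\{0\}$ set $$\sigma(z):=-\frac1{2\pi}\Delta_z\int_0^\infty\Big(\langle v(|z|^2,\eta)\rangle-\frac1{1+\eta}\Big)\,d\eta ,$$ where $\Delta_z$ is the Laplacian on $\mathbb{C}\cong\mathbb{R}^2$. Normal form: since $S$ has support, there are permutation matrices $Q_1,Q_2$ such that $\widetilde S:=Q_1SQ_2^t$ is block upper triangular, $\widetilde S=(\widetilde S_{lk})_{l,k=1}^L$ with $\widetilde S_{lk}=0$ for $l>k$,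 and the square diagonal blocks $\widetilde S_{11},\dots,\widetilde S_{LL}$ are primitive with positive main diagonal. Fix such a choice. Let $Q:=Q_1Q_2^t$, partitioned into blocks $Q_{lk}$ in the same way as $\widetilde S$. Labeled graph: for $l,k\in\{1,\dots,L\}$ define $$l\lhd k:\Leftrightarrow \widetilde S_{lk}\neq0\text{ and }l\neq k,\qquad l\prec k:\Leftrightarrow Q_{lk}\ne0 .$$ The edge-labeled directed graph on $\{1,\dots,L\}$ has a $\lhd$-labeled edge $(l,k)$ for every $l\lhd k$ and a $\prec$-labeled edge $(l,k)$ for every $l\prec k$ (self-loops of type $\prec$ are possible; if both relations hold for $(l,k)$ there are two parallel edges, one of each label). A path $\gamma=e_1e_2\cdots e_\ell$, $\ell\ge1$, is a finite concatenation of labeled edges $e_j=(k_{j-1},k_j)$; $|\gamma|:=\ell$, and $\langle\gamma\rangle$ is the number of $j$ for which $e_j$ is $\prec$-labeled. It is a cycle if $k_0=k_\ell$. *)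

theory Defs
  imports
    "HOL-Analysis.Analysis"
    "HOL-Combinatorics.Permutations"
    "Jordan_Normal_Form.Matrix"
    "Graph_Theory.Arc_Walk"
begin

unbundle no vec_syntax \<comment> \<open>\<open>$\<close> is the entry operator of \<open>Jordan_Normal_Form.Matrix\<close>\<close>

text \<open>Indices \<open>{1,\<dots>,K}\<close> are shifted to \<open>{0,\<dots>,K-1}\<close> throughout, and likewise for block indices.\<close>

section \<open>Non-negative matrices\<close>

definition has_support :: "real mat \<Rightarrow> bool" where
  "has_support R \<longleftrightarrow> (\<exists>\<pi>. \<pi> permutes {..<dim_row R} \<and> (\<forall>i<dim_row R. R $$ (i, \<pi> i) > 0))"

text \<open>Irreducibility and primitivity of an (implicitly square and entrywise non-negative) matrix.\<close>

definition irreducible_mat :: "real mat \<Rightarrow> bool" where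
  "irreducible_mat R \<longleftrightarrow> (\<forall>i<dim_row R. \<forall>j<dim_row R. \<exists>m\<ge>1. (R ^\<^sub>m m) $$ (i, j) > 0)"

definition primitive_mat :: "real mat \<Rightarrow> bool" where
  "primitive_mat R \<longleftrightarrow> (\<exists>m\<ge>1. \<forall>i<dim_row R. \<forall>j<dim_row R. (R ^\<^sub>m m) $$ (i, j) > 0)"

definition permutation_mat :: "nat \<Rightarrow> real mat \<Rightarrow> bool" where
  "permutation_mat K Q \<longleftrightarrow>
    (\<exists>\<pi>. \<pi> permutes {..<K} \<and> Q = mat K K (\<lambda>(i, j). if j = \<pi> i then 1 else 0))"

section \<open>Self-consistent density of states\<close>

definition variance_profile :: "real mat \<Rightarrow> real mat" where
  "variance_profile P =
    mat (dim_row P) (dim_col P) (\<lambda>(i, j). P $$ (i, j) * (1 - P $$ (i, j)))"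

definition vec_mean :: "real vec \<Rightarrow> real" where
  "vec_mean x = (\<Sum>i<dim_vec x. x $ i) / real (dim_vec x)"

definition positive_solution ::
    "real mat \<Rightarrow> real \<Rightarrow> real \<Rightarrow> real vec \<Rightarrow> real vec \<Rightarrow> bool" where
  "positive_solution S \<tau> \<eta> v w \<longleftrightarrow>
    v \<in> carrier_vec (dim_row S) \<and> w \<in> carrier_vec (dim_row S) \<and>
    (\<forall>i<dim_row S.
      v $ i > 0 \<and> w $ i > 0 \<and>
      1 / v $ i = \<eta> + (S *\<^sub>v w) $ i + \<tau> / (\<eta> + (S\<^sup>T *\<^sub>v v) $ i) \<and>
      1 / w $ i = \<eta> + (S\<^sup>T *\<^sub>v v) $ i + \<tau> / (\<eta> + (S *\<^sub>v w) $ i))"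

text \<open>The \<open>v\<close>-component of the unique positive solution (for \<open>\<tau>, \<eta> > 0\<close>).\<close>

definition sol_v :: "real mat \<Rightarrow> real \<Rightarrow> real \<Rightarrow> real vec" where
  "sol_v S \<tau> \<eta> = fst (THE (v, w). positive_solution S \<tau> \<eta> v w)"

definition laplacian :: "(complex \<Rightarrow> real) \<Rightarrow> complex \<Rightarrow> real" where
  "laplacian f z =
    (deriv ^^ 2) (\<lambda>x. f (z + of_real x)) 0 + (deriv ^^ 2) (\<lambda>y. f (z + \<i> * of_real y)) 0"

text \<open>Only the values for \<open>z \<noteq> 0\<close> are meaningful; \<open>{0}\<close> is a null set.\<close>

definition scdos :: "real mat \<Rightarrow> complex \<Rightarrow> real" where
  "scdos S z = - 1 / (2 * pi) *
    laplacian
      (\<lambda>\<zeta>. LINT \<eta>:{0<..}|lborel. vec_mean (sol_v S ((cmod \<zeta>)\<^sup>2) \<eta>) - 1 / (1 + \<eta>)) z"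

section \<open>Normal form\<close>

text \<open>A partition of \<open>{0,\<dots>,K-1}\<close> into \<open>L\<close> consecutive non-empty blocks is given by the list
  \<open>bs\<close> of block sizes, so \<open>L = length bs\<close>.\<close>

definition block :: "nat list \<Rightarrow> real mat \<Rightarrow> nat \<Rightarrow> nat \<Rightarrow> real mat" where
  "block bs M l k = mat (bs ! l) (bs ! k)
    (\<lambda>(i, j). M $$ (sum_list (take l bs) + i, sum_list (take k bs) + j))"

definition normal_form :: "real mat \<Rightarrow> real mat \<Rightarrow> real mat \<Rightarrow> nat list \<Rightarrow> bool" where
  "normal_form S Q1 Q2 bs \<longleftrightarrow>
    permutation_mat (dim_row S) Q1 \<and> permutation_mat (dim_row S) Q2 \<and>
    0 \<notin> set bs \<and> sum_list bs = dim_row S \<and>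
    (let St = Q1 * S * Q2\<^sup>T in
      (\<forall>l<length bs. \<forall>k<l. block bs St l k = 0\<^sub>m (bs ! l) (bs ! k)) \<and>
      (\<forall>l<length bs. primitive_mat (block bs St l l) \<and>
        (\<forall>i<bs ! l. block bs St l l $$ (i, i) > 0)))"

section \<open>Edge-labeled directed graph\<close>

datatype edge_label = Lhd | Prec

text \<open>An edge \<open>(l, a, k)\<close> leads from \<open>l\<close> to \<open>k\<close> and carries the label \<open>a\<close>.\<close>

definition block_graph ::
    "real mat \<Rightarrow> real mat \<Rightarrow> real mat \<Rightarrow> nat list \<Rightarrow> (nat, nat \<times> edge_label \<times> nat) pre_digraph" where
  "block_graph S Q1 Q2 bs =
    \<lparr> verts = {..<length bs},
      arcs =
        {(l, Lhd, k) | l k. l < length bs \<and> k < length bs \<and> l \<noteq> k \<and>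
          block bs (Q1 * S * Q2\<^sup>T) l k \<noteq> 0\<^sub>m (bs ! l) (bs ! k)} \<union>
        {(l, Prec, k) | l k. l < length bs \<and> k < length bs \<and>
          block bs (Q1 * Q2\<^sup>T) l k \<noteq> 0\<^sub>m (bs ! l) (bs ! k)},
      tail = (\<lambda>(l, a, k). l),
      head = (\<lambda>(l, a, k). k) \<rparr>"

definition prec_count :: "(nat \<times> edge_label \<times> nat) list \<Rightarrow> nat" where
  "prec_count \<gamma> = length (filter (\<lambda>(l, a, k). a = Prec) \<gamma>)"

text \<open>Cycles are closed walks of positive length, vertices and edges may repeat. There are
  infinitely many of them, hence the minimum is expressed by \<open>LEAST\<close> rather than \<open>Min\<close>.\<close>

definition min_cycle_ratio :: "(nat, nat \<times> edge_label \<times> nat) pre_digraph \<Rightarrow> real" where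
  "min_cycle_ratio G =
    (LEAST r. \<exists>\<gamma>. (\<exists>u. pre_digraph.awalk G u \<gamma> u) \<and> \<gamma> \<noteq> [] \<and>
      r = real (prec_count \<gamma>) / real (length \<gamma>))"

end

theory Submission
  imports Defs "HOL-Real_Asymp.Real_Asymp"
begin

text \<open>
  Write \<open>a = \<eta> + S w\<close> and \<open>b = \<eta> + S\<^sup>t v\<close>. The potential
  \<open>\<Phi> = \<Sum> ln (a b + \<tau>) - \<Sum> v S w\<close> is stationary in \<open>v\<close> and \<open>w\<close> at a solution, so its
  \<open>\<eta>\<close>-derivative is \<open>2 \<Sum> v\<close> and its \<open>\<tau>\<close>-derivative is \<open>\<Sum> 1 / (a b + \<tau>)\<close>. Integrating
  over \<open>\<eta>\<close> and taking the Laplacian shows that \<open>\<sigma>\<close> gives the disc of radius \<open>t\<close> the mass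
  \<open>\<langle>y\<rangle>\<close> at \<open>\<tau> = t\<^sup>2\<close>, where \<open>y = \<tau> / (a b + \<tau>)\<close> is evaluated at \<open>\<eta> = 0\<close>.

  At \<open>\<eta> = 0\<close> the matrix \<open>v\<^sub>i s\<^sub>i\<^sub>j w\<^sub>j\<close> has row and column sums \<open>1 - y\<close>, so adding \<open>y\<close> on the
  diagonal makes it doubly stochastic: mass circulates on the block graph, with \<open>v\<^sub>i s\<^sub>i\<^sub>j w\<^sub>j\<close> on the
  \<open>\<lhd>\<close>-edges and \<open>y \<approx> \<tau> v w\<close> on the \<open>\<prec>\<close>-edges. An entropy estimate bounds \<open>v\<^sub>i w\<^sub>j\<close> from above
  and below within each block. In the product of these masses along a cycle the factors \<open>v\<close> and \<open>w\<close>
  cancel up to constants, which leaves \<open>\<tau>\<close> to the number of \<open>\<prec>\<close>-edges. Every mass is at most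
  \<open>\<Sum> y\<close>, and some cycle carries on all its edges a mass comparable to \<open>\<Sum> y\<close>; hence
  \<open>\<Sum> y \<approx> \<tau>\<^sup>\<kappa>\<close>.
\<close>

section \<open>The coupled system\<close>

text \<open>At \<open>\<eta> = 0\<close>, where the exponent is read off, the system is invariant
  under multiplying \<open>v\<close> and dividing \<open>w\<close> by the same constant. Solutions
  come in curves, the linearisation is singular, and the implicit function theorem does not apply.
  Two devices get around this. Requiring \<open>v\<close> and \<open>w\<close> to have equal sums
  singles out one solution; for \<open>\<eta> > 0\<close> this holds by itself. And in the
  coordinates \<open>ln v\<close> and \<open>- ln w\<close> the difference of two solutions solves a
  linear system with non-negative coefficients and row sums at most 1, whose degenerate direction is
  the constant vector; irreducibility bounds the difference modulo constants. This gives Lipschitz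
  dependence down to \<open>\<eta> = 0\<close> and, for difference quotients, the continuous
  derivative of the total defect that the Laplacian calls for.

  As \<open>\<tau>\<close> tends to 0, entries of \<open>v\<close> and \<open>w\<close> may
  degenerate at different rates, so no limiting problem is solved. The way in is the entropy
  estimate: it bounds the sum of \<open>y\<close> by a multiple of 1 / |ln \<tau>|, far from the
  true power of \<open>\<tau>\<close> but enough to start.\<close>

definition lin :: "nat \<Rightarrow> (nat \<Rightarrow> nat \<Rightarrow> real) \<Rightarrow> real \<Rightarrow> (nat \<Rightarrow> real) \<Rightarrow> nat \<Rightarrow> real" where
  "lin K s \<eta> w i = \<eta> + (\<Sum>j<K. s i j * w j)"

definition sol :: "nat \<Rightarrow> (nat \<Rightarrow> nat \<Rightarrow> real) \<Rightarrow> real \<Rightarrow> real \<Rightarrow> (nat \<Rightarrow> real) \<Rightarrow> (nat \<Rightarrow> real) \<Rightarrow> bool" where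
  "sol K s \<tau> \<eta> v w \<longleftrightarrow> (\<forall>i<K. v i > 0 \<and> w i > 0 \<and>
     1 / v i = lin K s \<eta> w i + \<tau> / lin K (\<lambda>i j. s j i) \<eta> v i \<and>
     1 / w i = lin K (\<lambda>i j. s j i) \<eta> v i + \<tau> / lin K s \<eta> w i)"

lemma sol_swap: "sol K s \<tau> \<eta> v w \<Longrightarrow> sol K (\<lambda>i j. s j i) \<tau> \<eta> w v"
  unfolding sol_def by auto

locale variance_matrix =
  fixes K :: nat and s :: "nat \<Rightarrow> nat \<Rightarrow> real"
  assumes K_pos: "K > 0" and s_nonneg: "s i j \<ge> 0" and s_le_1: "s i j \<le> 1"
begin

abbreviation a :: "real \<Rightarrow> (nat \<Rightarrow> real) \<Rightarrow> nat \<Rightarrow> real" where "a \<equiv> lin K s"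
abbreviation b :: "real \<Rightarrow> (nat \<Rightarrow> real) \<Rightarrow> nat \<Rightarrow> real" where "b \<equiv> lin K (\<lambda>i j. s j i)"

lemma variance_matrix_transpose: "variance_matrix K (\<lambda>i j. s j i)"
  using K_pos s_nonneg s_le_1 by unfold_locales auto

lemma lin_mono: "(\<And>j. j < K \<Longrightarrow> w j \<le> w' j) \<Longrightarrow> a \<eta> w i \<le> a \<eta> w' i"
  unfolding lin_def by (auto intro!: sum_mono mult_left_mono s_nonneg)

lemma lin_ge: "(\<And>j. j < K \<Longrightarrow> w j \<ge> 0) \<Longrightarrow> \<eta> \<le> a \<eta> w i"
  unfolding lin_def by (auto intro!: sum_nonneg mult_nonneg_nonneg s_nonneg)

lemma lin_le: fixes c :: real assumes "\<And>j. j < K \<Longrightarrow> 0 \<le> w j \<and> w j \<le> c" shows "a \<eta> w i \<le> \<eta> + K * c"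
proof -
  have "(\<Sum>j<K. s i j * w j) \<le> (\<Sum>j<K. 1 * c)"
    using assms s_nonneg s_le_1 by (intro sum_mono mult_mono) auto
  then show ?thesis unfolding lin_def by simp
qed

lemma lin_scale_less:
  assumes "c > 1" "\<eta> > 0" "\<And>j. j < K \<Longrightarrow> w' j \<le> c * w j"
  shows "a \<eta> w' i < c * a \<eta> w i"
proof -
  have "(\<Sum>j<K. s i j * w' j) \<le> (\<Sum>j<K. s i j * (c * w j))"
    by (intro sum_mono mult_left_mono s_nonneg assms) auto
  also have "\<dots> = c * (\<Sum>j<K. s i j * w j)" by (simp add: sum_distrib_left mult_ac)
  moreover have "\<eta> < c * \<eta>" using assms by simp
  ultimately show ?thesis unfolding lin_def distrib_left by linarith
qed

end

text \<open>The system is monotone for the order that raises \<open>v\<close> and lowers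
  \<open>w\<close>, hence the crossed ratios \<open>v' / v\<close> and \<open>w / w'\<close>. If
  their maximum \<open>c\<close> exceeded 1, the summand \<open>\<eta> > 0\<close>, which is not
  multiplied by \<open>c\<close>, would push every ratio strictly below \<open>c\<close>. Exchanging
  the two solutions then gives uniqueness.\<close>

lemma sol_le_aux:
  assumes "variance_matrix K s" "\<tau> > 0" "\<eta> > 0" "sol K s \<tau> \<eta> v w" "sol K s \<tau> \<eta> v' w'"
  shows "\<forall>i<K. v' i \<le> v i \<and> w i \<le> w' i"
proof -
  interpret variance_matrix K s by fact
  interpret T: variance_matrix K "\<lambda>i j. s j i" by (rule variance_matrix_transpose)
  have pos: "v i > 0" "w i > 0" "v' i > 0" "w' i > 0" if "i < K" for i
    using assms that unfolding sol_def by auto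
  define c where "c = Max ((\<lambda>i. v' i / v i) ` {..<K} \<union> (\<lambda>i. w i / w' i) ` {..<K})"
  have fin: "finite ((\<lambda>i. v' i / v i) ` {..<K} \<union> (\<lambda>i. w i / w' i) ` {..<K})" by simp
  have ne: "(\<lambda>i. v' i / v i) ` {..<K} \<union> (\<lambda>i. w i / w' i) ` {..<K} \<noteq> {}" using K_pos by auto
  have c1: "v' i \<le> c * v i" "w i \<le> c * w' i" if "i < K" for i
  proof -
    have "v' i / v i \<le> c" "w i / w' i \<le> c" unfolding c_def using that by (auto intro!: Max_ge)
    then show "v' i \<le> c * v i" "w i \<le> c * w' i" using pos[OF that] by (auto simp: field_simps)
  qed
  have "c \<le> 1"
  proof (rule ccontr)
    assume "\<not> c \<le> 1"
    then have c: "c > 1" by simp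
    have A: "a \<eta> w i < c * a \<eta> w' i" for i
      using lin_scale_less[OF c assms(3), of w w'] c1 by auto
    have B: "b \<eta> v' i < c * b \<eta> v i" for i
      using T.lin_scale_less[OF c assms(3), of v' v] c1 by auto
    have ge: "a \<eta> w i > 0" "a \<eta> w' i > 0" "b \<eta> v i > 0" "b \<eta> v' i > 0" for i
      using lin_ge[of w \<eta> i] lin_ge[of w' \<eta> i] T.lin_ge[of v \<eta> i] T.lin_ge[of v' \<eta> i] pos assms(3)
      by (smt (verit))+
    have V: "v' i < c * v i" if "i < K" for i
    proof -
      have "\<tau> / (c * b \<eta> v i) < \<tau> / b \<eta> v' i"
        using B[of i] ge[of i] assms(2) c by (intro divide_strict_left_mono) auto
      moreover have "a \<eta> w i / c < a \<eta> w' i" using A[of i] c by (simp add: field_simps)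
      ultimately have "(a \<eta> w i + \<tau> / b \<eta> v i) / c < a \<eta> w' i + \<tau> / b \<eta> v' i"
        by (simp add: add_divide_distrib mult.commute)
      then have "1 / v i / c < 1 / v' i" using assms(4,5) that unfolding sol_def by auto
      then show ?thesis using pos[OF that] c by (simp add: field_simps)
    qed
    have W: "w i < c * w' i" if "i < K" for i
    proof -
      have "\<tau> / (c * a \<eta> w' i) < \<tau> / a \<eta> w i"
        using A[of i] ge[of i] assms(2) c by (intro divide_strict_left_mono) auto
      moreover have "b \<eta> v' i / c < b \<eta> v i" using B[of i] c by (simp add: field_simps)
      ultimately have "(b \<eta> v' i + \<tau> / a \<eta> w' i) / c < b \<eta> v i + \<tau> / a \<eta> w i"
        by (simp add: add_divide_distrib mult.commute)
      then have "1 / w' i / c < 1 / w i" using assms(4,5) that unfolding sol_def by auto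
      then show ?thesis using pos[OF that] c by (simp add: field_simps)
    qed
    have "c \<in> (\<lambda>i. v' i / v i) ` {..<K} \<union> (\<lambda>i. w i / w' i) ` {..<K}"
      unfolding c_def by (rule Max_in[OF fin ne])
    then obtain i where i: "i < K" "c = v' i / v i \<or> c = w i / w' i" by auto
    then show False using V[OF i(1)] W[OF i(1)] pos[OF i(1)] by (auto simp: field_simps)
  qed
  show ?thesis
  proof (intro allI impI conjI)
    fix i assume i: "i < K"
    show "v' i \<le> v i" using c1[OF i] \<open>c \<le> 1\<close> pos[OF i] by (smt (verit) mult_left_le_one_le mult_right_mono)
    show "w i \<le> w' i" using c1[OF i] \<open>c \<le> 1\<close> pos[OF i] by (smt (verit) mult_left_le_one_le mult_right_mono)
  qed
qed

lemma sol_unique: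
  assumes "variance_matrix K s" "\<tau> > 0" "\<eta> > 0" "sol K s \<tau> \<eta> v w" "sol K s \<tau> \<eta> v' w'" "i < K"
  shows "v i = v' i" "w i = w' i"
  using sol_le_aux[OF assms(1-5)] sol_le_aux[OF assms(1-3,5,4)] assms(6) by (auto simp: order_antisym)

text \<open>In the variables \<open>v\<close> and \<open>u = 1 / w\<close> the system is a fixed point equation for a monotone map.\<close>

lemma sol_exists:
  assumes "variance_matrix K s" "\<tau> > 0" "\<eta> > 0"
  shows "\<exists>v w. sol K s \<tau> \<eta> v w"
proof -
  interpret variance_matrix K s by fact
  interpret T: variance_matrix K "\<lambda>i j. s j i" by (rule variance_matrix_transpose)
  define f where "f = (\<lambda>v u i. 1 / (a \<eta> (\<lambda>j. 1 / u j) i + \<tau> / b \<eta> v i))"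
  define g where "g = (\<lambda>v u i. b \<eta> v i + \<tau> / a \<eta> (\<lambda>j. 1 / u j) i)"
  \<comment> \<open>Upper bound for \<open>a + \<tau> / b\<close> and \<open>b + \<tau> / a\<close>
    once the entries of \<open>v\<close> and \<open>w\<close> are at most \<open>1 / \<eta>\<close>.
    It makes the box \<open>low \<le> v \<le> 1 / \<eta>\<close>,
    \<open>\<eta> \<le> u \<le> U\<close> invariant.\<close>
  define U where "U = \<eta> + K * (1 / \<eta>) + \<tau> / \<eta>"
  define low where "low = 1 / U"
  have U: "U > 0" "\<eta> \<le> U" unfolding U_def using assms by (auto intro!: add_pos_nonneg)
  have apos: "a \<eta> (\<lambda>j. 1 / u j) i \<ge> \<eta>" if "\<And>j. u j \<ge> \<eta>" for u i
  proof (rule lin_ge)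
    fix j have "u j > 0" using that[of j] assms by linarith
    then show "1 / u j \<ge> 0" by simp
  qed
  have bpos: "b \<eta> v i \<ge> \<eta>" if "\<And>j. v j \<ge> low" for v i
  proof (rule T.lin_ge)
    fix j have "v j > 0" using that[of j] U unfolding low_def by (smt (verit) divide_pos_pos)
    then show "v j \<ge> 0" by simp
  qed
  have aub: "a \<eta> (\<lambda>j. 1 / u j) i \<le> \<eta> + K * (1 / \<eta>)" if "\<And>j. u j \<ge> \<eta>" for u i
  proof (rule lin_le)
    fix j have "u j > 0" using that[of j] assms by linarith
    then show "0 \<le> 1 / u j \<and> 1 / u j \<le> 1 / \<eta>" using that[of j] assms by (auto simp: frac_le)
  qed
  have bub: "b \<eta> v i \<le> \<eta> + K * (1 / \<eta>)" if "\<And>j. v j \<ge> low" "\<And>j. v j \<le> 1 / \<eta>" for v i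
  proof (rule T.lin_le)
    fix j have "v j > 0" using that(1)[of j] U unfolding low_def by (smt (verit) divide_pos_pos)
    then show "0 \<le> v j \<and> v j \<le> 1 / \<eta>" using that(2)[of j] by auto
  qed
  have inv: "low \<le> f v u i \<and> f v u i \<le> 1 / \<eta> \<and> \<eta> \<le> g v u i \<and> g v u i \<le> U"
    if "\<And>j. low \<le> v j" "\<And>j. v j \<le> 1 / \<eta>" "\<And>j. \<eta> \<le> u j" for v u i
  proof -
    have "0 \<le> \<tau> / b \<eta> v i" "0 \<le> \<tau> / a \<eta> (\<lambda>j. 1 / u j) i"
      using apos[of u i] bpos[of v i] that assms by (smt (verit) divide_nonneg_pos)+
    moreover have "\<tau> / b \<eta> v i \<le> \<tau> / \<eta>" "\<tau> / a \<eta> (\<lambda>j. 1 / u j) i \<le> \<tau> / \<eta>"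
      using apos[of u i] bpos[of v i] that assms by (auto intro!: divide_left_mono mult_pos_pos)
    moreover note apos[of u i] bpos[of v i] aub[of u i] bub[of v i]
    ultimately have *: "\<eta> \<le> a \<eta> (\<lambda>j. 1 / u j) i + \<tau> / b \<eta> v i"
      "a \<eta> (\<lambda>j. 1 / u j) i + \<tau> / b \<eta> v i \<le> U" "\<eta> \<le> g v u i" "g v u i \<le> U"
      unfolding g_def U_def using that by (smt (verit))+
    have "low \<le> f v u i" unfolding f_def low_def using * assms by (intro divide_left_mono) auto
    moreover have "f v u i \<le> 1 / \<eta>" unfolding f_def using * assms by (intro divide_left_mono) auto
    ultimately show ?thesis using * by auto
  qed
  have mono: "f v u i \<le> f v' u' i \<and> g v u i \<le> g v' u' i"
    if "\<And>j. low \<le> v j" "\<And>j. v j \<le> v' j" "\<And>j. \<eta> \<le> u j" "\<And>j. u j \<le> u' j" for v u v' u' i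
  proof -
    have low': "\<And>j. low \<le> v' j" "\<And>j. \<eta> \<le> u' j" using that order_trans by blast+
    have 1: "a \<eta> (\<lambda>j. 1 / u' j) i \<le> a \<eta> (\<lambda>j. 1 / u j) i"
    proof (rule lin_mono)
      fix j have "u j > 0" using that(3)[of j] assms by linarith
      then show "1 / u' j \<le> 1 / u j" using that(4)[of j] by (auto simp: frac_le)
    qed
    have 2: "b \<eta> v i \<le> b \<eta> v' i" by (rule T.lin_mono) (use that in auto)
    have p: "a \<eta> (\<lambda>j. 1 / u' j) i > 0" "b \<eta> v i > 0" using apos[of u' i] bpos[of v i] low' that assms by (smt (verit))+
    have 3: "\<tau> / b \<eta> v' i \<le> \<tau> / b \<eta> v i" "\<tau> / a \<eta> (\<lambda>j. 1 / u j) i \<le> \<tau> / a \<eta> (\<lambda>j. 1 / u' j) i"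
      using 1 2 p assms by (auto intro!: divide_left_mono mult_pos_pos)
    have 4: "\<tau> / b \<eta> v' i \<ge> 0" using p 2 assms by (smt (verit) divide_nonneg_pos)
    show ?thesis unfolding f_def g_def using 1 2 3 4 p
      by (auto intro!: divide_left_mono mult_pos_pos add_mono add_pos_nonneg)
  qed
  \<comment> \<open>The iteration starts at the lowest corner of the invariant box, so its first
    step goes up, and monotonicity makes the whole sequence increasing.\<close>
  define V where "V = (\<lambda>n::nat. ((\<lambda>(v, u). (f v u, g v u)) ^^ n) (\<lambda>_. low, \<lambda>_. \<eta>))"
  define vn where "vn = (\<lambda>n. fst (V n))"
  define un where "un = (\<lambda>n. snd (V n))"
  have rec: "vn (Suc n) = f (vn n) (un n)" "un (Suc n) = g (vn n) (un n)" for n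
    unfolding vn_def un_def V_def by (auto simp: case_prod_beta)
  have low_le: "low \<le> 1 / \<eta>" unfolding low_def using U assms by (intro divide_left_mono) auto
  have bnd: "low \<le> vn n i \<and> vn n i \<le> 1 / \<eta> \<and> \<eta> \<le> un n i \<and> un n i \<le> U" for n i
  proof (induction n arbitrary: i)
    case 0 then show ?case using U low_le unfolding vn_def un_def V_def by auto
  next
    case (Suc n)
    show ?case unfolding rec by (rule inv) (use Suc in auto)
  qed
  have inc: "vn n i \<le> vn (Suc n) i \<and> un n i \<le> un (Suc n) i" for n i
  proof (induction n arbitrary: i)
    case 0 then show ?case using bnd[of "Suc 0" i] unfolding vn_def un_def V_def by auto
  next
    case (Suc n)
    show ?case unfolding rec(1)[of "Suc n"] rec(2)[of "Suc n"] rec(1)[of n] rec(2)[of n]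
      by (rule mono) (use Suc bnd in \<open>auto simp flip: rec\<close>)
  qed
  have "\<exists>l. (\<lambda>n. vn n i) \<longlonglongrightarrow> l" for i
    using incseq_convergent[of "\<lambda>n. vn n i" "1 / \<eta>"] inc bnd by (metis incseq_SucI)
  then obtain v where v: "\<And>i. (\<lambda>n. vn n i) \<longlonglongrightarrow> v i" by metis
  have "\<exists>l. (\<lambda>n. un n i) \<longlonglongrightarrow> l" for i
    using incseq_convergent[of "\<lambda>n. un n i" U] inc bnd by (metis incseq_SucI)
  then obtain u where u: "\<And>i. (\<lambda>n. un n i) \<longlonglongrightarrow> u i" by metis
  have lowv: "low \<le> v i" for i by (rule LIMSEQ_le_const[OF v]) (use bnd in auto)
  have lowu: "\<eta> \<le> u i" for i by (rule LIMSEQ_le_const[OF u]) (use bnd in auto)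
  have pos: "v i > 0" "u i > 0" for i using lowv[of i] lowu[of i] assms U unfolding low_def
    by (smt (verit) divide_pos_pos)+
  have ap: "a \<eta> (\<lambda>j. 1 / u j) i > 0" "b \<eta> v i > 0" for i
    using apos[of u i] bpos[of v i] lowv lowu assms by (smt (verit))+
  have la: "(\<lambda>n. a \<eta> (\<lambda>j. 1 / un n j) i) \<longlonglongrightarrow> a \<eta> (\<lambda>j. 1 / u j) i" for i
    unfolding lin_def using pos by (intro tendsto_intros u) (metis less_irrefl)
  have lb: "(\<lambda>n. b \<eta> (vn n) i) \<longlonglongrightarrow> b \<eta> v i" for i
    unfolding lin_def by (intro tendsto_intros v)
  have ap2: "a \<eta> (\<lambda>j. 1 / u j) i + \<tau> / b \<eta> v i > 0" for i using ap[of i] assms by (auto intro!: add_pos_pos)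
  have "(\<lambda>n. f (vn n) (un n) i) \<longlonglongrightarrow> f v u i" for i
    unfolding f_def using ap[of i] ap2[of i] by (intro tendsto_intros la lb) auto
  moreover have "(\<lambda>n. f (vn n) (un n) i) \<longlonglongrightarrow> v i" for i
    using LIMSEQ_Suc[OF v[of i]] by (simp add: rec)
  ultimately have fv: "v i = f v u i" for i using LIMSEQ_unique by blast
  have "(\<lambda>n. g (vn n) (un n) i) \<longlonglongrightarrow> g v u i" for i
    unfolding g_def using ap[of i] by (intro tendsto_intros la lb) auto
  moreover have "(\<lambda>n. g (vn n) (un n) i) \<longlonglongrightarrow> u i" for i
    using LIMSEQ_Suc[OF u[of i]] by (simp add: rec)
  ultimately have gu: "u i = g v u i" for i using LIMSEQ_unique by blast
  have "sol K s \<tau> \<eta> v (\<lambda>j. 1 / u j)" unfolding sol_def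
  proof (intro allI impI conjI)
    fix i
    show "1 / v i = a \<eta> (\<lambda>j. 1 / u j) i + \<tau> / b \<eta> v i"
      by (subst fv[of i]) (simp add: f_def)
    show "1 / (1 / u i) = b \<eta> v i + \<tau> / a \<eta> (\<lambda>j. 1 / u j) i"
      using gu[of i] by (simp add: g_def)
  qed (use pos in auto)
  then show ?thesis by blast
qed

section \<open>Almost stochastic linear systems\<close>

text \<open>\<open>C\<close> has to serve all matrices \<open>A\<close> with the same
  \<open>\<delta>\<close>, since the coefficients vary with the solution. In both alternatives a row
  average of the constant \<open>Max D\<close> is at most \<open>Max D\<close>: either the rows sum
  to 1, or they sum to at most 1 and \<open>Max D\<close> is non-negative.\<close>

definition propagates :: "'a set \<Rightarrow> ('a \<times> 'a) set \<Rightarrow> real \<Rightarrow> real \<Rightarrow> bool" where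
  "propagates N E \<delta> C \<longleftrightarrow> (\<forall>A D r \<beta>. (\<forall>i\<in>N. \<forall>j\<in>N. A i j \<ge> 0) \<longrightarrow>
    (\<forall>i\<in>N. \<forall>j\<in>N. (i, j) \<in> E \<longrightarrow> A i j \<ge> \<delta>) \<longrightarrow>
    (\<forall>i\<in>N. D i = (\<Sum>j\<in>N. A i j * D j) + r i) \<longrightarrow> (\<forall>i\<in>N. \<bar>r i\<bar> \<le> \<beta>) \<longrightarrow>
    ((\<forall>i\<in>N. (\<Sum>j\<in>N. A i j) = 1) \<or> (\<forall>i\<in>N. (\<Sum>j\<in>N. A i j) \<le> 1) \<and> (\<exists>i\<in>N. D i \<ge> 0)) \<longrightarrow>
    (\<forall>i\<in>N. \<forall>j\<in>N. D i - D j \<le> C * \<beta>))"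

lemma propagatesD:
  assumes "propagates N E \<delta> C" "\<And>i j. i \<in> N \<Longrightarrow> j \<in> N \<Longrightarrow> A i j \<ge> 0"
    "\<And>i j. i \<in> N \<Longrightarrow> j \<in> N \<Longrightarrow> (i, j) \<in> E \<Longrightarrow> A i j \<ge> \<delta>"
    "\<And>i. i \<in> N \<Longrightarrow> D i = (\<Sum>j\<in>N. A i j * D j) + r i" "\<And>i. i \<in> N \<Longrightarrow> \<bar>r i\<bar> \<le> \<beta>"
    "(\<forall>i\<in>N. (\<Sum>j\<in>N. A i j) = 1) \<or> (\<forall>i\<in>N. (\<Sum>j\<in>N. A i j) \<le> 1) \<and> (\<exists>i\<in>N. D i \<ge> 0)"
    "i \<in> N" "j \<in> N"
  shows "D i - D j \<le> C * \<beta>"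
  using assms(1)[unfolded propagates_def, rule_format, of A D r \<beta> i j] assms(2-) by blast

text \<open>The defect \<open>Max D - D j\<close> spreads from a maximiser along the edges of \<open>E\<close> with a loss of a
  bounded factor.\<close>

lemma propagation:
  fixes E :: "('a \<times> 'a) set" and \<delta> :: real
  assumes fin: "finite N" and conn: "\<And>i j. i \<in> N \<Longrightarrow> j \<in> N \<Longrightarrow> (i, j) \<in> E\<^sup>*"
    and EN: "E \<subseteq> N \<times> N" and \<delta>: "\<delta> > 0"
  shows "\<exists>C>0. propagates N E \<delta> C"
proof -
  \<comment> \<open>Loss after \<open>n\<close> edges: row \<open>l\<close> of the system gives
    \<open>A l k * (M - D k) \<le> M - D l + r l\<close>, so a defect \<open>c n * \<beta>\<close>
    at \<open>l\<close> becomes at most \<open>(c n + 1) / \<delta> * \<beta>\<close> at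
    \<open>k\<close>.\<close>
  define c where "c = rec_nat (0::real) (\<lambda>_ x. (x + 1) / \<delta>)"
  have c_simps: "c 0 = 0" "c (Suc n) = (c n + 1) / \<delta>" for n unfolding c_def by auto
  have c_nonneg: "c n \<ge> 0" for n by (induction n) (use \<delta> in \<open>auto simp: c_simps\<close>)
  have "\<exists>n. (i, j) \<in> E ^^ n" if "i \<in> N" "j \<in> N" for i j using conn[OF that] rtrancl_imp_relpow by blast
  then obtain n where n: "\<And>i j. i \<in> N \<Longrightarrow> j \<in> N \<Longrightarrow> (i, j) \<in> E ^^ n i j" by metis
  define C where "C = 1 + (\<Sum>(i, j)\<in>N \<times> N. c (n i j))"
  have C1: "c (n i j) \<le> C" if "i \<in> N" "j \<in> N" for i j
  proof -
    have "c (n i j) \<le> (\<Sum>(i, j)\<in>N \<times> N. c (n i j))"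
      using member_le_sum[of "(i, j)" "N \<times> N" "\<lambda>(i, j). c (n i j)"] that fin c_nonneg by auto
    then show ?thesis unfolding C_def by simp
  qed
  have "C > 0" unfolding C_def by (intro add_pos_nonneg sum_nonneg) (use c_nonneg in auto)
  moreover have "D i - D j \<le> C * \<beta>"
    if A0: "\<forall>i\<in>N. \<forall>j\<in>N. A i j \<ge> 0" and AE: "\<forall>i\<in>N. \<forall>j\<in>N. (i, j) \<in> E \<longrightarrow> A i j \<ge> \<delta>"
      and D: "\<forall>i\<in>N. D i = (\<Sum>j\<in>N. A i j * D j) + r i" and r: "\<forall>i\<in>N. \<bar>r i\<bar> \<le> \<beta>"
      and sto: "(\<forall>i\<in>N. (\<Sum>j\<in>N. A i j) = 1) \<or> (\<forall>i\<in>N. (\<Sum>j\<in>N. A i j) \<le> 1) \<and> (\<exists>i\<in>N. D i \<ge> 0)"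
      and ij: "i \<in> N" "j \<in> N" for A :: "'a \<Rightarrow> 'a \<Rightarrow> real" and D r :: "'a \<Rightarrow> real" and \<beta> :: real and i j
  proof -
    define M where "M = Max (D ` N)"
    have MD: "D k \<le> M" if "k \<in> N" for k unfolding M_def using fin that by auto
    have "M \<in> D ` N" unfolding M_def by (rule Max_in) (use fin ij in auto)
    then obtain i0 where i0: "i0 \<in> N" "D i0 = M" by auto
    have \<beta>0: "\<beta> \<ge> 0" using r ij(1) by force
    have rs: "(\<Sum>j\<in>N. A k j) * M \<le> M" if "k \<in> N" for k
      using sto
    proof (elim disjE)
      assume *: "(\<forall>i\<in>N. (\<Sum>j\<in>N. A i j) \<le> 1) \<and> (\<exists>i\<in>N. D i \<ge> 0)"
      then obtain l where "l \<in> N" "D l \<ge> 0" by auto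
      then have "M \<ge> 0" using MD[of l] by linarith
      then show ?thesis using * that by (intro mult_left_le_one_le) (auto intro!: sum_nonneg simp: A0)
    qed (use that in auto)
    have step: "M - D k \<le> (c m + 1) / \<delta> * \<beta>" if "l \<in> N" "M - D l \<le> c m * \<beta>" "(l, k) \<in> E" for l k m
    proof -
      have k: "k \<in> N" using that EN by auto
      have "A l k * (M - D k) \<le> (\<Sum>q\<in>N. A l q * (M - D q))"
        using member_le_sum[of k N "\<lambda>q. A l q * (M - D q)"] k fin A0 that MD by auto
      also have "\<dots> = (\<Sum>j\<in>N. A l j) * M - (\<Sum>j\<in>N. A l j * D j)"
        by (simp add: algebra_simps sum_subtractf sum_distrib_left)
      also have "\<dots> \<le> M - D l + r l" using rs[OF that(1)] D that(1) by auto
      also have "\<dots> \<le> (c m + 1) * \<beta>" using r that by (auto simp: algebra_simps abs_le_iff)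
      finally have "A l k * (M - D k) \<le> (c m + 1) * \<beta>" .
      moreover have "\<delta> * (M - D k) \<le> A l k * (M - D k)"
        using AE that k MD[OF k] by (intro mult_right_mono) auto
      ultimately have "\<delta> * (M - D k) \<le> (c m + 1) * \<beta>" by linarith
      then show ?thesis using \<delta> by (simp add: field_simps)
    qed
    have "M - D k \<le> c m * \<beta>" if "(i0, k) \<in> E ^^ m" for k m
      using that
    proof (induction m arbitrary: k)
      case 0 then show ?case using i0 by (simp add: c_simps)
    next
      case (Suc m)
      then obtain l where l: "(i0, l) \<in> E ^^ m" "(l, k) \<in> E" by auto
      then have "l \<in> N" using EN by auto
      then show ?case using step[OF _ Suc.IH[OF l(1)] l(2)] by (simp add: c_simps)
    qed
    then have "M - D j \<le> c (n i0 j) * \<beta>" using n i0 ij by blast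
    also have "\<dots> \<le> C * \<beta>" using C1[OF i0(1) ij(2)] \<beta>0 by (rule mult_right_mono)
    finally show ?thesis using MD[OF ij(1)] by linarith
  qed
  ultimately show ?thesis unfolding propagates_def
    by (intro exI[of _ C] conjI allI impI ballI)
qed

section \<open>The mean value identity\<close>

text \<open>The end points come in no fixed order, because two solutions need not be comparable
  entry by entry.\<close>

definition betw :: "real \<Rightarrow> real \<Rightarrow> real \<Rightarrow> bool" where
  "betw x y z \<longleftrightarrow> min y z \<le> x \<and> x \<le> max y z"

lemma betw_linear: assumes "0 \<le> t" "t \<le> 1" shows "betw (y + t * (z - y)) y z"
proof -
  have "y + t * (z - y) = (1 - t) * y + t * z" by (simp add: algebra_simps)
  moreover have "convex {min y z .. max y z}" by simp
  ultimately have "y + t * (z - y) \<in> {min y z .. max y z}"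
    using assms convexD[of "{min y z .. max y z}" y z "1 - t" t] by auto
  then show ?thesis unfolding betw_def by auto
qed

lemma betw_exp: assumes "betw x (ln y) (ln z)" "y > 0" "z > 0" shows "betw (exp x) y z"
  using assms unfolding betw_def min_def max_def
  by (smt (verit) exp_le_cancel_iff exp_ln)

lemma betw_bounds: "betw x y z \<Longrightarrow> l \<le> y \<Longrightarrow> l \<le> z \<Longrightarrow> l \<le> x"
  "betw x y z \<Longrightarrow> y \<le> u \<Longrightarrow> z \<le> u \<Longrightarrow> x \<le> u"
  unfolding betw_def by auto

text \<open>Partial derivatives of \<open>ln (v i) = - ln (a i + \<tau> / b i)\<close>:
  \<open>cdir\<close> in the variable \<open>- ln (w j)\<close>, \<open>ctra\<close> in
  \<open>ln (v j)\<close>, while \<open>csrc\<close> is minus the derivative in the direction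
  \<open>(d\<tau>, d\<eta>)\<close>. The sign in front of \<open>ln (w j)\<close> is what makes all
  coefficients non-negative.\<close>

definition cdir where "cdir K s \<tau> \<eta> v w i j =
  s i j * w j / (lin K s \<eta> w i + \<tau> / lin K (\<lambda>i j. s j i) \<eta> v i)"

definition ctra where "ctra K s \<tau> \<eta> v w i j =
  \<tau> * s j i * v j / ((lin K (\<lambda>i j. s j i) \<eta> v i)\<^sup>2 * (lin K s \<eta> w i + \<tau> / lin K (\<lambda>i j. s j i) \<eta> v i))"

definition csrc where "csrc K s \<tau> \<eta> v w d\<tau> d\<eta> i =
  (d\<eta> * (1 - \<tau> / (lin K (\<lambda>i j. s j i) \<eta> v i)\<^sup>2) + d\<tau> / lin K (\<lambda>i j. s j i) \<eta> v i) /
    (lin K s \<eta> w i + \<tau> / lin K (\<lambda>i j. s j i) \<eta> v i)"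

text \<open>The permutation is a parameter because it enters the estimates: it keeps
  \<open>a\<close> and \<open>b\<close> positive at \<open>\<eta> = 0\<close>, and the products
  \<open>v i * w (\<pi> i)\<close> are the ones that get two-sided bounds.\<close>

locale supported_matrix = variance_matrix +
  fixes \<pi> :: "nat \<Rightarrow> nat"
  assumes perm: "\<pi> permutes {..<K}" and s_pi: "i < K \<Longrightarrow> s i (\<pi> i) > 0"
begin

lemma supported_matrix_transpose: "supported_matrix K (\<lambda>i j. s j i) (inv_into UNIV \<pi>)"
proof -
  interpret T: variance_matrix K "\<lambda>i j. s j i" by (rule variance_matrix_transpose)
  show ?thesis
  proof
    show "inv_into UNIV \<pi> permutes {..<K}" by (rule permutes_inv[OF perm])
    fix i assume "i < K"
    then have "inv_into UNIV \<pi> i < K" using permutes_in_image[OF permutes_inv[OF perm], of i] by auto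
    then show "s (inv_into UNIV \<pi> i) i > 0" using s_pi[of "inv_into UNIV \<pi> i"] permutes_inverses(1)[OF perm] by simp
  qed
qed

lemma pi_less: "i < K \<Longrightarrow> \<pi> i < K" using permutes_in_image[OF perm, of i] by auto

lemma lin_ge_entry:
  assumes "\<eta> \<ge> 0" "\<And>j. j < K \<Longrightarrow> w j \<ge> 0" "i < K" shows "s i (\<pi> i) * w (\<pi> i) \<le> a \<eta> w i"
proof -
  have "s i (\<pi> i) * w (\<pi> i) \<le> (\<Sum>j<K. s i j * w j)"
    using member_le_sum[of "\<pi> i" "{..<K}" "\<lambda>j. s i j * w j"] pi_less[OF assms(3)] assms s_nonneg by auto
  then show ?thesis unfolding lin_def using assms by simp
qed

lemma lin_pos: assumes "\<eta> \<ge> 0" "\<And>j. j < K \<Longrightarrow> w j > 0" "i < K" shows "a \<eta> w i > 0"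
proof -
  have "0 < s i (\<pi> i) * w (\<pi> i)" using assms s_pi pi_less by auto
  also have "\<dots> \<le> a \<eta> w i" by (rule lin_ge_entry) (use assms less_imp_le in auto)
  finally show ?thesis .
qed

end

context supported_matrix begin

text \<open>Mean value theorem for \<open>ln (a + \<tau> / b)\<close> along the path that is linear
  in \<open>\<tau>\<close>, \<open>\<eta>\<close> and in the logarithms of \<open>v\<close>,
  \<open>w\<close>; its end values are \<open>- ln (v0 i)\<close> and \<open>- ln (v1 i)\<close>.
  The intermediate point is in general not a solution, so later bounds on the coefficients use only
  the box in which it lies.\<close>

lemma mean_value_v:
  assumes "sol K s \<tau>0 \<eta>0 v0 w0" "sol K s \<tau>1 \<eta>1 v1 w1" "\<tau>0 > 0" "\<tau>1 > 0" "\<eta>0 \<ge> 0" "\<eta>1 \<ge> 0" "i < K"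
  shows "\<exists>\<tau> \<eta> v w. betw \<tau> \<tau>0 \<tau>1 \<and> betw \<eta> \<eta>0 \<eta>1 \<and> (\<forall>j<K. betw (v j) (v0 j) (v1 j) \<and> betw (w j) (w0 j) (w1 j)) \<and>
    ln (v1 i) - ln (v0 i) = (\<Sum>j<K. cdir K s \<tau> \<eta> v w i j * (ln (w0 j) - ln (w1 j))) +
      (\<Sum>j<K. ctra K s \<tau> \<eta> v w i j * (ln (v1 j) - ln (v0 j))) -
      csrc K s \<tau> \<eta> v w (\<tau>1 - \<tau>0) (\<eta>1 - \<eta>0) i"
proof -
  interpret T: supported_matrix K "\<lambda>i j. s j i" "inv_into UNIV \<pi>" by (rule supported_matrix_transpose)
  define V where "V = (\<lambda>t j. exp (ln (v0 j) + t * (ln (v1 j) - ln (v0 j))))"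
  define W where "W = (\<lambda>t j. exp (ln (w0 j) + t * (ln (w1 j) - ln (w0 j))))"
  define H where "H = (\<lambda>t. \<eta>0 + t * (\<eta>1 - \<eta>0))"
  define T where "T = (\<lambda>t. \<tau>0 + t * (\<tau>1 - \<tau>0))"
  have pos: "v0 j > 0" "w0 j > 0" "v1 j > 0" "w1 j > 0" if "j < K" for j
    using assms that unfolding sol_def by auto
  have bt: "betw (T t) \<tau>0 \<tau>1" "betw (H t) \<eta>0 \<eta>1" if "0 \<le> t" "t \<le> 1" for t
    unfolding T_def H_def using that by (auto intro: betw_linear)
  have bvw: "betw (V t j) (v0 j) (v1 j)" "betw (W t j) (w0 j) (w1 j)" if "0 \<le> t" "t \<le> 1" "j < K" for t j
    unfolding V_def W_def using that pos by (auto intro!: betw_exp betw_linear)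
  have H0: "H t \<ge> 0" if "0 \<le> t" "t \<le> 1" for t using betw_bounds(1)[OF bt(2)[OF that]] assms by auto
  have T0: "T t > 0" if "0 \<le> t" "t \<le> 1" for t
    using betw_bounds(1)[OF bt(1)[OF that], of "min \<tau>0 \<tau>1"] assms by auto
  have apos: "a (H t) (W t) i > 0" if "0 \<le> t" "t \<le> 1" for t
    by (rule lin_pos) (use H0[OF that] assms in \<open>auto simp: W_def\<close>)
  have bpos: "b (H t) (V t) i > 0" if "0 \<le> t" "t \<le> 1" for t
    by (rule T.lin_pos) (use H0[OF that] assms in \<open>auto simp: V_def\<close>)
  define g where "g = (\<lambda>t. ln (a (H t) (W t) i + T t / b (H t) (V t) i))"
  define g' where "g' = (\<lambda>t. (((\<eta>1 - \<eta>0) + (\<Sum>j<K. s i j * (W t j * (ln (w1 j) - ln (w0 j))))) +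
      ((\<tau>1 - \<tau>0) * b (H t) (V t) i - T t * ((\<eta>1 - \<eta>0) + (\<Sum>j<K. s j i * (V t j * (ln (v1 j) - ln (v0 j))))))
        / (b (H t) (V t) i * b (H t) (V t) i)) / (a (H t) (W t) i + T t / b (H t) (V t) i))"
  have dW: "((\<lambda>t. W t j) has_real_derivative W t j * (ln (w1 j) - ln (w0 j))) (at t)" for t j
    unfolding W_def by (auto intro!: derivative_eq_intros)
  have dV: "((\<lambda>t. V t j) has_real_derivative V t j * (ln (v1 j) - ln (v0 j))) (at t)" for t j
    unfolding V_def by (auto intro!: derivative_eq_intros)
  have dH: "(H has_real_derivative (\<eta>1 - \<eta>0)) (at t)" for t
    unfolding H_def by (auto intro!: derivative_eq_intros)
  have dT: "(T has_real_derivative (\<tau>1 - \<tau>0)) (at t)" for t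
    unfolding T_def by (auto intro!: derivative_eq_intros)
  have da: "((\<lambda>t. a (H t) (W t) i) has_real_derivative
      (\<eta>1 - \<eta>0) + (\<Sum>j<K. s i j * (W t j * (ln (w1 j) - ln (w0 j))))) (at t)" for t
    unfolding lin_def by (intro DERIV_add dH DERIV_sum DERIV_cmult dW)
  have db: "((\<lambda>t. b (H t) (V t) i) has_real_derivative
      (\<eta>1 - \<eta>0) + (\<Sum>j<K. s j i * (V t j * (ln (v1 j) - ln (v0 j))))) (at t)" for t
    unfolding lin_def by (intro DERIV_add dH DERIV_sum DERIV_cmult dV)
  have dg: "(g has_real_derivative g' t) (at t)" if "0 \<le> t" "t \<le> 1" for t
  proof -
    have X: "a (H t) (W t) i + T t / b (H t) (V t) i > 0"
      using apos[OF that] bpos[OF that] T0[OF that] by (auto intro!: add_pos_pos)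
    have "((\<lambda>t. a (H t) (W t) i + T t / b (H t) (V t) i) has_real_derivative
      (((\<eta>1 - \<eta>0) + (\<Sum>j<K. s i j * (W t j * (ln (w1 j) - ln (w0 j))))) +
      ((\<tau>1 - \<tau>0) * b (H t) (V t) i - T t * ((\<eta>1 - \<eta>0) + (\<Sum>j<K. s j i * (V t j * (ln (v1 j) - ln (v0 j))))))
        / (b (H t) (V t) i * b (H t) (V t) i))) (at t)"
      by (intro DERIV_add da DERIV_divide dT db) (use bpos[OF that] in auto)
    from DERIV_ln_divide[THEN DERIV_chain2, OF X this] show ?thesis
      unfolding g_def g'_def by (simp add: divide_inverse mult.commute)
  qed
  obtain t where t: "0 < t" "t < 1" "g 1 - g 0 = (1 - 0) * g' t"
    using MVT2[of 0 1 g g'] dg by auto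
  have V0: "V 0 j = v0 j" "V 1 j = v1 j" "W 0 j = w0 j" "W 1 j = w1 j" if "j < K" for j
    using pos[OF that] unfolding V_def W_def by auto
  have lc: "lin K s' \<eta> f i = lin K s' \<eta> f' i" if "\<And>j. j < K \<Longrightarrow> f j = f' j" for s' \<eta> f f'
    unfolding lin_def using that by simp
  have g0: "g 0 = - ln (v0 i)"
  proof -
    have "g 0 = ln (1 / v0 i)" using assms(1,7) lc[of "W 0" w0] lc[of "V 0" v0] V0
      unfolding g_def H_def T_def sol_def by simp
    then show ?thesis using pos[OF assms(7)] by (simp add: ln_div)
  qed
  have g1: "g 1 = - ln (v1 i)"
  proof -
    have "g 1 = ln (1 / v1 i)" using assms(2,7) lc[of "W 1" w1] lc[of "V 1" v1] V0
      unfolding g_def H_def T_def sol_def by simp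
    then show ?thesis using pos[OF assms(7)] by (simp add: ln_div)
  qed
  have t': "0 \<le> t" "t \<le> 1" using t by auto
  define bb where "bb = b (H t) (V t) i"
  define X where "X = a (H t) (W t) i + T t / bb"
  have bb: "bb > 0" unfolding bb_def using bpos[OF t'] .
  have "X > 0" unfolding X_def bb_def using apos[OF t'] bpos[OF t'] T0[OF t'] by (auto intro!: add_pos_pos)
  have e1: "(\<Sum>j<K. cdir K s (T t) (H t) (V t) (W t) i j * (ln (w0 j) - ln (w1 j))) =
     - (\<Sum>j<K. s i j * (W t j * (ln (w1 j) - ln (w0 j)))) / X"
    unfolding cdir_def bb_def[symmetric] X_def[symmetric] sum_divide_distrib sum_negf[symmetric]
    by (intro sum.cong) (auto simp: field_simps)
  have e2: "(\<Sum>j<K. ctra K s (T t) (H t) (V t) (W t) i j * (ln (v1 j) - ln (v0 j))) =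
     T t * (\<Sum>j<K. s j i * (V t j * (ln (v1 j) - ln (v0 j)))) / (bb\<^sup>2 * X)"
    unfolding ctra_def bb_def[symmetric] X_def[symmetric] sum_divide_distrib sum_distrib_left
    by (intro sum.cong) (auto simp: field_simps)
  have "ln (v1 i) - ln (v0 i) = - g' t" using t(3) g0 g1 by simp
  also have "\<dots> = (\<Sum>j<K. cdir K s (T t) (H t) (V t) (W t) i j * (ln (w0 j) - ln (w1 j))) +
      (\<Sum>j<K. ctra K s (T t) (H t) (V t) (W t) i j * (ln (v1 j) - ln (v0 j))) -
      csrc K s (T t) (H t) (V t) (W t) (\<tau>1 - \<tau>0) (\<eta>1 - \<eta>0) i"
    unfolding e1 e2 g'_def csrc_def bb_def[symmetric] X_def[symmetric]
    using bb \<open>X > 0\<close> by (simp add: field_simps power2_eq_square)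
  finally show ?thesis using bt[OF t'] bvw[OF t'] by blast
qed

end

section \<open>Lipschitz dependence on the parameters\<close>

definition pos_edges :: "nat \<Rightarrow> (nat \<Rightarrow> nat \<Rightarrow> real) \<Rightarrow> (nat \<times> nat) set" where
  "pos_edges K s = {(i, j). i < K \<and> j < K \<and> s i j > 0}"

text \<open>The coordinate \<open>(i, True)\<close> stands for \<open>ln (v i)\<close>, the coordinate \<open>(i, False)\<close> for \<open>- ln (w i)\<close>.\<close>

definition nodes :: "nat \<Rightarrow> (nat \<times> bool) set" where "nodes K = {..<K} \<times> UNIV"

text \<open>Pattern of the non-zero coefficients. It depends on the type of the target only:
  \<open>ln (v j)\<close> acts through \<open>b i\<close>, hence through \<open>s j i\<close>, and
  \<open>ln (w j)\<close> through \<open>a i\<close>, hence through \<open>s i j\<close>, in both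
  equations.\<close>

definition node_edges :: "nat \<Rightarrow> (nat \<Rightarrow> nat \<Rightarrow> real) \<Rightarrow> ((nat \<times> bool) \<times> (nat \<times> bool)) set" where
  "node_edges K s = {((i, \<beta>), (j, \<gamma>)). if \<gamma> then (j, i) \<in> pos_edges K s else (i, j) \<in> pos_edges K s}"

definition coef where "coef K s \<tau> \<eta> v w p q = (case p of (i, \<beta>) \<Rightarrow> case q of (j, \<gamma>) \<Rightarrow>
  if \<beta> then (if \<gamma> then ctra K s \<tau> \<eta> v w i j else cdir K s \<tau> \<eta> v w i j)
  else (if \<gamma> then cdir K (\<lambda>i j. s j i) \<tau> \<eta> w v i j else ctra K (\<lambda>i j. s j i) \<tau> \<eta> w v i j))"

definition src where "src K s \<tau> \<eta> v w d\<tau> d\<eta> p = (case p of (i, \<beta>) \<Rightarrow>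
  if \<beta> then - csrc K s \<tau> \<eta> v w d\<tau> d\<eta> i else csrc K (\<lambda>i j. s j i) \<tau> \<eta> w v d\<tau> d\<eta> i)"

definition logdiff :: "(nat \<Rightarrow> real) \<Rightarrow> (nat \<Rightarrow> real) \<Rightarrow> (nat \<Rightarrow> real) \<Rightarrow> (nat \<Rightarrow> real) \<Rightarrow> nat \<times> bool \<Rightarrow> real" where
  "logdiff v0 w0 v1 w1 p = (case p of (i, \<beta>) \<Rightarrow> if \<beta> then ln (v1 i) - ln (v0 i) else ln (w0 i) - ln (w1 i))"

lemma sum_nodes: "(\<Sum>q\<in>nodes K. f q) = (\<Sum>j<K. f (j, True)) + (\<Sum>j<K. f (j, False))"
  unfolding nodes_def by (simp add: sum.cartesian_product' UNIV_bool sum.distrib add.commute)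

definition confined :: "nat \<Rightarrow> real \<Rightarrow> real \<Rightarrow> real \<Rightarrow> real \<Rightarrow> (nat \<Rightarrow> real) \<Rightarrow> (nat \<Rightarrow> real) \<Rightarrow> bool" where
  "confined K c C \<tau> \<eta> v w \<longleftrightarrow> c \<le> \<tau> \<and> \<tau> \<le> C \<and> 0 \<le> \<eta> \<and> \<eta> \<le> C \<and>
    (\<forall>i<K. c \<le> v i \<and> v i \<le> C \<and> c \<le> w i \<and> w i \<le> C)"

lemma confined_swap: "confined K c C \<tau> \<eta> v w \<Longrightarrow> confined K c C \<tau> \<eta> w v"
  unfolding confined_def by auto

lemma confined_betw:
  assumes "confined K c C \<tau>0 \<eta>0 v0 w0" "confined K c C \<tau>1 \<eta>1 v1 w1" "betw \<tau> \<tau>0 \<tau>1" "betw \<eta> \<eta>0 \<eta>1"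
    "\<forall>j<K. betw (v j) (v0 j) (v1 j) \<and> betw (w j) (w0 j) (w1 j)"
  shows "confined K c C \<tau> \<eta> v w"
  unfolding confined_def
proof (intro conjI allI impI)
  have *: "c \<le> \<tau>0" "c \<le> \<tau>1" "\<tau>0 \<le> C" "\<tau>1 \<le> C" "0 \<le> \<eta>0" "0 \<le> \<eta>1" "\<eta>0 \<le> C" "\<eta>1 \<le> C"
    using assms(1,2) unfolding confined_def by auto
  show "c \<le> \<tau>" "\<tau> \<le> C" "0 \<le> \<eta>" "\<eta> \<le> C"
    using * betw_bounds[OF assms(3)] betw_bounds[OF assms(4)] by blast+
  fix i assume "i < K"
  then have *: "c \<le> v0 i" "c \<le> v1 i" "v0 i \<le> C" "v1 i \<le> C" "c \<le> w0 i" "c \<le> w1 i" "w0 i \<le> C" "w1 i \<le> C"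
    and b: "betw (v i) (v0 i) (v1 i)" "betw (w i) (w0 i) (w1 i)"
    using assms(1,2,5) unfolding confined_def by auto
  show "c \<le> v i" "v i \<le> C" "c \<le> w i" "w i \<le> C"
    using * betw_bounds[OF b(1)] betw_bounds[OF b(2)] by blast+
qed

text \<open>The equation of sums fixes the free factor that the system has at
  \<open>\<eta> = 0\<close>, where \<open>v\<close> may be multiplied and \<open>w\<close> divided
  by a constant.\<close>

definition bal :: "nat \<Rightarrow> (nat \<Rightarrow> nat \<Rightarrow> real) \<Rightarrow> real \<Rightarrow> real \<Rightarrow> (nat \<Rightarrow> real) \<Rightarrow> (nat \<Rightarrow> real) \<Rightarrow> bool" where
  "bal K s \<tau> \<eta> v w \<longleftrightarrow> sol K s \<tau> \<eta> v w \<and> (\<Sum>i<K. v i) = (\<Sum>i<K. w i)"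

definition coef_bounded :: "nat \<Rightarrow> (nat \<Rightarrow> nat \<Rightarrow> real) \<Rightarrow> real \<Rightarrow> real \<Rightarrow> real \<Rightarrow> real \<Rightarrow> bool" where
  "coef_bounded K s c C \<delta> Q \<longleftrightarrow> (\<forall>\<tau> \<eta> v w p. confined K c C \<tau> \<eta> v w \<longrightarrow> p \<in> nodes K \<longrightarrow>
     (\<forall>q\<in>nodes K. 0 \<le> coef K s \<tau> \<eta> v w p q \<and> ((p, q) \<in> node_edges K s \<longrightarrow> \<delta> \<le> coef K s \<tau> \<eta> v w p q)) \<and>
     (\<Sum>q\<in>nodes K. coef K s \<tau> \<eta> v w p q) \<le> 1 \<and>
     (\<eta> = 0 \<longrightarrow> (\<Sum>q\<in>nodes K. coef K s \<tau> \<eta> v w p q) = 1) \<and>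
     (\<forall>d\<tau> d\<eta>. \<bar>src K s \<tau> \<eta> v w d\<tau> d\<eta> p\<bar> \<le> Q * (\<bar>d\<tau>\<bar> + \<bar>d\<eta>\<bar>)))"

lemma coef_boundedD:
  assumes "coef_bounded K s c C \<delta> Q" "confined K c C \<tau> \<eta> v w" "p \<in> nodes K"
  shows "\<And>q. q \<in> nodes K \<Longrightarrow> 0 \<le> coef K s \<tau> \<eta> v w p q"
    "\<And>q. q \<in> nodes K \<Longrightarrow> (p, q) \<in> node_edges K s \<Longrightarrow> \<delta> \<le> coef K s \<tau> \<eta> v w p q"
    "(\<Sum>q\<in>nodes K. coef K s \<tau> \<eta> v w p q) \<le> 1"
    "\<eta> = 0 \<Longrightarrow> (\<Sum>q\<in>nodes K. coef K s \<tau> \<eta> v w p q) = 1"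
    "\<bar>src K s \<tau> \<eta> v w d\<tau> d\<eta> p\<bar> \<le> Q * (\<bar>d\<tau>\<bar> + \<bar>d\<eta>\<bar>)"
  using assms unfolding coef_bounded_def by blast+

context supported_matrix begin

lemma lin_bounds:
  fixes c C \<mu> :: real
  assumes "0 < c" "confined K c C \<tau> \<eta> v w" "\<mu> > 0" "\<And>i j. i < K \<Longrightarrow> j < K \<Longrightarrow> s i j > 0 \<Longrightarrow> \<mu> \<le> s i j" "i < K"
  shows "\<mu> * c \<le> a \<eta> w i" "a \<eta> w i \<le> C + K * C"
proof -
  have "\<mu> * c \<le> s i (\<pi> i) * w (\<pi> i)"
    using assms pi_less[OF assms(5)] s_pi[OF assms(5)] unfolding confined_def by (intro mult_mono) auto
  also have "\<dots> \<le> a \<eta> w i"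
  proof (rule lin_ge_entry)
    show "0 \<le> w j" if "j < K" for j using assms(1,2) that unfolding confined_def by force
  qed (use assms in \<open>auto simp: confined_def\<close>)
  finally show "\<mu> * c \<le> a \<eta> w i" .
  have "a \<eta> w i \<le> \<eta> + K * C"
  proof (rule lin_le)
    show "0 \<le> w j \<and> w j \<le> C" if "j < K" for j using assms(1,2) that unfolding confined_def by force
  qed
  then show "a \<eta> w i \<le> C + K * C" using assms(2) unfolding confined_def by linarith
qed

text \<open>With \<open>X = a + \<tau> / b\<close> a row sums to
  \<open>((a - \<eta>) + \<tau> * (b - \<eta>) / b^2) / X\<close>, which is at most 1 and equal to 1
  at \<open>\<eta> = 0\<close>. Equality reflects the scaling invariance: a constant vector of
  logarithmic differences multiplies \<open>v\<close> and divides \<open>w\<close> by the same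
  factor. The constants \<open>g\<close> and \<open>G\<close> are lower and upper bounds for
  \<open>a\<close> and \<open>b\<close> on the box.\<close>

lemma coef_bounds:
  fixes c C \<mu> :: real
  assumes "0 < c" "confined K c C \<tau> \<eta> v w" "\<mu> > 0" "\<And>i j. i < K \<Longrightarrow> j < K \<Longrightarrow> s i j > 0 \<Longrightarrow> \<mu> \<le> s i j" "i < K"
  defines "G \<equiv> C + K * C" and "g \<equiv> \<mu> * c"
  defines "\<delta> \<equiv> min (\<mu> * c / (G + C / g)) (c * \<mu> * c / (G\<^sup>2 * (G + C / g)))"
  shows "\<And>j. j < K \<Longrightarrow> 0 \<le> cdir K s \<tau> \<eta> v w i j" "\<And>j. j < K \<Longrightarrow> 0 \<le> ctra K s \<tau> \<eta> v w i j"
    "\<And>j. j < K \<Longrightarrow> s i j > 0 \<Longrightarrow> \<delta> \<le> cdir K s \<tau> \<eta> v w i j"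
    "\<And>j. j < K \<Longrightarrow> s j i > 0 \<Longrightarrow> \<delta> \<le> ctra K s \<tau> \<eta> v w i j"
    "\<bar>csrc K s \<tau> \<eta> v w d\<tau> d\<eta> i\<bar> \<le> (1 + C / g\<^sup>2 + 1 / g) / g * (\<bar>d\<tau>\<bar> + \<bar>d\<eta>\<bar>)"
    "(\<Sum>j<K. cdir K s \<tau> \<eta> v w i j) + (\<Sum>j<K. ctra K s \<tau> \<eta> v w i j) \<le> 1"
    "\<eta> = 0 \<Longrightarrow> (\<Sum>j<K. cdir K s \<tau> \<eta> v w i j) + (\<Sum>j<K. ctra K s \<tau> \<eta> v w i j) = 1"
proof -
  interpret T: supported_matrix K "\<lambda>i j. s j i" "inv_into UNIV \<pi>" by (rule supported_matrix_transpose)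
  have sT: "\<And>i j. i < K \<Longrightarrow> j < K \<Longrightarrow> s j i > 0 \<Longrightarrow> \<mu> \<le> s j i" using assms(4) by blast
  define X where "X = a \<eta> w i + \<tau> / b \<eta> v i"
  note A = lin_bounds[OF assms(1-5), folded G_def g_def]
  note B = T.lin_bounds[OF assms(1) confined_swap[OF assms(2)] assms(3) sT assms(5), folded G_def g_def]
  have g: "g > 0" unfolding g_def using assms by simp
  have cC: "\<tau> > 0" "\<tau> \<le> C" "c \<le> \<tau>" "\<eta> \<ge> 0" "C > 0" using assms(1,2) unfolding confined_def by auto
  have vw: "v j > 0" "w j > 0" "c \<le> v j" "c \<le> w j" if "j < K" for j
    using assms(1,2) that unfolding confined_def by force+
  have "\<tau> / b \<eta> v i \<le> C / g" using B g cC by (intro frac_le) auto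
  then have X2: "X \<le> G + C / g" unfolding X_def using A by linarith
  have q0: "\<tau> / b \<eta> v i \<ge> 0" using B g cC by simp
  then have X1: "g \<le> X" unfolding X_def using A by linarith
  have bp: "b \<eta> v i > 0" and Xp: "X > 0" using B g X1 by linarith+
  show "0 \<le> cdir K s \<tau> \<eta> v w i j" if "j < K" for j
    unfolding cdir_def X_def[symmetric] using Xp vw[OF that] s_nonneg by (auto intro!: divide_nonneg_pos mult_nonneg_nonneg)
  show "0 \<le> ctra K s \<tau> \<eta> v w i j" if "j < K" for j
    unfolding ctra_def X_def[symmetric] using Xp vw[OF that] s_nonneg bp cC by (auto intro!: divide_nonneg_pos mult_nonneg_nonneg mult_pos_pos)
  show "\<delta> \<le> cdir K s \<tau> \<eta> v w i j" if j: "j < K" "s i j > 0" for j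
  proof -
    have "\<mu> * c / (G + C / g) \<le> s i j * w j / X"
    proof (rule frac_le)
      show "\<mu> * c \<le> s i j * w j" by (intro mult_mono) (use assms vw j in auto)
    qed (use assms vw j Xp X2 in \<open>auto intro!: mult_nonneg_nonneg less_imp_le\<close>)
    then show ?thesis unfolding \<delta>_def cdir_def X_def[symmetric] by linarith
  qed
  show "\<delta> \<le> ctra K s \<tau> \<eta> v w i j" if j: "j < K" "s j i > 0" for j
  proof -
    have "c * \<mu> * c / (G\<^sup>2 * (G + C / g)) \<le> \<tau> * s j i * v j / ((b \<eta> v i)\<^sup>2 * X)"
    proof (rule frac_le)
      show "c * \<mu> * c \<le> \<tau> * s j i * v j" by (intro mult_mono) (use assms vw j cC in \<open>auto intro!: mult_nonneg_nonneg\<close>)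
      show "(b \<eta> v i)\<^sup>2 * X \<le> G\<^sup>2 * (G + C / g)"
        using B X2 bp Xp by (intro mult_mono power_mono) auto
    qed (use assms vw j Xp bp cC in \<open>auto intro!: mult_nonneg_nonneg less_imp_le\<close>)
    then show ?thesis unfolding \<delta>_def ctra_def X_def[symmetric] by linarith
  qed
  show "\<bar>csrc K s \<tau> \<eta> v w d\<tau> d\<eta> i\<bar> \<le> (1 + C / g\<^sup>2 + 1 / g) / g * (\<bar>d\<tau>\<bar> + \<bar>d\<eta>\<bar>)"
  proof -
    have t1: "\<tau> / (b \<eta> v i)\<^sup>2 \<le> C / g\<^sup>2" "0 \<le> \<tau> / (b \<eta> v i)\<^sup>2"
      using B g cC bp by (auto intro!: frac_le power_mono)
    have t2: "\<bar>d\<eta> * (1 - \<tau> / (b \<eta> v i)\<^sup>2)\<bar> \<le> \<bar>d\<eta>\<bar> * (1 + C / g\<^sup>2)"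
      unfolding abs_mult using t1 by (intro mult_left_mono) auto
    have t3: "\<bar>d\<tau> / b \<eta> v i\<bar> \<le> \<bar>d\<tau>\<bar> * (1 / g)"
      using B(1) g bp by (auto simp: abs_divide intro!: divide_left_mono mult_pos_pos)
    have "\<bar>d\<eta>\<bar> * (1 + C / g\<^sup>2) \<le> \<bar>d\<eta>\<bar> * (1 + C / g\<^sup>2 + 1 / g)" "\<bar>d\<tau>\<bar> * (1 / g) \<le> \<bar>d\<tau>\<bar> * (1 + C / g\<^sup>2 + 1 / g)"
      using g cC by (intro mult_left_mono; simp)+
    then have t4: "\<bar>d\<eta>\<bar> * (1 + C / g\<^sup>2) + \<bar>d\<tau>\<bar> * (1 / g) \<le> (1 + C / g\<^sup>2 + 1 / g) * (\<bar>d\<tau>\<bar> + \<bar>d\<eta>\<bar>)"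
      by (metis (no_types, opaque_lifting) add.commute add_mono distrib_left mult.commute)
    have t5: "0 \<le> (1 + C / g\<^sup>2 + 1 / g) * (\<bar>d\<tau>\<bar> + \<bar>d\<eta>\<bar>)"
      using g cC by (intro mult_nonneg_nonneg add_nonneg_nonneg) auto
    have "\<bar>csrc K s \<tau> \<eta> v w d\<tau> d\<eta> i\<bar> = \<bar>d\<eta> * (1 - \<tau> / (b \<eta> v i)\<^sup>2) + d\<tau> / b \<eta> v i\<bar> / X"
      unfolding csrc_def X_def[symmetric] abs_divide using Xp by simp
    also have "\<dots> \<le> ((1 + C / g\<^sup>2 + 1 / g) * (\<bar>d\<tau>\<bar> + \<bar>d\<eta>\<bar>)) / g"
      using t2 t3 t4 t5 X1 g abs_triangle_ineq[of "d\<eta> * (1 - \<tau> / (b \<eta> v i)\<^sup>2)" "d\<tau> / b \<eta> v i"]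
      by (intro frac_le) auto
    finally show ?thesis by simp
  qed
  have sums: "(\<Sum>j<K. cdir K s \<tau> \<eta> v w i j) + (\<Sum>j<K. ctra K s \<tau> \<eta> v w i j) =
      ((a \<eta> w i - \<eta>) + \<tau> * (b \<eta> v i - \<eta>) / (b \<eta> v i)\<^sup>2) / X"
  proof -
    have "(\<Sum>j<K. cdir K s \<tau> \<eta> v w i j) = (a \<eta> w i - \<eta>) / X"
      unfolding cdir_def X_def[symmetric] by (simp add: lin_def sum_divide_distrib)
    moreover have "(\<Sum>j<K. ctra K s \<tau> \<eta> v w i j) = \<tau> * (b \<eta> v i - \<eta>) / ((b \<eta> v i)\<^sup>2 * X)"
      unfolding ctra_def X_def[symmetric] by (simp add: lin_def sum_divide_distrib sum_distrib_left mult_ac)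
    ultimately show ?thesis by (simp add: add_divide_distrib)
  qed
  have "\<tau> * (b \<eta> v i - \<eta>) / (b \<eta> v i)\<^sup>2 \<le> \<tau> * b \<eta> v i / (b \<eta> v i)\<^sup>2"
    using cC bp by (intro divide_right_mono mult_left_mono) auto
  also have "\<dots> = \<tau> / b \<eta> v i" using bp by (simp add: power2_eq_square)
  finally have "(a \<eta> w i - \<eta>) + \<tau> * (b \<eta> v i - \<eta>) / (b \<eta> v i)\<^sup>2 \<le> X" unfolding X_def using cC by linarith
  then show "(\<Sum>j<K. cdir K s \<tau> \<eta> v w i j) + (\<Sum>j<K. ctra K s \<tau> \<eta> v w i j) \<le> 1"
    unfolding sums using Xp by simp
  show "(\<Sum>j<K. cdir K s \<tau> \<eta> v w i j) + (\<Sum>j<K. ctra K s \<tau> \<eta> v w i j) = 1" if "\<eta> = 0"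
    unfolding sums using that Xp bp by (simp add: X_def power2_eq_square)
qed

text \<open>The equation for \<open>w\<close> is the one for \<open>v\<close> with \<open>s\<close>
  transposed; passing to \<open>- ln w\<close> reverses all signs, including that of the
  source.\<close>

lemma mean_value:
  assumes "sol K s \<tau>0 \<eta>0 v0 w0" "sol K s \<tau>1 \<eta>1 v1 w1" "\<tau>0 > 0" "\<tau>1 > 0" "\<eta>0 \<ge> 0" "\<eta>1 \<ge> 0" "p \<in> nodes K"
  shows "\<exists>\<tau> \<eta> v w. betw \<tau> \<tau>0 \<tau>1 \<and> betw \<eta> \<eta>0 \<eta>1 \<and> (\<forall>j<K. betw (v j) (v0 j) (v1 j) \<and> betw (w j) (w0 j) (w1 j)) \<and>
    logdiff v0 w0 v1 w1 p = (\<Sum>q\<in>nodes K. coef K s \<tau> \<eta> v w p q * logdiff v0 w0 v1 w1 q)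
      + src K s \<tau> \<eta> v w (\<tau>1 - \<tau>0) (\<eta>1 - \<eta>0) p"
proof -
  interpret T: supported_matrix K "\<lambda>i j. s j i" "inv_into UNIV \<pi>" by (rule supported_matrix_transpose)
  obtain i \<beta> where p: "p = (i, \<beta>)" "i < K" using assms(7) unfolding nodes_def by auto
  show ?thesis
  proof (cases \<beta>)
    case True
    from mean_value_v[OF assms(1-6) p(2)] obtain \<tau> \<eta> v w where *:
      "betw \<tau> \<tau>0 \<tau>1" "betw \<eta> \<eta>0 \<eta>1" "\<forall>j<K. betw (v j) (v0 j) (v1 j) \<and> betw (w j) (w0 j) (w1 j)"
      "ln (v1 i) - ln (v0 i) = (\<Sum>j<K. cdir K s \<tau> \<eta> v w i j * (ln (w0 j) - ln (w1 j))) +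
      (\<Sum>j<K. ctra K s \<tau> \<eta> v w i j * (ln (v1 j) - ln (v0 j))) -
      csrc K s \<tau> \<eta> v w (\<tau>1 - \<tau>0) (\<eta>1 - \<eta>0) i" by blast
    show ?thesis
      by (rule exI[of _ \<tau>], rule exI[of _ \<eta>], rule exI[of _ v], rule exI[of _ w])
        (use * True p in \<open>simp add: sum_nodes coef_def src_def logdiff_def\<close>)
  next
    case False
    from T.mean_value_v[OF sol_swap[OF assms(1)] sol_swap[OF assms(2)] assms(3-6) p(2)] obtain \<tau> \<eta> v w where *:
      "betw \<tau> \<tau>0 \<tau>1" "betw \<eta> \<eta>0 \<eta>1" "\<forall>j<K. betw (w j) (w0 j) (w1 j) \<and> betw (v j) (v0 j) (v1 j)"
      "ln (w1 i) - ln (w0 i) = (\<Sum>j<K. cdir K (\<lambda>i j. s j i) \<tau> \<eta> w v i j * (ln (v0 j) - ln (v1 j))) +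
      (\<Sum>j<K. ctra K (\<lambda>i j. s j i) \<tau> \<eta> w v i j * (ln (w1 j) - ln (w0 j))) -
      csrc K (\<lambda>i j. s j i) \<tau> \<eta> w v (\<tau>1 - \<tau>0) (\<eta>1 - \<eta>0) i" by blast
    have n1: "(\<Sum>j<K. f j * (x j - y j)) = - (\<Sum>j<K. f j * (y j - x j))" for f x y :: "nat \<Rightarrow> real"
      unfolding sum_negf[symmetric] by (intro sum.cong) (auto simp: algebra_simps)
    have "ln (w0 i) - ln (w1 i) = (\<Sum>j<K. cdir K (\<lambda>i j. s j i) \<tau> \<eta> w v i j * (ln (v1 j) - ln (v0 j))) +
      (\<Sum>j<K. ctra K (\<lambda>i j. s j i) \<tau> \<eta> w v i j * (ln (w0 j) - ln (w1 j))) +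
      csrc K (\<lambda>i j. s j i) \<tau> \<eta> w v (\<tau>1 - \<tau>0) (\<eta>1 - \<eta>0) i"
      using *(4) n1[of _ "\<lambda>j. ln (v0 j)" "\<lambda>j. ln (v1 j)"] n1[of _ "\<lambda>j. ln (w1 j)" "\<lambda>j. ln (w0 j)"] by simp
    then show ?thesis
      by (intro exI[of _ \<tau>] exI[of _ \<eta>] exI[of _ v] exI[of _ w])
        (use * False p in \<open>simp add: sum_nodes coef_def src_def logdiff_def\<close>)
  qed
qed

text \<open>Each row is evaluated at an intermediate point of its own. This does no harm, because
  \<open>propagates\<close> asks for bounds on the coefficients only.\<close>

lemma mean_value_nodes:
  assumes "sol K s \<tau>0 \<eta>0 v0 w0" "sol K s \<tau>1 \<eta>1 v1 w1" "\<tau>0 > 0" "\<tau>1 > 0" "\<eta>0 \<ge> 0" "\<eta>1 \<ge> 0"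
  shows "\<exists>\<tau> \<eta> v w. \<forall>p\<in>nodes K. betw (\<tau> p) \<tau>0 \<tau>1 \<and> betw (\<eta> p) \<eta>0 \<eta>1 \<and>
    (\<forall>j<K. betw (v p j) (v0 j) (v1 j) \<and> betw (w p j) (w0 j) (w1 j)) \<and>
    logdiff v0 w0 v1 w1 p = (\<Sum>q\<in>nodes K. coef K s (\<tau> p) (\<eta> p) (v p) (w p) p q * logdiff v0 w0 v1 w1 q)
      + src K s (\<tau> p) (\<eta> p) (v p) (w p) (\<tau>1 - \<tau>0) (\<eta>1 - \<eta>0) p"
proof -
  define R where "R = (\<lambda>p (\<tau>, \<eta>, v, w). betw \<tau> \<tau>0 \<tau>1 \<and> betw \<eta> \<eta>0 \<eta>1 \<and>
    (\<forall>j<K. betw (v j) (v0 j) (v1 j) \<and> betw (w j) (w0 j) (w1 j)) \<and>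
    logdiff v0 w0 v1 w1 p = (\<Sum>q\<in>nodes K. coef K s \<tau> \<eta> v w p q * logdiff v0 w0 v1 w1 q)
      + src K s \<tau> \<eta> v w (\<tau>1 - \<tau>0) (\<eta>1 - \<eta>0) p)"
  have "\<forall>p\<in>nodes K. \<exists>x. R p x"
    using mean_value[OF assms] unfolding R_def split_paired_Ex by simp
  from bchoice[OF this] obtain x where x: "\<forall>p\<in>nodes K. R p (x p)" by blast
  show ?thesis
    by (rule exI[of _ "\<lambda>p. fst (x p)"], rule exI[of _ "\<lambda>p. fst (snd (x p))"],
        rule exI[of _ "\<lambda>p. fst (snd (snd (x p)))"], rule exI[of _ "\<lambda>p. snd (snd (snd (x p)))"])
      (use x in \<open>auto simp: R_def case_prod_beta\<close>)
qed

lemma min_positive_entry: "\<exists>\<mu>>0. \<mu> \<le> 1 \<and> (\<forall>i<K. \<forall>j<K. s i j > 0 \<longrightarrow> \<mu> \<le> s i j)"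
proof -
  define S where "S = insert 1 ((\<lambda>(i, j). s i j) ` pos_edges K s)"
  have "finite (pos_edges K s)" by (rule finite_subset[of _ "{..<K} \<times> {..<K}"]) (auto simp: pos_edges_def)
  then have f: "finite S" unfolding S_def by auto
  have "Min S > 0" using f by (subst Min_gr_iff) (auto simp: S_def pos_edges_def)
  moreover have "Min S \<le> 1" using f by (auto simp: S_def)
  moreover have "Min S \<le> s i j" if "i < K" "j < K" "s i j > 0" for i j
    using f that by (intro Min_le) (auto simp: S_def pos_edges_def intro!: image_eqI[of _ _ "(i, j)"])
  ultimately show ?thesis by blast
qed

lemma coef_node_bounds:
  assumes "0 < c"
  shows "\<exists>\<delta>>0. \<exists>Q>0. coef_bounded K s c C \<delta> Q"
proof (cases "C > 0")
  case False
  have "\<not> confined K c C \<tau> \<eta> v w" for \<tau> \<eta> v w using False assms unfolding confined_def by auto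
  then show ?thesis unfolding coef_bounded_def by (intro exI[of _ "1::real"] conjI) auto
next
  case C: True
  interpret T: supported_matrix K "\<lambda>i j. s j i" "inv_into UNIV \<pi>" by (rule supported_matrix_transpose)
  obtain \<mu> where \<mu>: "\<mu> > 0" "\<And>i j. i < K \<Longrightarrow> j < K \<Longrightarrow> s i j > 0 \<Longrightarrow> \<mu> \<le> s i j"
    using min_positive_entry by blast
  define G where "G = C + K * C"
  define g where "g = \<mu> * c"
  define \<delta> where "\<delta> = min (g / (G + C / g)) (c * \<mu> * c / (G\<^sup>2 * (G + C / g)))"
  define Q where "Q = (1 + C / g\<^sup>2 + 1 / g) / g"
  have g: "g > 0" "G > 0" unfolding g_def G_def using \<mu> assms C by (auto intro: add_pos_nonneg)
  have "\<delta> > 0" unfolding \<delta>_def using g assms \<mu> C by (auto intro!: divide_pos_pos mult_pos_pos add_pos_pos)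
  moreover have "Q > 0" unfolding Q_def using g C by (auto intro!: divide_pos_pos add_pos_pos)
  moreover have "(\<forall>q\<in>nodes K. 0 \<le> coef K s \<tau> \<eta> v w p q \<and> ((p, q) \<in> node_edges K s \<longrightarrow> \<delta> \<le> coef K s \<tau> \<eta> v w p q)) \<and>
     (\<Sum>q\<in>nodes K. coef K s \<tau> \<eta> v w p q) \<le> 1 \<and>
     (\<eta> = 0 \<longrightarrow> (\<Sum>q\<in>nodes K. coef K s \<tau> \<eta> v w p q) = 1) \<and>
     (\<forall>d\<tau> d\<eta>. \<bar>src K s \<tau> \<eta> v w d\<tau> d\<eta> p\<bar> \<le> Q * (\<bar>d\<tau>\<bar> + \<bar>d\<eta>\<bar>))"
    if w: "confined K c C \<tau> \<eta> v w" and p: "p \<in> nodes K" for \<tau> \<eta> v w p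
  proof -
    obtain i \<beta> where ip: "p = (i, \<beta>)" "i < K" using p unfolding nodes_def by auto
    have \<mu>T: "\<And>i j. i < K \<Longrightarrow> j < K \<Longrightarrow> s j i > 0 \<Longrightarrow> \<mu> \<le> s j i" using \<mu> by blast
    note c1 = coef_bounds[OF assms w \<mu> ip(2), folded G_def g_def, folded \<delta>_def Q_def]
    note c2 = T.coef_bounds[OF assms confined_swap[OF w] \<mu>(1) \<mu>T ip(2), folded G_def g_def, folded \<delta>_def Q_def]
    show ?thesis
    proof (cases \<beta>)
      case True
      show ?thesis unfolding sum_nodes ip using True c1
        by (auto simp: coef_def src_def nodes_def node_edges_def pos_edges_def)
    next
      case False
      show ?thesis unfolding sum_nodes ip using False c2
        by (auto simp: coef_def src_def nodes_def node_edges_def pos_edges_def)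
    qed
  qed
  ultimately show ?thesis unfolding coef_bounded_def by blast
qed

end

locale irreducible_matrix = supported_matrix +
  assumes irr: "i < K \<Longrightarrow> j < K \<Longrightarrow> (i, j) \<in> (pos_edges K s)\<^sup>*"
begin

text \<open>Since edges ignore the type of their source, one step along the support permutation
  switches to the type of the target. From there irreducibility leads on, backwards through
  \<open>pos_edges\<close> for \<open>ln v\<close> and forwards for \<open>- ln w\<close>.\<close>

lemma node_edges_connected:
  assumes "p \<in> nodes K" "q \<in> nodes K" shows "(p, q) \<in> (node_edges K s)\<^sup>*"
proof -
  interpret T: supported_matrix K "\<lambda>i j. s j i" "inv_into UNIV \<pi>" by (rule supported_matrix_transpose)
  obtain i \<beta> j \<gamma> where pq: "p = (i, \<beta>)" "q = (j, \<gamma>)" "i < K" "j < K" using assms unfolding nodes_def by auto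
  show ?thesis
  proof (cases \<gamma>)
    case True
    have step: "((k, True), (l, True)) \<in> (node_edges K s)\<^sup>*" if "(l, k) \<in> (pos_edges K s)\<^sup>*" for k l
      using that
    proof (induction rule: converse_rtrancl_induct)
      case (step y z)
      then have "((z, True), (y, True)) \<in> node_edges K s" unfolding node_edges_def by auto
      with step show ?case by (meson rtrancl.rtrancl_into_rtrancl)
    qed auto
    have "((i, \<beta>), (inv_into UNIV \<pi> i, True)) \<in> node_edges K s"
      using T.s_pi[OF pq(3)] T.pi_less[OF pq(3)] pq unfolding node_edges_def pos_edges_def by auto
    then show ?thesis using step[OF irr[OF pq(4) T.pi_less[OF pq(3)]]] True pq
      by (auto intro: converse_rtrancl_into_rtrancl)
  next
    case False
    have step: "((k, False), (l, False)) \<in> (node_edges K s)\<^sup>*" if "(k, l) \<in> (pos_edges K s)\<^sup>*" for k l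
      using that
    proof (induction rule: rtrancl_induct)
      case (step y z)
      then have "((y, False), (z, False)) \<in> node_edges K s" unfolding node_edges_def by auto
      with step show ?case by (meson rtrancl.rtrancl_into_rtrancl)
    qed auto
    have "((i, \<beta>), (\<pi> i, False)) \<in> node_edges K s"
      using s_pi[OF pq(3)] pi_less[OF pq(3)] pq unfolding node_edges_def pos_edges_def by auto
    then show ?thesis using step[OF irr[OF pi_less[OF pq(3)] pq(4)]] False pq
      by (auto intro: converse_rtrancl_into_rtrancl)
  qed
qed

lemma propagation_nodes: "\<delta> > 0 \<Longrightarrow> \<exists>C>0. propagates (nodes K) (node_edges K s) \<delta> C"
  by (rule propagation) (use node_edges_connected in
    \<open>auto simp: nodes_def node_edges_def pos_edges_def split: if_splits\<close>)

text \<open>Propagation bounds only differences of coordinates. Balance turns this into absolute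
  bounds: if all coordinates had the same strict sign, one of the sums of \<open>v\<close> and
  \<open>w\<close> would grow while the other shrinks.\<close>

lemma lipschitz:
  assumes "0 < c"
  shows "\<exists>L>0. \<forall>\<tau>0 \<eta>0 v0 w0 \<tau>1 \<eta>1 v1 w1. bal K s \<tau>0 \<eta>0 v0 w0 \<longrightarrow> confined K c C \<tau>0 \<eta>0 v0 w0 \<longrightarrow>
    bal K s \<tau>1 \<eta>1 v1 w1 \<longrightarrow> confined K c C \<tau>1 \<eta>1 v1 w1 \<longrightarrow>
    (\<forall>p\<in>nodes K. \<bar>logdiff v0 w0 v1 w1 p\<bar> \<le> L * (\<bar>\<tau>1 - \<tau>0\<bar> + \<bar>\<eta>1 - \<eta>0\<bar>))"
proof -
  obtain \<delta> Q where dQ: "\<delta> > 0" "Q > 0" and co: "coef_bounded K s c C \<delta> Q"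
    using coef_node_bounds[OF assms, of C] by blast
  obtain L where L: "L > 0" and prpg: "propagates (nodes K) (node_edges K s) \<delta> L"
    using propagation_nodes[OF dQ(1)] by blast
  have "\<bar>logdiff v0 w0 v1 w1 p\<bar> \<le> (L * Q) * (\<bar>\<tau>1 - \<tau>0\<bar> + \<bar>\<eta>1 - \<eta>0\<bar>)"
    if b0: "bal K s \<tau>0 \<eta>0 v0 w0" and i0: "confined K c C \<tau>0 \<eta>0 v0 w0"
      and b1: "bal K s \<tau>1 \<eta>1 v1 w1" and i1: "confined K c C \<tau>1 \<eta>1 v1 w1" and p: "p \<in> nodes K"
    for \<tau>0 \<eta>0 v0 w0 \<tau>1 \<eta>1 v1 w1 p
  proof -
    define D where "D = logdiff v0 w0 v1 w1"
    have s01: "sol K s \<tau>0 \<eta>0 v0 w0" "sol K s \<tau>1 \<eta>1 v1 w1" using b0 b1 unfolding bal_def by auto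
    have pos: "\<tau>0 > 0" "\<tau>1 > 0" "\<eta>0 \<ge> 0" "\<eta>1 \<ge> 0" using i0 i1 assms unfolding confined_def by auto
    obtain \<tau> \<eta> v w where mv: "\<And>p. p \<in> nodes K \<Longrightarrow> betw (\<tau> p) \<tau>0 \<tau>1 \<and> betw (\<eta> p) \<eta>0 \<eta>1 \<and>
      (\<forall>j<K. betw (v p j) (v0 j) (v1 j) \<and> betw (w p j) (w0 j) (w1 j)) \<and>
      D p = (\<Sum>q\<in>nodes K. coef K s (\<tau> p) (\<eta> p) (v p) (w p) p q * D q) + src K s (\<tau> p) (\<eta> p) (v p) (w p) (\<tau>1 - \<tau>0) (\<eta>1 - \<eta>0) p"
      using mean_value_nodes[OF s01 pos] unfolding D_def by blast
    have wi: "confined K c C (\<tau> p) (\<eta> p) (v p) (w p)" if "p \<in> nodes K" for p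
      using mv[OF that] confined_betw[OF i0 i1] by blast
    have vw: "v0 i > 0" "w0 i > 0" "v1 i > 0" "w1 i > 0" if "i < K" for i
      using s01 that unfolding sol_def by auto
    have ne: "{..<K} \<noteq> {}" using K_pos by auto
    have bs: "(\<Sum>i<K. v0 i) = (\<Sum>i<K. w0 i)" "(\<Sum>i<K. v1 i) = (\<Sum>i<K. w1 i)" using b0 b1 unfolding bal_def by auto
    have ex1: "\<exists>q\<in>nodes K. D q \<ge> 0"
    proof (rule ccontr)
      assume "\<not> ?thesis"
      then have neg: "D (i, \<beta>) < 0" if "i < K" for i \<beta> using that unfolding nodes_def by (meson UNIV_I SigmaI lessThan_iff linorder_not_le)
      have "v1 i < v0 i" "w0 i < w1 i" if "i < K" for i
        using neg[OF that, of True] neg[OF that, of False] vw[OF that] unfolding D_def logdiff_def by auto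
      then have "(\<Sum>i<K. v1 i) < (\<Sum>i<K. v0 i)" "(\<Sum>i<K. w0 i) < (\<Sum>i<K. w1 i)"
        using ne by (auto intro!: sum_strict_mono)
      then show False using bs by simp
    qed
    have ex2: "\<exists>q\<in>nodes K. D q \<le> 0"
    proof (rule ccontr)
      assume "\<not> ?thesis"
      then have neg: "D (i, \<beta>) > 0" if "i < K" for i \<beta> using that unfolding nodes_def by (meson UNIV_I SigmaI lessThan_iff linorder_not_le)
      have "v1 i > v0 i" "w0 i > w1 i" if "i < K" for i
        using neg[OF that, of True] neg[OF that, of False] vw[OF that] unfolding D_def logdiff_def by auto
      then have "(\<Sum>i<K. v1 i) > (\<Sum>i<K. v0 i)" "(\<Sum>i<K. w0 i) > (\<Sum>i<K. w1 i)"
        using ne by (auto intro!: sum_strict_mono)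
      then show False using bs by simp
    qed
    have "D i - D j \<le> L * (Q * (\<bar>\<tau>1 - \<tau>0\<bar> + \<bar>\<eta>1 - \<eta>0\<bar>))" if "i \<in> nodes K" "j \<in> nodes K" for i j
    proof (rule propagatesD[OF prpg, where A = "\<lambda>p q. coef K s (\<tau> p) (\<eta> p) (v p) (w p) p q"
          and r = "\<lambda>p. src K s (\<tau> p) (\<eta> p) (v p) (w p) (\<tau>1 - \<tau>0) (\<eta>1 - \<eta>0) p"])
      show "(\<forall>i\<in>nodes K. (\<Sum>j\<in>nodes K. coef K s (\<tau> i) (\<eta> i) (v i) (w i) i j) = 1) \<or>
        (\<forall>i\<in>nodes K. (\<Sum>j\<in>nodes K. coef K s (\<tau> i) (\<eta> i) (v i) (w i) i j) \<le> 1) \<and> (\<exists>i\<in>nodes K. 0 \<le> D i)"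
        using coef_boundedD(3)[OF co wi] ex1 by blast
    next
      fix p q assume "p \<in> nodes K" "q \<in> nodes K"
      then show "0 \<le> coef K s (\<tau> p) (\<eta> p) (v p) (w p) p q" by (intro coef_boundedD(1)[OF co wi])
    next
      fix p q assume "p \<in> nodes K" "q \<in> nodes K" "(p, q) \<in> node_edges K s"
      then show "\<delta> \<le> coef K s (\<tau> p) (\<eta> p) (v p) (w p) p q" by (intro coef_boundedD(2)[OF co wi])
    next
      fix p assume p: "p \<in> nodes K"
      show "D p = (\<Sum>q\<in>nodes K. coef K s (\<tau> p) (\<eta> p) (v p) (w p) p q * D q) + src K s (\<tau> p) (\<eta> p) (v p) (w p) (\<tau>1 - \<tau>0) (\<eta>1 - \<eta>0) p"
        using mv[OF p] by simp
      show "\<bar>src K s (\<tau> p) (\<eta> p) (v p) (w p) (\<tau>1 - \<tau>0) (\<eta>1 - \<eta>0) p\<bar> \<le> Q * (\<bar>\<tau>1 - \<tau>0\<bar> + \<bar>\<eta>1 - \<eta>0\<bar>)"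
        using p by (intro coef_boundedD(5)[OF co wi])
    qed (use that in auto)
    then show ?thesis using ex1 ex2 p unfolding D_def[symmetric]
      by (smt (verit, best) mult.assoc)
  qed
  then show ?thesis using L dQ by (intro exI[of _ "L * Q"]) auto
qed

end

section \<open>Entropy bounds\<close>

text \<open>For a solution \<open>v i * a \<eta> w i\<close> and \<open>w i * b \<eta> v i\<close>
  both equal 1 minus this number, so it measures what is missing in row \<open>i\<close> and in
  column \<open>i\<close> alike.\<close>

definition defect :: "nat \<Rightarrow> (nat \<Rightarrow> nat \<Rightarrow> real) \<Rightarrow> real \<Rightarrow> real \<Rightarrow> (nat \<Rightarrow> real) \<Rightarrow> (nat \<Rightarrow> real) \<Rightarrow> nat \<Rightarrow> real" where
  "defect K s \<tau> \<eta> v w i = \<tau> / (lin K s \<eta> w i * lin K (\<lambda>i j. s j i) \<eta> v i + \<tau>)"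

lemma xlnx_ge: "(x::real) > 0 \<Longrightarrow> x * ln x \<ge> x - 1"
  using ln_le_minus_one[of "1 / x"] by (simp add: ln_div field_simps)

context supported_matrix begin

lemma sol_facts:
  assumes "sol K s \<tau> \<eta> v w" "\<tau> > 0" "\<eta> \<ge> 0" "i < K"
  defines "y \<equiv> defect K s \<tau> \<eta> v w i"
  shows "a \<eta> w i > 0" "b \<eta> v i > 0" "v i > 0" "w i > 0"
    "v i * a \<eta> w i = 1 - y" "w i * b \<eta> v i = 1 - y" "(1 - y) * y = \<tau> * (v i * w i)" "0 < y" "y < 1"
proof -
  interpret T: supported_matrix K "\<lambda>i j. s j i" "inv_into UNIV \<pi>" by (rule supported_matrix_transpose)
  have vw: "v j > 0" "w j > 0" if "j < K" for j using assms(1) that unfolding sol_def by auto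
  show ap: "a \<eta> w i > 0" by (rule lin_pos) (use assms vw in auto)
  show bp: "b \<eta> v i > 0" by (rule T.lin_pos) (use assms vw in auto)
  show "v i > 0" "w i > 0" using vw assms by auto
  define A where "A = a \<eta> w i" define B where "B = b \<eta> v i"
  have p: "A * B + \<tau> > 0" using ap bp assms unfolding A_def B_def by (auto intro!: add_pos_pos)
  have "1 / v i = A + \<tau> / B" "1 / w i = B + \<tau> / A" using assms unfolding sol_def A_def B_def by auto
  then have e: "v i = B / (A * B + \<tau>)" "w i = A / (A * B + \<tau>)"
    using vw[OF assms(4)] ap bp p unfolding A_def[symmetric] B_def[symmetric] by (auto simp: field_simps)
  have y: "y = \<tau> / (A * B + \<tau>)" unfolding y_def defect_def A_def B_def ..
  show "v i * a \<eta> w i = 1 - y" "w i * b \<eta> v i = 1 - y"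
    unfolding y A_def[symmetric] B_def[symmetric] e using p by (auto simp: field_simps)
  show "(1 - y) * y = \<tau> * (v i * w i)" unfolding y e using p by (simp add: field_simps)
  show "0 < y" "y < 1" unfolding y using p assms ap bp unfolding A_def[symmetric] B_def[symmetric] by auto
qed

lemma sol_formula:
  assumes "sol K s \<tau> \<eta> v w" "\<tau> > 0" "\<eta> \<ge> 0" "i < K"
  shows "v i = b \<eta> v i / (a \<eta> w i * b \<eta> v i + \<tau>)" "w i = a \<eta> w i / (a \<eta> w i * b \<eta> v i + \<tau>)"
proof -
  note f = sol_facts[OF assms]
  have "a \<eta> w i * b \<eta> v i + \<tau> > 0" using f assms by (auto intro!: add_pos_pos)
  then show "v i = b \<eta> v i / (a \<eta> w i * b \<eta> v i + \<tau>)" "w i = a \<eta> w i / (a \<eta> w i * b \<eta> v i + \<tau>)"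
  proof -
    assume X: "a \<eta> w i * b \<eta> v i + \<tau> > 0"
    have "v i * a \<eta> w i = b \<eta> v i * a \<eta> w i / (a \<eta> w i * b \<eta> v i + \<tau>)"
      "w i * b \<eta> v i = a \<eta> w i * b \<eta> v i / (a \<eta> w i * b \<eta> v i + \<tau>)"
      unfolding f(5,6) defect_def using X by (simp_all add: field_simps)
    then have "v i * a \<eta> w i = b \<eta> v i / (a \<eta> w i * b \<eta> v i + \<tau>) * a \<eta> w i"
      "w i * b \<eta> v i = a \<eta> w i / (a \<eta> w i * b \<eta> v i + \<tau>) * b \<eta> v i" by simp_all
    then show "v i = b \<eta> v i / (a \<eta> w i * b \<eta> v i + \<tau>)" "w i = a \<eta> w i / (a \<eta> w i * b \<eta> v i + \<tau>)"
      using f(1,2) mult_right_cancel less_irrefl by metis+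
  qed
qed

lemma ln_vw:
  assumes "sol K s \<tau> \<eta> v w" "\<tau> > 0" "\<eta> \<ge> 0" "i < K"
  shows "ln (v i) + ln (w i) = ln (1 - defect K s \<tau> \<eta> v w i) + ln (defect K s \<tau> \<eta> v w i) - ln \<tau>"
proof -
  note f = sol_facts[OF assms]
  have "ln (v i) + ln (w i) = ln (v i * w i)" using f by (simp add: ln_mult)
  also have "v i * w i = (1 - defect K s \<tau> \<eta> v w i) * defect K s \<tau> \<eta> v w i / \<tau>" using f(7) assms by simp
  also have "ln \<dots> = ln (1 - defect K s \<tau> \<eta> v w i) + ln (defect K s \<tau> \<eta> v w i) - ln \<tau>"
    using f(8,9) assms by (simp add: ln_mult ln_div)
  finally show ?thesis .
qed

text \<open>The weights \<open>1 - defect\<close> are row and column sums of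
  \<open>v i * s i j * w j\<close> plus terms with \<open>\<eta>\<close>. Regrouping leaves
  \<open>K * K\<close> terms \<open>s i j * (z * ln z)\<close> with \<open>z = v i * w j\<close> and
  \<open>2 * K\<close> terms \<open>\<eta> * z * ln z\<close>, each at least -1.\<close>

lemma entropy:
  assumes "sol K s \<tau> \<eta> v w" "\<tau> > 0" "0 \<le> \<eta>" "\<eta> \<le> 1"
  shows "(\<Sum>i<K. (1 - defect K s \<tau> \<eta> v w i) * (ln (v i) + ln (w i))) \<ge> - (real K * K + 2 * K)"
proof -
  note f = sol_facts[OF assms(1-3)]
  have t0: "\<eta> * z * ln z \<ge> - 1" if "z > 0" for z :: real
  proof -
    have "\<eta> * (z * ln z) \<ge> \<eta> * (z - 1)" by (rule mult_left_mono[OF xlnx_ge[OF that] assms(3)])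
    moreover have "\<eta> * (z - 1) \<ge> - 1" using assms(3,4) that by (simp add: algebra_simps) (smt (verit) mult_nonneg_nonneg)
    ultimately show ?thesis by (simp add: mult.assoc)
  qed
  have T: "v i * s i j * w j * (ln (v i) + ln (w j)) \<ge> - 1" if "i < K" "j < K" for i j
  proof -
    define z where "z = v i * w j"
    have z: "z > 0" unfolding z_def using f that by auto
    have "s i j * (z * ln z) \<ge> s i j * (z - 1)" by (rule mult_left_mono[OF xlnx_ge[OF z] s_nonneg])
    moreover have "s i j * (z - 1) \<ge> - 1" using s_le_1[of i j] s_nonneg[of i j] z
      by (simp add: algebra_simps) (smt (verit) mult_nonneg_nonneg)
    moreover have "ln z = ln (v i) + ln (w j)" unfolding z_def using f(3)[OF that(1)] f(4)[OF that(2)] by (simp add: ln_mult)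
    ultimately show ?thesis unfolding z_def by (simp add: mult_ac)
  qed
  have e1: "(1 - defect K s \<tau> \<eta> v w i) * ln (v i) = \<eta> * v i * ln (v i) + (\<Sum>j<K. v i * s i j * w j * ln (v i))"
    if "i < K" for i
    unfolding f(5)[OF that, symmetric] lin_def by (simp add: algebra_simps sum_distrib_left sum_distrib_right)
  have e2: "(1 - defect K s \<tau> \<eta> v w j) * ln (w j) = \<eta> * w j * ln (w j) + (\<Sum>i<K. v i * s i j * w j * ln (w j))"
    if "j < K" for j
    unfolding f(6)[OF that, symmetric] lin_def by (simp add: algebra_simps sum_distrib_left sum_distrib_right)
  have "(\<Sum>i<K. (1 - defect K s \<tau> \<eta> v w i) * (ln (v i) + ln (w i))) =
    (\<Sum>i<K. (1 - defect K s \<tau> \<eta> v w i) * ln (v i)) + (\<Sum>j<K. (1 - defect K s \<tau> \<eta> v w j) * ln (w j))"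
    by (simp add: distrib_left sum.distrib)
  also have "\<dots> = (\<Sum>i<K. \<eta> * v i * ln (v i)) + (\<Sum>j<K. \<eta> * w j * ln (w j)) +
      ((\<Sum>i<K. \<Sum>j<K. v i * s i j * w j * ln (v i)) + (\<Sum>j<K. \<Sum>i<K. v i * s i j * w j * ln (w j)))"
    by (simp add: e1 e2 sum.distrib)
  also have "(\<Sum>j<K. \<Sum>i<K. v i * s i j * w j * ln (w j)) = (\<Sum>i<K. \<Sum>j<K. v i * s i j * w j * ln (w j))"
    by (rule sum.swap)
  also have "(\<Sum>i<K. \<Sum>j<K. v i * s i j * w j * ln (v i)) + (\<Sum>i<K. \<Sum>j<K. v i * s i j * w j * ln (w j)) =
      (\<Sum>i<K. \<Sum>j<K. v i * s i j * w j * (ln (v i) + ln (w j)))"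
    by (simp add: sum.distrib distrib_left)
  finally have E: "(\<Sum>i<K. (1 - defect K s \<tau> \<eta> v w i) * (ln (v i) + ln (w i))) =
      (\<Sum>i<K. \<eta> * v i * ln (v i)) + (\<Sum>j<K. \<eta> * w j * ln (w j)) +
      (\<Sum>i<K. \<Sum>j<K. v i * s i j * w j * (ln (v i) + ln (w j)))" .
  have "(\<Sum>i<K. - 1) \<le> (\<Sum>i<K. \<eta> * v i * ln (v i))" "(\<Sum>i<K. - 1) \<le> (\<Sum>i<K. \<eta> * w i * ln (w i))"
    by (intro sum_mono t0 f; simp)+
  moreover have "(\<Sum>i<K. \<Sum>j<K. - 1) \<le> (\<Sum>i<K. \<Sum>j<K. v i * s i j * w j * (ln (v i) + ln (w j)))"
    by (intro sum_mono T; simp)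
  ultimately show ?thesis unfolding E by simp
qed

lemma sum_ln_perm: "(\<Sum>i<K. ln (v i) + ln (w i)) = (\<Sum>i<K. ln (v i) + ln (w (\<pi> i)))" for v w :: "nat \<Rightarrow> real"
  using sum.permute[OF perm, of "\<lambda>i. ln (w i)"] by (simp add: sum.distrib comp_def)

lemma entry_le:
  assumes "sol K s \<tau> \<eta> v w" "\<tau> > 0" "\<eta> \<ge> 0" "i < K" "j < K"
  shows "v i * s i j * w j \<le> 1 - defect K s \<tau> \<eta> v w i"
proof -
  note f = sol_facts[OF assms(1-3)]
  have "s i j * w j \<le> (\<Sum>j<K. s i j * w j)"
    using assms less_imp_le[OF f(4)] by (intro member_le_sum[of j "{..<K}" "\<lambda>j. s i j * w j"]) (auto intro!: mult_nonneg_nonneg s_nonneg)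
  then have "s i j * w j \<le> a \<eta> w i" unfolding lin_def using assms by linarith
  then have "v i * (s i j * w j) \<le> v i * a \<eta> w i" using f(3)[OF assms(4)] by simp
  then show ?thesis using f(5)[OF assms(4)] by (simp add: mult.assoc)
qed

text \<open>Since \<open>v i * s i (\<pi> i) * w (\<pi> i) \<le> 1\<close>, the sum of all
  \<open>ln v + ln w\<close> is bounded above after reordering by \<open>\<pi>\<close>; subtracting
  \<open>entropy\<close> bounds the part weighted with \<open>y\<close>. By \<open>ln_vw\<close>
  that part contains \<open>y * - ln \<tau>\<close>, and the remaining terms in \<open>y\<close> are
  bounded.\<close>

lemma sum_defect_le:
  assumes "sol K s \<tau> \<eta> v w" "0 < \<tau>" "\<tau> < 1" "0 \<le> \<eta>" "\<eta> \<le> 1"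
  shows "(\<Sum>i<K. defect K s \<tau> \<eta> v w i) * - ln \<tau> \<le> real K * K + 3 * K - (\<Sum>i<K. ln (s i (\<pi> i)))"
proof -
  note f = sol_facts[OF assms(1,2,4)]
  define y where "y = defect K s \<tau> \<eta> v w"
  have y: "0 < y i" "y i < 1" if "i < K" for i using f that unfolding y_def by auto
  have "(\<Sum>i<K. y i * (ln (v i) + ln (w i))) = (\<Sum>i<K. ln (v i) + ln (w i)) - (\<Sum>i<K. (1 - y i) * (ln (v i) + ln (w i)))"
    by (simp add: algebra_simps sum_subtractf sum.distrib)
  also have "\<dots> \<le> (\<Sum>i<K. ln (v i) + ln (w (\<pi> i))) + (real K * K + 2 * K)"
    using entropy[OF assms(1,2,4,5)] sum_ln_perm[of v w] unfolding y_def by linarith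
  also have "(\<Sum>i<K. ln (v i) + ln (w (\<pi> i))) \<le> (\<Sum>i<K. ln (1 - y i) - ln (s i (\<pi> i)))"
  proof (rule sum_mono)
    fix i assume "i \<in> {..<K}"
    then have i: "i < K" "\<pi> i < K" using pi_less by auto
    have "ln (v i) + ln (s i (\<pi> i)) + ln (w (\<pi> i)) = ln (v i * s i (\<pi> i) * w (\<pi> i))"
      using f(3)[OF i(1)] f(4)[OF i(2)] s_pi[OF i(1)] by (simp add: ln_mult)
    also have "\<dots> \<le> ln (1 - y i)"
      using entry_le[OF assms(1,2,4) i] f(3)[OF i(1)] f(4)[OF i(2)] s_pi[OF i(1)] y[OF i(1)] unfolding y_def by (subst ln_le_cancel_iff) auto
    finally show "ln (v i) + ln (w (\<pi> i)) \<le> ln (1 - y i) - ln (s i (\<pi> i))" by linarith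
  qed
  finally have 1: "(\<Sum>i<K. y i * (ln (v i) + ln (w i))) \<le>
      (\<Sum>i<K. ln (1 - y i) - ln (s i (\<pi> i))) + (real K * K + 2 * K)" by simp
  have "(\<Sum>i<K. y i * - ln \<tau>) = (\<Sum>i<K. y i * (ln (v i) + ln (w i))) - (\<Sum>i<K. y i * (ln (1 - y i) + ln (y i)))"
    unfolding sum_subtractf[symmetric]
  proof (intro sum.cong refl)
    fix i assume "i \<in> {..<K}"
    then have "ln (v i) + ln (w i) = ln (1 - y i) + ln (y i) - ln \<tau>" using ln_vw[OF assms(1,2,4)] unfolding y_def by auto
    then show "y i * - ln \<tau> = y i * (ln (v i) + ln (w i)) - y i * (ln (1 - y i) + ln (y i))"
      by (simp only:) (simp add: algebra_simps)
  qed
  also have "\<dots> \<le> (\<Sum>i<K. ln (1 - y i) - ln (s i (\<pi> i))) - (\<Sum>i<K. y i * (ln (1 - y i) + ln (y i))) + (real K * K + 2 * K)"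
    using 1 by simp
  also have "\<dots> = (\<Sum>i<K. (1 - y i) * ln (1 - y i) - y i * ln (y i)) - (\<Sum>i<K. ln (s i (\<pi> i))) + (real K * K + 2 * K)"
    by (simp add: algebra_simps sum_subtractf sum.distrib)
  also have "(\<Sum>i<K. (1 - y i) * ln (1 - y i) - y i * ln (y i)) \<le> (\<Sum>i<K. 1)"
  proof (rule sum_mono)
    fix i assume "i \<in> {..<K}"
    then have i: "i < K" by auto
    have "(1 - y i) * ln (1 - y i) \<le> 0" using y[OF i] by (intro mult_nonneg_nonpos) auto
    then show "(1 - y i) * ln (1 - y i) - y i * ln (y i) \<le> 1" using xlnx_ge[of "y i"] y[OF i] by linarith
  qed
  finally show ?thesis unfolding y_def sum_distrib_right by simp
qed

text \<open>The upper bound for \<open>v i * w j\<close> is immediate, as the entry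
  \<open>v i * s i j * w j\<close> is at most 1. For the lower one, entropy bounds the product of
  all \<open>v i * w (\<pi> i)\<close> from below, and as each factor is bounded above, none can be
  small.\<close>

lemma pairing_bounds:
  shows "\<exists>\<tau>0 c. 0 < \<tau>0 \<and> \<tau>0 < 1 \<and> 0 < c \<and> c \<le> 1 \<and> (\<forall>\<tau> \<eta> v w. sol K s \<tau> \<eta> v w \<longrightarrow> 0 < \<tau> \<longrightarrow> \<tau> < \<tau>0 \<longrightarrow>
    0 \<le> \<eta> \<longrightarrow> \<eta> \<le> 1 \<longrightarrow> (\<Sum>i<K. defect K s \<tau> \<eta> v w i) \<le> 1 / 2 \<and> (\<forall>i<K. c \<le> v i * w (\<pi> i)) \<and>
    (\<forall>i<K. \<forall>j<K. s i j > 0 \<longrightarrow> v i * w j \<le> 1 / c))"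
proof -
  obtain \<mu> where \<mu>: "0 < \<mu>" "\<mu> \<le> 1" "\<And>i j. i < K \<Longrightarrow> j < K \<Longrightarrow> s i j > 0 \<Longrightarrow> \<mu> \<le> s i j"
    using min_positive_entry by blast
  define C1 where "C1 = real K * K + 2 * K"
  define C2 where "C2 = real K * K + 3 * K - (\<Sum>i<K. ln (s i (\<pi> i)))"
  have "(\<Sum>i<K. ln (s i (\<pi> i))) \<le> 0"
    using s_pi s_le_1 by (intro sum_nonpos) (auto simp: less_imp_le)
  then have C2: "C2 \<ge> 0" unfolding C2_def by (smt (verit) of_nat_0_le_iff zero_le_mult_iff)
  \<comment> \<open>For \<open>\<tau> < \<tau>0\<close> one has
    \<open>- ln \<tau> > 2 * C2 + 1\<close>, and \<open>sum_defect_le\<close> bounds the total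
    defect by \<open>C2 / (2 * C2 + 1)\<close>, which is at most 1/2.\<close>
  define \<tau>0 where "\<tau>0 = exp (- (2 * C2 + 1))"
  \<comment> \<open>Lower bound for a single \<open>ln (v i) + ln (w (\<pi> i))\<close>: the sum of
    these is at least \<open>- (2 * K + C1)\<close>, and the others contribute at most
    \<open>- ln \<mu>\<close> each.\<close>
  define L where "L = - (2 * K + C1) + K * ln \<mu>"
  define c where "c = min \<mu> (exp L)"
  have "ln \<mu> \<le> 0" using \<mu> by simp
  have c: "0 < c" "c \<le> \<mu>" "c \<le> exp L" "c \<le> 1" unfolding c_def using \<mu> by auto
  have "(\<Sum>i<K. defect K s \<tau> \<eta> v w i) \<le> 1 / 2 \<and> (\<forall>i<K. c \<le> v i * w (\<pi> i)) \<and>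
    (\<forall>i<K. \<forall>j<K. s i j > 0 \<longrightarrow> v i * w j \<le> 1 / c)"
    if A: "sol K s \<tau> \<eta> v w" "0 < \<tau>" "\<tau> < \<tau>0" "0 \<le> \<eta>" "\<eta> \<le> 1" for \<tau> \<eta> v w
  proof -
    define y where "y = defect K s \<tau> \<eta> v w"
    note f = sol_facts[OF A(1,2,4)]
    have y: "0 < y i" "y i < 1" if "i < K" for i using f that unfolding y_def by auto
    have "\<tau>0 \<le> exp 0" unfolding \<tau>0_def by (subst exp_le_cancel_iff) (use C2 in auto)
    then have t1: "\<tau> < 1" using A by simp
    have "ln \<tau> < ln \<tau>0" using A by simp
    then have lt: "- ln \<tau> > 2 * C2 + 1" unfolding \<tau>0_def by simp
    have ys: "(\<Sum>i<K. y i) \<ge> 0" using y by (intro sum_nonneg) (auto intro: less_imp_le)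
    have "(\<Sum>i<K. y i) * (2 * C2 + 1) \<le> (\<Sum>i<K. y i) * - ln \<tau>" using lt ys by (intro mult_left_mono) auto
    also have "\<dots> \<le> C2" using sum_defect_le[OF A(1,2) t1 A(4,5)] unfolding y_def C2_def .
    finally have "(\<Sum>i<K. y i) * (2 * C2 + 1) \<le> (1 / 2) * (2 * C2 + 1)" by (simp add: algebra_simps)
    then have half: "(\<Sum>i<K. y i) \<le> 1 / 2" using C2 by (subst (asm) mult_le_cancel_right_pos) auto
    have yh: "y i \<le> 1 / 2" if "i < K" for i
      using member_le_sum[of i "{..<K}" y] half that y by (force intro: less_imp_le)
    have up: "v i * w j \<le> 1 / \<mu>" if "i < K" "j < K" "s i j > 0" for i j
    proof -
      have "v i * w j * \<mu> \<le> v i * w j * s i j" using \<mu>(3)[OF that] f(3)[OF that(1)] f(4)[OF that(2)] by (intro mult_left_mono) auto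
      also have "\<dots> \<le> 1" using entry_le[OF A(1,2,4) that(1,2)] y[OF that(1)] unfolding y_def by (simp add: mult_ac)
      finally show ?thesis using \<mu> by (simp add: field_simps)
    qed
    have lnup: "ln (v i) + ln (w (\<pi> i)) \<le> - ln \<mu>" if "i < K" for i
    proof -
      have "ln (v i) + ln (w (\<pi> i)) = ln (v i * w (\<pi> i))" using f(3)[OF that] f(4)[OF pi_less[OF that]] by (simp add: ln_mult)
      also have "\<dots> \<le> ln (1 / \<mu>)" using up[OF that pi_less[OF that] s_pi[OF that]] f(3)[OF that] f(4)[OF pi_less[OF that]] \<mu>
        by (subst ln_le_cancel_iff) auto
      finally show ?thesis using \<mu> by (simp add: ln_div)
    qed
    have "(\<Sum>i<K. - 2) \<le> (\<Sum>i<K. y i * (ln (v i) + ln (w i)))"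
    proof (rule sum_mono)
      fix i assume "i \<in> {..<K}"
      then have i: "i < K" by auto
      have "ln (1 / (1 - y i)) \<le> 1 / (1 - y i) - 1" by (rule ln_le_minus_one) (use y[OF i] in auto)
      also have "\<dots> \<le> 1" using yh[OF i] by (simp add: field_simps)
      finally have "ln (1 - y i) \<ge> - 1" using y[OF i] by (simp add: ln_div)
      then have "y i * ln (1 - y i) \<ge> y i * - 1" using y[OF i] by (intro mult_left_mono) auto
      moreover have "y i * ln (y i) \<ge> y i - 1" using xlnx_ge y[OF i] by auto
      moreover have "y i * - ln \<tau> \<ge> 0" using y[OF i] t1 A by (intro mult_nonneg_nonneg) auto
      moreover have "y i * (ln (v i) + ln (w i)) = y i * ln (1 - y i) + y i * ln (y i) + y i * - ln \<tau>"
        unfolding ln_vw[OF A(1,2,4) i] y_def by (simp add: algebra_simps)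
      ultimately show "- 2 \<le> y i * (ln (v i) + ln (w i))" using y[OF i] by linarith
    qed
    moreover have "(\<Sum>i<K. ln (v i) + ln (w i)) = (\<Sum>i<K. y i * (ln (v i) + ln (w i))) + (\<Sum>i<K. (1 - y i) * (ln (v i) + ln (w i)))"
      unfolding sum.distrib[symmetric] by (simp add: algebra_simps)
    ultimately have S: "(\<Sum>i<K. ln (v i) + ln (w (\<pi> i))) \<ge> - (2 * K + C1)"
      using entropy[OF A(1,2,4,5)] sum_ln_perm[of v w] unfolding y_def C1_def by simp
    have low: "c \<le> v i * w (\<pi> i)" if i: "i < K" for i
    proof -
      have "(\<Sum>i<K. ln (v i) + ln (w (\<pi> i))) = (ln (v i) + ln (w (\<pi> i))) + (\<Sum>j\<in>{..<K} - {i}. ln (v j) + ln (w (\<pi> j)))"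
        using i by (subst sum.remove[of _ i]) auto
      also have "(\<Sum>j\<in>{..<K} - {i}. ln (v j) + ln (w (\<pi> j))) \<le> (\<Sum>j\<in>{..<K} - {i}. - ln \<mu>)"
        using lnup by (intro sum_mono) auto
      also have "\<dots> \<le> (\<Sum>j\<in>{..<K}. - ln \<mu>)" using \<open>ln \<mu> \<le> 0\<close> by (intro sum_mono2) auto
      finally have "L \<le> ln (v i) + ln (w (\<pi> i))" using S unfolding L_def by simp
      also have "\<dots> = ln (v i * w (\<pi> i))" using f(3)[OF i] f(4)[OF pi_less[OF i]] by (simp add: ln_mult)
      finally have "exp L \<le> v i * w (\<pi> i)" using f(3)[OF i] f(4)[OF pi_less[OF i]] by (subst (asm) ln_ge_iff) auto
      then show ?thesis using c by simp
    qed
    have "1 / \<mu> \<le> 1 / c" using c \<mu> by (intro divide_left_mono) auto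
    then show ?thesis using half low up unfolding y_def by (meson order_trans)
  qed
  moreover have "0 < \<tau>0" "\<tau>0 < 1" unfolding \<tau>0_def using C2 by auto
  ultimately show ?thesis using c by blast
qed

text \<open>With \<open>x = 1 - y\<close>, compare the matrices \<open>T\<close> and
  \<open>T'\<close> by relative entropy. Log-sum inequalities give the sum of
  \<open>(x - x') * (ln x - ln x')\<close> as a lower bound for that of
  \<open>(T - T') * ln (T / T')\<close>. The latter is computed from \<open>ln_vw\<close>: it
  repeats the same sum, adds terms with \<open>ln (1 - x)\<close> that are at most 0, and leaves the
  sum of \<open>x - x'\<close> times \<open>ln \<tau>' - ln \<tau>\<close>. This monotonicity makes
  the density non-negative near 0.\<close>

lemma sum_defect_mono:
  assumes S: "sol K s \<tau> 0 v w" "sol K s \<tau>' 0 v' w'" and t: "0 < \<tau>" "\<tau> < \<tau>'"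
  shows "(\<Sum>i<K. defect K s \<tau> 0 v w i) \<le> (\<Sum>i<K. defect K s \<tau>' 0 v' w' i)"
proof -
  have t': "0 < \<tau>'" using t by simp
  note f = sol_facts[OF S(1) t(1) order_refl] note f' = sol_facts[OF S(2) t' order_refl]
  define x where "x = (\<lambda>i. 1 - defect K s \<tau> 0 v w i)"
  define x' where "x' = (\<lambda>i. 1 - defect K s \<tau>' 0 v' w' i)"
  define T where "T = (\<lambda>i j. v i * s i j * w j)"
  define T' where "T' = (\<lambda>i j. v' i * s i j * w' j)"
  define dv where "dv = (\<lambda>i. ln (v i) - ln (v' i))"
  define dw where "dw = (\<lambda>i. ln (w i) - ln (w' i))"
  have x: "0 < x i" "x i < 1" "0 < x' i" "x' i < 1" if "i < K" for i
    using f(8,9)[OF that] f'(8,9)[OF that] unfolding x_def x'_def by auto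
  have xr: "x i = (\<Sum>j<K. T i j)" "x' i = (\<Sum>j<K. T' i j)" if "i < K" for i
    using f(5)[OF that] f'(5)[OF that] unfolding x_def x'_def T_def T'_def lin_def
    by (simp_all add: sum_distrib_left mult.assoc)
  have xc: "x j = (\<Sum>i<K. T i j)" "x' j = (\<Sum>i<K. T' i j)" if "j < K" for j
    using f(6)[OF that] f'(6)[OF that] unfolding x_def x'_def T_def T'_def lin_def
    by (simp_all add: sum_distrib_left mult_ac)
  have TT: "T i j = T' i j * exp (dv i + dw j)" "T' i j = T i j * exp (- (dv i + dw j))" if "i < K" "j < K" for i j
  proof -
    have "exp (dv i) = v i / v' i" "exp (dw j) = w j / w' j"
      using f f' that unfolding dv_def dw_def by (simp_all add: exp_diff)
    then show "T i j = T' i j * exp (dv i + dw j)" "T' i j = T i j * exp (- (dv i + dw j))"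
      using f(3,4) f'(3,4) that unfolding T_def T'_def exp_minus exp_add by (auto simp: field_simps) 
  qed
  have T0: "T i j \<ge> 0" "T' i j \<ge> 0" if "i < K" "j < K" for i j
    unfolding T_def T'_def
    by (intro mult_nonneg_nonneg s_nonneg less_imp_le[OF f(3)] less_imp_le[OF f(4)] less_imp_le[OF f'(3)] less_imp_le[OF f'(4)] that)+
  \<comment> \<open>Log-sum inequality for row \<open>i\<close> in both directions, with
    \<open>dv i + dw j\<close> in the role of \<open>ln (T i j / T' i j)\<close> so that vanishing
    entries need no special treatment.\<close>
  have row: "(x i - x' i) * (ln (x i) - ln (x' i)) \<le> (\<Sum>j<K. (T i j - T' i j) * (dv i + dw j))" if i: "i < K" for i
  proof -
    define D where "D = ln (x i) - ln (x' i)"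
    have eD: "exp D = x i / x' i" "exp (- D) = x' i / x i"
      unfolding D_def using x[OF i] by (simp_all add: exp_diff exp_minus)
    have "(\<Sum>j<K. T i j - T' i j * exp D) \<le> (\<Sum>j<K. T i j * (dv i + dw j - D))"
    proof (rule sum_mono)
      fix j assume "j \<in> {..<K}"
      then have j: "j < K" by simp
      have "1 + (D - (dv i + dw j)) \<le> exp (D - (dv i + dw j))" by (rule exp_ge_add_one_self)
      then have "T i j * (1 - exp (D - (dv i + dw j))) \<le> T i j * (dv i + dw j - D)"
        using T0[OF i j] by (intro mult_left_mono) linarith+
      moreover have "T i j * (1 - exp (D - (dv i + dw j))) = T i j - T' i j * exp D"
      proof -
        have "exp (D - (dv i + dw j)) = exp (- (dv i + dw j)) * exp D" by (simp flip: exp_add)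
        then show ?thesis using TT(2)[OF i j] by (simp add: right_diff_distrib flip: mult.assoc)
      qed
      ultimately show "T i j - T' i j * exp D \<le> T i j * (dv i + dw j - D)" by simp
    qed
    moreover have "(\<Sum>j<K. T i j - T' i j * exp D) = 0"
      unfolding sum_subtractf sum_distrib_right[symmetric] xr[OF i, symmetric] eD using x[OF i] by simp
    ultimately have 1: "x i * D \<le> (\<Sum>j<K. T i j * (dv i + dw j))"
      unfolding right_diff_distrib sum_subtractf sum_distrib_right[symmetric] xr[OF i, symmetric] by simp
    have "(\<Sum>j<K. T' i j * (dv i + dw j - D)) \<le> (\<Sum>j<K. T i j * exp (- D) - T' i j)"
    proof (rule sum_mono)
      fix j assume "j \<in> {..<K}"
      then have j: "j < K" by simp
      have "1 + (dv i + dw j - D) \<le> exp (dv i + dw j - D)" by (rule exp_ge_add_one_self)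
      then have "T' i j * (dv i + dw j - D) \<le> T' i j * (exp (dv i + dw j - D) - 1)"
        using T0[OF i j] by (intro mult_left_mono) linarith+
      moreover have "T' i j * (exp (dv i + dw j - D) - 1) = T i j * exp (- D) - T' i j"
      proof -
        have "exp (dv i + dw j - D) = exp (dv i + dw j) * exp (- D)" by (simp flip: exp_add)
        then show ?thesis using TT(1)[OF i j] by (simp add: right_diff_distrib flip: mult.assoc)
      qed
      ultimately show "T' i j * (dv i + dw j - D) \<le> T i j * exp (- D) - T' i j" by simp
    qed
    moreover have "(\<Sum>j<K. T i j * exp (- D) - T' i j) = 0"
      unfolding sum_subtractf sum_distrib_right[symmetric] xr[OF i, symmetric] eD using x[OF i] by simp
    ultimately have 2: "(\<Sum>j<K. T' i j * (dv i + dw j)) \<le> x' i * D"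
      unfolding right_diff_distrib sum_subtractf sum_distrib_right[symmetric] xr[OF i, symmetric] by simp
    from 1 2 show ?thesis unfolding D_def[symmetric] by (simp add: left_diff_distrib sum_subtractf)
  qed
  have "(\<Sum>i<K. (x i - x' i) * (ln (x i) - ln (x' i))) \<le> (\<Sum>i<K. \<Sum>j<K. (T i j - T' i j) * (dv i + dw j))"
    by (intro sum_mono row) auto
  also have "\<dots> = (\<Sum>i<K. \<Sum>j<K. (T i j - T' i j) * dv i) + (\<Sum>i<K. \<Sum>j<K. (T i j - T' i j) * dw j)"
    by (simp add: distrib_left sum.distrib)
  also have "(\<Sum>i<K. \<Sum>j<K. (T i j - T' i j) * dw j) = (\<Sum>j<K. \<Sum>i<K. (T i j - T' i j) * dw j)" by (rule sum.swap)
  also have "(\<Sum>i<K. \<Sum>j<K. (T i j - T' i j) * dv i) = (\<Sum>i<K. (x i - x' i) * dv i)"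
    by (intro sum.cong) (auto simp: xr sum_distrib_right[symmetric] sum_subtractf)
  also have "(\<Sum>j<K. \<Sum>i<K. (T i j - T' i j) * dw j) = (\<Sum>i<K. (x i - x' i) * dw i)"
    by (intro sum.cong) (auto simp: xc sum_distrib_right[symmetric] sum_subtractf)
  also have "(\<Sum>i<K. (x i - x' i) * dv i) + (\<Sum>i<K. (x i - x' i) * dw i) = (\<Sum>i<K. (x i - x' i) *
      ((ln (x i) - ln (x' i)) + (ln (1 - x i) - ln (1 - x' i)) + (ln \<tau>' - ln \<tau>)))"
    unfolding sum.distrib[symmetric]
  proof (intro sum.cong refl)
    fix i assume "i \<in> {..<K}"
    then have i: "i < K" by simp
    have "dv i + dw i = (ln (x i) - ln (x' i)) + (ln (1 - x i) - ln (1 - x' i)) + (ln \<tau>' - ln \<tau>)"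
      using ln_vw[OF S(1) t(1) order_refl i] ln_vw[OF S(2) t' order_refl i] unfolding dv_def dw_def x_def x'_def by simp
    then show "(x i - x' i) * dv i + (x i - x' i) * dw i = (x i - x' i) *
      ((ln (x i) - ln (x' i)) + (ln (1 - x i) - ln (1 - x' i)) + (ln \<tau>' - ln \<tau>))"
      by (metis distrib_left)
  qed
  also have "\<dots> \<le> (\<Sum>i<K. (x i - x' i) * (ln (x i) - ln (x' i)) + (x i - x' i) * (ln \<tau>' - ln \<tau>))"
  proof (rule sum_mono)
    fix i assume "i \<in> {..<K}"
    then have i: "i < K" by simp
    have "(x i - x' i) * (ln (1 - x i) - ln (1 - x' i)) \<le> 0"
    proof (cases "x i \<le> x' i")
      case True then show ?thesis using x[OF i] by (intro mult_nonpos_nonneg) auto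
    next
      case False then show ?thesis using x[OF i] by (intro mult_nonneg_nonpos) auto
    qed
    then show "(x i - x' i) * ((ln (x i) - ln (x' i)) + (ln (1 - x i) - ln (1 - x' i)) + (ln \<tau>' - ln \<tau>)) \<le>
      (x i - x' i) * (ln (x i) - ln (x' i)) + (x i - x' i) * (ln \<tau>' - ln \<tau>)" by (simp add: distrib_left)
  qed
  finally have "0 \<le> (\<Sum>i<K. x i - x' i) * (ln \<tau>' - ln \<tau>)" by (simp add: sum.distrib sum_distrib_right)
  moreover have "ln \<tau>' - ln \<tau> > 0" using t by simp
  ultimately have "0 \<le> (\<Sum>i<K. x i - x' i)" by (simp add: zero_le_mult_iff)
  then show ?thesis unfolding x_def x'_def by (simp add: sum_subtractf)
qed

end

section \<open>A priori bounds and the limit of vanishing regularisation\<close>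

text \<open>The exponent \<open>N\<close> depends on the graph alone, so the comparison is uniform
  over all solutions and all factors \<open>M\<close>.\<close>

lemma chain_bound:
  fixes R :: "('a \<times> 'a) set"
  assumes "finite P" "P \<subseteq> R\<^sup>*"
  shows "\<exists>N::nat. \<forall>u. \<forall>M::real. M \<ge> 1 \<longrightarrow> (\<forall>i. u i \<ge> 0) \<longrightarrow> (\<forall>(i, j)\<in>R. u i \<le> M * u j) \<longrightarrow> (\<forall>(i, j)\<in>P. u i \<le> M ^ N * u j)"
proof -
  have "\<exists>n. p \<in> R ^^ n" if "p \<in> P" for p using that assms(2) rtrancl_imp_relpow[of p R] by auto
  then obtain n where n: "\<And>p. p \<in> P \<Longrightarrow> p \<in> R ^^ n p" by metis
  define N where "N = (\<Sum>p\<in>P. n p)"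
  have N: "n p \<le> N" if "p \<in> P" for p unfolding N_def using that assms(1) by (intro member_le_sum) auto
  have "u i \<le> M ^ N * u j" if M: "M \<ge> 1" and u: "\<forall>i. u i \<ge> 0" and R: "\<forall>(i, j)\<in>R. u i \<le> M * u j" and P: "(i, j) \<in> P"
    for u :: "'a \<Rightarrow> real" and M i j
  proof -
    have "u i \<le> M ^ m * u k" if "(i, k) \<in> R ^^ m" for k m using that
    proof (induction m arbitrary: k)
      case (Suc m)
      then obtain l where l: "(i, l) \<in> R ^^ m" "(l, k) \<in> R" by auto
      have "u i \<le> M ^ m * u l" using Suc.IH[OF l(1)] .
      also have "\<dots> \<le> M ^ m * (M * u k)" using R l(2) M by (intro mult_left_mono) auto
      finally show ?case by (simp add: mult_ac)
    qed simp
    from this[OF n[OF P]] have "u i \<le> M ^ n (i, j) * u j" .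
    also have "\<dots> \<le> M ^ N * u j" using u M N[OF P] by (intro mult_right_mono power_increasing) auto
    finally show ?thesis .
  qed
  then show ?thesis by blast
qed

text \<open>Following \<open>p\<close> around its cycle undoes one application of \<open>p\<close>.
  Formally, \<open>p\<close> maps the part of \<open>S\<close> reachable from \<open>p j\<close>
  injectively into itself, hence onto, so \<open>p j\<close> is the image of a reachable point,
  which must be \<open>j\<close>.\<close>

lemma permutes_orbit:
  assumes "p permutes S" "finite S" "\<And>i. i \<in> S \<Longrightarrow> (i, p i) \<in> R" "j \<in> S"
  shows "(p j, j) \<in> R\<^sup>*"
proof -
  define A where "A = {k \<in> S. (p j, k) \<in> R\<^sup>*}"
  have "p ` A \<subseteq> A"
  proof
    fix x assume "x \<in> p ` A"
    then obtain k where k: "k \<in> S" "(p j, k) \<in> R\<^sup>*" "x = p k" unfolding A_def by auto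
    then show "x \<in> A" unfolding A_def using assms(3)[OF k(1)] permutes_in_image[OF assms(1), of k]
      by (auto intro: rtrancl_into_rtrancl)
  qed
  moreover have "finite A" unfolding A_def using assms by auto
  moreover have "inj_on p A" using permutes_inj[OF assms(1)] by (rule inj_on_subset) auto
  ultimately have "p ` A = A" by (metis endo_inj_surj)
  moreover have "p j \<in> A" unfolding A_def using assms permutes_in_image[OF assms(1), of j] by auto
  ultimately obtain k where "k \<in> A" "p j = p k" by auto
  then have "k = j" using permutes_inj[OF assms(1)] by (auto dest: injD)
  then show ?thesis using \<open>k \<in> A\<close> unfolding A_def by auto
qed

context variance_matrix begin

text \<open>The two equations give \<open>v i * a i = w i * b i\<close>. Summed over
  \<open>i\<close>, the bilinear parts agree, and \<open>\<eta>\<close> times the two sums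
  remains.\<close>

lemma balanced_pos:
  assumes "sol K s \<tau> \<eta> v w" "\<tau> > 0" "\<eta> > 0" shows "bal K s \<tau> \<eta> v w"
proof -
  interpret T: variance_matrix K "\<lambda>i j. s j i" by (rule variance_matrix_transpose)
  have vw: "v i > 0" "w i > 0" if "i < K" for i using assms(1) that unfolding sol_def by auto
  have "v i * a \<eta> w i = w i * b \<eta> v i" if i: "i < K" for i
  proof -
    have "\<eta> \<le> a \<eta> w i" "\<eta> \<le> b \<eta> v i" using lin_ge[of w \<eta> i] T.lin_ge[of v \<eta> i] vw by (auto intro: less_imp_le)
    then have p: "a \<eta> w i > 0" "b \<eta> v i > 0" using assms(3) by auto
    have "1 / v i * b \<eta> v i = 1 / w i * a \<eta> w i"
      using assms(1) i p unfolding sol_def by (simp add: distrib_right)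
    then show ?thesis using vw[OF i] by (simp add: field_simps)
  qed
  then have "(\<Sum>i<K. v i * a \<eta> w i) = (\<Sum>i<K. w i * b \<eta> v i)" by simp
  moreover have "(\<Sum>i<K. v i * a \<eta> w i) = \<eta> * (\<Sum>i<K. v i) + (\<Sum>i<K. \<Sum>j<K. v i * s i j * w j)"
    unfolding lin_def by (simp add: distrib_left sum.distrib sum_distrib_left mult_ac)
  moreover have "(\<Sum>i<K. w i * b \<eta> v i) = \<eta> * (\<Sum>i<K. w i) + (\<Sum>j<K. \<Sum>i<K. v i * s i j * w j)"
    unfolding lin_def by (simp add: distrib_left sum.distrib sum_distrib_left mult_ac)
  moreover have "(\<Sum>j<K. \<Sum>i<K. v i * s i j * w j) = (\<Sum>i<K. \<Sum>j<K. v i * s i j * w j)" by (rule sum.swap)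
  ultimately have "\<eta> * (\<Sum>i<K. v i) = \<eta> * (\<Sum>i<K. w i)" by linarith
  then show ?thesis unfolding bal_def using assms by simp
qed

lemma sol_bounds_large:
  assumes "sol K s \<tau> \<eta> v w" "\<tau> > 0" "\<eta> > 0" "i < K"
  shows "v i \<le> 1 / \<eta>" "1 / (\<eta> + K / \<eta> + \<tau> / \<eta>) \<le> v i"
proof -
  interpret T: variance_matrix K "\<lambda>i j. s j i" by (rule variance_matrix_transpose)
  have vw: "v i > 0" "w i > 0" if "i < K" for i using assms(1) that unfolding sol_def by auto
  have ge: "\<eta> \<le> a \<eta> w i" "\<eta> \<le> b \<eta> v i" for i using lin_ge[of w \<eta> i] T.lin_ge[of v \<eta> i] vw by (auto intro: less_imp_le)
  have wle: "w j \<le> 1 / \<eta>" if "j < K" for j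
  proof -
    have "\<tau> / a \<eta> w j \<ge> 0" using ge[of j] assms by simp
    moreover have "1 / w j = b \<eta> v j + \<tau> / a \<eta> w j" using assms(1) that unfolding sol_def by auto
    ultimately have "\<eta> \<le> 1 / w j" using ge[of j] by linarith
    then show ?thesis using vw[OF that] assms(3) by (simp add: field_simps)
  qed
  have e: "1 / v i = a \<eta> w i + \<tau> / b \<eta> v i" using assms unfolding sol_def by auto
  have t: "\<tau> / b \<eta> v i \<ge> 0" "\<tau> / b \<eta> v i \<le> \<tau> / \<eta>" using ge[of i] assms by (auto intro!: divide_left_mono mult_pos_pos)
  then have "\<eta> \<le> 1 / v i" using ge[of i] e by linarith
  then show "v i \<le> 1 / \<eta>" using vw[OF assms(4)] assms(3) by (simp add: field_simps)
  have "a \<eta> w i \<le> \<eta> + K * (1 / \<eta>)" by (rule lin_le) (use wle vw in \<open>auto intro: less_imp_le\<close>)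
  then have "1 / v i \<le> \<eta> + K / \<eta> + \<tau> / \<eta>" using e t by simp
  moreover have "\<eta> + K / \<eta> + \<tau> / \<eta> > 0" using assms by (intro add_pos_pos add_pos_nonneg) auto
  ultimately show "1 / (\<eta> + K / \<eta> + \<tau> / \<eta>) \<le> v i" using vw[OF assms(4)] by (simp add: field_simps)
qed

lemma confined_large:
  assumes "0 < \<tau>1" "0 < e1"
  shows "\<exists>c>0. \<exists>C>0. \<forall>\<tau> \<eta> v w. sol K s \<tau> \<eta> v w \<longrightarrow> \<tau>1 \<le> \<tau> \<longrightarrow> \<tau> \<le> \<tau>2 \<longrightarrow> e1 \<le> \<eta> \<longrightarrow> \<eta> \<le> e2 \<longrightarrow> confined K c C \<tau> \<eta> v w"
proof -
  interpret T: variance_matrix K "\<lambda>i j. s j i" by (rule variance_matrix_transpose)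
  define U where "U = \<bar>e2\<bar> + K / e1 + \<bar>\<tau>2\<bar> / e1"
  define c where "c = min \<tau>1 (1 / U)"
  define C where "C = max (max \<tau>1 \<tau>2) (max e2 (1 / e1))"
  have Kp: "0 < K / e1" using K_pos assms by simp
  have U: "U > 0" unfolding U_def using assms Kp by (intro add_pos_nonneg add_nonneg_pos) auto
  then have c: "c > 0" unfolding c_def using assms by auto
  have C: "C > 0" unfolding C_def using assms by (simp add: less_max_iff_disj)
  have "confined K c C \<tau> \<eta> v w" if A: "sol K s \<tau> \<eta> v w" "\<tau>1 \<le> \<tau>" "\<tau> \<le> \<tau>2" "e1 \<le> \<eta>" "\<eta> \<le> e2" for \<tau> \<eta> v w
  proof -
    have p: "\<tau> > 0" "\<eta> > 0" using A assms by auto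
    have u: "1 / \<eta> \<le> C" unfolding C_def using A assms by (intro max.coboundedI2) (auto intro!: divide_left_mono)
    have "\<eta> + K / \<eta> + \<tau> / \<eta> \<le> U" unfolding U_def
      using A assms p by (intro add_mono frac_le) auto
    moreover have "\<eta> + K / \<eta> + \<tau> / \<eta> > 0" using p by (intro add_pos_pos add_pos_nonneg) auto
    ultimately have l: "c \<le> 1 / (\<eta> + K / \<eta> + \<tau> / \<eta>)" unfolding c_def
      using U by (intro min.coboundedI2 divide_left_mono) auto
    note vb = sol_bounds_large[OF A(1) p] note wb = T.sol_bounds_large[OF sol_swap[OF A(1)] p]
    show ?thesis unfolding confined_def
    proof (intro conjI allI impI)
      show "c \<le> \<tau>" using A unfolding c_def by auto
      show "\<tau> \<le> C" "\<eta> \<le> C" using A unfolding C_def by auto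
      show "0 \<le> \<eta>" using p by simp
      fix i assume i: "i < K"
      show "c \<le> v i" "c \<le> w i" using l vb(2)[OF i] wb(2)[OF i] by linarith+
      show "v i \<le> C" "w i \<le> C" using u vb(1)[OF i] wb(1)[OF i] by linarith+
    qed
  qed
  then show ?thesis using c C by blast
qed

end

text \<open>Fixes one choice of the constants from \<open>pairing_bounds\<close>, so that everything
  later refers to the same range \<open>\<tau> < \<tau>0\<close>,
  \<open>\<eta> \<le> 1\<close>.\<close>

locale controlled_matrix = irreducible_matrix +
  fixes \<tau>0 c0 :: real
  assumes \<tau>0: "0 < \<tau>0" "\<tau>0 < 1" and c0: "0 < c0" "c0 \<le> 1"
    and defect_half: "\<And>\<tau> \<eta> v w. sol K s \<tau> \<eta> v w \<Longrightarrow> 0 < \<tau> \<Longrightarrow> \<tau> < \<tau>0 \<Longrightarrow> 0 \<le> \<eta> \<Longrightarrow> \<eta> \<le> 1 \<Longrightarrow>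
      (\<Sum>i<K. defect K s \<tau> \<eta> v w i) \<le> 1 / 2"
    and pair_ge: "\<And>\<tau> \<eta> v w i. sol K s \<tau> \<eta> v w \<Longrightarrow> 0 < \<tau> \<Longrightarrow> \<tau> < \<tau>0 \<Longrightarrow> 0 \<le> \<eta> \<Longrightarrow> \<eta> \<le> 1 \<Longrightarrow>
      i < K \<Longrightarrow> c0 \<le> v i * w (\<pi> i)"
    and pair_le: "\<And>\<tau> \<eta> v w i j. sol K s \<tau> \<eta> v w \<Longrightarrow> 0 < \<tau> \<Longrightarrow> \<tau> < \<tau>0 \<Longrightarrow> 0 \<le> \<eta> \<Longrightarrow> \<eta> \<le> 1 \<Longrightarrow>
      i < K \<Longrightarrow> j < K \<Longrightarrow> s i j > 0 \<Longrightarrow> v i * w j \<le> 1 / c0"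

lemma (in irreducible_matrix) controlled_matrix_exists: "\<exists>\<tau>0 c0. controlled_matrix K s \<pi> \<tau>0 c0"
proof -
  obtain \<tau>0 c where *: "0 < \<tau>0" "\<tau>0 < 1" "0 < c" "c \<le> 1" and
    b: "\<And>\<tau> \<eta> v w. sol K s \<tau> \<eta> v w \<Longrightarrow> 0 < \<tau> \<Longrightarrow> \<tau> < \<tau>0 \<Longrightarrow>
    0 \<le> \<eta> \<Longrightarrow> \<eta> \<le> 1 \<Longrightarrow> (\<Sum>i<K. defect K s \<tau> \<eta> v w i) \<le> 1 / 2 \<and> (\<forall>i<K. c \<le> v i * w (\<pi> i)) \<and>
    (\<forall>i<K. \<forall>j<K. s i j > 0 \<longrightarrow> v i * w j \<le> 1 / c)"
    using pairing_bounds by blast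
  have "controlled_matrix K s \<pi> \<tau>0 c"
    by unfold_locales (use * b in \<open>blast+\<close>)
  then show ?thesis by blast
qed

context controlled_matrix begin

text \<open>The ratios \<open>v i / v j\<close> are controlled along the chains generated by \<open>i \<rightarrow> \<pi>\<^sup>-\<^sup>1 j\<close> with \<open>s i j > 0\<close>
  and by \<open>i \<rightarrow> \<pi>\<^sup>-\<^sup>1 i\<close>; the second kind of step uses \<open>\<tau> v i w i \<le> 1\<close>, so its constant depends on \<open>\<tau>\<close>.\<close>

lemma all_pairs_bounds:
  assumes "0 < \<tau>1"
  shows "\<exists>c>0. \<forall>\<tau> \<eta> v w. sol K s \<tau> \<eta> v w \<longrightarrow> \<tau>1 \<le> \<tau> \<longrightarrow> \<tau> < \<tau>0 \<longrightarrow> 0 \<le> \<eta> \<longrightarrow> \<eta> \<le> 1 \<longrightarrow>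
    (\<forall>i<K. \<forall>j<K. c \<le> v i * w j \<and> v i * w j \<le> 1 / c)"
proof -
  define p where "p = inv_into UNIV \<pi>"
  have pp: "p permutes {..<K}" unfolding p_def by (rule permutes_inv[OF perm])
  have ppi: "\<pi> (p i) = i" for i unfolding p_def using permutes_inverses[OF perm] by auto
  have pl: "p i < K" if "i < K" for i using permutes_in_image[OF pp, of i] that by auto
  define R where "R = {(i, p j) | i j. (i, j) \<in> pos_edges K s} \<union> {(i, p i) | i. i < K}"
  \<comment> \<open>A positive entry \<open>(y, z)\<close> leads in \<open>R\<close> only to
    \<open>p z\<close>; the steps \<open>k \<rightarrow> p k\<close> then run around the orbit back
    to \<open>z\<close>.\<close>
  have conn: "(i, j) \<in> R\<^sup>*" if "i < K" "j < K" for i j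
    using irr[OF that]
  proof (induction rule: rtrancl_induct)
    case (step y z)
    have z: "z < K" using step unfolding pos_edges_def by auto
    have "(y, p z) \<in> R" using step(2) unfolding R_def by auto
    moreover have "(p z, z) \<in> R\<^sup>*" by (rule permutes_orbit[OF pp]) (use z in \<open>auto simp: R_def\<close>)
    ultimately show ?case using step(3) by (meson rtrancl.rtrancl_into_rtrancl rtrancl_trans)
  qed auto
  define u where "u = (\<lambda>v i. if i < K then v i else (0::real))"
  have "finite ({..<K} \<times> {..<K})" "{..<K} \<times> {..<K} \<subseteq> R\<^sup>*" using conn by auto
  from chain_bound[OF this] obtain N where N: "\<And>u M. M \<ge> (1::real) \<Longrightarrow> (\<forall>i. u i \<ge> 0) \<Longrightarrow>
    (\<forall>(i, j)\<in>R. u i \<le> M * u j) \<Longrightarrow> (\<forall>(i, j)\<in>{..<K} \<times> {..<K}. u i \<le> M ^ N * u j)" by blast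
  define M where "M = max (1 / (c0 * c0)) (max 1 (1 / (\<tau>1 * c0)))"
  have M: "M \<ge> 1" "1 / (c0 * c0) \<le> M" "1 / (\<tau>1 * c0) \<le> M" unfolding M_def by auto
  define c where "c = c0 / M ^ N"
  have MN: "M ^ N \<ge> 1" using M by simp
  have c: "c > 0" unfolding c_def using c0 MN by auto
  have "c \<le> v i * w j \<and> v i * w j \<le> 1 / c"
    if A: "sol K s \<tau> \<eta> v w" "\<tau>1 \<le> \<tau>" "\<tau> < \<tau>0" "0 \<le> \<eta>" "\<eta> \<le> 1" and ij: "i < K" "j < K" for \<tau> \<eta> v w i j
  proof -
    have tp: "\<tau> > 0" using A assms by simp
    note f = sol_facts[OF A(1) tp A(4)]
    have u0: "u v i \<ge> 0" for i unfolding u_def using f(3)[of i] by auto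
    have "u v i \<le> M * u v j" if "(i, j) \<in> R" for i j
    proof -
      have step: "v i \<le> M * v (p k)" if i: "i < K" and k: "k < K" and le: "v i * w k \<le> D" "D / c0 \<le> M" for i k D
      proof -
        have ge: "c0 \<le> v (p k) * w k" using pair_ge[OF A(1) tp A(3-5) pl[OF k]] by (simp add: ppi)
        have "v i * w k \<le> D / c0 * c0" using le c0 by simp
        also have "\<dots> \<le> M * c0" using le(2) c0 by (intro mult_right_mono) auto
        also have "\<dots> \<le> M * (v (p k) * w k)" using ge M by (intro mult_left_mono) auto
        finally have "v i * w k \<le> (M * v (p k)) * w k" by simp
        then show ?thesis using f(4)[OF k] by simp
      qed
      from that consider k where "(i, k) \<in> pos_edges K s" "j = p k" | "i < K" "j = p i" unfolding R_def by auto
      then show ?thesis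
      proof cases
        case 1
        then have ik: "i < K" "k < K" "s i k > 0" unfolding pos_edges_def by auto
        have "v i \<le> M * v (p k)"
          by (rule step[OF ik(1,2) pair_le[OF A(1) tp A(3-5) ik]]) (use M in simp)
        then show ?thesis using ik pl[OF ik(2)] 1 unfolding u_def by simp
      next
        case 2
        have y: "0 < defect K s \<tau> \<eta> v w i" "defect K s \<tau> \<eta> v w i < 1" using f(8,9)[OF 2(1)] by auto
        have "(1 - defect K s \<tau> \<eta> v w i) * defect K s \<tau> \<eta> v w i \<le> 1 * 1" using y by (intro mult_mono) auto
        then have "\<tau> * (v i * w i) \<le> 1" using f(7)[OF 2(1)] by simp
        moreover have "\<tau>1 * (v i * w i) \<le> \<tau> * (v i * w i)" using A(2) f(3,4)[OF 2(1)] by (intro mult_right_mono) auto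
        ultimately have "v i * w i \<le> 1 / \<tau>1" using assms by (simp add: field_simps)
        then have "v i \<le> M * v (p i)" by (rule step[OF 2(1,1)]) (use M in simp)
        then show ?thesis using 2 pl[OF 2(1)] unfolding u_def by simp
      qed
    qed
    then have comp: "v i \<le> M ^ N * v j" if "i < K" "j < K" for i j
      using N[OF M(1), of "u v"] u0 that unfolding u_def by fastforce
    have sp: "s (p j) j > 0" using s_pi[OF pl[OF ij(2)]] by (simp add: ppi)
    have "c0 \<le> v (p j) * w j" using pair_ge[OF A(1) tp A(3-5) pl[OF ij(2)]] by (simp add: ppi)
    also have "\<dots> \<le> (M ^ N * v i) * w j" using comp[OF pl[OF ij(2)] ij(1)] f(4)[OF ij(2)] by (intro mult_right_mono) auto
    finally have 1: "c \<le> v i * w j" unfolding c_def using MN by (simp add: field_simps)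
    have "v i * w j \<le> (M ^ N * v (p j)) * w j" using comp[OF ij(1) pl[OF ij(2)]] f(4)[OF ij(2)] by (intro mult_right_mono) auto
    also have "\<dots> = M ^ N * (v (p j) * w j)" by simp
    also have "\<dots> \<le> M ^ N * (1 / c0)" using pair_le[OF A(1) tp A(3-5) pl[OF ij(2)] ij(2) sp] MN by (intro mult_left_mono) auto
    finally have "v i * w j \<le> 1 / c" unfolding c_def by simp
    with 1 show ?thesis by simp
  qed
  then show ?thesis using c by blast
qed

text \<open>By balance the square of the common sum of \<open>v\<close> and \<open>w\<close> is the
  sum of all \<open>v i * w j\<close>, hence at most \<open>K * K / d\<close>. This bounds every
  entry from above, and the lower bound for the products then bounds it from below. \<open>B\<close>
  has the extra 1 so that a sum below 1 is covered too.\<close>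

lemma confined_small:
  assumes "0 < \<tau>1"
  shows "\<exists>c>0. \<exists>C>0. \<forall>\<tau> \<eta> v w. bal K s \<tau> \<eta> v w \<longrightarrow> \<tau>1 \<le> \<tau> \<longrightarrow> \<tau> < \<tau>0 \<longrightarrow> 0 \<le> \<eta> \<longrightarrow> \<eta> \<le> 1 \<longrightarrow> confined K c C \<tau> \<eta> v w"
proof -
  obtain d where d: "d > 0" and pb: "\<And>\<tau> \<eta> v w i j. sol K s \<tau> \<eta> v w \<Longrightarrow> \<tau>1 \<le> \<tau> \<Longrightarrow> \<tau> < \<tau>0 \<Longrightarrow> 0 \<le> \<eta> \<Longrightarrow> \<eta> \<le> 1 \<Longrightarrow>
    i < K \<Longrightarrow> j < K \<Longrightarrow> d \<le> v i * w j \<and> v i * w j \<le> 1 / d" using all_pairs_bounds[OF assms] by meson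
  define B where "B = 1 + real K * K * (1 / d)"
  define c where "c = min \<tau>1 (d / B)"
  have B: "B \<ge> 1" unfolding B_def using d by simp
  have c: "c > 0" "c \<le> \<tau>1" "c \<le> d / B" unfolding c_def using assms d B by auto
  have "confined K c B \<tau> \<eta> v w" if A: "bal K s \<tau> \<eta> v w" "\<tau>1 \<le> \<tau>" "\<tau> < \<tau>0" "0 \<le> \<eta>" "\<eta> \<le> 1" for \<tau> \<eta> v w
  proof -
    have sl: "sol K s \<tau> \<eta> v w" "(\<Sum>i<K. v i) = (\<Sum>i<K. w i)" using A unfolding bal_def by auto
    have vw: "v i > 0" "w i > 0" if "i < K" for i using sl that unfolding sol_def by auto
    note pb' = pb[OF sl(1) A(2-5)]
    define S where "S = (\<Sum>i<K. v i)"
    have S0: "S \<ge> 0" unfolding S_def using vw by (intro sum_nonneg) (auto intro: less_imp_le)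
    have "S * S = (\<Sum>i<K. v i) * (\<Sum>j<K. w j)" unfolding S_def using sl by simp
    also have "\<dots> = (\<Sum>i<K. \<Sum>j<K. v i * w j)" by (rule sum_product)
    also have "\<dots> \<le> (\<Sum>i<K. \<Sum>j<K. 1 / d)" using pb' by (intro sum_mono) auto
    finally have SS: "S * S \<le> B - 1" unfolding B_def by simp
    have "S \<le> B"
    proof (cases "S \<le> 1")
      case False
      then have "S * 1 \<le> S * S" by (intro mult_left_mono) auto
      then show ?thesis using SS by linarith
    qed (use B in auto)
    then have up: "v i \<le> B" "w i \<le> B" if "i < K" for i
      using member_le_sum[of i "{..<K}" v] member_le_sum[of i "{..<K}" w] that vw sl(2) unfolding S_def
      by (force intro: less_imp_le)+
    have lo: "c \<le> v i" "c \<le> w i" if i: "i < K" for i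
    proof -
      have "d \<le> v i * B" using pb'[OF i i] up(2)[OF i] vw(1)[OF i] by (meson mult_left_mono less_imp_le order_trans)
      then have "d / B \<le> v i" using B by (simp add: field_simps)
      moreover have "d \<le> B * w i" using pb'[OF i i] up(1)[OF i] vw(2)[OF i] by (meson mult_right_mono less_imp_le order_trans)
      then have "d / B \<le> w i" using B by (simp add: field_simps)
      ultimately show "c \<le> v i" "c \<le> w i" using c by linarith+
    qed
    show ?thesis unfolding confined_def using up lo A c B \<tau>0 by auto
  qed
  moreover have "B > 0" using B by simp
  ultimately show ?thesis using c by blast
qed

text \<open>The solutions at \<open>\<eta> = 1 / (n + 1)\<close> are balanced and confined, so by
  the Lipschitz estimate their logarithms form Cauchy sequences. Equations and balance pass to the
  limit, where support keeps the denominators positive.\<close>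

lemma bal_exists_zero:
  assumes "0 < \<tau>" "\<tau> < \<tau>0"
  shows "\<exists>v w. bal K s \<tau> 0 v w"
proof -
  interpret T: supported_matrix K "\<lambda>i j. s j i" "inv_into UNIV \<pi>" by (rule supported_matrix_transpose)
  obtain c C where c: "c > 0" and conf: "\<And>\<tau>' \<eta> v w. bal K s \<tau>' \<eta> v w \<Longrightarrow> \<tau> \<le> \<tau>' \<Longrightarrow> \<tau>' < \<tau>0 \<Longrightarrow> 0 \<le> \<eta> \<Longrightarrow> \<eta> \<le> 1 \<Longrightarrow>
    confined K c C \<tau>' \<eta> v w" using confined_small[OF assms(1)] by blast
  obtain L where L: "L > 0" and lip: "\<And>\<tau>0 \<eta>0 v0 w0 \<tau>1 \<eta>1 v1 w1. bal K s \<tau>0 \<eta>0 v0 w0 \<Longrightarrow> confined K c C \<tau>0 \<eta>0 v0 w0 \<Longrightarrow>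
    bal K s \<tau>1 \<eta>1 v1 w1 \<Longrightarrow> confined K c C \<tau>1 \<eta>1 v1 w1 \<Longrightarrow>
    (\<forall>p\<in>nodes K. \<bar>logdiff v0 w0 v1 w1 p\<bar> \<le> L * (\<bar>\<tau>1 - \<tau>0\<bar> + \<bar>\<eta>1 - \<eta>0\<bar>))"
    using lipschitz[OF c, of C] by blast
  define e where "e = (\<lambda>n. 1 / real (Suc n))"
  have e: "0 < e n" "e n \<le> 1" for n unfolding e_def by auto
  have "\<exists>x. sol K s \<tau> (e n) (fst x) (snd x)" for n
    using sol_exists[OF variance_matrix_axioms assms(1) e(1)] by simp
  then obtain x where x: "\<And>n. sol K s \<tau> (e n) (fst (x n)) (snd (x n))" by metis
  define V where "V = (\<lambda>n. fst (x n))" define W where "W = (\<lambda>n. snd (x n))"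
  have SL: "sol K s \<tau> (e n) (V n) (W n)" for n using x unfolding V_def W_def by simp
  have BL: "bal K s \<tau> (e n) (V n) (W n)" for n by (rule balanced_pos[OF SL assms(1) e(1)])
  have CF: "confined K c C \<tau> (e n) (V n) (W n)" for n
    by (rule conf[OF BL]) (use assms e[of n] in auto)
  have e0: "e \<longlonglongrightarrow> 0" unfolding e_def by (rule LIMSEQ_inverse_real_of_nat[unfolded inverse_eq_divide])
  have cau: "Cauchy (\<lambda>n. f n)" if f: "\<And>m n. \<bar>f m - f n\<bar> \<le> L * \<bar>e m - e n\<bar>" for f :: "nat \<Rightarrow> real"
  proof (rule CauchyI)
    fix \<epsilon> :: real assume "\<epsilon> > 0"
    then have "\<epsilon> / L > 0" using L by simp
    from CauchyD[OF LIMSEQ_imp_Cauchy[OF e0] this] obtain M where "\<forall>m\<ge>M. \<forall>n\<ge>M. \<bar>e m - e n\<bar> < \<epsilon> / L" by auto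
    then have "\<forall>m\<ge>M. \<forall>n\<ge>M. \<bar>f m - f n\<bar> < \<epsilon>"
      using f L by (smt (verit) mult.commute pos_less_divide_eq)
    then show "\<exists>M. \<forall>m\<ge>M. \<forall>n\<ge>M. norm (f m - f n) < \<epsilon>" by auto
  qed
  have ld: "\<bar>logdiff (V n) (W n) (V m) (W m) p\<bar> \<le> L * \<bar>e m - e n\<bar>" if "p \<in> nodes K" for n m p
    using lip[OF BL CF BL CF] that by fastforce
  have pos: "V n i > 0" "W n i > 0" if "i < K" for n i using SL[of n] that unfolding sol_def by auto
  have lv: "\<exists>l. (\<lambda>n. ln (V n i)) \<longlonglongrightarrow> l" if "i < K" for i
  proof -
    have "Cauchy (\<lambda>n. ln (V n i))"
      by (rule cau) (use ld[of "(i, True)"] that in \<open>auto simp: logdiff_def nodes_def\<close>)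
    then show ?thesis using Cauchy_convergent convergent_def by blast
  qed
  have lw: "\<exists>l. (\<lambda>n. ln (W n i)) \<longlonglongrightarrow> l" if "i < K" for i
  proof -
    have "Cauchy (\<lambda>n. ln (W n i))"
      by (rule cau) (use ld[of "(i, False)"] that in \<open>auto simp: logdiff_def nodes_def abs_minus_commute\<close>)
    then show ?thesis using Cauchy_convergent convergent_def by blast
  qed
  obtain lv' where lv': "\<And>i. i < K \<Longrightarrow> (\<lambda>n. ln (V n i)) \<longlonglongrightarrow> lv' i" using lv by metis
  obtain lw' where lw': "\<And>i. i < K \<Longrightarrow> (\<lambda>n. ln (W n i)) \<longlonglongrightarrow> lw' i" using lw by metis
  define v where "v = (\<lambda>i. exp (lv' i))" define w where "w = (\<lambda>i. exp (lw' i))"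
  have v: "(\<lambda>n. V n i) \<longlonglongrightarrow> v i" if "i < K" for i
    using tendsto_exp[OF lv'[OF that]] pos[OF that] unfolding v_def by simp
  have w: "(\<lambda>n. W n i) \<longlonglongrightarrow> w i" if "i < K" for i
    using tendsto_exp[OF lw'[OF that]] pos[OF that] unfolding w_def by simp
  have la: "(\<lambda>n. a (e n) (W n) i) \<longlonglongrightarrow> a 0 w i" for i unfolding lin_def by (intro tendsto_intros w e0) auto
  have lb: "(\<lambda>n. b (e n) (V n) i) \<longlonglongrightarrow> b 0 v i" for i unfolding lin_def by (intro tendsto_intros v e0) auto
  have "sol K s \<tau> 0 v w" unfolding sol_def
  proof (intro allI impI conjI)
    fix i assume i: "i < K"
    show vp: "v i > 0" "w i > 0" unfolding v_def w_def by auto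
    have ap: "a 0 w i > 0" "b 0 v i > 0" using lin_pos[of 0 w i] T.lin_pos[of 0 v i] i unfolding v_def w_def by auto
    have "(\<lambda>n. 1 / V n i) \<longlonglongrightarrow> 1 / v i" using v[OF i] vp by (intro tendsto_intros) auto
    moreover have "(\<lambda>n. a (e n) (W n) i + \<tau> / b (e n) (V n) i) \<longlonglongrightarrow> a 0 w i + \<tau> / b 0 v i"
      using ap by (intro tendsto_intros la lb) auto
    moreover have "1 / V n i = a (e n) (W n) i + \<tau> / b (e n) (V n) i" for n using SL[of n] i unfolding sol_def by auto
    ultimately show "1 / v i = a 0 w i + \<tau> / b 0 v i" using LIMSEQ_unique by auto
    have "(\<lambda>n. 1 / W n i) \<longlonglongrightarrow> 1 / w i" using w[OF i] vp by (intro tendsto_intros) auto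
    moreover have "(\<lambda>n. b (e n) (V n) i + \<tau> / a (e n) (W n) i) \<longlonglongrightarrow> b 0 v i + \<tau> / a 0 w i"
      using ap by (intro tendsto_intros la lb) auto
    moreover have "1 / W n i = b (e n) (V n) i + \<tau> / a (e n) (W n) i" for n using SL[of n] i unfolding sol_def by auto
    ultimately show "1 / w i = b 0 v i + \<tau> / a 0 w i" using LIMSEQ_unique by auto
  qed
  moreover have "(\<Sum>i<K. v i) = (\<Sum>i<K. w i)"
  proof (rule LIMSEQ_unique)
    show "(\<lambda>n. \<Sum>i<K. V n i) \<longlonglongrightarrow> (\<Sum>i<K. v i)" by (intro tendsto_sum v) auto
    have "(\<lambda>n. \<Sum>i<K. W n i) \<longlonglongrightarrow> (\<Sum>i<K. w i)" by (intro tendsto_sum w) auto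
    then show "(\<lambda>n. \<Sum>i<K. V n i) \<longlonglongrightarrow> (\<Sum>i<K. w i)" using BL unfolding bal_def by simp
  qed
  ultimately show ?thesis unfolding bal_def by blast
qed

end

section \<open>The potential\<close>

definition Phi :: "nat \<Rightarrow> (nat \<Rightarrow> nat \<Rightarrow> real) \<Rightarrow> real \<Rightarrow> real \<Rightarrow> (nat \<Rightarrow> real) \<Rightarrow> (nat \<Rightarrow> real) \<Rightarrow> real" where
  "Phi K s \<tau> \<eta> v w = (\<Sum>i<K. ln (lin K s \<eta> w i * lin K (\<lambda>i j. s j i) \<eta> v i + \<tau>)) - (\<Sum>i<K. \<Sum>j<K. s i j * (v i * w j))"

context supported_matrix begin

text \<open>The potential is stationary in \<open>v\<close> and \<open>w\<close> at a solution, so a Lipschitz dependence of \<open>v\<close> and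
  \<open>w\<close> on the parameter suffices for differentiability.\<close>

lemma Phi_deriv:
  fixes T H :: "real \<Rightarrow> real" and V W :: "real \<Rightarrow> nat \<Rightarrow> real"
  assumes S: "sol K s (T p0) (H p0) (V p0) (W p0)" and T0: "T p0 > 0" and H0: "H p0 \<ge> 0"
    and dT: "(T has_real_derivative T') (at p0)" and dH: "(H has_real_derivative H') (at p0)"
    and lip: "\<forall>\<^sub>F p in at p0. \<forall>i<K. \<bar>V p i - V p0 i\<bar> \<le> L * \<bar>p - p0\<bar> \<and> \<bar>W p i - W p0 i\<bar> \<le> L * \<bar>p - p0\<bar>"
  shows "((\<lambda>p. Phi K s (T p) (H p) (V p) (W p)) has_real_derivative
    (H' * (\<Sum>i<K. V p0 i + W p0 i) + T' * (\<Sum>i<K. 1 / (a (H p0) (W p0) i * b (H p0) (V p0) i + T p0)))) (at p0)"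
proof -
  note f = sol_facts[OF S T0 H0]
  define h where "h = (\<lambda>p. p - p0)"
  define dv where "dv = (\<lambda>i p. V p i - V p0 i)"
  define dw where "dw = (\<lambda>i p. W p i - W p0 i)"
  define dt where "dt = (\<lambda>p. T p - T p0)"
  define dh where "dh = (\<lambda>p. H p - H p0)"
  define a0 where "a0 = a (H p0) (W p0)"
  define b0 where "b0 = b (H p0) (V p0)"
  define da where "da = (\<lambda>i p. a (H p) (W p) i - a0 i)"
  define db where "db = (\<lambda>i p. b (H p) (V p) i - b0 i)"
  define X where "X = (\<lambda>i. a0 i * b0 i + T p0)"
  define dX where "dX = (\<lambda>i p. a (H p) (W p) i * b (H p) (V p) i + T p - X i)"
  have X: "X i > 0" if "i < K" for i unfolding X_def a0_def b0_def using f(1,2)[OF that] T0 by (auto intro!: add_pos_pos)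
  have vX: "V p0 i = b0 i / X i" "W p0 i = a0 i / X i" if "i < K" for i
    using sol_formula[OF S T0 H0 that] unfolding X_def a0_def b0_def by auto
  have h: "(h \<longlongrightarrow> 0) (at p0)" unfolding h_def by (auto intro!: tendsto_eq_intros)
  have hne: "\<forall>\<^sub>F p in at p0. h p \<noteq> 0" unfolding h_def by (auto simp: eventually_at_filter)
  have Lh: "((\<lambda>p. L * \<bar>h p\<bar>) \<longlongrightarrow> 0) (at p0)" using h by (auto intro!: tendsto_eq_intros)
  have dv: "(dv i \<longlongrightarrow> 0) (at p0)" "(dw i \<longlongrightarrow> 0) (at p0)" if "i < K" for i
    by (rule Lim_null_comparison[OF _ Lh], use lip that in \<open>auto elim!: eventually_mono simp: dv_def dw_def h_def\<close>)+
  have qb: "\<forall>\<^sub>F p in at p0. \<bar>dv i p / h p\<bar> \<le> L \<and> \<bar>dw i p / h p\<bar> \<le> L" if "i < K" for i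
    using lip hne by eventually_elim (use that in \<open>auto simp: dv_def dw_def h_def abs_divide field_simps\<close>)
  have qt: "((\<lambda>p. dt p / h p) \<longlongrightarrow> T') (at p0)" using dT unfolding has_field_derivative_iff dt_def h_def .
  have qh: "((\<lambda>p. dh p / h p) \<longlongrightarrow> H') (at p0)" using dH unfolding has_field_derivative_iff dh_def h_def .
  have dt: "(dt \<longlongrightarrow> 0) (at p0)"
    using DERIV_isCont[OF dT] unfolding isCont_def dt_def by (auto intro: LIM_zero)
  have dh: "(dh \<longlongrightarrow> 0) (at p0)"
    using DERIV_isCont[OF dH] unfolding isCont_def dh_def by (auto intro: LIM_zero)
  have da_eq: "da i p = dh p + (\<Sum>j<K. s i j * dw j p)" for i p
    unfolding da_def a0_def lin_def dh_def dw_def by (simp add: right_diff_distrib sum_subtractf)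
  have db_eq: "db i p = dh p + (\<Sum>j<K. s j i * dv j p)" for i p
    unfolding db_def b0_def lin_def dh_def dv_def by (simp add: right_diff_distrib sum_subtractf)
  have da: "(da i \<longlongrightarrow> 0) (at p0)" for i
  proof -
    have "((\<lambda>p. dh p + (\<Sum>j<K. s i j * dw j p)) \<longlongrightarrow> 0 + (\<Sum>j<K. s i j * 0)) (at p0)"
      by (intro tendsto_intros dh dv) auto
    then show ?thesis by (simp add: da_eq[abs_def])
  qed
  have db: "(db i \<longlongrightarrow> 0) (at p0)" for i
  proof -
    have "((\<lambda>p. dh p + (\<Sum>j<K. s j i * dv j p)) \<longlongrightarrow> 0 + (\<Sum>j<K. s j i * 0)) (at p0)"
      by (intro tendsto_intros dh dv) auto
    then show ?thesis by (simp add: db_eq[abs_def])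
  qed
  have bq: "\<forall>\<^sub>F p in at p0. \<forall>i<K. \<bar>dv i p / h p\<bar> \<le> L \<and> \<bar>dw i p / h p\<bar> \<le> L"
    using lip hne by eventually_elim (auto simp: dv_def dw_def h_def abs_divide field_simps)
  have bh: "\<forall>\<^sub>F p in at p0. \<bar>dh p / h p\<bar> \<le> \<bar>H'\<bar> + 1"
  proof -
    have "((\<lambda>p. \<bar>dh p / h p\<bar>) \<longlongrightarrow> \<bar>H'\<bar>) (at p0)" by (intro tendsto_intros qh)
    then have "\<forall>\<^sub>F p in at p0. \<bar>dh p / h p\<bar> < \<bar>H'\<bar> + 1" by (rule order_tendstoD) simp
    then show ?thesis by eventually_elim simp
  qed
  have bt: "\<forall>\<^sub>F p in at p0. \<bar>dt p / h p\<bar> \<le> \<bar>T'\<bar> + 1"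
  proof -
    have "((\<lambda>p. \<bar>dt p / h p\<bar>) \<longlongrightarrow> \<bar>T'\<bar>) (at p0)" by (intro tendsto_intros qt)
    then have "\<forall>\<^sub>F p in at p0. \<bar>dt p / h p\<bar> < \<bar>T'\<bar> + 1" by (rule order_tendstoD) simp
    then show ?thesis by eventually_elim simp
  qed
  define Q where "Q = \<bar>H'\<bar> + 1 + K * L"
  have sumb: "\<bar>\<Sum>j<K. r j * q j\<bar> \<le> K * L" if "\<And>j. 0 \<le> r j \<and> r j \<le> 1" "\<And>j. j < K \<Longrightarrow> \<bar>q j\<bar> \<le> L" for r q :: "nat \<Rightarrow> real"
  proof -
    have "\<bar>\<Sum>j<K. r j * q j\<bar> \<le> (\<Sum>j<K. \<bar>r j * q j\<bar>)" by (rule sum_abs)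
    also have "\<dots> \<le> (\<Sum>j<K. 1 * L)" unfolding abs_mult using that by (intro sum_mono mult_mono) auto
    finally show ?thesis by simp
  qed
  have qa: "\<forall>\<^sub>F p in at p0. \<bar>da i p / h p\<bar> \<le> Q" for i
    using bq bh
  proof eventually_elim
    case (elim p)
    have "da i p / h p = dh p / h p + (\<Sum>j<K. s i j * (dw j p / h p))"
      unfolding da_eq add_divide_distrib sum_divide_distrib by simp
    moreover have "\<bar>\<Sum>j<K. s i j * (dw j p / h p)\<bar> \<le> K * L"
      by (rule sumb) (use elim s_nonneg s_le_1 in auto)
    ultimately show ?case using elim(2) unfolding Q_def by linarith
  qed
  have qbb: "\<forall>\<^sub>F p in at p0. \<bar>db i p / h p\<bar> \<le> Q" for i
    using bq bh
  proof eventually_elim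
    case (elim p)
    have "db i p / h p = dh p / h p + (\<Sum>j<K. s j i * (dv j p / h p))"
      unfolding db_eq add_divide_distrib sum_divide_distrib by simp
    moreover have "\<bar>\<Sum>j<K. s j i * (dv j p / h p)\<bar> \<le> K * L"
      by (rule sumb) (use elim s_nonneg s_le_1 in auto)
    ultimately show ?case using elim(2) unfolding Q_def by linarith
  qed
  have dX_eq: "dX i p = da i p * b0 i + a0 i * db i p + da i p * db i p + dt p" for i p
    unfolding dX_def X_def da_def db_def dt_def by (simp add: algebra_simps)
  have dX: "(dX i \<longlongrightarrow> 0) (at p0)" for i
    unfolding dX_eq[abs_def] by (auto intro!: tendsto_eq_intros da db dt)
  have db1: "\<forall>\<^sub>F p in at p0. \<bar>db i p\<bar> \<le> 1" for i
  proof -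
    have "((\<lambda>p. \<bar>db i p\<bar>) \<longlongrightarrow> \<bar>0\<bar>) (at p0)" by (intro tendsto_intros db)
    then have "\<forall>\<^sub>F p in at p0. \<bar>db i p\<bar> < 1" by (rule order_tendstoD) simp
    then show ?thesis by eventually_elim simp
  qed
  have tri: "\<bar>x + y + z + u\<bar> \<le> A + B + C + D" if "\<bar>x\<bar> \<le> A" "\<bar>y\<bar> \<le> B" "\<bar>z\<bar> \<le> C" "\<bar>u\<bar> \<le> D"
    for x y z u A B C D :: real using that by linarith
  have qX: "\<forall>\<^sub>F p in at p0. \<bar>dX i p / h p\<bar> \<le> Q * \<bar>b0 i\<bar> + \<bar>a0 i\<bar> * Q + Q * 1 + (\<bar>T'\<bar> + 1)" for i
    using qa[of i] qbb[of i] bt db1[of i]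
  proof eventually_elim
    case (elim p)
    have "0 \<le> Q" using elim(1) abs_ge_zero order_trans by blast
    have "dX i p / h p = da i p / h p * b0 i + a0 i * (db i p / h p) + da i p / h p * db i p + dt p / h p"
      unfolding dX_eq by (simp add: add_divide_distrib)
    moreover have "\<bar>da i p / h p * b0 i\<bar> \<le> Q * \<bar>b0 i\<bar>" using elim unfolding abs_mult by (intro mult_right_mono) auto
    moreover have "\<bar>a0 i * (db i p / h p)\<bar> \<le> \<bar>a0 i\<bar> * Q" using elim unfolding abs_mult by (intro mult_left_mono) auto
    moreover have "\<bar>da i p / h p * db i p\<bar> \<le> Q * 1" using elim \<open>0 \<le> Q\<close> unfolding abs_mult by (intro mult_mono) auto
    ultimately show ?case using elim(3) tri by presburger
  qed
  \<comment> \<open>Caratheodory's form of the derivative: the slope \<open>g\<close> is defined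
    everywhere, so points with \<open>dX i p = 0\<close> cause no division by zero.\<close>
  have "\<exists>g. (\<forall>z. ln z - ln (X i) = g z * (z - X i)) \<and> isCont g (X i) \<and> g (X i) = 1 / X i" if "i < K" for i
    using DERIV_ln_divide[OF X[OF that]] unfolding CARAT_DERIV .
  then obtain g where g: "\<And>i z. i < K \<Longrightarrow> ln z - ln (X i) = g i z * (z - X i)"
    "\<And>i. i < K \<Longrightarrow> isCont (g i) (X i)" "\<And>i. i < K \<Longrightarrow> g i (X i) = 1 / X i" by metis
  have gl: "((\<lambda>p. g i (X i + dX i p) - 1 / X i) \<longlongrightarrow> 0) (at p0)" if "i < K" for i
  proof -
    have "((\<lambda>p. X i + dX i p) \<longlongrightarrow> X i + 0) (at p0)" by (intro tendsto_intros dX)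
    then have "((\<lambda>p. g i (X i + dX i p)) \<longlongrightarrow> g i (X i)) (at p0)"
      using isCont_tendsto_compose[OF g(2)[OF that]] by simp
    then show ?thesis unfolding g(3)[OF that] by (rule LIM_zero)
  qed
  \<comment> \<open>Stationarity at work: \<open>V p0 i = b0 i / X i\<close> and
    \<open>W p0 i = a0 i / X i\<close> make the terms linear in \<open>dv\<close> and
    \<open>dw\<close> from the logarithm cancel those from the double sum. Each remainder is a
    factor tending to 0 times a quantity of order \<open>h p\<close>.\<close>
  have main: "Phi K s (T p) (H p) (V p) (W p) - Phi K s (T p0) (H p0) (V p0) (W p0) =
      dh p * (\<Sum>i<K. V p0 i + W p0 i) + dt p * (\<Sum>i<K. 1 / X i)
      + (\<Sum>i<K. (g i (X i + dX i p) - 1 / X i) * dX i p) + (\<Sum>i<K. 1 / X i * (da i p * db i p))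
      - (\<Sum>i<K. \<Sum>j<K. s i j * (dv i p * dw j p))" for p
  proof -
    have "Phi K s (T p) (H p) (V p) (W p) - Phi K s (T p0) (H p0) (V p0) (W p0) =
      (\<Sum>i<K. ln (X i + dX i p) - ln (X i)) - (\<Sum>i<K. \<Sum>j<K. s i j * (V p i * W p j) - s i j * (V p0 i * W p0 j))"
      unfolding Phi_def X_def dX_def a0_def b0_def by (simp add: sum_subtractf)
    also have "(\<Sum>i<K. ln (X i + dX i p) - ln (X i)) = (\<Sum>i<K. g i (X i + dX i p) * dX i p)"
      by (intro sum.cong) (auto simp: g(1))
    also have "\<dots> = (\<Sum>i<K. (g i (X i + dX i p) - 1 / X i) * dX i p) + (\<Sum>i<K. dX i p / X i)"
      unfolding sum.distrib[symmetric] by (intro sum.cong) (auto simp: algebra_simps)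
    also have "(\<Sum>i<K. dX i p / X i) = (\<Sum>i<K. V p0 i * da i p + W p0 i * db i p + 1 / X i * (da i p * db i p) + dt p * (1 / X i))"
      by (intro sum.cong) (auto simp: dX_eq vX add_divide_distrib)
    also have "\<dots> = (\<Sum>i<K. V p0 i * da i p) + (\<Sum>i<K. W p0 i * db i p) + (\<Sum>i<K. 1 / X i * (da i p * db i p)) + dt p * (\<Sum>i<K. 1 / X i)"
      by (simp only: sum.distrib sum_distrib_left)
    also have "(\<Sum>i<K. V p0 i * da i p) = dh p * (\<Sum>i<K. V p0 i) + (\<Sum>i<K. \<Sum>j<K. s i j * (V p0 i * dw j p))"
      unfolding da_eq by (simp add: distrib_left sum.distrib sum_distrib_left mult_ac)
    also have "(\<Sum>i<K. W p0 i * db i p) = dh p * (\<Sum>i<K. W p0 i) + (\<Sum>i<K. \<Sum>j<K. s j i * (dv j p * W p0 i))"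
      unfolding db_eq by (simp add: distrib_left sum.distrib sum_distrib_left mult_ac)
    also have "(\<Sum>i<K. \<Sum>j<K. s j i * (dv j p * W p0 i)) = (\<Sum>i<K. \<Sum>j<K. s i j * (dv i p * W p0 j))"
      by (rule sum.swap)
    also have "(\<Sum>i<K. \<Sum>j<K. s i j * (V p i * W p j) - s i j * (V p0 i * W p0 j)) =
       (\<Sum>i<K. \<Sum>j<K. s i j * (V p0 i * dw j p)) + (\<Sum>i<K. \<Sum>j<K. s i j * (dv i p * W p0 j)) + (\<Sum>i<K. \<Sum>j<K. s i j * (dv i p * dw j p))"
      unfolding sum.distrib[symmetric] by (intro sum.cong refl) (simp add: dv_def dw_def algebra_simps)
    finally show ?thesis by (simp add: sum.distrib distrib_left)
  qed
  have quot: "(Phi K s (T p) (H p) (V p) (W p) - Phi K s (T p0) (H p0) (V p0) (W p0)) / h p =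
      dh p / h p * (\<Sum>i<K. V p0 i + W p0 i) + dt p / h p * (\<Sum>i<K. 1 / X i)
      + (\<Sum>i<K. (g i (X i + dX i p) - 1 / X i) * (dX i p / h p)) + (\<Sum>i<K. 1 / X i * (da i p * (db i p / h p)))
      - (\<Sum>i<K. \<Sum>j<K. s i j * (dv i p * (dw j p / h p)))" for p
    unfolding main diff_divide_distrib add_divide_distrib sum_divide_distrib by simp
  have l1: "((\<lambda>p. (g i (X i + dX i p) - 1 / X i) * (dX i p / h p)) \<longlongrightarrow> 0) (at p0)" if "i < K" for i
    by (rule lim_null_mult_right_bounded[OF gl[OF that]]) (use qX[of i] in auto)
  have l2: "((\<lambda>p. da i p * (db i p / h p)) \<longlongrightarrow> 0) (at p0)" for i
    by (rule lim_null_mult_right_bounded[OF da]) (use qbb[of i] in auto)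
  have l3: "((\<lambda>p. dv i p * (dw j p / h p)) \<longlongrightarrow> 0) (at p0)" if "i < K" "j < K" for i j
  proof (rule lim_null_mult_right_bounded[OF dv(1)[OF that(1)]])
    show "\<forall>\<^sub>F p in at p0. norm (dw j p / h p) \<le> L" using qb[OF that(2)] by eventually_elim simp
  qed
  have "((\<lambda>p. (Phi K s (T p) (H p) (V p) (W p) - Phi K s (T p0) (H p0) (V p0) (W p0)) / h p) \<longlongrightarrow>
      H' * (\<Sum>i<K. V p0 i + W p0 i) + T' * (\<Sum>i<K. 1 / X i)
      + (\<Sum>i<K. 0) + (\<Sum>i<K. 1 / X i * 0) - (\<Sum>i<K. \<Sum>j<K. s i j * 0)) (at p0)"
    unfolding quot by (intro tendsto_diff tendsto_add tendsto_mult tendsto_const qh qt tendsto_sum l1 l2 l3) auto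
  then show ?thesis unfolding has_field_derivative_iff h_def X_def a0_def b0_def by simp
qed

end

section \<open>Choice of a balanced solution and its Lipschitz dependence on the parameters\<close>

context irreducible_matrix begin

lemma lipschitz_abs:
  assumes "0 < c" "0 < C"
  shows "\<exists>L>0. \<forall>\<tau>0 \<eta>0 v0 w0 \<tau>1 \<eta>1 v1 w1. bal K s \<tau>0 \<eta>0 v0 w0 \<longrightarrow> confined K c C \<tau>0 \<eta>0 v0 w0 \<longrightarrow>
    bal K s \<tau>1 \<eta>1 v1 w1 \<longrightarrow> confined K c C \<tau>1 \<eta>1 v1 w1 \<longrightarrow>
    (\<forall>i<K. \<bar>v1 i - v0 i\<bar> \<le> L * (\<bar>\<tau>1 - \<tau>0\<bar> + \<bar>\<eta>1 - \<eta>0\<bar>) \<and> \<bar>w1 i - w0 i\<bar> \<le> L * (\<bar>\<tau>1 - \<tau>0\<bar> + \<bar>\<eta>1 - \<eta>0\<bar>))"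
proof -
  obtain L where L: "L > 0" and lip: "\<And>\<tau>0 \<eta>0 v0 w0 \<tau>1 \<eta>1 v1 w1. bal K s \<tau>0 \<eta>0 v0 w0 \<Longrightarrow> confined K c C \<tau>0 \<eta>0 v0 w0 \<Longrightarrow>
    bal K s \<tau>1 \<eta>1 v1 w1 \<Longrightarrow> confined K c C \<tau>1 \<eta>1 v1 w1 \<Longrightarrow>
    (\<forall>p\<in>nodes K. \<bar>logdiff v0 w0 v1 w1 p\<bar> \<le> L * (\<bar>\<tau>1 - \<tau>0\<bar> + \<bar>\<eta>1 - \<eta>0\<bar>))"
    using lipschitz[OF assms(1), of C] by blast
  have dl: "x - y \<le> C * \<bar>ln x - ln y\<bar>" if "0 < x" "x \<le> C" "0 < y" for x y :: real
  proof -
    have "ln (y / x) \<le> y / x - 1" by (rule ln_le_minus_one) (use that in auto)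
    then have "x * (1 - y / x) \<le> x * (ln x - ln y)" using that by (intro mult_left_mono) (auto simp: ln_div)
    also have "\<dots> \<le> x * \<bar>ln x - ln y\<bar>" using that by (intro mult_left_mono) auto
    also have "\<dots> \<le> C * \<bar>ln x - ln y\<bar>" using that by (intro mult_right_mono) auto
    finally show ?thesis using that by (simp add: algebra_simps)
  qed
  then have dl2: "\<bar>x - y\<bar> \<le> C * \<bar>ln x - ln y\<bar>" if "0 < x" "x \<le> C" "0 < y" "y \<le> C" for x y :: real
    using dl[of x y] dl[of y x] that by (auto simp: abs_le_iff abs_minus_commute)
  have "\<bar>v1 i - v0 i\<bar> \<le> C * L * (\<bar>\<tau>1 - \<tau>0\<bar> + \<bar>\<eta>1 - \<eta>0\<bar>) \<and> \<bar>w1 i - w0 i\<bar> \<le> C * L * (\<bar>\<tau>1 - \<tau>0\<bar> + \<bar>\<eta>1 - \<eta>0\<bar>)"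
    if A: "bal K s \<tau>0 \<eta>0 v0 w0" "confined K c C \<tau>0 \<eta>0 v0 w0" "bal K s \<tau>1 \<eta>1 v1 w1" "confined K c C \<tau>1 \<eta>1 v1 w1"
      and i: "i < K" for \<tau>0 \<eta>0 v0 w0 \<tau>1 \<eta>1 v1 w1 i
  proof -
    define E where "E = \<bar>\<tau>1 - \<tau>0\<bar> + \<bar>\<eta>1 - \<eta>0\<bar>"
    have "\<bar>logdiff v0 w0 v1 w1 (i, True)\<bar> \<le> L * E" "\<bar>logdiff v0 w0 v1 w1 (i, False)\<bar> \<le> L * E"
      using lip[OF A] i unfolding E_def by (auto simp: nodes_def)
    then have l: "\<bar>ln (v1 i) - ln (v0 i)\<bar> \<le> L * E" "\<bar>ln (w1 i) - ln (w0 i)\<bar> \<le> L * E"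
      unfolding logdiff_def by (auto simp: abs_minus_commute)
    have p: "0 < v0 i" "v0 i \<le> C" "0 < v1 i" "v1 i \<le> C" "0 < w0 i" "w0 i \<le> C" "0 < w1 i" "w1 i \<le> C"
      using A(2,4) assms i unfolding confined_def by force+
    have "\<bar>v1 i - v0 i\<bar> \<le> C * (L * E)"
      using dl2[OF p(3,4,1,2)] mult_left_mono[OF l(1), of C] assms by linarith
    moreover have "\<bar>w1 i - w0 i\<bar> \<le> C * (L * E)"
      using dl2[OF p(7,8,5,6)] mult_left_mono[OF l(2), of C] assms by linarith
    ultimately show ?thesis unfolding E_def by (simp add: mult.assoc)
  qed
  moreover have "C * L > 0" using assms L by simp
  ultimately show ?thesis by blast
qed

end

context controlled_matrix begin

text \<open>An arbitrary choice is enough, because the Lipschitz estimate compares any two balanced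
  solutions. For \<open>\<eta> = 0\<close> existence is known only when
  \<open>\<tau> < \<tau>0\<close>.\<close>

definition pr :: "real \<Rightarrow> real \<Rightarrow> (nat \<Rightarrow> real) \<times> (nat \<Rightarrow> real)" where
  "pr \<tau> \<eta> = (SOME x. bal K s \<tau> \<eta> (fst x) (snd x))"
definition sv :: "real \<Rightarrow> real \<Rightarrow> nat \<Rightarrow> real" where "sv \<tau> \<eta> = fst (pr \<tau> \<eta>)"
definition sw :: "real \<Rightarrow> real \<Rightarrow> nat \<Rightarrow> real" where "sw \<tau> \<eta> = snd (pr \<tau> \<eta>)"

lemma bal_pos: assumes "0 < \<tau>" "0 < \<eta>" shows "bal K s \<tau> \<eta> (sv \<tau> \<eta>) (sw \<tau> \<eta>)"
proof -
  have "\<exists>x. bal K s \<tau> \<eta> (fst x) (snd x)"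
    using sol_exists[OF variance_matrix_axioms assms] balanced_pos[OF _ assms] by fastforce
  from someI_ex[OF this] show ?thesis unfolding sv_def sw_def pr_def .
qed

lemma bal_zero: assumes "0 < \<tau>" "\<tau> < \<tau>0" shows "bal K s \<tau> 0 (sv \<tau> 0) (sw \<tau> 0)"
proof -
  have "\<exists>x. bal K s \<tau> 0 (fst x) (snd x)" using bal_exists_zero[OF assms] by fastforce
  from someI_ex[OF this] show ?thesis unfolding sv_def sw_def pr_def .
qed

lemma bal_nonneg: "0 < \<tau> \<Longrightarrow> \<tau> < \<tau>0 \<Longrightarrow> 0 \<le> \<eta> \<Longrightarrow> bal K s \<tau> \<eta> (sv \<tau> \<eta>) (sw \<tau> \<eta>)"
  using bal_pos bal_zero by (cases "\<eta> = 0") auto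

lemma lip_smallE:
  assumes "0 < \<tau>1"
  obtains L where "L > 0" "\<And>\<tau> \<eta> \<tau>' \<eta>' i. \<tau>1 \<le> \<tau> \<Longrightarrow> \<tau> < \<tau>0 \<Longrightarrow> \<tau>1 \<le> \<tau>' \<Longrightarrow> \<tau>' < \<tau>0 \<Longrightarrow> 0 \<le> \<eta> \<Longrightarrow> \<eta> \<le> 1 \<Longrightarrow> 0 \<le> \<eta>' \<Longrightarrow> \<eta>' \<le> 1 \<Longrightarrow>
    i < K \<Longrightarrow> \<bar>sv \<tau>' \<eta>' i - sv \<tau> \<eta> i\<bar> \<le> L * (\<bar>\<tau>' - \<tau>\<bar> + \<bar>\<eta>' - \<eta>\<bar>) \<and> \<bar>sw \<tau>' \<eta>' i - sw \<tau> \<eta> i\<bar> \<le> L * (\<bar>\<tau>' - \<tau>\<bar> + \<bar>\<eta>' - \<eta>\<bar>)"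
proof -
  obtain c C where c: "c > 0" "C > 0" and conf: "\<And>\<tau>' \<eta> v w. bal K s \<tau>' \<eta> v w \<Longrightarrow> \<tau>1 \<le> \<tau>' \<Longrightarrow> \<tau>' < \<tau>0 \<Longrightarrow> 0 \<le> \<eta> \<Longrightarrow> \<eta> \<le> 1 \<Longrightarrow>
    confined K c C \<tau>' \<eta> v w" using confined_small[OF assms] by blast
  obtain L where L: "L > 0" and lip: "\<And>\<tau>0 \<eta>0 v0 w0 \<tau>1 \<eta>1 v1 w1. bal K s \<tau>0 \<eta>0 v0 w0 \<Longrightarrow> confined K c C \<tau>0 \<eta>0 v0 w0 \<Longrightarrow>
    bal K s \<tau>1 \<eta>1 v1 w1 \<Longrightarrow> confined K c C \<tau>1 \<eta>1 v1 w1 \<Longrightarrow>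
    (\<forall>i<K. \<bar>v1 i - v0 i\<bar> \<le> L * (\<bar>\<tau>1 - \<tau>0\<bar> + \<bar>\<eta>1 - \<eta>0\<bar>) \<and> \<bar>w1 i - w0 i\<bar> \<le> L * (\<bar>\<tau>1 - \<tau>0\<bar> + \<bar>\<eta>1 - \<eta>0\<bar>))"
    using lipschitz_abs[OF c] by blast
  have B: "bal K s \<tau> \<eta> (sv \<tau> \<eta>) (sw \<tau> \<eta>)" "confined K c C \<tau> \<eta> (sv \<tau> \<eta>) (sw \<tau> \<eta>)"
    if "\<tau>1 \<le> \<tau>" "\<tau> < \<tau>0" "0 \<le> \<eta>" "\<eta> \<le> 1" for \<tau> \<eta>
  proof -
    show "bal K s \<tau> \<eta> (sv \<tau> \<eta>) (sw \<tau> \<eta>)" by (rule bal_nonneg) (use that assms in auto)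
    then show "confined K c C \<tau> \<eta> (sv \<tau> \<eta>) (sw \<tau> \<eta>)" by (rule conf) (use that in auto)
  qed
  show thesis
  proof (rule that[OF L])
    fix \<tau> \<eta> \<tau>' \<eta>' :: real and i assume A: "\<tau>1 \<le> \<tau>" "\<tau> < \<tau>0" "\<tau>1 \<le> \<tau>'" "\<tau>' < \<tau>0" "0 \<le> \<eta>" "\<eta> \<le> 1" "0 \<le> \<eta>'" "\<eta>' \<le> 1" "i < K"
    show "\<bar>sv \<tau>' \<eta>' i - sv \<tau> \<eta> i\<bar> \<le> L * (\<bar>\<tau>' - \<tau>\<bar> + \<bar>\<eta>' - \<eta>\<bar>) \<and> \<bar>sw \<tau>' \<eta>' i - sw \<tau> \<eta> i\<bar> \<le> L * (\<bar>\<tau>' - \<tau>\<bar> + \<bar>\<eta>' - \<eta>\<bar>)"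
      using lip[OF B[OF A(1,2,5,6)] B[OF A(3,4,7,8)]] A(9) by blast
  qed
qed

text \<open>Complements the estimate near \<open>\<eta> = 0\<close>, which requires
  \<open>\<eta> \<le> 1\<close> and \<open>\<tau> < \<tau>0\<close>: here \<open>\<tau>\<close> is
  fixed and \<open>\<eta>\<close> stays in a compact interval away from 0, where the elementary
  bounds by powers of \<open>\<eta>\<close> confine the solution.\<close>

lemma lip_largeE:
  assumes "0 < \<tau>" "0 < e1"
  obtains L where "L > 0" "\<And>\<eta> \<eta>' i. e1 \<le> \<eta> \<Longrightarrow> \<eta> \<le> e2 \<Longrightarrow> e1 \<le> \<eta>' \<Longrightarrow> \<eta>' \<le> e2 \<Longrightarrow> i < K \<Longrightarrow>
    \<bar>sv \<tau> \<eta>' i - sv \<tau> \<eta> i\<bar> \<le> L * \<bar>\<eta>' - \<eta>\<bar> \<and> \<bar>sw \<tau> \<eta>' i - sw \<tau> \<eta> i\<bar> \<le> L * \<bar>\<eta>' - \<eta>\<bar>"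
proof -
  obtain c C where c: "c > 0" "C > 0" and conf: "\<And>\<tau>' \<eta> v w. sol K s \<tau>' \<eta> v w \<Longrightarrow> \<tau> \<le> \<tau>' \<Longrightarrow> \<tau>' \<le> \<tau> \<Longrightarrow> e1 \<le> \<eta> \<Longrightarrow> \<eta> \<le> e2 \<Longrightarrow>
    confined K c C \<tau>' \<eta> v w" using confined_large[OF assms, of \<tau> e2] by blast
  obtain L where L: "L > 0" and lip: "\<And>\<tau>0 \<eta>0 v0 w0 \<tau>1 \<eta>1 v1 w1. bal K s \<tau>0 \<eta>0 v0 w0 \<Longrightarrow> confined K c C \<tau>0 \<eta>0 v0 w0 \<Longrightarrow>
    bal K s \<tau>1 \<eta>1 v1 w1 \<Longrightarrow> confined K c C \<tau>1 \<eta>1 v1 w1 \<Longrightarrow>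
    (\<forall>i<K. \<bar>v1 i - v0 i\<bar> \<le> L * (\<bar>\<tau>1 - \<tau>0\<bar> + \<bar>\<eta>1 - \<eta>0\<bar>) \<and> \<bar>w1 i - w0 i\<bar> \<le> L * (\<bar>\<tau>1 - \<tau>0\<bar> + \<bar>\<eta>1 - \<eta>0\<bar>))"
    using lipschitz_abs[OF c] by blast
  have B: "bal K s \<tau> \<eta> (sv \<tau> \<eta>) (sw \<tau> \<eta>)" "confined K c C \<tau> \<eta> (sv \<tau> \<eta>) (sw \<tau> \<eta>)"
    if "e1 \<le> \<eta>" "\<eta> \<le> e2" for \<eta>
  proof -
    show "bal K s \<tau> \<eta> (sv \<tau> \<eta>) (sw \<tau> \<eta>)" by (rule bal_pos) (use that assms in auto)
    then show "confined K c C \<tau> \<eta> (sv \<tau> \<eta>) (sw \<tau> \<eta>)" unfolding bal_def by (intro conf) (use that in auto)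
  qed
  have "\<bar>sv \<tau> \<eta>' i - sv \<tau> \<eta> i\<bar> \<le> L * \<bar>\<eta>' - \<eta>\<bar> \<and> \<bar>sw \<tau> \<eta>' i - sw \<tau> \<eta> i\<bar> \<le> L * \<bar>\<eta>' - \<eta>\<bar>"
    if "e1 \<le> \<eta>" "\<eta> \<le> e2" "e1 \<le> \<eta>'" "\<eta>' \<le> e2" "i < K" for \<eta> \<eta>' i
    using lip[OF B[OF that(1,2)] B[OF that(3,4)]] that(5) by auto
  then show thesis using that L by blast
qed

end

section \<open>The integral over the regularisation parameter\<close>

lemma isCont_lip:
  fixes f :: "real \<Rightarrow> real"
  assumes "\<forall>\<^sub>F p in at x. \<bar>f p - f x\<bar> \<le> L * \<bar>p - x\<bar>" shows "isCont f x"
proof -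
  have "((\<lambda>p. L * \<bar>p - x\<bar>) \<longlongrightarrow> L * \<bar>x - x\<bar>) (at x)" by (intro tendsto_intros)
  then have "((\<lambda>p. L * \<bar>p - x\<bar>) \<longlongrightarrow> 0) (at x)" by simp
  then have "((\<lambda>p. f p - f x) \<longlongrightarrow> 0) (at x)"
    by (rule Lim_null_comparison[rotated]) (use assms in simp)
  then show ?thesis unfolding isCont_def by (simp add: LIM_zero_iff)
qed

context controlled_matrix begin

lemma sv_lip_at:
  assumes "0 < \<tau>" "0 < \<eta>"
  shows "\<exists>L. \<forall>\<^sub>F p in at \<eta>. \<forall>i<K. \<bar>sv \<tau> p i - sv \<tau> \<eta> i\<bar> \<le> L * \<bar>p - \<eta>\<bar> \<and> \<bar>sw \<tau> p i - sw \<tau> \<eta> i\<bar> \<le> L * \<bar>p - \<eta>\<bar>"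
proof -
  have "0 < \<eta> / 2" using assms by simp
  with assms(1) obtain L where L: "\<And>p i. \<eta> / 2 \<le> p \<Longrightarrow> p \<le> 2 * \<eta> \<Longrightarrow> i < K \<Longrightarrow>
    \<bar>sv \<tau> p i - sv \<tau> \<eta> i\<bar> \<le> L * \<bar>p - \<eta>\<bar> \<and> \<bar>sw \<tau> p i - sw \<tau> \<eta> i\<bar> \<le> L * \<bar>p - \<eta>\<bar>"
  proof (rule lip_largeE[where ?e2.0 = "2 * \<eta>"])
    fix L assume L: "\<And>\<eta>' \<eta>'' i. \<eta> / 2 \<le> \<eta>' \<Longrightarrow> \<eta>' \<le> 2 * \<eta> \<Longrightarrow> \<eta> / 2 \<le> \<eta>'' \<Longrightarrow> \<eta>'' \<le> 2 * \<eta> \<Longrightarrow> i < K \<Longrightarrow>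
      \<bar>sv \<tau> \<eta>'' i - sv \<tau> \<eta>' i\<bar> \<le> L * \<bar>\<eta>'' - \<eta>'\<bar> \<and> \<bar>sw \<tau> \<eta>'' i - sw \<tau> \<eta>' i\<bar> \<le> L * \<bar>\<eta>'' - \<eta>'\<bar>"
    show thesis by (rule that[OF L]) (use assms in auto)
  qed
  have "\<forall>\<^sub>F p in at \<eta>. p \<in> {\<eta> / 2<..<2 * \<eta>}"
    by (rule eventually_at_in_open') (use assms in auto)
  then have "\<forall>\<^sub>F p in at \<eta>. \<forall>i<K. \<bar>sv \<tau> p i - sv \<tau> \<eta> i\<bar> \<le> L * \<bar>p - \<eta>\<bar> \<and> \<bar>sw \<tau> p i - sw \<tau> \<eta> i\<bar> \<le> L * \<bar>p - \<eta>\<bar>"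
    by eventually_elim (use L in auto)
  then show ?thesis by blast
qed

lemma isCont_sv: assumes "0 < \<tau>" "0 < \<eta>" "i < K" shows "isCont (\<lambda>\<eta>. sv \<tau> \<eta> i) \<eta>"
proof -
  obtain L where "\<forall>\<^sub>F p in at \<eta>. \<forall>i<K. \<bar>sv \<tau> p i - sv \<tau> \<eta> i\<bar> \<le> L * \<bar>p - \<eta>\<bar> \<and> \<bar>sw \<tau> p i - sw \<tau> \<eta> i\<bar> \<le> L * \<bar>p - \<eta>\<bar>"
    using sv_lip_at[OF assms(1,2)] by blast
  then have "\<forall>\<^sub>F p in at \<eta>. \<bar>sv \<tau> p i - sv \<tau> \<eta> i\<bar> \<le> L * \<bar>p - \<eta>\<bar>" by eventually_elim (use assms in auto)
  then show ?thesis by (rule isCont_lip)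
qed

definition pot :: "real \<Rightarrow> real \<Rightarrow> real" where "pot \<tau> \<eta> = Phi K s \<tau> \<eta> (sv \<tau> \<eta>) (sw \<tau> \<eta>)"

lemma pot_deriv_eta:
  assumes "0 < \<tau>" "0 < \<eta>"
  shows "(pot \<tau> has_real_derivative 2 * (\<Sum>i<K. sv \<tau> \<eta> i)) (at \<eta>)"
proof -
  obtain L where L: "\<forall>\<^sub>F p in at \<eta>. \<forall>i<K. \<bar>sv \<tau> p i - sv \<tau> \<eta> i\<bar> \<le> L * \<bar>p - \<eta>\<bar> \<and> \<bar>sw \<tau> p i - sw \<tau> \<eta> i\<bar> \<le> L * \<bar>p - \<eta>\<bar>"
    using sv_lip_at[OF assms] by blast
  have B: "sol K s \<tau> \<eta> (sv \<tau> \<eta>) (sw \<tau> \<eta>)" "(\<Sum>i<K. sv \<tau> \<eta> i) = (\<Sum>i<K. sw \<tau> \<eta> i)"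
    using bal_pos[OF assms] unfolding bal_def by auto
  have "((\<lambda>p. Phi K s \<tau> p (sv \<tau> p) (sw \<tau> p)) has_real_derivative
    (1 * (\<Sum>i<K. sv \<tau> \<eta> i + sw \<tau> \<eta> i) + 0 * (\<Sum>i<K. 1 / (a \<eta> (sw \<tau> \<eta>) i * b \<eta> (sv \<tau> \<eta>) i + \<tau>)))) (at \<eta>)"
    using assms B(1) L by (intro Phi_deriv[where L = L]) (auto intro: DERIV_ident)
  then show ?thesis unfolding pot_def[abs_def] using B(2) by (simp add: sum.distrib)
qed

lemma pot_at_zero:
  assumes "0 < \<tau>" "\<tau> < \<tau>0"
  shows "(pot \<tau> \<longlongrightarrow> pot \<tau> 0) (at_right 0)"
proof -
  interpret T: supported_matrix K "\<lambda>i j. s j i" "inv_into UNIV \<pi>" by (rule supported_matrix_transpose)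
  obtain L where L: "\<And>\<eta>. 0 \<le> \<eta> \<Longrightarrow> \<eta> \<le> 1 \<Longrightarrow> \<forall>i<K. \<bar>sv \<tau> \<eta> i - sv \<tau> 0 i\<bar> \<le> L * \<bar>\<eta>\<bar> \<and> \<bar>sw \<tau> \<eta> i - sw \<tau> 0 i\<bar> \<le> L * \<bar>\<eta>\<bar>"
  proof (rule lip_smallE[OF assms(1)])
    fix L assume L: "\<And>\<tau>' \<eta> \<tau>'' \<eta>' i. \<tau> \<le> \<tau>' \<Longrightarrow> \<tau>' < \<tau>0 \<Longrightarrow> \<tau> \<le> \<tau>'' \<Longrightarrow> \<tau>'' < \<tau>0 \<Longrightarrow> 0 \<le> \<eta> \<Longrightarrow> \<eta> \<le> 1 \<Longrightarrow> 0 \<le> \<eta>' \<Longrightarrow> \<eta>' \<le> 1 \<Longrightarrow>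
      i < K \<Longrightarrow> \<bar>sv \<tau>'' \<eta>' i - sv \<tau>' \<eta> i\<bar> \<le> L * (\<bar>\<tau>'' - \<tau>'\<bar> + \<bar>\<eta>' - \<eta>\<bar>) \<and> \<bar>sw \<tau>'' \<eta>' i - sw \<tau>' \<eta> i\<bar> \<le> L * (\<bar>\<tau>'' - \<tau>'\<bar> + \<bar>\<eta>' - \<eta>\<bar>)"
    show thesis
    proof (rule that[of L], intro allI impI)
      fix \<eta> :: real and i assume "0 \<le> \<eta>" "\<eta> \<le> 1" "i < K"
      then show "\<bar>sv \<tau> \<eta> i - sv \<tau> 0 i\<bar> \<le> L * \<bar>\<eta>\<bar> \<and> \<bar>sw \<tau> \<eta> i - sw \<tau> 0 i\<bar> \<le> L * \<bar>\<eta>\<bar>"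
        using L[of \<tau> \<tau> 0 \<eta> i] assms by simp
    qed
  qed
  have ev: "\<forall>\<^sub>F \<eta> in at_right 0. \<eta> \<in> {0<..<1::real}" by (rule eventually_at_right_real) auto
  have L0: "((\<lambda>\<eta>. L * \<bar>\<eta>\<bar>) \<longlongrightarrow> 0) (at_right 0)" by (auto intro!: tendsto_eq_intros)
  have v: "((\<lambda>\<eta>. sv \<tau> \<eta> i) \<longlongrightarrow> sv \<tau> 0 i) (at_right 0)" if "i < K" for i
  proof -
    have "((\<lambda>\<eta>. sv \<tau> \<eta> i - sv \<tau> 0 i) \<longlongrightarrow> 0) (at_right 0)"
      by (rule Lim_null_comparison[OF _ L0]) (use ev in eventually_elim, use L that in auto)
    then show ?thesis by (simp add: LIM_zero_iff)
  qed
  have w: "((\<lambda>\<eta>. sw \<tau> \<eta> i) \<longlongrightarrow> sw \<tau> 0 i) (at_right 0)" if "i < K" for i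
  proof -
    have "((\<lambda>\<eta>. sw \<tau> \<eta> i - sw \<tau> 0 i) \<longlongrightarrow> 0) (at_right 0)"
      by (rule Lim_null_comparison[OF _ L0]) (use ev in eventually_elim, use L that in auto)
    then show ?thesis by (simp add: LIM_zero_iff)
  qed
  have la: "((\<lambda>\<eta>. a \<eta> (sw \<tau> \<eta>) i) \<longlongrightarrow> a 0 (sw \<tau> 0) i) (at_right 0)" for i
    unfolding lin_def by (intro tendsto_intros w) auto
  have lb: "((\<lambda>\<eta>. b \<eta> (sv \<tau> \<eta>) i) \<longlongrightarrow> b 0 (sv \<tau> 0) i) (at_right 0)" for i
    unfolding lin_def by (intro tendsto_intros v) auto
  have "sol K s \<tau> 0 (sv \<tau> 0) (sw \<tau> 0)" using bal_zero[OF assms] unfolding bal_def by auto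
  note f = sol_facts[OF this assms(1) order_refl]
  have "a 0 (sw \<tau> 0) i * b 0 (sv \<tau> 0) i + \<tau> \<noteq> 0" if "i < K" for i
    using f(1,2)[OF that] assms by (metis add_pos_pos less_irrefl mult_pos_pos)
  then show ?thesis unfolding pot_def Phi_def by (intro tendsto_intros la lb v w) auto
qed

text \<open>Subtracting \<open>1 / (1 + \<eta>)\<close> removes the non-integrable leading order of
  \<open>v\<close> at infinity; the quadratic decay of the rest makes the integral over
  \<open>\<eta>\<close> converge absolutely.\<close>

lemma sv_large_bound:
  fixes \<tau> \<eta> :: real
  assumes "0 < \<tau>" "1 \<le> \<eta>" "i < K"
  shows "\<bar>sv \<tau> \<eta> i - 1 / (1 + \<eta>)\<bar> \<le> (2 + 2 * (K + \<tau>)) / (1 + \<eta>)\<^sup>2"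
proof -
  have e: "\<eta> > 0" using assms by simp
  have S: "sol K s \<tau> \<eta> (sv \<tau> \<eta>) (sw \<tau> \<eta>)" using bal_pos[OF assms(1) e] unfolding bal_def by auto
  note sb = sol_bounds_large[OF S assms(1) e assms(3)]
  define k where "k = K + \<tau>"
  have k: "k \<ge> 0" unfolding k_def using assms by simp
  have dk: "\<eta> + K / \<eta> + \<tau> / \<eta> = \<eta> + k / \<eta>" unfolding k_def by (simp add: add_divide_distrib)
  have ke: "k / \<eta> \<ge> 0" using k e by simp
  have *: "1 / (\<eta> * (1 + \<eta>)) \<le> 2 / (1 + \<eta>)\<^sup>2"
  proof -
    have "1 / x \<le> 2 / y" if "0 < x" "0 < y" "y \<le> 2 * x" for x y :: real
      using that by (simp add: field_simps)
    moreover have "(1 + \<eta>)\<^sup>2 \<le> 2 * (\<eta> * (1 + \<eta>))"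
      using mult_right_mono[of "1 + \<eta>" "2 * \<eta>" "1 + \<eta>"] assms(2) by (simp add: power2_eq_square mult.assoc)
    ultimately show ?thesis using e by simp
  qed
  have "1 / \<eta> - 1 / (1 + \<eta>) = 1 / (\<eta> * (1 + \<eta>))" using e by (simp add: field_simps)
  then have up: "sv \<tau> \<eta> i - 1 / (1 + \<eta>) \<le> 2 / (1 + \<eta>)\<^sup>2" using sb(1) * by linarith
  have "1 / (1 + \<eta>) - 1 / (\<eta> + k / \<eta>) = (k / \<eta> - 1) / ((1 + \<eta>) * (\<eta> + k / \<eta>))"
  proof -
    have "1 / p - 1 / q = (q - p) / (p * q)" if "p > 0" "q > 0" for p q :: real using that by (simp add: field_simps)
    from this[of "1 + \<eta>" "\<eta> + k / \<eta>"] show ?thesis using e ke by simp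
  qed
  also have "\<dots> \<le> k / ((1 + \<eta>) * \<eta>)"
  proof (rule frac_le)
    have "k / \<eta> \<le> k" using k assms(2) by (simp add: divide_le_eq mult_left_le e) (metis mult.right_neutral mult_left_mono)
    then show "k / \<eta> - 1 \<le> k" by simp
    show "(1 + \<eta>) * \<eta> \<le> (1 + \<eta>) * (\<eta> + k / \<eta>)" using ke e by (intro mult_left_mono) auto
  qed (use k e in auto)
  also have "\<dots> = k * (1 / (\<eta> * (1 + \<eta>)))" by (simp add: mult.commute)
  also have "\<dots> \<le> k * (2 / (1 + \<eta>)\<^sup>2)" by (rule mult_left_mono[OF * k])
  finally have "1 / (1 + \<eta>) - sv \<tau> \<eta> i \<le> 2 * k / (1 + \<eta>)\<^sup>2" using sb(2) unfolding dk by (simp add: mult.commute)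
  moreover have "2 / (1 + \<eta>)\<^sup>2 \<le> (2 + 2 * k) / (1 + \<eta>)\<^sup>2" "2 * k / (1 + \<eta>)\<^sup>2 \<le> (2 + 2 * k) / (1 + \<eta>)\<^sup>2"
    using k by (auto intro!: divide_right_mono)
  ultimately show ?thesis using up unfolding k_def by linarith
qed

text \<open>As \<open>v\<close> and \<open>w\<close> are at most \<open>1 / \<eta>\<close>, both
  \<open>a\<close> and \<open>b\<close> lie between \<open>\<eta>\<close> and
  \<open>\<eta> + K / \<eta>\<close>. So each logarithm in the potential is
  \<open>2 * ln (1 + \<eta>)\<close> up to a null term, and the bilinear part vanishes.\<close>

lemma pot_at_infinity:
  assumes "0 < \<tau>"
  shows "((\<lambda>\<eta>. pot \<tau> \<eta> / (2 * K) - ln (1 + \<eta>)) \<longlongrightarrow> 0) at_top"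
proof -
  interpret T: supported_matrix K "\<lambda>i j. s j i" "inv_into UNIV \<pi>" by (rule supported_matrix_transpose)
  define k where "k = real K"
  have k: "k > 0" unfolding k_def using K_pos by simp
  have S: "sol K s \<tau> \<eta> (sv \<tau> \<eta>) (sw \<tau> \<eta>)" if "\<eta> > 0" for \<eta> using bal_pos[OF assms that] unfolding bal_def by auto
  have bnd: "\<eta> \<le> a \<eta> (sw \<tau> \<eta>) i \<and> a \<eta> (sw \<tau> \<eta>) i \<le> \<eta> + k * (1 / \<eta>) \<and> \<eta> \<le> b \<eta> (sv \<tau> \<eta>) i \<and> b \<eta> (sv \<tau> \<eta>) i \<le> \<eta> + k * (1 / \<eta>)
    \<and> 0 \<le> sv \<tau> \<eta> i \<and> sv \<tau> \<eta> i \<le> 1 / \<eta> \<and> 0 \<le> sw \<tau> \<eta> i \<and> sw \<tau> \<eta> i \<le> 1 / \<eta>" if "\<eta> > 0" "i < K" for \<eta> i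
  proof -
    note f = sol_facts[OF S[OF that(1)] assms less_imp_le[OF that(1)]]
    have v: "0 \<le> sv \<tau> \<eta> j \<and> sv \<tau> \<eta> j \<le> 1 / \<eta>" "0 \<le> sw \<tau> \<eta> j \<and> sw \<tau> \<eta> j \<le> 1 / \<eta>" if j: "j < K" for j
      using f(3,4)[OF j] sol_bounds_large(1)[OF S assms _ j, of \<eta>] T.sol_bounds_large(1)[OF sol_swap[OF S] assms _ j, of \<eta>] \<open>\<eta> > 0\<close>
      by auto
    show ?thesis unfolding k_def using lin_ge[of "sw \<tau> \<eta>" \<eta> i] T.lin_ge[of "sv \<tau> \<eta>" \<eta> i]
      lin_le[of "sw \<tau> \<eta>" "1 / \<eta>" \<eta> i] T.lin_le[of "sv \<tau> \<eta>" "1 / \<eta>" \<eta> i] v that(2) by blast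
  qed
  have ev: "\<forall>\<^sub>F \<eta> in at_top. \<eta> > (0::real)" by (rule eventually_gt_at_top)
  have ln_lim: "((\<lambda>\<eta>. ln (a \<eta> (sw \<tau> \<eta>) i * b \<eta> (sv \<tau> \<eta>) i + \<tau>) - 2 * ln (1 + \<eta>)) \<longlongrightarrow> 0) at_top" if i: "i < K" for i
  proof (rule tendsto_sandwich)
    show "((\<lambda>\<eta>. ln (\<eta> * \<eta> + \<tau>) - 2 * ln (1 + \<eta>)) \<longlongrightarrow> 0) at_top" using assms by real_asymp
    show "((\<lambda>\<eta>. ln ((\<eta> + k * (1 / \<eta>)) * (\<eta> + k * (1 / \<eta>)) + \<tau>) - 2 * ln (1 + \<eta>)) \<longlongrightarrow> 0) at_top"
      using assms k by real_asymp
    show "\<forall>\<^sub>F \<eta> in at_top. ln (\<eta> * \<eta> + \<tau>) - 2 * ln (1 + \<eta>) \<le> ln (a \<eta> (sw \<tau> \<eta>) i * b \<eta> (sv \<tau> \<eta>) i + \<tau>) - 2 * ln (1 + \<eta>)"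
      using ev
    proof eventually_elim
      case (elim \<eta>)
      have "\<eta> * \<eta> \<le> a \<eta> (sw \<tau> \<eta>) i * b \<eta> (sv \<tau> \<eta>) i" using bnd[OF elim i] elim by (intro mult_mono) auto
      moreover have "0 < \<eta> * \<eta>" using elim by simp
      ultimately show ?case using assms by (simp add: ln_le_cancel_iff add_pos_pos)
    qed
    show "\<forall>\<^sub>F \<eta> in at_top. ln (a \<eta> (sw \<tau> \<eta>) i * b \<eta> (sv \<tau> \<eta>) i + \<tau>) - 2 * ln (1 + \<eta>) \<le>
      ln ((\<eta> + k * (1 / \<eta>)) * (\<eta> + k * (1 / \<eta>)) + \<tau>) - 2 * ln (1 + \<eta>)"
      using ev
    proof eventually_elim
      case (elim \<eta>)
      have "a \<eta> (sw \<tau> \<eta>) i * b \<eta> (sv \<tau> \<eta>) i \<le> (\<eta> + k * (1 / \<eta>)) * (\<eta> + k * (1 / \<eta>))"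
        using bnd[OF elim i] elim by (intro mult_mono) auto
      moreover have "0 < a \<eta> (sw \<tau> \<eta>) i * b \<eta> (sv \<tau> \<eta>) i" using bnd[OF elim i] elim by (intro mult_pos_pos) auto
      ultimately show ?case using assms by (simp add: ln_le_cancel_iff add_pos_pos)
    qed
  qed
  have vw_lim: "((\<lambda>\<eta>. s i j * (sv \<tau> \<eta> i * sw \<tau> \<eta> j)) \<longlongrightarrow> 0) at_top" if ij: "i < K" "j < K" for i j
  proof (rule tendsto_sandwich)
    show "((\<lambda>\<eta>::real. 0::real) \<longlongrightarrow> 0) at_top" by simp
    show "((\<lambda>\<eta>::real. 1 * (1 / \<eta> * (1 / \<eta>))) \<longlongrightarrow> 0) at_top" by real_asymp
    show "\<forall>\<^sub>F \<eta> in at_top. 0 \<le> s i j * (sv \<tau> \<eta> i * sw \<tau> \<eta> j)" using ev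
    proof eventually_elim
      case (elim \<eta>) show ?case using bnd[OF elim ij(1)] bnd[OF elim ij(2)] by (intro mult_nonneg_nonneg s_nonneg) auto
    qed
    show "\<forall>\<^sub>F \<eta> in at_top. s i j * (sv \<tau> \<eta> i * sw \<tau> \<eta> j) \<le> 1 * (1 / \<eta> * (1 / \<eta>))" using ev
    proof eventually_elim
      case (elim \<eta>) show ?case using elim bnd[OF elim ij(1)] bnd[OF elim ij(2)] s_nonneg s_le_1
        by (intro mult_mono mult_nonneg_nonneg) auto
    qed
  qed
  have "((\<lambda>\<eta>. ((\<Sum>i<K. ln (a \<eta> (sw \<tau> \<eta>) i * b \<eta> (sv \<tau> \<eta>) i + \<tau>) - 2 * ln (1 + \<eta>)) -
      (\<Sum>i<K. \<Sum>j<K. s i j * (sv \<tau> \<eta> i * sw \<tau> \<eta> j))) / (2 * K)) \<longlongrightarrow> ((\<Sum>i<K. 0) - (\<Sum>i<K. \<Sum>j<K. 0)) / (2 * K)) at_top"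
    using K_pos by (intro tendsto_intros ln_lim vw_lim) auto
  moreover have "((\<Sum>i<K. ln (a \<eta> (sw \<tau> \<eta>) i * b \<eta> (sv \<tau> \<eta>) i + \<tau>) - 2 * ln (1 + \<eta>)) -
      (\<Sum>i<K. \<Sum>j<K. s i j * (sv \<tau> \<eta> i * sw \<tau> \<eta> j))) / (2 * K) = pot \<tau> \<eta> / (2 * K) - ln (1 + \<eta>)" for \<eta>
    unfolding pot_def Phi_def sum_subtractf using K_pos by (simp add: field_simps)
  ultimately show ?thesis by simp
qed

lemma inverse_square_integrable: "set_integrable lborel {0::real<..} (\<lambda>\<eta>. D / (1 + \<eta>)\<^sup>2)"
proof -
  have "set_integrable lborel (einterval 0 \<infinity>) (\<lambda>\<eta>. 1 / (1 + \<eta>)\<^sup>2)"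
  proof (rule interval_integral_FTC_nonneg(1))
    show "((\<lambda>\<eta>. - 1 / (1 + \<eta>)) has_real_derivative 1 / (1 + x)\<^sup>2) (at x)" if "0 < ereal x" for x
      using that by (auto intro!: derivative_eq_intros simp: power2_eq_square)
    show "(((\<lambda>\<eta>. - 1 / (1 + \<eta>)) \<circ> real_of_ereal) \<longlongrightarrow> -1) (at_right 0)"
      unfolding zero_ereal_def ereal_tendsto_simps by (auto intro!: tendsto_eq_intros)
    show "(((\<lambda>\<eta>::real. - 1 / (1 + \<eta>)) \<circ> real_of_ereal) \<longlongrightarrow> 0) (at_left \<infinity>)"
      unfolding ereal_tendsto_simps by real_asymp
  qed (auto intro!: continuous_intros)
  then have "set_integrable lborel (einterval 0 \<infinity>) (\<lambda>\<eta>. D * (1 / (1 + \<eta>)\<^sup>2))" by (rule set_integrable_mult_right)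
  moreover have "einterval 0 \<infinity> = {0::real<..}" by (auto simp: einterval_def)
  ultimately show ?thesis by simp
qed

text \<open>The antiderivative \<open>pot \<tau> \<eta> / (2 * K) - ln (1 + \<eta>)\<close> tends to
  0 at infinity, so only its value at 0 survives. That the integrand stays bounded near 0 is the
  confinement of solutions for \<open>\<tau> < \<tau>0\<close>.\<close>

theorem pot_integral:
  assumes "0 < \<tau>" "\<tau> < \<tau>0"
  shows "(LINT \<eta>:{0<..}|lborel. (\<Sum>i<K. sv \<tau> \<eta> i) / K - 1 / (1 + \<eta>)) = - pot \<tau> 0 / (2 * K)"
proof -
  define m where "m = (\<lambda>\<eta>. (\<Sum>i<K. sv \<tau> \<eta> i) / K - 1 / (1 + \<eta>))"
  define H where "H = (\<lambda>\<eta>. pot \<tau> \<eta> / (2 * K) - ln (1 + \<eta>))"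
  have ei: "einterval 0 \<infinity> = {0::real<..}" by (auto simp: einterval_def)
  have dH: "(H has_real_derivative m x) (at x)" if "x > 0" for x
  proof -
    have "((\<lambda>\<eta>. pot \<tau> \<eta> / (2 * K)) has_real_derivative 2 * (\<Sum>i<K. sv \<tau> x i) / (2 * K)) (at x)"
      by (rule DERIV_cdivide[OF pot_deriv_eta[OF assms(1) that]])
    moreover have "((\<lambda>\<eta>. ln (1 + \<eta>)) has_real_derivative 1 / (1 + x)) (at x)"
      using that by (auto intro!: derivative_eq_intros)
    ultimately have "(H has_real_derivative 2 * (\<Sum>i<K. sv \<tau> x i) / (2 * K) - 1 / (1 + x)) (at x)"
      unfolding H_def by (rule DERIV_diff)
    then show ?thesis unfolding m_def by simp
  qed
  have cm: "isCont m x" if "x > 0" for x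
    unfolding m_def using that K_pos by (intro continuous_intros isCont_sv assms) auto
  obtain C where C: "C > 0" and conf: "\<And>\<eta>. 0 \<le> \<eta> \<Longrightarrow> \<eta> \<le> 1 \<Longrightarrow> \<forall>i<K. 0 \<le> sv \<tau> \<eta> i \<and> sv \<tau> \<eta> i \<le> C"
  proof -
    obtain c C where c: "c > 0" "C > 0" and conf: "\<And>\<tau>' \<eta> v w. bal K s \<tau>' \<eta> v w \<Longrightarrow> \<tau> \<le> \<tau>' \<Longrightarrow> \<tau>' < \<tau>0 \<Longrightarrow> 0 \<le> \<eta> \<Longrightarrow> \<eta> \<le> 1 \<Longrightarrow>
      confined K c C \<tau>' \<eta> v w" using confined_small[OF assms(1)] by blast
    have "\<forall>i<K. 0 \<le> sv \<tau> \<eta> i \<and> sv \<tau> \<eta> i \<le> C" if "0 \<le> \<eta>" "\<eta> \<le> 1" for \<eta>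
      using conf[OF bal_nonneg[OF assms that(1)]] that assms c unfolding confined_def by force
    then show ?thesis using that c by blast
  qed
  \<comment> \<open>First entry for \<open>\<eta> \<le> 1\<close>, where the difference is at most
    \<open>C + 1\<close> and \<open>(1 + \<eta>)^2\<close> at most 4; second entry from
    \<open>sv_large_bound\<close>.\<close>
  define D where "D = max (4 * (C + 1)) (2 + 2 * (K + \<tau>))"
  have bound: "\<bar>m \<eta>\<bar> \<le> D / (1 + \<eta>)\<^sup>2" if e: "\<eta> > 0" for \<eta>
  proof -
    have "\<bar>sv \<tau> \<eta> i - 1 / (1 + \<eta>)\<bar> \<le> D / (1 + \<eta>)\<^sup>2" if i: "i < K" for i
    proof (cases "\<eta> \<le> 1")
      case True
      have "0 \<le> 1 / (1 + \<eta>)" "1 / (1 + \<eta>) \<le> 1" using e by auto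
      then have "\<bar>sv \<tau> \<eta> i - 1 / (1 + \<eta>)\<bar> \<le> C + 1" using conf[of \<eta>] True e i by (smt (verit))
      also have "\<dots> \<le> 4 * (C + 1) / (1 + \<eta>)\<^sup>2"
      proof -
        have "(1 + \<eta>)\<^sup>2 \<le> 2\<^sup>2" using True e by (intro power_mono) auto
        then have "(C + 1) * (1 + \<eta>)\<^sup>2 \<le> (C + 1) * 4" using C by (intro mult_left_mono) auto
        then show ?thesis using e by (simp add: field_simps)
      qed
      also have "\<dots> \<le> D / (1 + \<eta>)\<^sup>2" unfolding D_def by (intro divide_right_mono) auto
      finally show ?thesis .
    next
      case False
      then have "\<bar>sv \<tau> \<eta> i - 1 / (1 + \<eta>)\<bar> \<le> (2 + 2 * (K + \<tau>)) / (1 + \<eta>)\<^sup>2" using sv_large_bound[OF assms(1) _ i, of \<eta>] by simp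
      also have "\<dots> \<le> D / (1 + \<eta>)\<^sup>2" unfolding D_def by (intro divide_right_mono) auto
      finally show ?thesis .
    qed
    then have "\<bar>\<Sum>i<K. sv \<tau> \<eta> i - 1 / (1 + \<eta>)\<bar> \<le> (\<Sum>i<K. D / (1 + \<eta>)\<^sup>2)"
      by (intro order_trans[OF sum_abs] sum_mono) auto
    moreover have "m \<eta> = (\<Sum>i<K. sv \<tau> \<eta> i - 1 / (1 + \<eta>)) / K"
      unfolding m_def using K_pos by (simp add: sum_subtractf diff_divide_distrib)
    ultimately have "\<bar>m \<eta>\<bar> \<le> (\<Sum>i<K. D / (1 + \<eta>)\<^sup>2) / K"
      by (simp only: abs_divide abs_of_nat) (rule divide_right_mono, auto)
    then show ?thesis using K_pos by simp
  qed
  have meas: "set_borel_measurable lborel {0<..} m"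
    unfolding set_borel_measurable_def
    using borel_measurable_continuous_on_indicator[of "{0<..}" m] cm
    by (auto intro!: continuous_at_imp_continuous_on)
  have int: "set_integrable lborel {0<..} m"
  proof (rule set_integrable_bound[OF inverse_square_integrable[of D] meas], rule AE_I2, rule impI)
    fix x :: real assume "x \<in> {0<..}"
    then have "\<bar>m x\<bar> \<le> D / (1 + x)\<^sup>2" using bound by simp
    also have "\<dots> \<le> \<bar>D / (1 + x)\<^sup>2\<bar>" by (rule abs_ge_self)
    finally show "norm (m x) \<le> norm (D / (1 + x)\<^sup>2)" by simp
  qed
  have "(LBINT x=0..\<infinity>. m x) = 0 - pot \<tau> 0 / (2 * K)"
  proof (rule interval_integral_FTC_integrable)
    show "(H has_vector_derivative m x) (at x)" if "0 < ereal x" for x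
      using dH[of x] that by (simp add: has_real_derivative_iff_has_vector_derivative)
    show "isCont m x" if "0 < ereal x" for x using cm that by simp
    show "set_integrable lborel (einterval 0 \<infinity>) m" using int ei by simp
    show "((H \<circ> real_of_ereal) \<longlongrightarrow> pot \<tau> 0 / (2 * K)) (at_right 0)"
      unfolding zero_ereal_def ereal_tendsto_simps H_def using K_pos
      by (auto intro!: tendsto_eq_intros pot_at_zero[OF assms])
    show "((H \<circ> real_of_ereal) \<longlongrightarrow> 0) (at_left \<infinity>)"
      unfolding ereal_tendsto_simps H_def by (rule pot_at_infinity[OF assms(1)])
  qed auto
  then show ?thesis unfolding interval_lebesgue_integral_def m_def by (simp add: ei)
qed

section \<open>The total defect at \<open>\<eta> = 0\<close> as derivative of the potential in
  \<open>\<tau>\<close>\<close>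

definition total_defect :: "real \<Rightarrow> real" where
  "total_defect \<tau> = (\<Sum>i<K. defect K s \<tau> 0 (sv \<tau> 0) (sw \<tau> 0) i)"

lemma sv_zero_lip_at:
  assumes "0 < \<tau>" "\<tau> < \<tau>0"
  shows "\<exists>L. \<forall>\<^sub>F p in at \<tau>. \<forall>i<K. \<bar>sv p 0 i - sv \<tau> 0 i\<bar> \<le> L * \<bar>p - \<tau>\<bar> \<and> \<bar>sw p 0 i - sw \<tau> 0 i\<bar> \<le> L * \<bar>p - \<tau>\<bar>"
proof -
  have "0 < \<tau> / 2" using assms by simp
  then obtain L where L: "\<And>p i. \<tau> / 2 \<le> p \<Longrightarrow> p < \<tau>0 \<Longrightarrow> i < K \<Longrightarrow>
    \<bar>sv p 0 i - sv \<tau> 0 i\<bar> \<le> L * \<bar>p - \<tau>\<bar> \<and> \<bar>sw p 0 i - sw \<tau> 0 i\<bar> \<le> L * \<bar>p - \<tau>\<bar>"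
  proof (rule lip_smallE)
    fix L assume L: "\<And>\<tau>' \<eta> \<tau>'' \<eta>' i. \<tau> / 2 \<le> \<tau>' \<Longrightarrow> \<tau>' < \<tau>0 \<Longrightarrow> \<tau> / 2 \<le> \<tau>'' \<Longrightarrow> \<tau>'' < \<tau>0 \<Longrightarrow> 0 \<le> \<eta> \<Longrightarrow> \<eta> \<le> 1 \<Longrightarrow> 0 \<le> \<eta>' \<Longrightarrow> \<eta>' \<le> 1 \<Longrightarrow>
      i < K \<Longrightarrow> \<bar>sv \<tau>'' \<eta>' i - sv \<tau>' \<eta> i\<bar> \<le> L * (\<bar>\<tau>'' - \<tau>'\<bar> + \<bar>\<eta>' - \<eta>\<bar>) \<and> \<bar>sw \<tau>'' \<eta>' i - sw \<tau>' \<eta> i\<bar> \<le> L * (\<bar>\<tau>'' - \<tau>'\<bar> + \<bar>\<eta>' - \<eta>\<bar>)"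
    show thesis
    proof (rule that[of L])
      fix p :: real and i assume "\<tau> / 2 \<le> p" "p < \<tau>0" "i < K"
      then show "\<bar>sv p 0 i - sv \<tau> 0 i\<bar> \<le> L * \<bar>p - \<tau>\<bar> \<and> \<bar>sw p 0 i - sw \<tau> 0 i\<bar> \<le> L * \<bar>p - \<tau>\<bar>"
        using L[of \<tau> p 0 0 i] assms by simp
    qed
  qed
  have "\<forall>\<^sub>F p in at \<tau>. p \<in> {\<tau> / 2<..<\<tau>0}"
    by (rule eventually_at_in_open') (use assms in auto)
  then have "\<forall>\<^sub>F p in at \<tau>. \<forall>i<K. \<bar>sv p 0 i - sv \<tau> 0 i\<bar> \<le> L * \<bar>p - \<tau>\<bar> \<and> \<bar>sw p 0 i - sw \<tau> 0 i\<bar> \<le> L * \<bar>p - \<tau>\<bar>"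
  proof eventually_elim
    case (elim p) then show ?case using L[of p] by auto
  qed
  then show ?thesis by blast
qed

lemma pot_zero_deriv:
  assumes "0 < \<tau>" "\<tau> < \<tau>0"
  shows "((\<lambda>\<tau>. pot \<tau> 0) has_real_derivative total_defect \<tau> / \<tau>) (at \<tau>)"
proof -
  obtain L where L: "\<forall>\<^sub>F p in at \<tau>. \<forall>i<K. \<bar>sv p 0 i - sv \<tau> 0 i\<bar> \<le> L * \<bar>p - \<tau>\<bar> \<and> \<bar>sw p 0 i - sw \<tau> 0 i\<bar> \<le> L * \<bar>p - \<tau>\<bar>"
    using sv_zero_lip_at[OF assms] by blast
  have B: "sol K s \<tau> 0 (sv \<tau> 0) (sw \<tau> 0)" using bal_zero[OF assms] unfolding bal_def by auto
  have "((\<lambda>p. Phi K s p 0 (sv p 0) (sw p 0)) has_real_derivative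
    (0 * (\<Sum>i<K. sv \<tau> 0 i + sw \<tau> 0 i) + 1 * (\<Sum>i<K. 1 / (a 0 (sw \<tau> 0) i * b 0 (sv \<tau> 0) i + \<tau>)))) (at \<tau>)"
    using assms B L by (intro Phi_deriv[where L = L]) (auto intro: DERIV_ident)
  moreover have "(\<Sum>i<K. 1 / (a 0 (sw \<tau> 0) i * b 0 (sv \<tau> 0) i + \<tau>)) = total_defect \<tau> / \<tau>"
    unfolding total_defect_def defect_def sum_divide_distrib using assms by simp
  ultimately show ?thesis unfolding pot_def by simp
qed

lemma total_defect_mono: "0 < \<tau> \<Longrightarrow> \<tau> \<le> \<tau>' \<Longrightarrow> \<tau>' < \<tau>0 \<Longrightarrow> total_defect \<tau> \<le> total_defect \<tau>'"
  using sum_defect_mono[of \<tau> "sv \<tau> 0" "sw \<tau> 0" \<tau>' "sv \<tau>' 0" "sw \<tau>' 0"] bal_zero[of \<tau>] bal_zero[of \<tau>']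
  unfolding bal_def total_defect_def by (cases "\<tau> = \<tau>'") auto

end

section \<open>Smoothness of the total defect\<close>

lemma finite_convergent_subseq:
  fixes f :: "nat \<Rightarrow> 'a \<Rightarrow> real"
  assumes "finite N" "\<And>n q. q \<in> N \<Longrightarrow> \<bar>f n q\<bar> \<le> B"
  shows "\<exists>r l. strict_mono r \<and> (\<forall>q\<in>N. (\<lambda>n. f (r n) q) \<longlonglongrightarrow> l q)"
  using assms
proof (induction N rule: finite_induct)
  case empty
  then show ?case by (intro exI[of _ id]) (auto simp: strict_mono_def)
next
  case (insert x N)
  then obtain r l where r: "strict_mono r" "\<forall>q\<in>N. (\<lambda>n. f (r n) q) \<longlonglongrightarrow> l q" by auto
  have "f (r n) x \<in> {- B..B}" for n using insert.prems[of x "r n"] by (auto simp: abs_le_iff)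
  then obtain y r' where r': "strict_mono r'" "((\<lambda>n. f (r n) x) \<circ> r') \<longlonglongrightarrow> y"
    using compact_Icc[of "- B" B, unfolded compact_def, rule_format, of "\<lambda>n. f (r n) x"] by blast
  have "(\<lambda>n. f ((r \<circ> r') n) q) \<longlonglongrightarrow> (l(x := y)) q" if q: "q \<in> insert x N" for q
  proof (cases "q = x")
    case True then show ?thesis using r'(2) by (simp add: comp_def)
  next
    case False
    then have "((\<lambda>n. f (r n) q) \<circ> r') \<longlonglongrightarrow> l q" using q r(2) r'(1) by (intro LIMSEQ_subseq_LIMSEQ) auto
    then show ?thesis using False by (simp add: comp_def)
  qed
  then show ?case using strict_mono_o[OF r(1) r'(1)] by blast
qed

lemma betw_tendsto:
  assumes "(f \<longlongrightarrow> l) F" "(g \<longlongrightarrow> l) F" "\<forall>\<^sub>F p in F. betw (h p) (f p) (g p)"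
  shows "(h \<longlongrightarrow> l) F"
proof (rule tendsto_sandwich)
  show "((\<lambda>p. min (f p) (g p)) \<longlongrightarrow> l) F" "((\<lambda>p. max (f p) (g p)) \<longlongrightarrow> l) F"
    using tendsto_min[OF assms(1,2)] tendsto_max[OF assms(1,2)] by auto
  show "\<forall>\<^sub>F p in F. min (f p) (g p) \<le> h p" "\<forall>\<^sub>F p in F. h p \<le> max (f p) (g p)"
    using assms(3) unfolding betw_def by (auto elim: eventually_mono)
qed

text \<open>Limits of difference quotients along this filter express strict differentiability: both
  points move to \<open>x\<close> independently.\<close>

abbreviation pairs_at :: "real \<Rightarrow> (real \<times> real) filter" where
  "pairs_at x \<equiv> at (x, x) within {p. fst p \<noteq> snd p}"

lemma pairs_at_fst_snd: "filterlim fst (nhds x) (pairs_at x)" "filterlim snd (nhds x) (pairs_at x)"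
  using tendsto_fst[OF tendsto_ident_at[of "(x, x)"]] tendsto_snd[OF tendsto_ident_at[of "(x, x)"]] by simp_all

lemma pairs_at_distinct: "\<forall>\<^sub>F p in pairs_at x. fst p \<noteq> snd p"
  by (rule iffD2[OF eventually_at_filter], rule always_eventually) simp

text \<open>Strict differentiability gives continuity of the derivative: for \<open>y\<close> near
  \<open>x\<close> all quotients between \<open>y\<close> and points close to it are within
  \<open>e / 2\<close> of \<open>D x\<close>, and so is their limit \<open>D y\<close>.\<close>

lemma C1_of_pairs_at:
  fixes f :: "real \<Rightarrow> real"
  assumes "open S" "\<And>x. x \<in> S \<Longrightarrow> \<exists>l. ((\<lambda>p. (f (snd p) - f (fst p)) / (snd p - fst p)) \<longlongrightarrow> l) (pairs_at x)"
  shows "\<exists>D. \<forall>x\<in>S. (f has_real_derivative D x) (at x) \<and> isCont D x"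
proof -
  have "\<forall>x\<in>S. \<exists>l. ((\<lambda>p. (f (snd p) - f (fst p)) / (snd p - fst p)) \<longlongrightarrow> l) (pairs_at x)" using assms(2) by blast
  from bchoice[OF this] obtain D where
    D: "\<And>x. x \<in> S \<Longrightarrow> ((\<lambda>p. (f (snd p) - f (fst p)) / (snd p - fst p)) \<longlongrightarrow> D x) (pairs_at x)" by blast
  have der: "(f has_real_derivative D x) (at x)" if "x \<in> S" for x
  proof -
    have "filterlim (\<lambda>y. (x, y)) (pairs_at x) (at x)"
      unfolding filterlim_at
    proof
      show "\<forall>\<^sub>F y in at x. (x, y) \<in> {p. fst p \<noteq> snd p} \<and> (x, y) \<noteq> (x, x)"
        by (rule iffD2[OF eventually_at_filter], rule always_eventually) simp
      show "((\<lambda>y. (x, y)) \<longlongrightarrow> (x, x)) (at x)" by (intro tendsto_intros)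
    qed
    from filterlim_compose[OF D[OF that] this] show ?thesis unfolding has_field_derivative_iff by simp
  qed
  moreover have "isCont D x" if x: "x \<in> S" for x
  proof -
    have "\<exists>\<delta>>0. \<forall>y. dist y x < \<delta> \<longrightarrow> dist (D y) (D x) < e" if e: "e > 0" for e
    proof -
      have "e / 2 > 0" using e by simp
      from tendstoD[OF D[OF x] this] have "\<forall>\<^sub>F p in pairs_at x. dist ((f (snd p) - f (fst p)) / (snd p - fst p)) (D x) < e / 2" .
      then obtain \<delta> where \<delta>: "\<delta> > 0" "\<And>p. fst p \<noteq> snd p \<Longrightarrow> dist p (x, x) < \<delta> \<Longrightarrow>
          dist ((f (snd p) - f (fst p)) / (snd p - fst p)) (D x) < e / 2"
        unfolding eventually_at by auto
      obtain \<rho> where \<rho>: "\<rho> > 0" "ball x \<rho> \<subseteq> S" using assms(1) x open_contains_ball by blast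
      have "dist (D y) (D x) < e" if y: "dist y x < min (\<delta> / 2) \<rho>" for y
      proof -
        have yS: "y \<in> S" using y \<rho> by (auto simp: dist_commute)
        have lim: "((\<lambda>z. dist ((f z - f y) / (z - y)) (D x)) \<longlongrightarrow> dist (D y) (D x)) (at y)"
          using der[OF yS] unfolding has_field_derivative_iff by (intro tendsto_dist tendsto_const)
        have "\<forall>\<^sub>F z in at y. dist z x < \<delta> / 2 \<and> z \<noteq> y"
        proof -
          have "open (ball x (\<delta> / 2))" by simp
          moreover have "y \<in> ball x (\<delta> / 2)" using y by (simp add: dist_commute)
          ultimately have "\<forall>\<^sub>F z in at y. z \<in> ball x (\<delta> / 2)" by (rule eventually_at_in_open')
          moreover have "\<forall>\<^sub>F z in at y. z \<noteq> y" by (rule iffD2[OF eventually_at_filter], rule always_eventually) simp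
          ultimately show ?thesis by eventually_elim (simp add: dist_commute)
        qed
        then have "\<forall>\<^sub>F z in at y. dist ((f z - f y) / (z - y)) (D x) \<le> e / 2"
        proof eventually_elim
          case (elim z)
          have "dist (y, z) (x, x) \<le> dist y x + dist z x"
            by (simp add: dist_Pair_Pair sqrt_sum_squares_le_sum)
          then have "dist (y, z) (x, x) < \<delta>" using y elim by auto
          then show ?case using \<delta>(2)[of "(y, z)"] elim by simp
        qed
        from tendsto_upperbound[OF lim this] show ?thesis using e by simp
      qed
      then show ?thesis using \<delta>(1) \<rho>(1) by (intro exI[of _ "min (\<delta> / 2) \<rho>"]) auto
    qed
    then show ?thesis unfolding continuous_at_eps_delta by blast
  qed
  ultimately show ?thesis by blast
qed

context supported_matrix begin

lemma coef_tendsto_aux: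
  assumes "(\<tau> \<longlongrightarrow> \<tau>') F" "(\<eta> \<longlongrightarrow> \<eta>') F" "\<And>j. j < K \<Longrightarrow> ((\<lambda>p. v p j) \<longlongrightarrow> v' j) F" "\<And>j. j < K \<Longrightarrow> ((\<lambda>p. w p j) \<longlongrightarrow> w' j) F"
    and pos: "\<tau>' > 0" "\<eta>' \<ge> 0" "\<And>j. j < K \<Longrightarrow> v' j > 0 \<and> w' j > 0" and i: "i < K"
  shows "\<And>j. j < K \<Longrightarrow> ((\<lambda>p. cdir K s (\<tau> p) (\<eta> p) (v p) (w p) i j) \<longlongrightarrow> cdir K s \<tau>' \<eta>' v' w' i j) F"
    "\<And>j. j < K \<Longrightarrow> ((\<lambda>p. ctra K s (\<tau> p) (\<eta> p) (v p) (w p) i j) \<longlongrightarrow> ctra K s \<tau>' \<eta>' v' w' i j) F"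
    "((\<lambda>p. csrc K s (\<tau> p) (\<eta> p) (v p) (w p) d\<tau> d\<eta> i) \<longlongrightarrow> csrc K s \<tau>' \<eta>' v' w' d\<tau> d\<eta> i) F"
proof -
  interpret T: supported_matrix K "\<lambda>i j. s j i" "inv_into UNIV \<pi>" by (rule supported_matrix_transpose)
  have la: "((\<lambda>p. a (\<eta> p) (w p) i) \<longlongrightarrow> a \<eta>' w' i) F" unfolding lin_def by (intro tendsto_intros assms) auto
  have lb: "((\<lambda>p. b (\<eta> p) (v p) i) \<longlongrightarrow> b \<eta>' v' i) F" unfolding lin_def by (intro tendsto_intros assms) auto
  have ap: "a \<eta>' w' i > 0" by (rule lin_pos) (use pos i in auto)
  have bp: "b \<eta>' v' i > 0" by (rule T.lin_pos) (use pos i in auto)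
  have Xp: "a \<eta>' w' i + \<tau>' / b \<eta>' v' i > 0" using ap bp pos by (auto intro!: add_pos_pos)
  show "((\<lambda>p. cdir K s (\<tau> p) (\<eta> p) (v p) (w p) i j) \<longlongrightarrow> cdir K s \<tau>' \<eta>' v' w' i j) F" if "j < K" for j
    unfolding cdir_def using ap bp Xp that by (intro tendsto_intros la lb assms) auto
  show "((\<lambda>p. ctra K s (\<tau> p) (\<eta> p) (v p) (w p) i j) \<longlongrightarrow> ctra K s \<tau>' \<eta>' v' w' i j) F" if "j < K" for j
    unfolding ctra_def using ap bp Xp that by (intro tendsto_intros la lb assms) auto
  show "((\<lambda>p. csrc K s (\<tau> p) (\<eta> p) (v p) (w p) d\<tau> d\<eta> i) \<longlongrightarrow> csrc K s \<tau>' \<eta>' v' w' d\<tau> d\<eta> i) F"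
    unfolding csrc_def using ap bp Xp by (intro tendsto_intros la lb assms) auto
qed

lemma coef_tendsto:
  assumes "(\<tau> \<longlongrightarrow> \<tau>') F" "(\<eta> \<longlongrightarrow> \<eta>') F" "\<And>j. j < K \<Longrightarrow> ((\<lambda>p. v p j) \<longlongrightarrow> v' j) F" "\<And>j. j < K \<Longrightarrow> ((\<lambda>p. w p j) \<longlongrightarrow> w' j) F"
    and pos: "\<tau>' > 0" "\<eta>' \<ge> 0" "\<And>j. j < K \<Longrightarrow> v' j > 0 \<and> w' j > 0" and q: "q \<in> nodes K"
  shows "\<And>q'. q' \<in> nodes K \<Longrightarrow> ((\<lambda>p. coef K s (\<tau> p) (\<eta> p) (v p) (w p) q q') \<longlongrightarrow> coef K s \<tau>' \<eta>' v' w' q q') F"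
    "((\<lambda>p. src K s (\<tau> p) (\<eta> p) (v p) (w p) d\<tau> d\<eta> q) \<longlongrightarrow> src K s \<tau>' \<eta>' v' w' d\<tau> d\<eta> q) F"
proof -
  interpret T: supported_matrix K "\<lambda>i j. s j i" "inv_into UNIV \<pi>" by (rule supported_matrix_transpose)
  obtain i \<beta> where i: "q = (i, \<beta>)" "i < K" using q unfolding nodes_def by auto
  have pos': "\<And>j. j < K \<Longrightarrow> w' j > 0 \<and> v' j > 0" using pos by auto
  note 1 = coef_tendsto_aux[OF assms(1-7) i(2)] note 2 = T.coef_tendsto_aux[OF assms(1,2,4,3,5,6) pos' i(2)]
  show "((\<lambda>p. coef K s (\<tau> p) (\<eta> p) (v p) (w p) q q') \<longlongrightarrow> coef K s \<tau>' \<eta>' v' w' q q') F" if "q' \<in> nodes K" for q'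
    using that 1(1,2) 2(1,2) unfolding i coef_def nodes_def by auto
  show "((\<lambda>p. src K s (\<tau> p) (\<eta> p) (v p) (w p) d\<tau> d\<eta> q) \<longlongrightarrow> src K s \<tau>' \<eta>' v' w' d\<tau> d\<eta> q) F"
    using 1(3) 2(3) unfolding i src_def by (cases \<beta>) (auto intro: tendsto_minus)
qed

end

context controlled_matrix begin

lemma isCont_sv_zero:
  assumes "0 < \<tau>" "\<tau> < \<tau>0" "i < K"
  shows "isCont (\<lambda>\<tau>. sv \<tau> 0 i) \<tau>" "isCont (\<lambda>\<tau>. sw \<tau> 0 i) \<tau>"
proof -
  obtain L where L: "\<forall>\<^sub>F p in at \<tau>. \<forall>i<K. \<bar>sv p 0 i - sv \<tau> 0 i\<bar> \<le> L * \<bar>p - \<tau>\<bar> \<and> \<bar>sw p 0 i - sw \<tau> 0 i\<bar> \<le> L * \<bar>p - \<tau>\<bar>"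
    using sv_zero_lip_at[OF assms(1,2)] by blast
  have "\<forall>\<^sub>F p in at \<tau>. \<bar>sv p 0 i - sv \<tau> 0 i\<bar> \<le> L * \<bar>p - \<tau>\<bar>" using L by eventually_elim (use assms in auto)
  then show "isCont (\<lambda>\<tau>. sv \<tau> 0 i) \<tau>" by (rule isCont_lip)
  have "\<forall>\<^sub>F p in at \<tau>. \<bar>sw p 0 i - sw \<tau> 0 i\<bar> \<le> L * \<bar>p - \<tau>\<bar>" using L by eventually_elim (use assms in auto)
  then show "isCont (\<lambda>\<tau>. sw \<tau> 0 i) \<tau>" by (rule isCont_lip)
qed

text \<open>The difference quotients solve a stochastic linear system whose coefficients converge. A
  subsequential limit solves the limiting system, and by propagation all difference quotients
  approach it modulo constants, which cancel in \<open>ln (v i) + ln (w j)\<close>.\<close>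

lemma log_entry_strict:
  assumes x: "0 < x" "x < \<tau>0" and i: "i < K" "j < K"
  defines "g \<equiv> \<lambda>\<tau>. ln (sv \<tau> 0 i) + ln (sw \<tau> 0 j)"
  shows "\<exists>l. ((\<lambda>p. (g (snd p) - g (fst p)) / (snd p - fst p)) \<longlongrightarrow> l) (pairs_at x)"
proof -
  have x2: "0 < x / 2" using x by simp
  define S where "S = {p. x / 2 \<le> fst p \<and> fst p < \<tau>0 \<and> x / 2 \<le> snd p \<and> snd p < \<tau>0 \<and> fst p \<noteq> (snd p :: real)}"
  define G where "G = pairs_at x"
  have GS: "\<forall>\<^sub>F p in G. p \<in> S"
  proof -
    have "\<forall>\<^sub>F y in nhds x. y \<in> {x / 2<..<\<tau>0}" by (rule eventually_nhds_in_open) (use x in auto)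
    then have "\<forall>\<^sub>F p in G. fst p \<in> {x / 2<..<\<tau>0}" "\<forall>\<^sub>F p in G. snd p \<in> {x / 2<..<\<tau>0}"
      using pairs_at_fst_snd[of x] unfolding filterlim_iff G_def by blast+
    then show ?thesis using pairs_at_distinct[of x] unfolding G_def S_def by eventually_elim auto
  qed
  obtain c C where c: "c > 0" "C > 0" and conf: "\<And>\<tau>' \<eta> v w. bal K s \<tau>' \<eta> v w \<Longrightarrow> x / 2 \<le> \<tau>' \<Longrightarrow> \<tau>' < \<tau>0 \<Longrightarrow> 0 \<le> \<eta> \<Longrightarrow> \<eta> \<le> 1 \<Longrightarrow>
    confined K c C \<tau>' \<eta> v w" using confined_small[OF x2] by blast
  have BC: "bal K s \<tau> 0 (sv \<tau> 0) (sw \<tau> 0)" "confined K c C \<tau> 0 (sv \<tau> 0) (sw \<tau> 0)" "0 < \<tau>" "sol K s \<tau> 0 (sv \<tau> 0) (sw \<tau> 0)"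
    if "x / 2 \<le> \<tau>" "\<tau> < \<tau>0" for \<tau>
  proof -
    show t: "0 < \<tau>" using that x by simp
    show "bal K s \<tau> 0 (sv \<tau> 0) (sw \<tau> 0)" by (rule bal_zero[OF t that(2)])
    then show "confined K c C \<tau> 0 (sv \<tau> 0) (sw \<tau> 0)" "sol K s \<tau> 0 (sv \<tau> 0) (sw \<tau> 0)"
      using conf that unfolding bal_def by auto
  qed
  obtain L where lip: "\<And>\<tau>0 \<eta>0 v0 w0 \<tau>1 \<eta>1 v1 w1. bal K s \<tau>0 \<eta>0 v0 w0 \<Longrightarrow> confined K c C \<tau>0 \<eta>0 v0 w0 \<Longrightarrow>
    bal K s \<tau>1 \<eta>1 v1 w1 \<Longrightarrow> confined K c C \<tau>1 \<eta>1 v1 w1 \<Longrightarrow>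
    (\<forall>p\<in>nodes K. \<bar>logdiff v0 w0 v1 w1 p\<bar> \<le> L * (\<bar>\<tau>1 - \<tau>0\<bar> + \<bar>\<eta>1 - \<eta>0\<bar>))"
    using lipschitz[OF c(1), of C] by blast
  obtain \<delta> Q where dQ: "\<delta> > 0" "Q > 0" and co: "coef_bounded K s c C \<delta> Q"
    using coef_node_bounds[OF c(1), of C] by blast
  obtain M where M: "M > 0" and prpg: "propagates (nodes K) (node_edges K s) \<delta> M"
    using propagation_nodes[OF dQ(1)] by blast
  define D where "D = (\<lambda>p q. logdiff (sv (fst p) 0) (sw (fst p) 0) (sv (snd p) 0) (sw (snd p) 0) q / (snd p - fst p))"
  define R where "R = (\<lambda>p (\<tau>, \<eta>, v, w). \<forall>q\<in>nodes K. betw (\<tau> q) (fst p) (snd p) \<and> betw (\<eta> q) 0 0 \<and>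
    (\<forall>j<K. betw (v q j) (sv (fst p) 0 j) (sv (snd p) 0 j) \<and> betw (w q j) (sw (fst p) 0 j) (sw (snd p) 0 j)) \<and>
    D p q = (\<Sum>q'\<in>nodes K. coef K s (\<tau> q) 0 (v q) (w q) q q' * D p q') + src K s (\<tau> q) 0 (v q) (w q) 1 0 q)"
  have "\<forall>p\<in>S. \<exists>y. R p y"
  proof
    fix p assume p: "p \<in> S"
    then have p1: "x / 2 \<le> fst p" "fst p < \<tau>0" "x / 2 \<le> snd p" "snd p < \<tau>0" "fst p \<noteq> snd p" unfolding S_def by auto
    from mean_value_nodes[OF BC(4)[OF p1(1,2)] BC(4)[OF p1(3,4)] BC(3)[OF p1(1,2)] BC(3)[OF p1(3,4)] order_refl order_refl]
    obtain \<tau> \<eta> v w where mv: "\<forall>q\<in>nodes K. betw (\<tau> q) (fst p) (snd p) \<and> betw (\<eta> q) 0 0 \<and>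
      (\<forall>j<K. betw (v q j) (sv (fst p) 0 j) (sv (snd p) 0 j) \<and> betw (w q j) (sw (fst p) 0 j) (sw (snd p) 0 j)) \<and>
      logdiff (sv (fst p) 0) (sw (fst p) 0) (sv (snd p) 0) (sw (snd p) 0) q =
        (\<Sum>q'\<in>nodes K. coef K s (\<tau> q) (\<eta> q) (v q) (w q) q q' * logdiff (sv (fst p) 0) (sw (fst p) 0) (sv (snd p) 0) (sw (snd p) 0) q')
        + src K s (\<tau> q) (\<eta> q) (v q) (w q) (snd p - fst p) (0 - 0) q" by blast
    \<comment> \<open>The source is linear in the increments of the parameters, so dividing by the
      increment of \<open>\<tau>\<close> leaves the source for a unit increment, and the quotients
      solve a system that no longer degenerates.\<close>
    have src1: "src K s \<tau> \<eta> v w d 0 q / d = src K s \<tau> \<eta> v w 1 0 q" if "d \<noteq> 0" for \<tau> \<eta> v w d q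
      using that unfolding src_def csrc_def by (auto split: prod.splits)
    have "R p (\<tau>, \<eta>, v, w)" unfolding R_def split_conv
    proof
      fix q assume q: "q \<in> nodes K"
      have "\<eta> q = 0" using mv q unfolding betw_def by auto
      then have "D p q = ((\<Sum>q'\<in>nodes K. coef K s (\<tau> q) 0 (v q) (w q) q q' * logdiff (sv (fst p) 0) (sw (fst p) 0) (sv (snd p) 0) (sw (snd p) 0) q')
        + src K s (\<tau> q) 0 (v q) (w q) (snd p - fst p) 0 q) / (snd p - fst p)" unfolding D_def using mv q by simp
      also have "\<dots> = (\<Sum>q'\<in>nodes K. coef K s (\<tau> q) 0 (v q) (w q) q q' * D p q') + src K s (\<tau> q) 0 (v q) (w q) 1 0 q"
        unfolding add_divide_distrib sum_divide_distrib D_def using src1 p1(5) by simp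
      finally show "betw (\<tau> q) (fst p) (snd p) \<and> betw (\<eta> q) 0 0 \<and>
        (\<forall>j<K. betw (v q j) (sv (fst p) 0 j) (sv (snd p) 0 j) \<and> betw (w q j) (sw (fst p) 0 j) (sw (snd p) 0 j)) \<and>
        D p q = (\<Sum>q'\<in>nodes K. coef K s (\<tau> q) 0 (v q) (w q) q q' * D p q') + src K s (\<tau> q) 0 (v q) (w q) 1 0 q"
        using mv q by simp
    qed
    then show "\<exists>y. R p y" by blast
  qed
  from bchoice[OF this] obtain y where y: "\<forall>p\<in>S. R p (y p)" by blast
  define T where "T = (\<lambda>q p. fst (y p) q)"
  define V where "V = (\<lambda>q p. fst (snd (snd (y p))) q)"
  define W where "W = (\<lambda>q p. snd (snd (snd (y p))) q)"
  have mv: "betw (T q p) (fst p) (snd p)" "\<And>j. j < K \<Longrightarrow> betw (V q p j) (sv (fst p) 0 j) (sv (snd p) 0 j)"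
    "\<And>j. j < K \<Longrightarrow> betw (W q p j) (sw (fst p) 0 j) (sw (snd p) 0 j)"
    "D p q = (\<Sum>q'\<in>nodes K. coef K s (T q p) 0 (V q p) (W q p) q q' * D p q') + src K s (T q p) 0 (V q p) (W q p) 1 0 q"
    if "p \<in> S" "q \<in> nodes K" for p q
    using y[rule_format, OF that(1)] that(2) unfolding R_def T_def V_def W_def case_prod_beta by blast+
  have cf: "confined K c C (T q p) 0 (V q p) (W q p)" if p: "p \<in> S" "q \<in> nodes K" for p q
  proof -
    have p1: "x / 2 \<le> fst p" "fst p < \<tau>0" "x / 2 \<le> snd p" "snd p < \<tau>0" using p unfolding S_def by auto
    show ?thesis by (rule confined_betw[OF BC(2)[OF p1(1,2)] BC(2)[OF p1(3,4)] mv(1)[OF p]])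
      (use mv(2,3)[OF p] in \<open>auto simp: betw_def\<close>)
  qed
  define A where "A = (\<lambda>p q q'. coef K s (T q p) 0 (V q p) (W q p) q q')"
  define r where "r = (\<lambda>p q. src K s (T q p) 0 (V q p) (W q p) 1 0 q)"
  define A' where "A' = coef K s x 0 (sv x 0) (sw x 0)"
  define r' where "r' = src K s x 0 (sv x 0) (sw x 0) 1 0"
  have D_eq: "D p q = (\<Sum>q'\<in>nodes K. A p q q' * D p q') + r p q" if "p \<in> S" "q \<in> nodes K" for p q
    unfolding A_def r_def by (rule mv(4)[OF that])
  have xx: "x / 2 \<le> x" using x by simp
  have posx: "sv x 0 j > 0 \<and> sw x 0 j > 0" if "j < K" for j using BC(4)[OF xx x(2)] that unfolding sol_def by auto
  have limT: "(T q \<longlongrightarrow> x) G" if "q \<in> nodes K" for q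
    by (rule betw_tendsto[where f = fst and g = snd])
      (use pairs_at_fst_snd GS mv(1)[OF _ that] in \<open>auto simp: G_def elim: eventually_mono\<close>)
  have limV: "((\<lambda>p. V q p j) \<longlongrightarrow> sv x 0 j) G" if "q \<in> nodes K" "j < K" for q j
  proof (rule betw_tendsto[where f = "\<lambda>p. sv (fst p) 0 j" and g = "\<lambda>p. sv (snd p) 0 j"])
    show "((\<lambda>p. sv (fst p) 0 j) \<longlongrightarrow> sv x 0 j) G" "((\<lambda>p. sv (snd p) 0 j) \<longlongrightarrow> sv x 0 j) G"
      using isCont_tendsto_compose[OF isCont_sv_zero(1)[OF x that(2)]] pairs_at_fst_snd unfolding G_def by blast+
    show "\<forall>\<^sub>F p in G. betw (V q p j) (sv (fst p) 0 j) (sv (snd p) 0 j)"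
      using GS by eventually_elim (rule mv(2)[OF _ that])
  qed
  have limW: "((\<lambda>p. W q p j) \<longlongrightarrow> sw x 0 j) G" if "q \<in> nodes K" "j < K" for q j
  proof (rule betw_tendsto[where f = "\<lambda>p. sw (fst p) 0 j" and g = "\<lambda>p. sw (snd p) 0 j"])
    show "((\<lambda>p. sw (fst p) 0 j) \<longlongrightarrow> sw x 0 j) G" "((\<lambda>p. sw (snd p) 0 j) \<longlongrightarrow> sw x 0 j) G"
      using isCont_tendsto_compose[OF isCont_sv_zero(2)[OF x that(2)]] pairs_at_fst_snd unfolding G_def by blast+
    show "\<forall>\<^sub>F p in G. betw (W q p j) (sw (fst p) 0 j) (sw (snd p) 0 j)"
      using GS by eventually_elim (rule mv(3)[OF _ that])
  qed
  have limA: "((\<lambda>p. A p q q') \<longlongrightarrow> A' q q') G" if "q \<in> nodes K" "q' \<in> nodes K" for q q'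
    unfolding A_def A'_def
    by (rule coef_tendsto(1)) (use that limT limV limW x posx in auto)
  have limr: "((\<lambda>p. r p q) \<longlongrightarrow> r' q) G" if "q \<in> nodes K" for q
    unfolding r_def r'_def
    by (rule coef_tendsto(2)) (use that limT limV limW x posx in auto)
  have Dbd: "\<bar>D p q\<bar> \<le> L" if p: "p \<in> S" "q \<in> nodes K" for p q
  proof -
    have p1: "x / 2 \<le> fst p" "fst p < \<tau>0" "x / 2 \<le> snd p" "snd p < \<tau>0" "fst p \<noteq> snd p" using p unfolding S_def by auto
    have "\<bar>logdiff (sv (fst p) 0) (sw (fst p) 0) (sv (snd p) 0) (sw (snd p) 0) q\<bar> \<le> L * (\<bar>snd p - fst p\<bar> + \<bar>0 - 0\<bar>)"
      using lip[OF BC(1,2)[OF p1(1,2)] BC(1,2)[OF p1(3,4)]] p by blast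
    then show ?thesis unfolding D_def abs_divide using p1(5) by (simp add: pos_divide_le_eq)
  qed
  \<comment> \<open>One concrete sequence of pairs, used to extract a candidate \<open>d\<close> for
    the limit. Dividing by \<open>n + 2\<close> keeps the second point strictly below
    \<open>\<tau>0\<close>.\<close>
  define P where "P = (\<lambda>n. (x, x + (\<tau>0 - x) / real (Suc (Suc n))))"
  have e: "0 < (\<tau>0 - x) / real (Suc (Suc n))" "(\<tau>0 - x) / real (Suc (Suc n)) < \<tau>0 - x" for n
  proof -
    show "0 < (\<tau>0 - x) / real (Suc (Suc n))" using x by simp
    have "(\<tau>0 - x) / real (Suc (Suc n)) < (\<tau>0 - x) / 1" by (rule divide_strict_left_mono) (use x in auto)
    then show "(\<tau>0 - x) / real (Suc (Suc n)) < \<tau>0 - x" by simp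
  qed
  have PS: "P n \<in> S" for n using e[of n] x unfolding P_def S_def by auto
  have "(\<lambda>n. (\<tau>0 - x) / real (Suc (Suc n))) \<longlonglongrightarrow> 0"
    using LIMSEQ_Suc[OF LIMSEQ_Suc[OF lim_const_over_n[of "\<tau>0 - x"]]] .
  then have "P \<longlonglongrightarrow> (x, x + 0)" unfolding P_def by (intro tendsto_intros)
  moreover have "fst (P n) \<noteq> snd (P n)" for n using e[of n] unfolding P_def by auto
  ultimately have PG: "filterlim P G sequentially" unfolding G_def filterlim_at
    using e by (auto simp: P_def)
  obtain ss d where ss: "strict_mono ss" and d: "\<forall>q\<in>nodes K. (\<lambda>n. D (P (ss n)) q) \<longlonglongrightarrow> d q"
    using finite_convergent_subseq[of "nodes K" "\<lambda>n. D (P n)" L] Dbd[OF PS] unfolding nodes_def by auto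
  have PG': "filterlim (\<lambda>n. P (ss n)) G sequentially"
    by (rule filterlim_compose[OF PG filterlim_subseq[OF ss]])
  have d_eq: "d q = (\<Sum>q'\<in>nodes K. A' q q' * d q') + r' q" if q: "q \<in> nodes K" for q
  proof (rule LIMSEQ_unique)
    show "(\<lambda>n. D (P (ss n)) q) \<longlonglongrightarrow> d q" using d q by blast
    have "(\<lambda>n. (\<Sum>q'\<in>nodes K. A (P (ss n)) q q' * D (P (ss n)) q') + r (P (ss n)) q) \<longlonglongrightarrow> (\<Sum>q'\<in>nodes K. A' q q' * d q') + r' q"
      using d by (intro tendsto_intros filterlim_compose[OF limA[OF q] PG'] filterlim_compose[OF limr[OF q] PG']) auto
    then show "(\<lambda>n. D (P (ss n)) q) \<longlonglongrightarrow> (\<Sum>q'\<in>nodes K. A' q q' * d q') + r' q"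
      using D_eq[OF PS q] by simp
  qed
  \<comment> \<open>Residual of \<open>d\<close> in the system with coefficients \<open>A p\<close>.
    Subtracting the limiting system shows that \<open>D p - d\<close> solves the system of
    \<open>A p\<close> with source \<open>\<epsilon> p\<close>, which tends to 0 along the whole
    filter and not only along the sequence.\<close>
  define \<epsilon> where "\<epsilon> = (\<lambda>p q. (\<Sum>q'\<in>nodes K. (A p q q' - A' q q') * d q') + (r p q - r' q))"
  define \<beta> where "\<beta> = (\<lambda>p. \<Sum>q\<in>nodes K. \<bar>\<epsilon> p q\<bar>)"
  have fin: "finite (nodes K)" unfolding nodes_def by simp
  have "((\<lambda>p. \<Sum>q\<in>nodes K. \<bar>(\<Sum>q'\<in>nodes K. (A p q q' - A' q q') * d q') + (r p q - r' q)\<bar>) \<longlongrightarrow>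
      (\<Sum>q\<in>nodes K. \<bar>(\<Sum>q'\<in>nodes K. (A' q q' - A' q q') * d q') + (r' q - r' q)\<bar>)) G"
    by (intro tendsto_intros limA limr) auto
  then have lim\<beta>: "((\<lambda>p. M * \<beta> p) \<longlongrightarrow> 0) G" unfolding \<beta>_def \<epsilon>_def by (intro tendsto_mult_right_zero) simp
  have close: "(D p q - d q) - (D p q' - d q') \<le> M * \<beta> p" if p: "p \<in> S" and qq: "q \<in> nodes K" "q' \<in> nodes K" for p q q'
  proof (rule propagatesD[OF prpg, where A = "A p" and r = "\<epsilon> p"])
    fix q q' assume "q \<in> nodes K" "q' \<in> nodes K"
    then show "0 \<le> A p q q'" unfolding A_def by (intro coef_boundedD(1)[OF co cf[OF p]])
  next
    fix q q' assume "q \<in> nodes K" "q' \<in> nodes K" "(q, q') \<in> node_edges K s"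
    then show "\<delta> \<le> A p q q'" unfolding A_def by (intro coef_boundedD(2)[OF co cf[OF p]])
  next
    fix q assume q: "q \<in> nodes K"
    have "D p q - d q = ((\<Sum>q'\<in>nodes K. A p q q' * D p q') + r p q) - ((\<Sum>q'\<in>nodes K. A' q q' * d q') + r' q)"
      using D_eq[OF p q] d_eq[OF q] by simp
    also have "\<dots> = (\<Sum>q'\<in>nodes K. A p q q' * (D p q' - d q')) + \<epsilon> p q"
      unfolding \<epsilon>_def by (simp add: algebra_simps sum_subtractf sum.distrib)
    finally show "D p q - d q = (\<Sum>q'\<in>nodes K. A p q q' * (D p q' - d q')) + \<epsilon> p q" .
    show "\<bar>\<epsilon> p q\<bar> \<le> \<beta> p" unfolding \<beta>_def using q fin by (intro member_le_sum) auto
  next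
    \<comment> \<open>At \<open>\<eta> = 0\<close> the rows sum to exactly 1, so no information on
      the sign of \<open>D p - d\<close> is called for.\<close>
    show "(\<forall>i\<in>nodes K. (\<Sum>j\<in>nodes K. A p i j) = 1) \<or>
      (\<forall>i\<in>nodes K. (\<Sum>j\<in>nodes K. A p i j) \<le> 1) \<and> (\<exists>i\<in>nodes K. D p i - d i \<ge> 0)"
      unfolding A_def using coef_boundedD(4)[OF co cf[OF p]] by blast
  qed (use qq in auto)
  have n: "(i, True) \<in> nodes K" "(j, False) \<in> nodes K" using i unfolding nodes_def by auto
  have "((\<lambda>p. (D p (i, True) - D p (j, False)) - (d (i, True) - d (j, False))) \<longlongrightarrow> 0) G"
  proof (rule Lim_null_comparison[OF _ lim\<beta>])
    show "\<forall>\<^sub>F p in G. norm ((D p (i, True) - D p (j, False)) - (d (i, True) - d (j, False))) \<le> M * \<beta> p"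
      using GS
    proof eventually_elim
      case (elim p)
      show ?case using close[OF elim n] close[OF elim n(2,1)] by (auto simp: abs_le_iff)
    qed
  qed
  then have "((\<lambda>p. D p (i, True) - D p (j, False)) \<longlongrightarrow> d (i, True) - d (j, False)) G" by (simp add: LIM_zero_iff)
  moreover have "D p (i, True) - D p (j, False) = (g (snd p) - g (fst p)) / (snd p - fst p)" for p
    unfolding D_def logdiff_def g_def by (simp add: diff_divide_distrib add_divide_distrib)
  ultimately show ?thesis unfolding G_def by auto
qed

text \<open>At \<open>\<eta> = 0\<close> the defect is 1 minus the sum of
  \<open>s i j * exp (ln (v i) + ln (w j))\<close>; it sees the solution only through the
  combinations for which strict derivatives are available.\<close>

lemma total_defect_C1: "\<exists>D. \<forall>\<tau>. 0 < \<tau> \<longrightarrow> \<tau> < \<tau>0 \<longrightarrow> (total_defect has_real_derivative D \<tau>) (at \<tau>) \<and> isCont D \<tau>"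
proof -
  define g where "g = (\<lambda>i j \<tau>. ln (sv \<tau> 0 i) + ln (sw \<tau> 0 j))"
  have ex: "\<exists>D. \<forall>x\<in>{0<..<\<tau>0}. (g i j has_real_derivative D x) (at x) \<and> isCont D x" if "i < K" "j < K" for i j
    unfolding g_def by (rule C1_of_pairs_at) (use log_entry_strict that in auto)
  define D where "D = (\<lambda>i j. SOME D. \<forall>x\<in>{0<..<\<tau>0}. (g i j has_real_derivative D x) (at x) \<and> isCont D x)"
  have D: "(g i j has_real_derivative D i j x) (at x) \<and> isCont (D i j) x" if "i < K" "j < K" "0 < x" "x < \<tau>0" for i j x
    using someI_ex[OF ex[OF that(1,2)]] that(3,4) unfolding D_def by simp
  define h where "h = (\<lambda>\<tau>. \<Sum>i<K. 1 - (\<Sum>j<K. s i j * exp (g i j \<tau>)))"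
  define E where "E = (\<lambda>\<tau>. \<Sum>i<K. 0 - (\<Sum>j<K. s i j * (exp (g i j \<tau>) * D i j \<tau>)))"
  have eq: "total_defect \<tau> = h \<tau>" if t: "0 < \<tau>" "\<tau> < \<tau>0" for \<tau>
  proof -
    have S: "sol K s \<tau> 0 (sv \<tau> 0) (sw \<tau> 0)" using bal_zero[OF t] unfolding bal_def by auto
    note f = sol_facts[OF S t(1) order_refl]
    have "exp (g i j \<tau>) = sv \<tau> 0 i * sw \<tau> 0 j" if "i < K" "j < K" for i j
      unfolding g_def exp_add using f(3)[OF that(1)] f(4)[OF that(2)] by simp
    moreover have "defect K s \<tau> 0 (sv \<tau> 0) (sw \<tau> 0) i = 1 - (\<Sum>j<K. s i j * (sv \<tau> 0 i * sw \<tau> 0 j))" if "i < K" for i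
      using f(5)[OF that] unfolding lin_def by (simp add: sum_distrib_left mult_ac)
    ultimately show ?thesis unfolding total_defect_def h_def by simp
  qed
  have "(total_defect has_real_derivative E \<tau>) (at \<tau>) \<and> isCont E \<tau>" if t: "0 < \<tau>" "\<tau> < \<tau>0" for \<tau>
  proof
    have dg: "((\<lambda>\<tau>. exp (g i j \<tau>)) has_real_derivative exp (g i j \<tau>) * D i j \<tau>) (at \<tau>)" if "i < K" "j < K" for i j
      using DERIV_chain2[OF DERIV_exp] D[OF that t] by blast
    have cg: "isCont (\<lambda>\<tau>. exp (g i j \<tau>)) \<tau>" if "i < K" "j < K" for i j
      using DERIV_isCont[OF dg[OF that]] .
    have "(h has_real_derivative E \<tau>) (at \<tau>)"
      unfolding h_def E_def by (intro DERIV_sum DERIV_diff DERIV_const DERIV_cmult dg) auto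
    moreover have "\<forall>\<^sub>F x in nhds \<tau>. h x = total_defect x"
      using eventually_nhds_in_open[of "{0<..<\<tau>0}" \<tau>] t eq by (auto elim: eventually_mono)
    ultimately show "(total_defect has_real_derivative E \<tau>) (at \<tau>)" using DERIV_cong_ev[of \<tau> \<tau> h total_defect] by blast
    show "isCont E \<tau>" unfolding E_def using D t by (intro continuous_intros cg) auto
  qed
  then show ?thesis by blast
qed

end

section \<open>Radial functions on the plane\<close>

lemma emeasure_cball_complex: "r \<ge> 0 \<Longrightarrow> emeasure lborel (cball (0::complex) r) = ennreal (pi * r\<^sup>2)"
  by (subst emeasure_cball) (auto simp: unit_ball_vol_2)

text \<open>Polar coordinates for functions of \<open>(cmod z)^2\<close>. Measures are compared on
  half-lines: the part of the disc outside radius \<open>sqrt x\<close> has area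
  \<open>pi * (t^2 - x)\<close>, which is linear in \<open>x\<close>.\<close>

lemma distr_cmod_square:
  fixes t :: real
  assumes "t > 0"
  shows "distr (density lborel (indicator (cball (0::complex) t))) borel (\<lambda>z. (cmod z)\<^sup>2) =
    density lborel (\<lambda>\<tau>. ennreal pi * indicator {0..t\<^sup>2} \<tau>)" (is "?M = ?N")
proof (rule measure_eqI_lessThan)
  show "sets ?M = sets borel" "sets ?N = sets borel" by auto
  have M: "emeasure ?M {x<..} = emeasure lborel (cball (0::complex) t \<inter> {z. x < (cmod z)\<^sup>2})" for x
  proof -
    have "emeasure ?M {x<..} = emeasure (density lborel (indicator (cball (0::complex) t))) ((\<lambda>z. (cmod z)\<^sup>2) -` {x<..})"
      by (subst emeasure_distr) auto
    also have "\<dots> = (\<integral>\<^sup>+z. indicator (cball (0::complex) t) z * indicator ((\<lambda>z. (cmod z)\<^sup>2) -` {x<..}) z \<partial>lborel)"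
      by (rule emeasure_density) (auto intro!: borel_measurable_indicator measurable_sets_borel[of _ borel])
    also have "\<dots> = (\<integral>\<^sup>+z. indicator (cball (0::complex) t \<inter> {z. x < (cmod z)\<^sup>2}) z \<partial>lborel)"
      by (intro nn_integral_cong) (auto simp: indicator_def)
    also have "\<dots> = emeasure lborel (cball (0::complex) t \<inter> {z. x < (cmod z)\<^sup>2})"
      by (rule nn_integral_indicator) auto
    finally show ?thesis .
  qed
  have N: "emeasure ?N {x<..} = ennreal pi * emeasure lborel ({0..t\<^sup>2} \<inter> {x<..})" for x
  proof -
    have "emeasure ?N {x<..} = (\<integral>\<^sup>+\<tau>. ennreal pi * indicator {0..t\<^sup>2} \<tau> * indicator {x<..} \<tau> \<partial>lborel)"
      by (rule emeasure_density) auto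
    also have "\<dots> = (\<integral>\<^sup>+\<tau>. ennreal pi * indicator ({0..t\<^sup>2} \<inter> {x<..}) \<tau> \<partial>lborel)"
      by (intro nn_integral_cong) (auto simp: indicator_def)
    also have "\<dots> = ennreal pi * emeasure lborel ({0..t\<^sup>2} \<inter> {x<..})"
      by (rule nn_integral_cmult_indicator) auto
    finally show ?thesis .
  qed
  have t2: "t\<^sup>2 \<ge> 0" by simp
  show "emeasure ?M {x<..} < \<infinity>" for x
  proof -
    have "emeasure lborel (cball (0::complex) t \<inter> {z. x < (cmod z)\<^sup>2}) \<le> emeasure lborel (cball (0::complex) t)"
      by (rule emeasure_mono) auto
    also have "\<dots> < \<infinity>" using emeasure_cball_complex[of t] assms by simp
    finally show ?thesis unfolding M .
  qed
  show "emeasure ?M {x<..} = emeasure ?N {x<..}" for x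
  proof -
    consider "x < 0" | "0 \<le> x" "x < t\<^sup>2" | "t\<^sup>2 \<le> x" by linarith
    then show ?thesis
    proof cases
      case 1
      have "x < (cmod z)\<^sup>2" for z using 1 zero_le_power2[of "cmod z"] by linarith
      then have "cball (0::complex) t \<inter> {z. x < (cmod z)\<^sup>2} = cball 0 t" by auto
      moreover have "{0..t\<^sup>2} \<inter> {x<..} = {0..t\<^sup>2}" using 1 by auto
      ultimately show ?thesis unfolding M N using assms
        by (simp add: emeasure_cball_complex ennreal_mult[symmetric])
    next
      case 2
      have "cball (0::complex) t \<inter> {z. x < (cmod z)\<^sup>2} = cball 0 t - cball 0 (sqrt x)"
      proof -
        have sq: "sqrt x < cmod z \<longleftrightarrow> x < (cmod z)\<^sup>2" for z using real_sqrt_less_iff[of x "(cmod z)\<^sup>2"] by simp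
        show ?thesis
          by (intro Set.set_eqI) (simp only: Int_iff Diff_iff mem_Collect_eq mem_cball dist_0_norm not_le sq)
      qed
      moreover have "emeasure lborel (cball (0::complex) t - cball 0 (sqrt x)) =
          emeasure lborel (cball (0::complex) t) - emeasure lborel (cball (0::complex) (sqrt x))"
      proof (rule emeasure_Diff)
        have "sqrt x \<le> sqrt (t\<^sup>2)" using 2 by (intro real_sqrt_le_mono) simp
        then show "cball 0 (sqrt x) \<subseteq> cball (0::complex) t" using assms by (intro subset_cball) simp
        show "emeasure lborel (cball (0::complex) (sqrt x)) \<noteq> \<infinity>" using 2 by (simp add: emeasure_cball_complex)
      qed simp_all
      moreover have "{0..t\<^sup>2} \<inter> {x<..} = {x<..t\<^sup>2}" using 2 by auto
      ultimately show ?thesis unfolding M N using assms 2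
        by (simp add: emeasure_cball_complex ennreal_minus ennreal_mult[symmetric] right_diff_distrib)
    next
      case 3
      have "(cmod z)\<^sup>2 \<le> t\<^sup>2" if "cmod z \<le> t" for z using that by (intro power_mono) auto
      then have "cball (0::complex) t \<inter> {z. x < (cmod z)\<^sup>2} = {}" using 3 by fastforce
      moreover have "{0..t\<^sup>2} \<inter> {x<..} = {}" using 3 by auto
      ultimately show ?thesis unfolding M N by simp
    qed
  qed
qed

lemma cball_indicator_measurable: "indicat_real (cball (0::complex) t) \<in> borel_measurable borel"
  by (rule borel_measurable_indicator) simp

lemma integral_radial:
  fixes h :: "real \<Rightarrow> real"
  assumes "t > 0" and h: "h \<in> borel_measurable borel"
  shows "(LINT z:cball (0::complex) t|lborel. h ((cmod z)\<^sup>2)) = pi * (LINT \<tau>:{0..t\<^sup>2}|lborel. h \<tau>)"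
proof -
  have m: "(\<lambda>z::complex. (cmod z)\<^sup>2) \<in> borel_measurable borel" by (intro borel_measurable_continuous_onI continuous_intros)
  have "(LINT z:cball (0::complex) t|lborel. h ((cmod z)\<^sup>2)) =
      (\<integral>z. h ((cmod z)\<^sup>2) \<partial>density lborel (indicator (cball (0::complex) t)))"
  proof -
    have "(\<integral>z. h ((cmod z)\<^sup>2) \<partial>density lborel (\<lambda>z. ennreal (indicator (cball (0::complex) t) z))) =
      (\<integral>z. indicator (cball (0::complex) t) z *\<^sub>R h ((cmod z)\<^sup>2) \<partial>lborel)"
      by (rule integral_density) (use measurable_compose[OF m h] cball_indicator_measurable in auto)
    then show ?thesis unfolding set_lebesgue_integral_def by (simp add: ennreal_indicator)
  qed
  also have "\<dots> = (\<integral>\<tau>. h \<tau> \<partial>distr (density lborel (indicator (cball (0::complex) t))) borel (\<lambda>z. (cmod z)\<^sup>2))"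
    by (rule integral_distr[symmetric]) (use h m in auto)
  also have "\<dots> = (\<integral>\<tau>. h \<tau> \<partial>density lborel (\<lambda>\<tau>. ennreal pi * indicator {0..t\<^sup>2} \<tau>))"
    unfolding distr_cmod_square[OF assms(1)] ..
  also have "\<dots> = (\<integral>\<tau>. h \<tau> \<partial>density lborel (\<lambda>\<tau>. ennreal (pi * indicator {0..t\<^sup>2} \<tau>)))"
    by (simp add: ennreal_mult' ennreal_indicator)
  also have "\<dots> = (\<integral>\<tau>. (pi * indicator {0..t\<^sup>2} \<tau>) *\<^sub>R h \<tau> \<partial>lborel)"
    by (rule integral_density) (use h in auto)
  also have "\<dots> = pi * (LINT \<tau>:{0..t\<^sup>2}|lborel. h \<tau>)"
    unfolding set_lebesgue_integral_def by (simp add: mult.assoc)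
  finally show ?thesis .
qed

text \<open>Along a horizontal or vertical line through \<open>z\<close> the squared modulus is
  \<open>c + 2 * x * p + x^2\<close>, with \<open>p\<close> the real or imaginary part of
  \<open>z\<close>. As \<open>f\<close> is known only where this lies in \<open>(0, T)\<close>, the
  derivatives are taken on the open set \<open>U\<close>.\<close>

lemma second_deriv_quadratic:
  fixes G :: "real \<Rightarrow> real"
  assumes G: "\<And>x. 0 < x \<Longrightarrow> x < T \<Longrightarrow> (G has_real_derivative g x) (at x)"
    and g: "\<And>x. 0 < x \<Longrightarrow> x < T \<Longrightarrow> (g has_real_derivative g2 x) (at x)"
    and c: "0 < c" "c < T" and f: "\<And>x. 0 < c + 2 * x * p + x\<^sup>2 \<Longrightarrow> c + 2 * x * p + x\<^sup>2 < T \<Longrightarrow> f x = G (c + 2 * x * p + x\<^sup>2)"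
  shows "(deriv ^^ 2) f 0 = g2 c * (2 * p)\<^sup>2 + 2 * g c"
proof -
  define q where "q = (\<lambda>x. c + 2 * x * p + x\<^sup>2)"
  define U where "U = {x. 0 < q x \<and> q x < T}"
  have cq: "continuous_on UNIV q" unfolding q_def by (intro continuous_intros)
  have U: "open U" unfolding U_def
    by (intro open_Collect_conj open_Collect_less continuous_intros cq)
  have U0: "0 \<in> U" unfolding U_def q_def using c by simp
  have dq: "(q has_real_derivative 2 * p + 2 * x) (at x)" for x
    unfolding q_def by (auto intro!: derivative_eq_intros)
  have df: "(f has_real_derivative g (q x) * (2 * p + 2 * x)) (at x)" if x: "x \<in> U" for x
  proof -
    have "((\<lambda>x. G (q x)) has_real_derivative g (q x) * (2 * p + 2 * x)) (at x)"
      by (rule DERIV_chain2[OF G dq]) (use x in \<open>auto simp: U_def\<close>)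
    moreover have "\<forall>\<^sub>F y in nhds x. G (q y) = f y"
      using eventually_nhds_in_open[OF U x] by eventually_elim (use f in \<open>auto simp: U_def q_def\<close>)
    ultimately show ?thesis using DERIV_cong_ev[of x x "\<lambda>y. G (q y)" f] by blast
  qed
  have "\<forall>\<^sub>F x in nhds 0. deriv f x = g (q x) * (2 * p + 2 * x)"
    using eventually_nhds_in_open[OF U U0] by eventually_elim (rule DERIV_imp_deriv[OF df])
  then have "deriv (deriv f) 0 = deriv (\<lambda>x. g (q x) * (2 * p + 2 * x)) 0"
    by (rule deriv_cong_ev) simp
  also have "((\<lambda>x. g (q x) * (2 * p + 2 * x)) has_real_derivative
      (g2 (q 0) * (2 * p + 2 * 0)) * (2 * p + 2 * 0) + 2 * g (q 0)) (at 0)"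
  proof (rule DERIV_mult'[where D = "g2 (q 0) * (2 * p + 2 * 0)" and E = 2, THEN DERIV_cong])
    show "((\<lambda>x. g (q x)) has_real_derivative g2 (q 0) * (2 * p + 2 * 0)) (at 0)"
      by (rule DERIV_chain2[OF g dq]) (use U0 in \<open>auto simp: U_def\<close>)
    show "((\<lambda>x. 2 * p + 2 * x) has_real_derivative 2) (at 0)" by (auto intro!: derivative_eq_intros)
  qed simp
  then have "deriv (\<lambda>x. g (q x) * (2 * p + 2 * x)) 0 = (g2 (q 0) * (2 * p + 2 * 0)) * (2 * p + 2 * 0) + 2 * g (q 0)"
    by (rule DERIV_imp_deriv)
  finally show ?thesis by (simp add: q_def power2_eq_square numeral_2_eq_2)
qed

lemma laplacian_radial:
  fixes G :: "real \<Rightarrow> real"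
  assumes G: "\<And>x. 0 < x \<Longrightarrow> x < T \<Longrightarrow> (G has_real_derivative g x) (at x)"
    and g: "\<And>x. 0 < x \<Longrightarrow> x < T \<Longrightarrow> (g has_real_derivative g2 x) (at x)"
    and z: "0 < (cmod z)\<^sup>2" "(cmod z)\<^sup>2 < T"
    and f: "\<And>\<zeta>. 0 < (cmod \<zeta>)\<^sup>2 \<Longrightarrow> (cmod \<zeta>)\<^sup>2 < T \<Longrightarrow> f \<zeta> = G ((cmod \<zeta>)\<^sup>2)"
  shows "laplacian f z = 4 * (cmod z)\<^sup>2 * g2 ((cmod z)\<^sup>2) + 4 * g ((cmod z)\<^sup>2)"
proof -
  have e1: "(cmod (z + of_real x))\<^sup>2 = (cmod z)\<^sup>2 + 2 * x * Re z + x\<^sup>2" for x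
    unfolding cmod_power2 by (simp add: power2_eq_square algebra_simps)
  have e2: "(cmod (z + \<i> * of_real x))\<^sup>2 = (cmod z)\<^sup>2 + 2 * x * Im z + x\<^sup>2" for x
    unfolding cmod_power2 by (simp add: power2_eq_square algebra_simps)
  have "(deriv ^^ 2) (\<lambda>x. f (z + of_real x)) 0 = g2 ((cmod z)\<^sup>2) * (2 * Re z)\<^sup>2 + 2 * g ((cmod z)\<^sup>2)"
    by (rule second_deriv_quadratic[OF G g z]) (use f in \<open>auto simp flip: e1\<close>)
  moreover have "(deriv ^^ 2) (\<lambda>x. f (z + \<i> * of_real x)) 0 = g2 ((cmod z)\<^sup>2) * (2 * Im z)\<^sup>2 + 2 * g ((cmod z)\<^sup>2)"
    by (rule second_deriv_quadratic[OF G g z]) (use f in \<open>auto simp flip: e2\<close>)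
  ultimately show ?thesis unfolding laplacian_def by (simp add: cmod_power2 power_mult_distrib algebra_simps)
qed

section \<open>The mass of small discs\<close>

context controlled_matrix begin

lemma sol_v_eq:
  assumes S: "S \<in> carrier_mat K K" "\<And>i j. i < K \<Longrightarrow> j < K \<Longrightarrow> s i j = S $$ (i, j)" and p: "0 < \<tau>" "0 < \<eta>"
  shows "sol_v S \<tau> \<eta> = vec K (sv \<tau> \<eta>)"
proof -
  have dim: "dim_row S = K" "dim_col S = K" using S by auto
  have l: "lin K s \<eta> w i = \<eta> + (S *\<^sub>v vec K w) $ i" "lin K (\<lambda>i j. s j i) \<eta> w i = \<eta> + (S\<^sup>T *\<^sub>v vec K w) $ i" if "i < K" for w i
    using that dim S(2) by (auto simp: lin_def scalar_prod_def atLeast0LessThan row_def)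
  have ps: "positive_solution S \<tau> \<eta> v w \<longleftrightarrow> v \<in> carrier_vec K \<and> w \<in> carrier_vec K \<and> sol K s \<tau> \<eta> (($) v) (($) w)" for v w
  proof (cases "v \<in> carrier_vec K \<and> w \<in> carrier_vec K")
    case True
    then have "vec K (($) v) = v" "vec K (($) w) = w" by auto
    then show ?thesis using True dim unfolding positive_solution_def sol_def by (auto simp: l)
  qed (auto simp: positive_solution_def dim)
  have S0: "sol K s \<tau> \<eta> (sv \<tau> \<eta>) (sw \<tau> \<eta>)" using bal_pos[OF p] unfolding bal_def by simp
  have lc: "lin K s' \<eta> (($) (vec K f)) i = lin K s' \<eta> f i" for s' f i unfolding lin_def by simp
  have S1: "sol K s \<tau> \<eta> (($) (vec K (sv \<tau> \<eta>))) (($) (vec K (sw \<tau> \<eta>)))"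
    using S0 unfolding sol_def lc by simp
  have "(THE (v, w). positive_solution S \<tau> \<eta> v w) = (vec K (sv \<tau> \<eta>), vec K (sw \<tau> \<eta>))"
  proof (rule the_equality)
    show "case (vec K (sv \<tau> \<eta>), vec K (sw \<tau> \<eta>)) of (v, w) \<Rightarrow> positive_solution S \<tau> \<eta> v w"
      using S1 by (simp add: ps)
    fix x assume "case x of (v, w) \<Rightarrow> positive_solution S \<tau> \<eta> v w"
    then obtain v w where x: "x = (v, w)" "v \<in> carrier_vec K" "w \<in> carrier_vec K" "sol K s \<tau> \<eta> (($) v) (($) w)"
      by (cases x) (auto simp: ps)
    have "v = vec K (sv \<tau> \<eta>)" "w = vec K (sw \<tau> \<eta>)"
      using sol_unique[OF variance_matrix_axioms p x(4) S0] x(2,3) by (auto intro!: eq_vecI)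
    then show "x = (vec K (sv \<tau> \<eta>), vec K (sw \<tau> \<eta>))" using x by simp
  qed
  then show ?thesis unfolding sol_v_def by simp
qed

text \<open>\<open>4 * t * g2 t + 4 * g t\<close> is four times the derivative of
  \<open>t * g t\<close>, and \<open>t * g t\<close> is \<open>- total_defect t / (2 * K)\<close>;
  the factor \<open>1 / \<tau>\<close> from the derivative of the potential thus disappears.\<close>

lemma scdos_eq:
  assumes S: "S \<in> carrier_mat K K" "\<And>i j. i < K \<Longrightarrow> j < K \<Longrightarrow> s i j = S $$ (i, j)"
    and D: "\<And>\<tau>. 0 < \<tau> \<Longrightarrow> \<tau> < \<tau>0 \<Longrightarrow> (total_defect has_real_derivative D \<tau>) (at \<tau>)"
    and z: "0 < (cmod z)\<^sup>2" "(cmod z)\<^sup>2 < \<tau>0"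
  shows "scdos S z = D ((cmod z)\<^sup>2) / (pi * K)"
proof -
  define G where "G = (\<lambda>\<tau>. - pot \<tau> 0 / (2 * K))"
  define g where "g = (\<lambda>\<tau>. - (total_defect \<tau> / \<tau>) / (2 * K))"
  define g2 where "g2 = (\<lambda>\<tau>. - ((D \<tau> * \<tau> - total_defect \<tau> * 1) / (\<tau> * \<tau>)) / (2 * K))"
  have G: "(G has_real_derivative g x) (at x)" if "0 < x" "x < \<tau>0" for x
    unfolding G_def g_def by (intro DERIV_cdivide DERIV_minus pot_zero_deriv that)
  have g: "(g has_real_derivative g2 x) (at x)" if "0 < x" "x < \<tau>0" for x
    unfolding g_def g2_def using that by (intro DERIV_cdivide DERIV_minus DERIV_divide D DERIV_ident) auto
  have f: "(LINT \<eta>:{0<..}|lborel. vec_mean (sol_v S ((cmod \<zeta>)\<^sup>2) \<eta>) - 1 / (1 + \<eta>)) = G ((cmod \<zeta>)\<^sup>2)"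
    if "0 < (cmod \<zeta>)\<^sup>2" "(cmod \<zeta>)\<^sup>2 < \<tau>0" for \<zeta>
  proof -
    have "(LINT \<eta>:{0<..}|lborel. vec_mean (sol_v S ((cmod \<zeta>)\<^sup>2) \<eta>) - 1 / (1 + \<eta>)) =
        (LINT \<eta>:{0<..}|lborel. (\<Sum>i<K. sv ((cmod \<zeta>)\<^sup>2) \<eta> i) / K - 1 / (1 + \<eta>))"
      by (rule set_lebesgue_integral_cong) (use sol_v_eq[OF S that(1)] in \<open>auto simp: vec_mean_def\<close>)
    then show ?thesis unfolding G_def pot_integral[OF that] .
  qed
  define t where "t = (cmod z)\<^sup>2"
  have t: "t > 0" using z t_def by simp
  have "laplacian (\<lambda>\<zeta>. LINT \<eta>:{0<..}|lborel. vec_mean (sol_v S ((cmod \<zeta>)\<^sup>2) \<eta>) - 1 / (1 + \<eta>)) z = 4 * t * g2 t + 4 * g t"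
    unfolding t_def by (rule laplacian_radial[OF G g z f])
  also have "\<dots> = - 2 * D t / K"
    unfolding g2_def g_def using t K_pos by (simp add: field_simps)
  finally show ?thesis unfolding scdos_def t_def[symmetric] using K_pos by (simp add: field_simps)
qed

text \<open>Boundary value at 0 when the density is integrated; the logarithmic rate from the
  entropy estimate is enough.\<close>

lemma total_defect_lim: "(total_defect \<longlongrightarrow> 0) (at_right 0)"
proof (rule tendsto_sandwich)
  define C where "C = real K * K + 3 * K - (\<Sum>i<K. ln (s i (\<pi> i)))"
  show "((\<lambda>\<tau>::real. 0::real) \<longlongrightarrow> 0) (at_right 0)" by simp
  show "((\<lambda>\<tau>. C / - ln \<tau>) \<longlongrightarrow> 0) (at_right 0)" by real_asymp
  have ev: "\<forall>\<^sub>F \<tau> in at_right 0. \<tau> \<in> {0<..<\<tau>0}" by (rule eventually_at_right_real) (use \<tau>0 in auto)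
  show "\<forall>\<^sub>F \<tau> in at_right 0. 0 \<le> total_defect \<tau>" using ev
  proof eventually_elim
    case (elim \<tau>)
    then have t: "0 < \<tau>" "\<tau> < \<tau>0" by auto
    have S: "sol K s \<tau> 0 (sv \<tau> 0) (sw \<tau> 0)" using bal_zero[OF t] unfolding bal_def by auto
    show ?case unfolding total_defect_def using sol_facts(8)[OF S t(1) order_refl] by (intro sum_nonneg) (auto intro: less_imp_le)
  qed
  show "\<forall>\<^sub>F \<tau> in at_right 0. total_defect \<tau> \<le> C / - ln \<tau>" using ev
  proof eventually_elim
    case (elim \<tau>)
    then have t: "0 < \<tau>" "\<tau> < \<tau>0" "\<tau> < 1" using \<tau>0 by auto
    have S: "sol K s \<tau> 0 (sv \<tau> 0) (sw \<tau> 0)" using bal_zero[OF t(1,2)] unfolding bal_def by auto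
    have "- ln \<tau> > 0" using t by simp
    then show ?case using sum_defect_le[OF S t(1,3)] unfolding total_defect_def C_def
      by (intro iffD2[OF pos_le_divide_eq]) auto
  qed
qed

theorem scdos_mass:
  assumes S: "S \<in> carrier_mat K K" "\<And>i j. i < K \<Longrightarrow> j < K \<Longrightarrow> s i j = S $$ (i, j)"
    and t: "0 < t" "t\<^sup>2 < \<tau>0"
  shows "(LINT z:cball 0 t|lborel. scdos S z) = total_defect (t\<^sup>2) / K"
proof -
  obtain D where D: "\<And>\<tau>. 0 < \<tau> \<Longrightarrow> \<tau> < \<tau>0 \<Longrightarrow> (total_defect has_real_derivative D \<tau>) (at \<tau>)"
    and cD: "\<And>\<tau>. 0 < \<tau> \<Longrightarrow> \<tau> < \<tau>0 \<Longrightarrow> isCont D \<tau>" using total_defect_C1 by blast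
  \<comment> \<open>Outside \<open>(0, \<tau>0)\<close> nothing is known about \<open>D\<close>; the
    cut-off produces a Borel function.\<close>
  define h where "h = (\<lambda>\<tau>. indicator {0<..<\<tau>0} \<tau> *\<^sub>R D \<tau>)"
  have hm: "h \<in> borel_measurable borel" unfolding h_def
    by (rule borel_measurable_continuous_on_indicator) (use cD in \<open>auto intro!: continuous_at_imp_continuous_on\<close>)
  define g where "g = (\<lambda>z. indicator (cball 0 t) z *\<^sub>R (h ((cmod z)\<^sup>2) / (pi * K)))"
  have m: "(\<lambda>z::complex. (cmod z)\<^sup>2) \<in> borel_measurable borel" by (intro borel_measurable_continuous_onI continuous_intros)
  have gm: "g \<in> borel_measurable borel" unfolding g_def
    by (intro borel_measurable_scaleR borel_measurable_divide borel_measurable_const cball_indicator_measurable measurable_compose[OF m hm])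
  \<comment> \<open>The value of \<open>scdos S\<close> at 0 is uncontrolled, so it is split off
    here and removed as a null set below.\<close>
  have pw: "indicator (cball 0 t) z *\<^sub>R scdos S z = (if z = 0 then scdos S 0 else g z)" for z
  proof (cases "z = 0 \<or> z \<notin> cball 0 t")
    case False
    then have "cmod z \<le> t" "z \<noteq> 0" by auto
    then have z0: "0 < (cmod z)\<^sup>2" and "(cmod z)\<^sup>2 \<le> t\<^sup>2" by (auto intro: power_mono)
    then have z: "0 < (cmod z)\<^sup>2" "(cmod z)\<^sup>2 < \<tau>0" using t(2) by linarith+
    show ?thesis using False scdos_eq[OF S D z] z unfolding g_def h_def by simp
  qed (use t in \<open>auto simp: g_def\<close>)
  have "(LINT z:cball 0 t|lborel. scdos S z) = (\<integral>z. (if z = 0 then scdos S 0 else g z) \<partial>lborel)"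
    unfolding set_lebesgue_integral_def pw ..
  also have "\<dots> = (\<integral>z. g z \<partial>lborel)"
  proof (rule integral_cong_AE)
    show "AE z in lborel. (if z = 0 then scdos S 0 else g z) = g z"
      using AE_lborel_singleton[of "0::complex"] by eventually_elim simp
  qed (use gm in auto)
  also have "\<dots> = (LINT z:cball (0::complex) t|lborel. h ((cmod z)\<^sup>2) / (pi * K))"
    unfolding set_lebesgue_integral_def g_def ..
  also have "\<dots> = (LINT z:cball (0::complex) t|lborel. h ((cmod z)\<^sup>2)) / (pi * K)"
    by simp
  also have "\<dots> = (LINT \<tau>:{0..t\<^sup>2}|lborel. h \<tau>) / K"
    unfolding integral_radial[OF t(1) hm] by simp
  also have "(LINT \<tau>:{0..t\<^sup>2}|lborel. h \<tau>) = (LINT \<tau>:{0<..<t\<^sup>2}|lborel. D \<tau>)"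
  proof -
    have "(LINT \<tau>:{0..t\<^sup>2}|lborel. h \<tau>) = (LINT \<tau>:{0<..<t\<^sup>2}|lborel. h \<tau>)"
      unfolding set_lebesgue_integral_def
    proof (rule integral_cong_AE)
      show "AE \<tau> in lborel. indicator {0..t\<^sup>2} \<tau> *\<^sub>R h \<tau> = indicator {0<..<t\<^sup>2} \<tau> *\<^sub>R h \<tau>"
        using AE_lborel_singleton[of "0::real"] AE_lborel_singleton[of "t\<^sup>2"]
        by eventually_elim (auto simp: indicator_def)
    qed (use hm in auto)
    also have "\<dots> = (LINT \<tau>:{0<..<t\<^sup>2}|lborel. D \<tau>)"
      by (rule set_lebesgue_integral_cong) (use t in \<open>auto simp: h_def\<close>)
    finally show ?thesis .
  qed
  also have "(LINT \<tau>:{0<..<t\<^sup>2}|lborel. D \<tau>) = total_defect (t\<^sup>2) - 0"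
  proof -
    have ei: "einterval 0 (ereal (t\<^sup>2)) = {0<..<t\<^sup>2}" by (auto simp: einterval_def)
    \<comment> \<open>Monotonicity gives \<open>D \<ge> 0\<close>, which allows the fundamental
      theorem on an interval whose left end is singular without proving integrability of
      \<open>D\<close> beforehand.\<close>
    have mono: "mono_on {0<..<\<tau>0} total_defect" by (auto intro!: mono_onI total_defect_mono)
    have "(LBINT \<tau>=0..ereal (t\<^sup>2). D \<tau>) = total_defect (t\<^sup>2) - 0"
    proof (rule interval_integral_FTC_nonneg(2))
      show "0 < ereal (t\<^sup>2)" using t by simp
      show "(total_defect has_real_derivative D x) (at x)" "isCont D x" if "0 < ereal x" "ereal x < ereal (t\<^sup>2)" for x
        using that t D[of x] cD[of x] by auto
      show "AE x in lborel. 0 < ereal x \<longrightarrow> ereal x < ereal (t\<^sup>2) \<longrightarrow> 0 \<le> D x"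
      proof (rule AE_I2, intro impI)
        fix x assume "0 < ereal x" "ereal x < ereal (t\<^sup>2)"
        then have x: "0 < x" "x < \<tau>0" using t by auto
        show "0 \<le> D x" using mono_on_imp_deriv_nonneg[OF mono D[OF x]] x by simp
      qed
      show "((total_defect \<circ> real_of_ereal) \<longlongrightarrow> 0) (at_right 0)"
        unfolding zero_ereal_def ereal_tendsto_simps by (rule total_defect_lim)
      have "isCont total_defect (t\<^sup>2)" using DERIV_isCont[OF D] t by simp
      then show "((total_defect \<circ> real_of_ereal) \<longlongrightarrow> total_defect (t\<^sup>2)) (at_left (ereal (t\<^sup>2)))"
        unfolding ereal_tendsto_simps isCont_def by (rule filterlim_at_split[THEN iffD1, THEN conjunct1])
    qed
    then show ?thesis unfolding interval_lebesgue_integral_def using t by (simp add: ei)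
  qed
  finally show ?thesis by simp
qed

end

section \<open>The block graph\<close>

lemma real_powr_ratio_le:
  fixes \<tau> x :: real
  assumes "\<tau> > 0" "x \<ge> 0" "n > 0"
  shows "\<tau> ^ m \<le> x ^ n \<Longrightarrow> \<tau> powr (real m / real n) \<le> x"
    and "x ^ n \<le> \<tau> ^ m \<Longrightarrow> x \<le> \<tau> powr (real m / real n)"
proof -
  have e: "(\<tau> powr (real m / real n)) ^ n = \<tau> ^ m"
    using assms by (simp add: powr_realpow[symmetric] powr_powr)
  show "\<tau> powr (real m / real n) \<le> x" if "\<tau> ^ m \<le> x ^ n"
    using that assms(2,3) power_mono_iff[of "\<tau> powr (real m / real n)" x n] unfolding e by simp
  show "x \<le> \<tau> powr (real m / real n)" if "x ^ n \<le> \<tau> ^ m"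
    using that assms(2,3) power_mono_iff[of x "\<tau> powr (real m / real n)" n] unfolding e by simp
qed

text \<open>The normal form in the original indices: \<open>rb i\<close> is the block in which row
  \<open>i\<close> ends up, \<open>cb j\<close> the block of column \<open>j\<close>, and
  \<open>\<pi>\<close> pairs the row and the column that meet on the main diagonal.
  \<open>block_conn\<close> keeps from primitivity that the positions inside a diagonal block are
  connected. In this way the solution itself never has to be permuted.\<close>

locale block_structure = controlled_matrix +
  fixes L :: nat and rb cb :: "nat \<Rightarrow> nat"
  assumes rb_less: "i < K \<Longrightarrow> rb i < L" and cb_less: "i < K \<Longrightarrow> cb i < L"
    and triangular: "i < K \<Longrightarrow> j < K \<Longrightarrow> s i j > 0 \<Longrightarrow> rb i \<le> cb j"
    and cb_pi: "i < K \<Longrightarrow> cb (\<pi> i) = rb i"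
    and block_conn: "i < K \<Longrightarrow> i' < K \<Longrightarrow> rb i = rb i' \<Longrightarrow> (i, i') \<in> {(i, i'). i < K \<and> i' < K \<and> s i (\<pi> i') > 0}\<^sup>*"
begin

text \<open>Index \<open>i\<close> occurs once as a row, in block \<open>rb i\<close>, and once as a
  column, in block \<open>cb i\<close>. The \<open>Prec\<close> arc joins these two and will carry
  the defect of \<open>i\<close>.\<close>

definition gr :: "(nat, nat \<times> edge_label \<times> nat) pre_digraph" where
  "gr = \<lparr> verts = {..<L},
    arcs = {(rb i, Lhd, cb j) | i j. i < K \<and> j < K \<and> s i j > 0 \<and> rb i \<noteq> cb j} \<union> {(rb i, Prec, cb i) | i. i < K},
    tail = (\<lambda>(l, a, k). l), head = (\<lambda>(l, a, k). k) \<rparr>"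

lemma gr_simps: "verts gr = {..<L}" "tail gr (l, x, k) = l" "head gr (l, x, k) = k"
  "arcs gr = {(rb i, Lhd, cb j) | i j. i < K \<and> j < K \<and> s i j > 0 \<and> rb i \<noteq> cb j} \<union> {(rb i, Prec, cb i) | i. i < K}"
  unfolding gr_def by auto

lemma pi_inv: "j < K \<Longrightarrow> inv_into UNIV \<pi> j < K \<and> \<pi> (inv_into UNIV \<pi> j) = j \<and> rb (inv_into UNIV \<pi> j) = cb j"
proof -
  assume j: "j < K"
  have 1: "inv_into UNIV \<pi> j < K" using permutes_in_image[OF permutes_inv[OF perm], of j] j by auto
  have 2: "\<pi> (inv_into UNIV \<pi> j) = j" using permutes_inverses[OF perm] by auto
  show ?thesis using 1 2 cb_pi[OF 1] by simp
qed

text \<open>The chain argument for arbitrary pairs, restricted to a block: its rows are connected by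
  steps with \<open>s i (\<pi> i') > 0\<close> alone, each costing a factor
  \<open>1 / (c0 * c0)\<close>, so the constant does not deteriorate as \<open>\<tau>\<close> tends
  to 0.\<close>

lemma block_bounds:
  "\<exists>c>0. c \<le> 1 \<and> (\<forall>\<tau> v w. sol K s \<tau> 0 v w \<longrightarrow> 0 < \<tau> \<longrightarrow> \<tau> < \<tau>0 \<longrightarrow>
    (\<forall>i<K. \<forall>j<K. rb i = cb j \<longrightarrow> c \<le> v i * w j \<and> v i * w j \<le> 1 / c))"
proof -
  define R where "R = {(i, i'). i < K \<and> i' < K \<and> s i (\<pi> i') > 0}"
  define P where "P = {(i, i'). i < K \<and> i' < K \<and> rb i = rb i'}"
  have fP: "finite P" by (rule finite_subset[of _ "{..<K} \<times> {..<K}"]) (auto simp: P_def)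
  have PR: "P \<subseteq> R\<^sup>*" using block_conn unfolding P_def R_def by auto
  from chain_bound[OF fP PR] obtain N where N: "\<And>u M. M \<ge> (1::real) \<Longrightarrow> (\<forall>i. u i \<ge> 0) \<Longrightarrow>
    (\<forall>(i, j)\<in>R. u i \<le> M * u j) \<Longrightarrow> (\<forall>(i, j)\<in>P. u i \<le> M ^ N * u j)" by blast
  define M where "M = 1 / (c0 * c0)"
  have "c0 * c0 \<le> 1 * 1" using c0 by (intro mult_mono) auto
  then have M: "M \<ge> 1" unfolding M_def using c0 by simp
  define c where "c = c0 / M ^ N"
  have MN: "M ^ N \<ge> 1" using M by simp
  have c: "c > 0" "c \<le> 1" unfolding c_def using c0 MN by auto
  have "c \<le> v i * w j \<and> v i * w j \<le> 1 / c"
    if A: "sol K s \<tau> 0 v w" "0 < \<tau>" "\<tau> < \<tau>0" and ij: "i < K" "j < K" "rb i = cb j" for \<tau> v w i j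
  proof -
    note f = sol_facts[OF A(1,2) order_refl]
    note pg = pair_ge[OF A order_refl zero_le_one] note pe = pair_le[OF A order_refl zero_le_one]
    define u where "u = (\<lambda>i. if i < K then v i else (0::real))"
    have "\<forall>i. u i \<ge> 0" unfolding u_def using f(3) less_imp_le by auto
    moreover have "\<forall>(i, i')\<in>R. u i \<le> M * u i'"
    proof clarify
      fix i i' assume "(i, i') \<in> R"
      then have i: "i < K" "i' < K" "s i (\<pi> i') > 0" unfolding R_def by auto
      have "v i * w (\<pi> i') \<le> 1 / c0" by (rule pe[OF i(1) pi_less[OF i(2)] i(3)])
      also have "\<dots> = M * c0" unfolding M_def using c0 by simp
      also have "\<dots> \<le> M * (v i' * w (\<pi> i'))" using pg[OF i(2)] M by (intro mult_left_mono) auto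
      finally have "v i * w (\<pi> i') \<le> (M * v i') * w (\<pi> i')" by simp
      then have "v i \<le> M * v i'" using f(4)[OF pi_less[OF i(2)]] by simp
      then show "u i \<le> M * u i'" unfolding u_def using i by simp
    qed
    ultimately have "\<forall>(i, i')\<in>P. u i \<le> M ^ N * u i'" by (rule N[OF M])
    then have comp: "v i \<le> M ^ N * v i'" if "i < K" "i' < K" "rb i = rb i'" for i i'
      using that unfolding P_def u_def by fastforce
    define i' where "i' = inv_into UNIV \<pi> j"
    have i': "i' < K" "\<pi> i' = j" "rb i' = rb i" unfolding i'_def using pi_inv[OF ij(2)] ij by auto
    have wj: "w j > 0" using f(4)[OF ij(2)] .
    have "c0 \<le> v i' * w j" using pg[OF i'(1)] i' by simp
    also have "\<dots> \<le> (M ^ N * v i) * w j" using comp[OF i'(1) ij(1) i'(3)] wj by (intro mult_right_mono) auto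
    finally have 1: "c \<le> v i * w j" unfolding c_def using MN by (simp add: field_simps)
    have "v i * w j \<le> (M ^ N * v i') * w j" using comp[OF ij(1) i'(1)] i' wj by (intro mult_right_mono) auto
    also have "\<dots> = M ^ N * (v i' * w j)" by simp
    also have "\<dots> \<le> M ^ N * (1 / c0)" using pe[OF i'(1) ij(2)] s_pi[OF i'(1)] i' MN by (intro mult_left_mono) auto
    finally show ?thesis unfolding c_def using 1 c_def by simp
  qed
  then show ?thesis using c by blast
qed

text \<open>Adding the defects on the diagonal makes \<open>v i * s i j * w j\<close> doubly stochastic, so the mass
  leaving a set of blocks equals the mass entering it.\<close>

lemma conservation:
  assumes S: "sol K s \<tau> 0 v w" and t: "0 < \<tau>"
  defines "y \<equiv> defect K s \<tau> 0 v w" and "T \<equiv> \<lambda>i j. v i * s i j * w j"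
  defines "r \<equiv> \<lambda>R i. of_bool (rb i \<in> R) :: real" and "q \<equiv> \<lambda>R i. of_bool (cb i \<in> R) :: real"
  shows "(\<Sum>i<K. \<Sum>j<K. r R i * (1 - q R j) * T i j) + (\<Sum>i<K. r R i * (1 - q R i) * y i) =
    (\<Sum>i<K. \<Sum>j<K. (1 - r R i) * q R j * T i j) + (\<Sum>i<K. (1 - r R i) * q R i * y i)"
proof -
  note f = sol_facts[OF S t order_refl]
  have row: "(\<Sum>j<K. T i j) + y i = 1" if "i < K" for i
    using f(5)[OF that] unfolding T_def y_def lin_def by (simp add: sum_distrib_left mult.assoc)
  have col: "(\<Sum>i<K. T i j) + y j = 1" if "j < K" for j
    using f(6)[OF that] unfolding T_def y_def lin_def by (simp add: sum_distrib_left mult_ac)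
  have "(\<Sum>i<K. r R i) = (\<Sum>i<K. q R (\<pi> i))" by (intro sum.cong) (auto simp: r_def q_def cb_pi)
  also have "\<dots> = (\<Sum>i<K. q R i)" using sum.permute[OF perm, of "q R"] by (simp add: comp_def)
  finally have rq: "(\<Sum>i<K. r R i) = (\<Sum>i<K. q R i)" .
  have "(\<Sum>i<K. \<Sum>j<K. r R i * T i j) + (\<Sum>i<K. r R i * y i) = (\<Sum>i<K. r R i * ((\<Sum>j<K. T i j) + y i))"
    by (simp add: distrib_left sum.distrib sum_distrib_left)
  also have "\<dots> = (\<Sum>i<K. r R i)" by (simp add: row)
  also have "\<dots> = (\<Sum>j<K. q R j * ((\<Sum>i<K. T i j) + y j))" unfolding rq by (simp add: col)
  also have "\<dots> = (\<Sum>j<K. \<Sum>i<K. q R j * T i j) + (\<Sum>i<K. q R i * y i)"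
    by (simp add: distrib_left sum.distrib sum_distrib_left)
  also have "(\<Sum>j<K. \<Sum>i<K. q R j * T i j) = (\<Sum>i<K. \<Sum>j<K. q R j * T i j)" by (rule sum.swap)
  finally have "(\<Sum>i<K. \<Sum>j<K. r R i * T i j) + (\<Sum>i<K. r R i * y i) = (\<Sum>i<K. \<Sum>j<K. q R j * T i j) + (\<Sum>i<K. q R i * y i)" .
  then show ?thesis by (simp add: algebra_simps sum_subtractf sum.distrib)
qed

text \<open>Cut after block \<open>rb i\<close>. The entry \<open>(i, j)\<close> leaves the initial
  segment of blocks, and by triangularity only defects can bring mass back into it.\<close>

lemma cut_bound:
  assumes S: "sol K s \<tau> 0 v w" and t: "0 < \<tau>" and ij: "i < K" "j < K" "rb i < cb j"
  shows "v i * s i j * w j \<le> (\<Sum>i<K. defect K s \<tau> 0 v w i)"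
proof -
  note f = sol_facts[OF S t order_refl]
  define R where "R = {..rb i}"
  define y where "y = defect K s \<tau> 0 v w"
  define T where "T = (\<lambda>i j. v i * s i j * w j)"
  define r where "r = (\<lambda>R i. of_bool (rb i \<in> R) :: real)"
  define q where "q = (\<lambda>R i. of_bool (cb i \<in> R) :: real)"
  have T0: "T k l \<ge> 0" if "k < K" "l < K" for k l
    unfolding T_def by (intro mult_nonneg_nonneg s_nonneg less_imp_le[OF f(3)] less_imp_le[OF f(4)] that)
  have y0: "y k \<ge> 0" if "k < K" for k using f(8)[OF that] unfolding y_def by simp
  have rq: "0 \<le> r R k" "r R k \<le> 1" "0 \<le> q R k" "q R k \<le> 1" for k unfolding r_def q_def by auto
  have "T i j = r R i * (1 - q R j) * T i j" using ij unfolding r_def q_def R_def by auto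
  also have "\<dots> \<le> (\<Sum>j<K. r R i * (1 - q R j) * T i j)"
    using ij T0 rq by (intro member_le_sum[of j "{..<K}" "\<lambda>j. r R i * (1 - q R j) * T i j"]) (auto intro!: mult_nonneg_nonneg)
  also have "\<dots> \<le> (\<Sum>i<K. \<Sum>j<K. r R i * (1 - q R j) * T i j)"
    using ij T0 rq by (intro member_le_sum[of i "{..<K}" "\<lambda>i. \<Sum>j<K. r R i * (1 - q R j) * T i j"])
      (auto intro!: mult_nonneg_nonneg sum_nonneg)
  also have "\<dots> \<le> (\<Sum>i<K. \<Sum>j<K. r R i * (1 - q R j) * T i j) + (\<Sum>i<K. r R i * (1 - q R i) * y i)"
    using y0 rq by (auto intro!: sum_nonneg mult_nonneg_nonneg)
  also have "\<dots> = (\<Sum>i<K. \<Sum>j<K. (1 - r R i) * q R j * T i j) + (\<Sum>i<K. (1 - r R i) * q R i * y i)"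
    using conservation[OF S t, of R] unfolding y_def T_def r_def q_def .
  also have "(\<Sum>i<K. \<Sum>j<K. (1 - r R i) * q R j * T i j) = 0"
  proof (intro sum.neutral ballI)
    fix k l assume "k \<in> {..<K}" "l \<in> {..<K}"
    then show "(1 - r R k) * q R l * T k l = 0"
      using triangular[of k l] s_nonneg[of k l] unfolding r_def q_def R_def T_def by (cases "s k l = 0") auto
  qed
  also have "(\<Sum>i<K. (1 - r R i) * q R i * y i) \<le> (\<Sum>i<K. y i)"
  proof (rule sum_mono)
    fix k assume "k \<in> {..<K}"
    then have "(1 - r R k) * q R k * y k \<le> 1 * 1 * y k" using rq y0 by (intro mult_mono) (auto intro: mult_nonneg_nonneg)
    then show "(1 - r R k) * q R k * y k \<le> y k" by simp
  qed
  finally show ?thesis unfolding T_def y_def by simp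
qed

text \<open>\<open>v (rep l)\<close> serves as a potential of block \<open>l\<close>: by
  \<open>block_bounds\<close> it is comparable to every \<open>v i\<close> in the block and to the
  inverse of every \<open>w j\<close> there.\<close>

definition rep :: "nat \<Rightarrow> nat" where "rep l = (SOME i. i < K \<and> rb i = l)"

lemma rep: "i < K \<Longrightarrow> rep (rb i) < K \<and> rb (rep (rb i)) = rb i"
  unfolding rep_def by (rule someI_ex) auto

definition pw :: "edge_label \<Rightarrow> real \<Rightarrow> real" where "pw x \<tau> = (if x = Prec then \<tau> else 1)"

text \<open>The mass on an arc is comparable to \<open>v i * w j * pw x \<tau>\<close> and at most
  the total defect, by \<open>cut_bound\<close> for \<open>Lhd\<close> and directly for
  \<open>Prec\<close>. Writing it with the potentials of the two blocks gives a form that telescopes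
  along walks.\<close>

lemma arc_upper:
  "\<exists>C>0. \<forall>\<tau> v w l x k. sol K s \<tau> 0 v w \<longrightarrow> 0 < \<tau> \<longrightarrow> \<tau> < \<tau>0 \<longrightarrow> (l, x, k) \<in> arcs gr \<longrightarrow>
    v (rep l) * pw x \<tau> \<le> C * (\<Sum>i<K. defect K s \<tau> 0 v w i) * v (rep k)"
proof -
  obtain c where c: "c > 0" "c \<le> 1" and bb: "\<And>\<tau> v w i j. sol K s \<tau> 0 v w \<Longrightarrow> 0 < \<tau> \<Longrightarrow> \<tau> < \<tau>0 \<Longrightarrow>
    i < K \<Longrightarrow> j < K \<Longrightarrow> rb i = cb j \<Longrightarrow> c \<le> v i * w j \<and> v i * w j \<le> 1 / c" using block_bounds by blast
  obtain \<mu> where \<mu>: "0 < \<mu>" "\<mu> \<le> 1" "\<And>i j. i < K \<Longrightarrow> j < K \<Longrightarrow> s i j > 0 \<Longrightarrow> \<mu> \<le> s i j"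
    using min_positive_entry by blast
  \<comment> \<open>Two factors \<open>1 / c\<close> exchange \<open>v (rep l)\<close> for
    \<open>v i\<close> by way of \<open>w (\<pi> i)\<close>, the third exchanges \<open>w j\<close>
    for the inverse of \<open>v (rep k)\<close>, and \<open>\<mu>\<close> is a lower bound for the
    positive entries of \<open>s\<close>.\<close>
  define C where "C = 1 / (c * c * c * \<mu>)"
  have C: "C > 0" unfolding C_def using c \<mu> by simp
  have "v (rep l) * pw x \<tau> \<le> C * (\<Sum>i<K. defect K s \<tau> 0 v w i) * v (rep k)"
    if A: "sol K s \<tau> 0 v w" "0 < \<tau>" "\<tau> < \<tau>0" and e: "(l, x, k) \<in> arcs gr" for \<tau> v w l x k
  proof -
    note f = sol_facts[OF A(1,2) order_refl]
    define y where "y = defect K s \<tau> 0 v w"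
    define Y where "Y = (\<Sum>i<K. y i)"
    have y: "0 < y i" "y i < 1" if "i < K" for i using f(8,9)[OF that] unfolding y_def by auto
    have yY: "y i \<le> Y" if "i < K" for i unfolding Y_def using that y by (intro member_le_sum) (auto intro: less_imp_le)
    obtain i j where ij: "i < K" "j < K" "l = rb i" "k = cb j" and le: "v i * w j * pw x \<tau> * \<mu> \<le> Y"
    proof -
      from e consider i j where "i < K" "j < K" "s i j > 0" "rb i \<noteq> cb j" "l = rb i" "x = Lhd" "k = cb j"
        | i where "i < K" "l = rb i" "x = Prec" "k = cb i" unfolding gr_simps by auto
      then show thesis
      proof cases
        case (1 i j)
        have "rb i < cb j" using triangular[OF 1(1-3)] 1(4) by simp
        from cut_bound[OF A(1,2) 1(1,2) this] have "v i * s i j * w j \<le> Y" unfolding Y_def y_def .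
        moreover have "v i * w j * \<mu> \<le> v i * w j * s i j"
          using \<mu>(3)[OF 1(1-3)] f(3)[OF 1(1)] f(4)[OF 1(2)] by (intro mult_left_mono) auto
        ultimately have "v i * w j * pw x \<tau> * \<mu> \<le> Y" unfolding pw_def 1 by (simp add: mult_ac)
        then show thesis using that 1 by blast
      next
        case (2 i)
        have "\<tau> * (v i * w i) = (1 - y i) * y i" using f(7)[OF 2(1)] unfolding y_def by simp
        also have "\<dots> \<le> 1 * y i" using y[OF 2(1)] by (intro mult_right_mono) auto
        also have "\<dots> \<le> Y" using yY[OF 2(1)] by simp
        finally have "\<tau> * (v i * w i) \<le> Y" .
        moreover have "(\<tau> * (v i * w i)) * \<mu> \<le> (\<tau> * (v i * w i)) * 1"
          using \<mu> A(2) f(3,4)[OF 2(1)] by (intro mult_left_mono) auto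
        ultimately have "v i * w i * pw x \<tau> * \<mu> \<le> Y" unfolding pw_def 2 by (simp add: mult_ac)
        then show thesis using that 2 by blast
      qed
    qed
    have l: "rep l < K" "rb (rep l) = rb i" using rep[OF ij(1)] ij by auto
    have ij': "inv_into UNIV \<pi> j < K" "rb (inv_into UNIV \<pi> j) = cb j" using pi_inv[OF ij(2)] by auto
    have k: "rep k < K" "rb (rep k) = cb j" using rep[OF ij'(1)] ij' ij by auto
    have pi: "\<pi> i < K" "cb (\<pi> i) = rb i" using pi_less[OF ij(1)] cb_pi[OF ij(1)] by auto
    have "v (rep l) * w (\<pi> i) \<le> 1 / c" using bb[OF A l(1) pi(1)] l pi by simp
    moreover have "c \<le> v i * w (\<pi> i)" using bb[OF A ij(1) pi(1)] pi by simp
    then have "1 / c \<le> v i * w (\<pi> i) / (c * c)" using c by (simp add: field_simps)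
    ultimately have "v (rep l) * w (\<pi> i) \<le> (v i / (c * c)) * w (\<pi> i)" by simp
    then have 1: "v (rep l) \<le> v i / (c * c)" using f(4)[OF pi(1)] by (simp only: mult_le_cancel_right_pos)
    have 2: "1 \<le> v (rep k) * w j / c" using bb[OF A k(1) ij(2) k(2)] c by (simp add: field_simps)
    have p0: "pw x \<tau> > 0" unfolding pw_def using A by simp
    have "v (rep l) * pw x \<tau> \<le> (v i / (c * c)) * pw x \<tau>" using 1 p0 by (intro mult_right_mono) auto
    also have "\<dots> = (v i / (c * c)) * pw x \<tau> * 1" by simp
    also have "\<dots> \<le> (v i / (c * c)) * pw x \<tau> * (v (rep k) * w j / c)"
      using 2 p0 f(3)[OF ij(1)] c by (intro mult_left_mono) auto
    also have "\<dots> = (v i * w j * pw x \<tau> * \<mu>) * (C * v (rep k))" unfolding C_def using c \<mu> by (simp add: field_simps)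
    also have "\<dots> \<le> Y * (C * v (rep k))" using le C f(3)[OF k(1)] by (intro mult_right_mono) auto
    finally show ?thesis unfolding Y_def y_def by (simp add: mult_ac)
  qed
  then show ?thesis using C by blast
qed

text \<open>Product of the arc inequalities: the potentials of inner vertices cancel, and every
  \<open>Prec\<close> arc leaves one factor \<open>\<tau>\<close>.\<close>

lemma walk_upper:
  assumes arc: "\<And>l x k. (l, x, k) \<in> arcs gr \<Longrightarrow> U l * pw x \<tau> \<le> B * U k" and B: "B \<ge> 0" and t: "\<tau> > 0"
  shows "set p \<subseteq> arcs gr \<Longrightarrow> pre_digraph.cas gr u p v \<Longrightarrow> U u * \<tau> ^ prec_count p \<le> B ^ length p * U v"
proof (induction p arbitrary: u)
  case Nil
  then show ?case by (simp add: pre_digraph.cas.simps prec_count_def)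
next
  case (Cons e p)
  obtain l x k where e: "e = (l, x, k)" by (cases e) auto
  have l: "l = u" and c: "pre_digraph.cas gr k p v" using Cons.prems unfolding e pre_digraph.cas.simps gr_simps by auto
  have IH: "U k * \<tau> ^ prec_count p \<le> B ^ length p * U v" using Cons c by auto
  have "\<tau> ^ prec_count (e # p) = pw x \<tau> * \<tau> ^ prec_count p" unfolding prec_count_def pw_def e by simp
  then have "U u * \<tau> ^ prec_count (e # p) = U l * pw x \<tau> * \<tau> ^ prec_count p" by (simp add: l)
  also have "\<dots> \<le> B * U k * \<tau> ^ prec_count p" using arc[of l x k] Cons.prems e t by (intro mult_right_mono) auto
  also have "\<dots> = B * (U k * \<tau> ^ prec_count p)" by simp
  also have "\<dots> \<le> B * (B ^ length p * U v)" by (rule mult_left_mono[OF IH B])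
  finally show ?case by (simp add: mult_ac)
qed

lemma walk_lower:
  assumes arc: "\<And>l x k. (l, x, k) \<in> E \<Longrightarrow> B * U k \<le> U l * pw x \<tau>" and B: "B \<ge> 0" and t: "\<tau> > 0"
  shows "set p \<subseteq> E \<Longrightarrow> pre_digraph.cas gr u p v \<Longrightarrow> B ^ length p * U v \<le> U u * \<tau> ^ prec_count p"
proof (induction p arbitrary: u)
  case Nil
  then show ?case by (simp add: pre_digraph.cas.simps prec_count_def)
next
  case (Cons e p)
  obtain l x k where e: "e = (l, x, k)" by (cases e) auto
  have l: "l = u" and c: "pre_digraph.cas gr k p v" using Cons.prems unfolding e pre_digraph.cas.simps gr_simps by auto
  have IH: "B ^ length p * U v \<le> U k * \<tau> ^ prec_count p" using Cons c by auto
  have "B ^ length (e # p) * U v = B * (B ^ length p * U v)" by simp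
  also have "\<dots> \<le> B * (U k * \<tau> ^ prec_count p)" by (rule mult_left_mono[OF IH B])
  also have "\<dots> = B * U k * \<tau> ^ prec_count p" by simp
  also have "\<dots> \<le> U l * pw x \<tau> * \<tau> ^ prec_count p" using arc[of l x k] Cons.prems e t by (intro mult_right_mono) auto
  also have "\<dots> = U u * \<tau> ^ prec_count (e # p)" unfolding prec_count_def pw_def e l by simp
  finally show ?case .
qed

lemma relpow_walk:
  "(u, v) \<in> {(l, k). \<exists>x. (l, x, k) \<in> E} ^^ n \<Longrightarrow> \<exists>p. set p \<subseteq> E \<and> length p = n \<and> pre_digraph.cas gr u p v"
proof (induction n arbitrary: u)
  case 0
  then show ?case by (intro exI[of _ "[]"]) (simp add: pre_digraph.cas.simps)
next
  case (Suc n)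
  from relpow_Suc_D2[OF Suc.prems] obtain m where m: "(u, m) \<in> {(l, k). \<exists>x. (l, x, k) \<in> E}"
    "(m, v) \<in> {(l, k). \<exists>x. (l, x, k) \<in> E} ^^ n" by blast
  then obtain x p where "(u, x, m) \<in> E" "set p \<subseteq> E" "length p = n" "pre_digraph.cas gr m p v" using Suc.IH by blast
  then show ?case by (intro exI[of _ "(u, x, m) # p"]) (simp add: pre_digraph.cas.simps gr_simps)
qed

section \<open>Cycles and the exponent of the total defect\<close>

definition cyc :: "(nat \<times> edge_label \<times> nat) list \<Rightarrow> bool" where
  "cyc p \<longleftrightarrow> (\<exists>u. pre_digraph.awalk gr u p u) \<and> p \<noteq> []"

definition ratio :: "(nat \<times> edge_label \<times> nat) list \<Rightarrow> real" where
  "ratio p = real (prec_count p) / real (length p)"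

lemma cyc_iff: "cyc p \<longleftrightarrow> (\<exists>u<L. set p \<subseteq> arcs gr \<and> pre_digraph.cas gr u p u) \<and> p \<noteq> []"
  unfolding cyc_def pre_digraph.awalk_def by (auto simp: gr_simps)

lemma cycle_start:
  assumes "set p \<subseteq> arcs gr" "pre_digraph.cas gr u p u" "p \<noteq> []" shows "\<exists>i<K. u = rb i"
proof (cases p)
  case (Cons e p')
  obtain l x k where e: "e = (l, x, k)" by (cases e) auto
  have "l = u" using assms(2) unfolding Cons e pre_digraph.cas.simps gr_simps by auto
  moreover have "(l, x, k) \<in> arcs gr" using assms(1) Cons e by auto
  ultimately show ?thesis unfolding gr_simps by auto
qed (use assms in auto)

text \<open>On a closed walk the potentials at the two ends agree and cancel. The constant is that
  of a single arc, whatever the length of the cycle, because the root of order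
  \<open>length p\<close> is taken.\<close>

lemma cycle_lower:
  "\<exists>C>0. \<forall>\<tau> p. 0 < \<tau> \<longrightarrow> \<tau> < \<tau>0 \<longrightarrow> cyc p \<longrightarrow> \<tau> powr ratio p \<le> C * total_defect \<tau>"
proof -
  obtain C where C: "C > 0" and arc: "\<And>\<tau> v w l x k. sol K s \<tau> 0 v w \<Longrightarrow> 0 < \<tau> \<Longrightarrow> \<tau> < \<tau>0 \<Longrightarrow> (l, x, k) \<in> arcs gr \<Longrightarrow>
    v (rep l) * pw x \<tau> \<le> C * (\<Sum>i<K. defect K s \<tau> 0 v w i) * v (rep k)" using arc_upper by blast
  have "\<tau> powr ratio p \<le> C * total_defect \<tau>" if t: "0 < \<tau>" "\<tau> < \<tau>0" and p: "cyc p" for \<tau> p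
  proof -
    have S: "sol K s \<tau> 0 (sv \<tau> 0) (sw \<tau> 0)" using bal_zero[OF t] unfolding bal_def by auto
    note f = sol_facts[OF S t(1) order_refl]
    have Y0: "total_defect \<tau> \<ge> 0" unfolding total_defect_def using f(8) by (intro sum_nonneg) (auto intro: less_imp_le)
    obtain u where u: "set p \<subseteq> arcs gr" "pre_digraph.cas gr u p u" "p \<noteq> []" using p unfolding cyc_iff by blast
    obtain i where i: "i < K" "u = rb i" using cycle_start[OF u] by blast
    have "sv \<tau> 0 (rep u) * \<tau> ^ prec_count p \<le> (C * total_defect \<tau>) ^ length p * sv \<tau> 0 (rep u)"
      by (rule walk_upper[where U = "\<lambda>l. sv \<tau> 0 (rep l)"])
        (use arc[OF S t] u t C Y0 in \<open>auto simp: total_defect_def\<close>)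
    moreover have "sv \<tau> 0 (rep u) > 0" using f(3) rep[OF i(1)] i by auto
    ultimately have "\<tau> ^ prec_count p \<le> (C * total_defect \<tau>) ^ length p" by (simp add: mult.commute)
    then show ?thesis unfolding ratio_def using t u C Y0 by (intro real_powr_ratio_le(1)) auto
  qed
  then show ?thesis using C by blast
qed

text \<open>The edge of maximal defect lies on a cycle all of whose edges carry a comparable amount of
  mass, because otherwise the set of blocks reachable along such edges would violate conservation.\<close>

lemma cycle_upper:
  "\<exists>C>0. \<forall>\<tau>. 0 < \<tau> \<longrightarrow> \<tau> < \<tau>0 \<longrightarrow> (\<exists>p. cyc p \<and> length p \<le> L * L + 1 \<and> total_defect \<tau> \<le> C * \<tau> powr ratio p)"
proof -
  obtain c where c: "c > 0" "c \<le> 1" and bb: "\<And>\<tau> v w i j. sol K s \<tau> 0 v w \<Longrightarrow> 0 < \<tau> \<Longrightarrow> \<tau> < \<tau>0 \<Longrightarrow>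
    i < K \<Longrightarrow> j < K \<Longrightarrow> rb i = cb j \<Longrightarrow> c \<le> v i * w j \<and> v i * w j \<le> 1 / c" using block_bounds by blast
  \<comment> \<open>At most \<open>K * K\<close> entries and \<open>K\<close> defects can leave a
    set of blocks. If each stays below \<open>\<delta> * y i0\<close>, together they stay strictly
    below \<open>y i0\<close>, the mass that the arc of maximal defect would bring in.\<close>
  define \<delta> where "\<delta> = 1 / (real K * K + K)"
  have \<delta>: "\<delta> > 0" unfolding \<delta>_def using K_pos by (simp add: add_pos_pos)
  \<comment> \<open>The 2 comes from \<open>1 - y \<ge> 1 / 2\<close>, the factor
    \<open>K / \<delta>\<close> from \<open>Y \<le> K * y i0\<close> and the threshold
    \<open>\<delta> * y i0\<close>, and the three factors \<open>1 / c\<close> from passing to the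
    potentials of the blocks.\<close>
  define C where "C = 2 * K / \<delta> * (1 / (c * c * c))"
  have C: "C > 0" unfolding C_def using c \<delta> K_pos by simp
  have "\<exists>p. cyc p \<and> length p \<le> L * L + 1 \<and> total_defect \<tau> \<le> C * \<tau> powr ratio p" if t: "0 < \<tau>" "\<tau> < \<tau>0" for \<tau>
  proof -
    define v where "v = sv \<tau> 0" define w where "w = sw \<tau> 0"
    have S: "sol K s \<tau> 0 v w" unfolding v_def w_def using bal_zero[OF t] unfolding bal_def by auto
    note f = sol_facts[OF S t(1) order_refl]
    define y where "y = defect K s \<tau> 0 v w"
    define T where "T = (\<lambda>i j. v i * s i j * w j)"
    define Y where "Y = total_defect \<tau>"
    have Ysum: "Y = (\<Sum>i<K. y i)" unfolding Y_def total_defect_def y_def v_def w_def ..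
    have y: "0 < y i" "y i < 1" if "i < K" for i using f(8,9)[OF that] unfolding y_def by auto
    have T0: "T k l \<ge> 0" if "k < K" "l < K" for k l
      unfolding T_def by (intro mult_nonneg_nonneg s_nonneg less_imp_le[OF f(3)] less_imp_le[OF f(4)] that)
    have "Max (y ` {..<K}) \<in> y ` {..<K}" by (rule Max_in) (use K_pos in auto)
    then obtain i0 where i0: "i0 < K" "y i0 = Max (y ` {..<K})" by auto
    have ymax: "y i \<le> y i0" if "i < K" for i using i0(2) that by auto
    have "Y \<le> (\<Sum>i<K. y i0)" unfolding Ysum by (intro sum_mono ymax) auto
    then have YK: "Y \<le> K * y i0" by simp
    have half: "y i \<le> 1 / 2" if "i < K" for i
    proof -
      have "y i \<le> (\<Sum>i<K. y i)" using that y by (intro member_le_sum) (auto intro: less_imp_le)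
      also have "\<dots> \<le> 1 / 2" using defect_half[OF S t order_refl zero_le_one] unfolding y_def .
      finally show ?thesis .
    qed
    define E where "E = {(rb i, Lhd, cb j) | i j. i < K \<and> j < K \<and> rb i \<noteq> cb j \<and> T i j \<ge> \<delta> * y i0} \<union>
      {(rb i, Prec, cb i) | i. i < K \<and> y i \<ge> \<delta> * y i0}"
    define Rel where "Rel = {(l, k). \<exists>x. (l, x, k) \<in> E}"
    have relT: "(rb i, cb j) \<in> Rel" if "i < K" "j < K" "rb i \<noteq> cb j" "T i j \<ge> \<delta> * y i0" for i j
    proof -
      have "(rb i, Lhd, cb j) \<in> E" unfolding E_def using that by blast
      then show ?thesis unfolding Rel_def by (intro CollectI case_prodI exI)
    qed
    have rely: "(rb i, cb i) \<in> Rel" if "i < K" "y i \<ge> \<delta> * y i0" for i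
    proof -
      have "(rb i, Prec, cb i) \<in> E" unfolding E_def using that by blast
      then show ?thesis unfolding Rel_def by (intro CollectI case_prodI exI)
    qed
    have dy: "\<delta> * y i0 > 0" using \<delta> y[OF i0(1)] by simp
    have EA: "E \<subseteq> arcs gr"
    proof
      fix e assume "e \<in> E"
      then consider i j where "i < K" "j < K" "rb i \<noteq> cb j" "T i j \<ge> \<delta> * y i0" "e = (rb i, Lhd, cb j)"
        | i where "i < K" "e = (rb i, Prec, cb i)" unfolding E_def by auto
      then show "e \<in> arcs gr"
      proof cases
        case (1 i j)
        then have "T i j > 0" using dy by linarith
        then have "s i j \<noteq> 0" unfolding T_def by auto
        then have "s i j > 0" using s_nonneg[of i j] by simp
        then show ?thesis using 1 unfolding gr_simps by auto
      qed (auto simp: gr_simps)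
    qed
    have RelL: "Rel \<subseteq> {..<L} \<times> {..<L}" unfolding Rel_def E_def using rb_less cb_less by auto
    have finR: "finite Rel" by (rule finite_subset[OF RelL]) auto
    have cardR: "card Rel \<le> L * L" using card_mono[OF _ RelL] by (simp add: card_cartesian_product)
    have reach: "(cb i0, rb i0) \<in> Rel\<^sup>*"
    proof (rule ccontr)
      assume nr: "(cb i0, rb i0) \<notin> Rel\<^sup>*"
      define R where "R = Rel\<^sup>* `` {cb i0}"
      define r where "r = (\<lambda>R i. of_bool (rb i \<in> R) :: real)"
      define q where "q = (\<lambda>R i. of_bool (cb i \<in> R) :: real)"
      have rq: "0 \<le> r R k" "r R k \<le> 1" "0 \<le> q R k" "q R k \<le> 1" for k unfolding r_def q_def by auto
      have cl: "k \<in> R" if "l \<in> R" "(l, k) \<in> Rel" for l k using that unfolding R_def by (auto intro: rtrancl_into_rtrancl)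
      have "y i0 = (1 - r R i0) * q R i0 * y i0" using nr unfolding r_def q_def R_def by auto
      also have "\<dots> \<le> (\<Sum>i<K. (1 - r R i) * q R i * y i)"
        using i0 less_imp_le[OF y(1)] rq by (intro member_le_sum[of i0 "{..<K}" "\<lambda>i. (1 - r R i) * q R i * y i"]) (auto intro!: mult_nonneg_nonneg)
      also have "\<dots> \<le> (\<Sum>i<K. \<Sum>j<K. (1 - r R i) * q R j * T i j) + (\<Sum>i<K. (1 - r R i) * q R i * y i)"
        using T0 rq by (auto intro!: sum_nonneg mult_nonneg_nonneg)
      also have "\<dots> = (\<Sum>i<K. \<Sum>j<K. r R i * (1 - q R j) * T i j) + (\<Sum>i<K. r R i * (1 - q R i) * y i)"
        using conservation[OF S t(1), of R] unfolding y_def T_def r_def q_def by simp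
      also have "\<dots> < (\<Sum>i<K. \<Sum>j<K. \<delta> * y i0) + (\<Sum>i<K. \<delta> * y i0)"
      proof (rule add_strict_mono)
        have ne: "{..<K} \<noteq> {}" using K_pos by auto
        show "(\<Sum>i<K. \<Sum>j<K. r R i * (1 - q R j) * T i j) < (\<Sum>i<K. \<Sum>j<K. \<delta> * y i0)"
        proof (intro sum_strict_mono ne finite_lessThan)
          fix i j assume "i \<in> {..<K}" "j \<in> {..<K}"
          then have ij: "i < K" "j < K" by auto
          show "r R i * (1 - q R j) * T i j < \<delta> * y i0"
          proof (cases "rb i \<in> R \<and> cb j \<notin> R")
            case True
            then have "(rb i, cb j) \<notin> Rel" using cl by blast
            moreover have "rb i \<noteq> cb j" using True by auto
            ultimately have "\<not> T i j \<ge> \<delta> * y i0" using relT[OF ij] by blast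
            then show ?thesis using True unfolding r_def q_def by simp
          qed (use dy in \<open>auto simp: r_def q_def\<close>)
        qed
        show "(\<Sum>i<K. r R i * (1 - q R i) * y i) < (\<Sum>i<K. \<delta> * y i0)"
        proof (intro sum_strict_mono ne finite_lessThan)
          fix i assume "i \<in> {..<K}"
          then have i: "i < K" by auto
          show "r R i * (1 - q R i) * y i < \<delta> * y i0"
          proof (cases "rb i \<in> R \<and> cb i \<notin> R")
            case True
            then have "(rb i, cb i) \<notin> Rel" using cl by blast
            then have "\<not> y i \<ge> \<delta> * y i0" using rely[OF i] by blast
            then show ?thesis using True unfolding r_def q_def by simp
          qed (use dy in \<open>auto simp: r_def q_def\<close>)
        qed
      qed
      also have "\<dots> = (real K * K + K) * \<delta> * y i0" by (simp add: algebra_simps)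
      also have "(real K * K + K) * \<delta> = 1" unfolding \<delta>_def using K_pos by (simp add: add_pos_pos less_imp_neq[symmetric])
      finally show False by simp
    qed
    \<comment> \<open>A connecting path no longer than the number of edges of \<open>Rel\<close>;
      together with the arc of \<open>i0\<close> that closes it, this bounds the cycle by
      \<open>L * L + 1\<close>, uniformly in \<open>\<tau>\<close>.\<close>
    then obtain n where n: "n \<le> card Rel" "(cb i0, rb i0) \<in> Rel ^^ n"
      unfolding rtrancl_finite_eq_relpow[OF finR] by auto
    obtain p where p: "set p \<subseteq> E" "length p = n" "pre_digraph.cas gr (cb i0) p (rb i0)"
      using relpow_walk n(2) unfolding Rel_def by blast
    define \<gamma> where "\<gamma> = (rb i0, Prec, cb i0) # p"
    have "\<delta> * y i0 \<le> 1 * y i0"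
    proof (rule mult_right_mono)
      have "1 \<le> real K * K + K" using K_pos by (cases K) auto
      then show "\<delta> \<le> 1" unfolding \<delta>_def by simp
    qed (use y[OF i0(1)] in simp)
    then have e0: "(rb i0, Prec, cb i0) \<in> E" unfolding E_def using i0(1) by auto
    have \<gamma>: "set \<gamma> \<subseteq> E" "pre_digraph.cas gr (rb i0) \<gamma> (rb i0)" "\<gamma> \<noteq> []" "length \<gamma> \<le> L * L + 1"
      unfolding \<gamma>_def using p e0 n cardR by (auto simp: pre_digraph.cas.simps gr_simps)
    have cy: "cyc \<gamma>" unfolding cyc_iff using \<gamma> EA rb_less[OF i0(1)] by blast
    have arc: "Y / C * v (rep k) \<le> v (rep l) * pw x \<tau>" if e: "(l, x, k) \<in> E" for l x k
    proof -
      obtain i j where ij: "i < K" "j < K" "l = rb i" "k = cb j" and le: "\<delta> * y i0 \<le> 2 * (v i * w j * pw x \<tau>)"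
      proof -
        from e consider i j where "i < K" "j < K" "T i j \<ge> \<delta> * y i0" "l = rb i" "x = Lhd" "k = cb j"
          | i where "i < K" "l = rb i" "x = Prec" "k = cb i" "y i \<ge> \<delta> * y i0" unfolding E_def by auto
        then show thesis
        proof cases
          case (1 i j)
          have vw: "v i * w j \<ge> 0" using f(3)[OF 1(1)] f(4)[OF 1(2)] by simp
          have "T i j = v i * w j * s i j" unfolding T_def by simp
          also have "\<dots> \<le> v i * w j * 1" using vw s_le_1 by (intro mult_left_mono) auto
          finally have "\<delta> * y i0 \<le> 2 * (v i * w j * pw x \<tau>)" using 1(3,5) vw unfolding pw_def by simp
          then show thesis using that 1 by blast
        next
          case (2 i)
          have "(1 / 2) * y i \<le> (1 - y i) * y i" using half[OF 2(1)] y[OF 2(1)] by (intro mult_right_mono) auto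
          also have "\<dots> = \<tau> * (v i * w i)" using f(7)[OF 2(1)] unfolding y_def by simp
          finally have "y i \<le> 2 * (\<tau> * (v i * w i))" by linarith
          moreover have "2 * (v i * w i * pw x \<tau>) = 2 * (\<tau> * (v i * w i))" unfolding pw_def 2(3) by simp
          ultimately have "\<delta> * y i0 \<le> 2 * (v i * w i * pw x \<tau>)" using 2(5) by linarith
          then show thesis using that 2 by blast
        qed
      qed
      have l: "rep l < K" "rb (rep l) = rb i" using rep[OF ij(1)] ij by auto
      have ij': "inv_into UNIV \<pi> j < K" "rb (inv_into UNIV \<pi> j) = cb j" using pi_inv[OF ij(2)] by auto
      have k: "rep k < K" "rb (rep k) = cb j" using rep[OF ij'(1)] ij' ij by auto
      have pi: "\<pi> i < K" "cb (\<pi> i) = rb i" using pi_less[OF ij(1)] cb_pi[OF ij(1)] by auto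
      have "v i * w (\<pi> i) \<le> 1 / c" using bb[OF S t ij(1) pi(1)] pi by simp
      moreover have "c \<le> v (rep l) * w (\<pi> i)" using bb[OF S t l(1) pi(1)] l pi by simp
      then have "1 / c \<le> v (rep l) * w (\<pi> i) / (c * c)" using c by (simp add: field_simps)
      ultimately have "v i * w (\<pi> i) \<le> (v (rep l) / (c * c)) * w (\<pi> i)" by simp
      then have 1: "v i \<le> v (rep l) / (c * c)" using f(4)[OF pi(1)] by (simp only: mult_le_cancel_right_pos)
      have 2: "v (rep k) * w j \<le> 1 / c" using bb[OF S t k(1) ij(2) k(2)] by simp
      have p0: "pw x \<tau> > 0" unfolding pw_def using t by simp
      have "Y \<le> K / \<delta> * (\<delta> * y i0)" using YK \<delta> by simp
      also have "\<dots> \<le> K / \<delta> * (2 * (v i * w j * pw x \<tau>))" using le \<delta> by (intro mult_left_mono) auto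
      finally have Y2: "Y \<le> 2 * K / \<delta> * (v i * w j * pw x \<tau>)" by (simp add: mult_ac)
      have "Y * v (rep k) \<le> 2 * K / \<delta> * (v i * w j * pw x \<tau>) * v (rep k)"
        using Y2 f(3)[OF k(1)] by (intro mult_right_mono) auto
      also have "\<dots> = 2 * K / \<delta> * (v i * pw x \<tau>) * (v (rep k) * w j)" by (simp add: mult_ac)
      also have "\<dots> \<le> 2 * K / \<delta> * (v i * pw x \<tau>) * (1 / c)"
        using 2 \<delta> p0 f(3)[OF ij(1)] by (intro mult_left_mono mult_nonneg_nonneg) auto
      also have "\<dots> \<le> 2 * K / \<delta> * (v (rep l) / (c * c) * pw x \<tau>) * (1 / c)"
        using 1 \<delta> p0 c by (intro mult_right_mono mult_left_mono) auto
      also have "\<dots> = C * (v (rep l) * pw x \<tau>)" unfolding C_def by simp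
      finally show ?thesis using C by (simp add: field_simps)
    qed
    have Y0: "Y \<ge> 0" unfolding Ysum using y by (intro sum_nonneg) (auto intro: less_imp_le)
    have "(Y / C) ^ length \<gamma> * v (rep (rb i0)) \<le> v (rep (rb i0)) * \<tau> ^ prec_count \<gamma>"
      by (rule walk_lower[where U = "\<lambda>l. v (rep l)" and E = E]) (use arc Y0 C t \<gamma> in auto)
    moreover have "v (rep (rb i0)) > 0" using f(3) rep[OF i0(1)] by auto
    ultimately have "(Y / C) ^ length \<gamma> \<le> \<tau> ^ prec_count \<gamma>" by (simp add: mult.commute)
    then have "Y / C \<le> \<tau> powr ratio \<gamma>" unfolding ratio_def using Y0 C t \<gamma> by (intro real_powr_ratio_le(2)) auto
    then have "Y \<le> C * \<tau> powr ratio \<gamma>" using C by (simp add: field_simps)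
    then show ?thesis using cy \<gamma>(4) unfolding Y_def by blast
  qed
  then show ?thesis using C by blast
qed

text \<open>By triangularity \<open>Lhd\<close> arcs strictly increase the block index, so a closed
  walk cannot do without \<open>Prec\<close>.\<close>

lemma prec_count_pos:
  "set p \<subseteq> arcs gr \<Longrightarrow> pre_digraph.cas gr u p v \<Longrightarrow> p \<noteq> [] \<Longrightarrow> prec_count p = 0 \<Longrightarrow> u < v"
proof (induction p arbitrary: u)
  case (Cons e p)
  obtain l x k where e: "e = (l, x, k)" by (cases e) auto
  have l: "l = u" and c: "pre_digraph.cas gr k p v" using Cons.prems unfolding e pre_digraph.cas.simps gr_simps by auto
  have x: "x \<noteq> Prec" "prec_count p = 0" using Cons.prems(4) unfolding e prec_count_def by (auto split: if_splits)
  have "(l, x, k) \<in> arcs gr" using Cons.prems e by auto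
  then have "l < k" using x triangular unfolding gr_simps by (auto simp: order_less_le)
  moreover have "k = v \<or> k < v"
    using Cons.IH[OF _ c _ x(2)] Cons.prems(1) c by (cases "p = []") (auto simp: pre_digraph.cas.simps)
  ultimately show ?case using l by auto
qed simp

lemma prec_count_le: "prec_count p \<le> length p" unfolding prec_count_def by simp

text \<open>The two-sided bounds identify the minimal ratio over short cycles as the least ratio of all
  cycles, since both are the exponent of the total defect.\<close>

theorem total_defect_exponent:
  "\<exists>C>0. \<exists>p. cyc p \<and> min_cycle_ratio gr = ratio p \<and>
    (\<forall>\<tau>. 0 < \<tau> \<longrightarrow> \<tau> < \<tau>0 \<longrightarrow> \<tau> powr ratio p \<le> C * total_defect \<tau> \<and> total_defect \<tau> \<le> C * \<tau> powr ratio p)"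
proof -
  obtain C1 where C1: "C1 > 0" and lo: "\<And>\<tau> p. 0 < \<tau> \<Longrightarrow> \<tau> < \<tau>0 \<Longrightarrow> cyc p \<Longrightarrow> \<tau> powr ratio p \<le> C1 * total_defect \<tau>"
    using cycle_lower by blast
  obtain C2 where C2: "C2 > 0" and up: "\<And>\<tau>. 0 < \<tau> \<Longrightarrow> \<tau> < \<tau>0 \<Longrightarrow>
    \<exists>p. cyc p \<and> length p \<le> L * L + 1 \<and> total_defect \<tau> \<le> C2 * \<tau> powr ratio p" using cycle_upper by blast
  \<comment> \<open>Short cycles have finitely many ratios, so a best one exists before anything is
    known about long cycles. This also makes the choice independent of
    \<open>\<tau>\<close>.\<close>
  define W where "W = ratio ` {p. cyc p \<and> length p \<le> L * L + 1}"
  have "W \<subseteq> (\<lambda>(m, n). real m / real n) ` ({..L * L + 1} \<times> {..L * L + 1})"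
  proof
    fix x assume "x \<in> W"
    then obtain p where p: "length p \<le> L * L + 1" "x = ratio p" unfolding W_def by auto
    then show "x \<in> (\<lambda>(m, n). real m / real n) ` ({..L * L + 1} \<times> {..L * L + 1})"
      using prec_count_le[of p] unfolding ratio_def by (intro image_eqI[of _ _ "(prec_count p, length p)"]) auto
  qed
  then have fW: "finite W" by (rule finite_subset) auto
  have "\<tau>0 / 2 > 0" "\<tau>0 / 2 < \<tau>0" using \<tau>0 by auto
  from up[OF this] have neW: "W \<noteq> {}" unfolding W_def by blast
  have "Min W \<in> W" by (rule Min_in[OF fW neW])
  then obtain p where p: "cyc p" "ratio p = Min W" unfolding W_def by auto
  have up': "total_defect \<tau> \<le> C2 * \<tau> powr ratio p" if t: "0 < \<tau>" "\<tau> < \<tau>0" for \<tau>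
  proof -
    obtain p' where p': "cyc p'" "length p' \<le> L * L + 1" "total_defect \<tau> \<le> C2 * \<tau> powr ratio p'" using up[OF t] by blast
    have "ratio p \<le> ratio p'" unfolding p(2) using fW p' by (intro Min_le) (auto simp: W_def)
    then have "\<tau> powr ratio p' \<le> \<tau> powr ratio p" using t \<tau>0 by (intro powr_mono') auto
    then have "C2 * \<tau> powr ratio p' \<le> C2 * \<tau> powr ratio p" using C2 by (intro mult_left_mono) auto
    then show ?thesis using p'(3) by linarith
  qed
  have least: "ratio p \<le> ratio p'" if p': "cyc p'" for p'
  proof (rule ccontr)
    \<comment> \<open>For a cycle with smaller ratio the lower bound it provides and the upper bound
      from \<open>p\<close> would keep \<open>\<tau> powr d\<close> bounded as \<open>\<tau>\<close>
      tends to 0, although \<open>d\<close> is negative.\<close>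
    define d where "d = ratio p' - ratio p"
    assume "\<not> ?thesis"
    then have d: "d < 0" unfolding d_def by simp
    have "filterlim (\<lambda>\<tau>::real. \<tau> powr d) at_top (at_right 0)" using d by real_asymp
    then have "\<forall>\<^sub>F \<tau>::real in at_right 0. \<tau> powr d > C1 * C2" unfolding filterlim_at_top_dense by blast
    moreover have "\<forall>\<^sub>F \<tau> in at_right 0. \<tau> \<in> {0<..<\<tau>0}" by (rule eventually_at_right_real) (use \<tau>0 in auto)
    ultimately have "\<forall>\<^sub>F \<tau>::real in at_right 0. False"
    proof eventually_elim
      case (elim \<tau>)
      then have t: "0 < \<tau>" "\<tau> < \<tau>0" by auto
      have "\<tau> powr ratio p' \<le> C1 * (C2 * \<tau> powr ratio p)"
        using lo[OF t p'] mult_left_mono[OF up'[OF t], of C1] C1 by linarith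
      moreover have "\<tau> powr ratio p' = \<tau> powr d * \<tau> powr ratio p" unfolding d_def by (simp flip: powr_add)
      ultimately have "\<tau> powr d * \<tau> powr ratio p \<le> (C1 * C2) * \<tau> powr ratio p" by simp
      moreover have "\<tau> powr ratio p > 0" using t by simp
      ultimately have "\<tau> powr d \<le> C1 * C2" by (simp only: mult_le_cancel_right_pos)
      then show False using elim(1) by simp
    qed
    then show False by simp
  qed
  have "min_cycle_ratio gr = ratio p" unfolding min_cycle_ratio_def
  proof (rule Least_equality)
    show "\<exists>\<gamma>. (\<exists>u. pre_digraph.awalk gr u \<gamma> u) \<and> \<gamma> \<noteq> [] \<and> ratio p = real (prec_count \<gamma>) / real (length \<gamma>)"
      using p(1) unfolding cyc_def ratio_def by blast
    fix r assume "\<exists>\<gamma>. (\<exists>u. pre_digraph.awalk gr u \<gamma> u) \<and> \<gamma> \<noteq> [] \<and> r = real (prec_count \<gamma>) / real (length \<gamma>)"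
    then obtain \<gamma> where "cyc \<gamma>" "r = ratio \<gamma>" unfolding cyc_def ratio_def by blast
    then show "ratio p \<le> r" using least by simp
  qed
  moreover have "\<tau> powr ratio p \<le> (C1 + C2) * total_defect \<tau> \<and> total_defect \<tau> \<le> (C1 + C2) * \<tau> powr ratio p"
    if t: "0 < \<tau>" "\<tau> < \<tau>0" for \<tau>
  proof -
    have Y: "0 \<le> C1 * total_defect \<tau>" using lo[OF t p(1)] powr_ge_zero order_trans by blast
    then have "0 \<le> total_defect \<tau>" using C1 by (simp add: zero_le_mult_iff)
    then have "0 \<le> C2 * total_defect \<tau>" "0 \<le> C1 * \<tau> powr ratio p" using C1 C2 by auto
    then show ?thesis using lo[OF t p(1)] up'[OF t] by (simp add: distrib_right)
  qed
  ultimately show ?thesis using p(1) C1 C2 by (intro exI[of _ "C1 + C2"]) (auto intro: add_pos_pos)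
qed

theorem mass_exponent:
  assumes S: "S \<in> carrier_mat K K" "\<And>i j. i < K \<Longrightarrow> j < K \<Longrightarrow> s i j = S $$ (i, j)"
  defines "\<kappa> \<equiv> min_cycle_ratio gr"
  shows "((\<lambda>t. ln (LINT z:cball 0 t|lborel. scdos S z) / ln t) \<longlongrightarrow> 2 * \<kappa>) (at_right 0)"
    and "\<exists>l1 l2 :: nat. \<kappa> = (1 + real l1) / (1 + real l1 + real l2)"
proof -
  obtain C p where C: "C > 0" and p: "cyc p" "\<kappa> = ratio p" and b: "\<And>\<tau>. 0 < \<tau> \<Longrightarrow> \<tau> < \<tau>0 \<Longrightarrow>
    \<tau> powr \<kappa> \<le> C * total_defect \<tau> \<and> total_defect \<tau> \<le> C * \<tau> powr \<kappa>"
    using total_defect_exponent unfolding \<kappa>_def by metis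
  define c1 where "c1 = ln (1 / (C * K))"
  define c2 where "c2 = ln (C / K)"
  have ev: "\<forall>\<^sub>F t in at_right 0. t \<in> {0<..<sqrt \<tau>0}" by (rule eventually_at_right_real) (use \<tau>0 in auto)
  have bounds: "c1 + 2 * \<kappa> * ln t \<le> ln (LINT z:cball 0 t|lborel. scdos S z) \<and>
      ln (LINT z:cball 0 t|lborel. scdos S z) \<le> c2 + 2 * \<kappa> * ln t \<and> ln t < 0" if t: "t \<in> {0<..<sqrt \<tau>0}" for t
  proof -
    have t0: "0 < t" "t < sqrt \<tau>0" using t by auto
    then have "t\<^sup>2 < (sqrt \<tau>0)\<^sup>2" by (intro power_strict_mono) auto
    then have t2: "0 < t\<^sup>2" "t\<^sup>2 < \<tau>0" using t0 \<tau>0 by auto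
    have "sqrt \<tau>0 < 1" using \<tau>0 by simp
    then have "t < 1" using t0 by linarith
    have "ln (t\<^sup>2) = 2 * ln t" using t0 by (simp add: ln_realpow)
    then have lp: "ln ((t\<^sup>2) powr \<kappa>) = 2 * \<kappa> * ln t" using t2 by (simp add: ln_powr)
    have pp: "(t\<^sup>2) powr \<kappa> > 0" using t2 by simp
    have m: "(LINT z:cball 0 t|lborel. scdos S z) = total_defect (t\<^sup>2) / K" by (rule scdos_mass[OF S t0(1) t2(2)])
    note bt = b[OF t2]
    have Kp: "real K > 0" using K_pos by simp
    have lo: "1 / (C * K) * (t\<^sup>2) powr \<kappa> \<le> total_defect (t\<^sup>2) / K" using bt C Kp by (simp add: field_simps)
    have up: "total_defect (t\<^sup>2) / K \<le> C / K * (t\<^sup>2) powr \<kappa>" using bt C Kp by (simp add: field_simps)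
    have lo0: "0 < 1 / (C * K) * (t\<^sup>2) powr \<kappa>" using C Kp pp by simp
    have "ln (1 / (C * K) * (t\<^sup>2) powr \<kappa>) \<le> ln (total_defect (t\<^sup>2) / K)"
      using lo lo0 by (subst ln_le_cancel_iff) auto
    moreover have "ln (1 / (C * K) * (t\<^sup>2) powr \<kappa>) = c1 + 2 * \<kappa> * ln t"
      unfolding c1_def lp[symmetric] using C Kp pp by (intro ln_mult_pos) auto
    moreover have "ln (total_defect (t\<^sup>2) / K) \<le> ln (C / K * (t\<^sup>2) powr \<kappa>)"
      using lo lo0 up by (subst ln_le_cancel_iff) linarith+
    moreover have "ln (C / K * (t\<^sup>2) powr \<kappa>) = c2 + 2 * \<kappa> * ln t"
      unfolding c2_def lp[symmetric] using C Kp pp by (intro ln_mult_pos) auto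
    ultimately show ?thesis unfolding m using \<open>t < 1\<close> t0 by simp
  qed
  show "((\<lambda>t. ln (LINT z:cball 0 t|lborel. scdos S z) / ln t) \<longlongrightarrow> 2 * \<kappa>) (at_right 0)"
  proof (rule tendsto_sandwich)
    \<comment> \<open>Dividing by \<open>ln t < 0\<close> reverses inequalities, so the upper
      constant \<open>c2\<close> yields the lower bound of the quotient.\<close>
    show "((\<lambda>t. (c2 + 2 * \<kappa> * ln t) / ln t) \<longlongrightarrow> 2 * \<kappa>) (at_right 0)" by real_asymp
    show "((\<lambda>t. (c1 + 2 * \<kappa> * ln t) / ln t) \<longlongrightarrow> 2 * \<kappa>) (at_right 0)" by real_asymp
    show "\<forall>\<^sub>F t in at_right 0. (c2 + 2 * \<kappa> * ln t) / ln t \<le> ln (LINT z:cball 0 t|lborel. scdos S z) / ln t"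
      using ev
    proof eventually_elim
      case (elim t)
      show ?case using bounds[OF elim] by (intro divide_right_mono_neg) (auto simp del: ln_less_zero_iff)
    qed
    show "\<forall>\<^sub>F t in at_right 0. ln (LINT z:cball 0 t|lborel. scdos S z) / ln t \<le> (c1 + 2 * \<kappa> * ln t) / ln t"
      using ev
    proof eventually_elim
      case (elim t)
      show ?case using bounds[OF elim] by (intro divide_right_mono_neg) (auto simp del: ln_less_zero_iff)
    qed
  qed
  obtain u where u: "set p \<subseteq> arcs gr" "pre_digraph.cas gr u p u" "p \<noteq> []" using p(1) unfolding cyc_iff by blast
  have "prec_count p \<noteq> 0" using prec_count_pos[OF u] by auto
  \<comment> \<open>Witnesses from an optimal cycle: its \<open>Prec\<close> arcs, of which there is
    at least one, number \<open>l1 + 1\<close>, and its \<open>Lhd\<close> arcs number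
    \<open>l2\<close>.\<close>
  then have "\<kappa> = (1 + real (prec_count p - 1)) / (1 + real (prec_count p - 1) + real (length p - prec_count p))"
    unfolding p(2) ratio_def using prec_count_le[of p] by (simp add: of_nat_diff)
  then show "\<exists>l1 l2 :: nat. \<kappa> = (1 + real l1) / (1 + real l1 + real l2)" by blast
qed

end

section \<open>From the normal form to the block structure\<close>

text \<open>Serves twice: for the irreducibility of \<open>P\<close> and for the primitivity of the
  diagonal blocks.\<close>

lemma pow_mat_path:
  fixes R :: "real mat"
  assumes R: "R \<in> carrier_mat n n" and "i < n" "j < n" "(R ^\<^sub>m m) $$ (i, j) \<noteq> 0"
  shows "(i, j) \<in> {(i, j). i < n \<and> j < n \<and> R $$ (i, j) \<noteq> 0}\<^sup>*"
  using assms(3,4)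
proof (induction m arbitrary: j)
  case 0
  then show ?case using R assms(2) by (auto split: if_splits)
next
  case (Suc m)
  have c: "R ^\<^sub>m m \<in> carrier_mat n n" using R by (rule pow_carrier_mat)
  have "(R ^\<^sub>m Suc m) $$ (i, j) = (\<Sum>k<n. (R ^\<^sub>m m) $$ (i, k) * R $$ (k, j))"
    using c R assms(2) Suc.prems(1) by (simp add: scalar_prod_def atLeast0LessThan)
  then obtain k where "k < n" "(R ^\<^sub>m m) $$ (i, k) \<noteq> 0" "R $$ (k, j) \<noteq> 0"
    using Suc.prems(2) by (metis (no_types, lifting) lessThan_iff mult_eq_0_iff sum.neutral)
  then show ?case using Suc.IH[of k] Suc.prems(1) by (auto intro: rtrancl_into_rtrancl)
qed

lemma permutation_product:
  fixes S :: "real mat"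
  assumes S: "S \<in> carrier_mat K K" and p: "\<pi>1 permutes {..<K}" "\<pi>2 permutes {..<K}"
    and Q: "Q1 = mat K K (\<lambda>(i, j). if j = \<pi>1 i then 1 else 0)" "Q2 = mat K K (\<lambda>(i, j). if j = \<pi>2 i then 1 else 0)"
    and ab: "a < K" "b < K"
  shows "(Q1 * S * Q2\<^sup>T) $$ (a, b) = S $$ (\<pi>1 a, \<pi>2 b)"
    and "(Q1 * Q2\<^sup>T) $$ (a, b) = (if \<pi>1 a = \<pi>2 b then 1 else 0)"
proof -
  have l: "\<pi>1 a < K" "\<pi>2 b < K" using permutes_in_image[OF p(1), of a] permutes_in_image[OF p(2), of b] ab by auto
  have 1: "(Q1 * S) $$ (a, j) = S $$ (\<pi>1 a, j)" if "j < K" for j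
  proof -
    have "(Q1 * S) $$ (a, j) = (\<Sum>k<K. (if k = \<pi>1 a then 1 else 0) * S $$ (k, j))"
      using S ab that unfolding Q by (simp add: scalar_prod_def atLeast0LessThan)
    also have "\<dots> = (\<Sum>k<K. if k = \<pi>1 a then S $$ (k, j) else 0)" by (intro sum.cong) auto
    finally show ?thesis using l by simp
  qed
  have "(Q1 * S * Q2\<^sup>T) $$ (a, b) = (\<Sum>k<K. (Q1 * S) $$ (a, k) * (if k = \<pi>2 b then 1 else 0))"
    using S ab unfolding Q by (simp add: scalar_prod_def atLeast0LessThan)
  also have "\<dots> = (\<Sum>k<K. if k = \<pi>2 b then S $$ (\<pi>1 a, k) else 0)" by (intro sum.cong) (auto simp: 1)
  finally show "(Q1 * S * Q2\<^sup>T) $$ (a, b) = S $$ (\<pi>1 a, \<pi>2 b)" using l by simp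
  have "(Q1 * Q2\<^sup>T) $$ (a, b) = (\<Sum>k<K. (if k = \<pi>1 a then 1 else 0) * (if k = \<pi>2 b then 1 else 0))"
    using ab unfolding Q by (simp add: scalar_prod_def atLeast0LessThan)
  also have "\<dots> = (\<Sum>k<K. if k = \<pi>1 a then (if k = \<pi>2 b then 1 else 0) else 0)" by (intro sum.cong) auto
  finally show "(Q1 * Q2\<^sup>T) $$ (a, b) = (if \<pi>1 a = \<pi>2 b then 1 else 0)" using l by simp
qed

section \<open>Positions and consecutive blocks\<close>

definition in_block :: "nat list \<Rightarrow> nat \<Rightarrow> nat \<Rightarrow> bool" where
  "in_block bs l a \<longleftrightarrow> l < length bs \<and> sum_list (take l bs) \<le> a \<and> a < sum_list (take l bs) + bs ! l"

definition block_of :: "nat list \<Rightarrow> nat \<Rightarrow> nat" where "block_of bs a = (SOME l. in_block bs l a)"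

lemma in_block_exists: "a < sum_list bs \<Longrightarrow> \<exists>l. in_block bs l a"
proof (induction bs arbitrary: a)
  case (Cons x bs)
  show ?case
  proof (cases "a < x")
    case True
    then show ?thesis by (intro exI[of _ 0]) (simp add: in_block_def)
  next
    case False
    then have "a - x < sum_list bs" using Cons.prems by simp
    then obtain l where "in_block bs l (a - x)" using Cons.IH by blast
    then show ?thesis using False by (intro exI[of _ "Suc l"]) (auto simp: in_block_def)
  qed
qed simp

lemma in_block_unique:
  assumes "in_block bs l a" "in_block bs k a" shows "l = k"
proof -
  have "False" if "in_block bs l a" "in_block bs k a" "l < k" for l k
  proof -
    have "sum_list (take (Suc l) bs) \<le> sum_list (take k bs)"
    proof -
      have "take k bs = take (Suc l) bs @ drop (Suc l) (take k bs)"
        using append_take_drop_id[of "Suc l" "take k bs"] that(3) by (simp add: min_absorb1 Suc_le_eq)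
      then have "sum_list (take k bs) = sum_list (take (Suc l) bs) + sum_list (drop (Suc l) (take k bs))"
        by (metis sum_list_append)
      then show ?thesis by simp
    qed
    moreover have "sum_list (take (Suc l) bs) = sum_list (take l bs) + bs ! l"
      using that(1) unfolding in_block_def by (simp add: take_Suc_conv_app_nth)
    ultimately show False using that unfolding in_block_def by linarith
  qed
  then show ?thesis using assms by (metis nat_neq_iff)
qed

lemma in_block_less: "in_block bs l a \<Longrightarrow> a < sum_list bs"
proof -
  assume a: "in_block bs l a"
  then have "sum_list (take l bs) + bs ! l = sum_list (take (Suc l) bs)" unfolding in_block_def by (simp add: take_Suc_conv_app_nth)
  also have "\<dots> \<le> sum_list (take (Suc l) bs) + sum_list (drop (Suc l) bs)" by simp
  also have "\<dots> = sum_list bs" by (metis append_take_drop_id sum_list_append)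
  finally show ?thesis using a unfolding in_block_def by linarith
qed

lemma block_of_iff: "a < sum_list bs \<Longrightarrow> block_of bs a = l \<longleftrightarrow> in_block bs l a"
  using someI_ex[OF in_block_exists] in_block_unique unfolding block_of_def by metis

lemma block_nonzero:
  assumes "l < length bs" "k < length bs"
  shows "block bs M l k \<noteq> 0\<^sub>m (bs ! l) (bs ! k) \<longleftrightarrow> (\<exists>a b. in_block bs l a \<and> in_block bs k b \<and> M $$ (a, b) \<noteq> 0)"
proof
  assume "block bs M l k \<noteq> 0\<^sub>m (bs ! l) (bs ! k)"
  then obtain i j where "i < bs ! l" "j < bs ! k" "M $$ (sum_list (take l bs) + i, sum_list (take k bs) + j) \<noteq> 0"
    unfolding block_def mat_eq_iff by auto
  then show "\<exists>a b. in_block bs l a \<and> in_block bs k b \<and> M $$ (a, b) \<noteq> 0"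
    using assms by (intro exI[of _ "sum_list (take l bs) + i"] exI[of _ "sum_list (take k bs) + j"]) (auto simp: in_block_def)
next
  assume "\<exists>a b. in_block bs l a \<and> in_block bs k b \<and> M $$ (a, b) \<noteq> 0"
  then obtain a b where ab: "in_block bs l a" "in_block bs k b" "M $$ (a, b) \<noteq> 0" by blast
  define i where "i = a - sum_list (take l bs)" define j where "j = b - sum_list (take k bs)"
  have ij: "i < bs ! l" "j < bs ! k" "sum_list (take l bs) + i = a" "sum_list (take k bs) + j = b"
    using ab unfolding i_def j_def in_block_def by auto
  then have "block bs M l k $$ (i, j) \<noteq> 0" using ab unfolding block_def by simp
  then show "block bs M l k \<noteq> 0\<^sub>m (bs ! l) (bs ! k)" using ij by auto
qed

text \<open>\<open>s\<close> is extended by 0 outside the index range, since the bounds on entries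
  in \<open>variance_matrix\<close> concern all natural numbers. The two graphs are shown to be
  equal, not merely isomorphic, so \<open>\<kappa>\<close> carries over at once.\<close>

lemma block_structure_of_normal_form:
  fixes P S :: "real mat"
  assumes "K \<ge> 1" and P: "P \<in> carrier_mat K K"
    and P01: "\<And>i j. i < K \<Longrightarrow> j < K \<Longrightarrow> 0 \<le> P $$ (i, j) \<and> P $$ (i, j) < 1"
    and irr: "irreducible_mat P" and S: "S = variance_profile P" and nf: "normal_form S Q1 Q2 bs"
  defines "s \<equiv> \<lambda>i j. if i < K \<and> j < K then S $$ (i, j) else 0"
  shows "\<exists>\<pi> \<tau>0 c0 rb cb. block_structure K s \<pi> \<tau>0 c0 (length bs) rb cb \<and>
    block_graph S Q1 Q2 bs = block_structure.gr K s (length bs) rb cb"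
proof -
  have SK: "S \<in> carrier_mat K K" "dim_row S = K" using P unfolding S variance_profile_def by auto
  have sP: "s i j = P $$ (i, j) * (1 - P $$ (i, j))" if "i < K" "j < K" for i j
    using that P unfolding s_def S variance_profile_def by simp
  have s0: "s i j \<ge> 0" for i j using sP[of i j] P01[of i j] by (cases "i < K \<and> j < K") (auto simp: s_def)
  have s1: "s i j \<le> 1" for i j
  proof (cases "i < K \<and> j < K")
    case True
    then have "P $$ (i, j) * (1 - P $$ (i, j)) \<le> 1 * 1" using P01[of i j] by (intro mult_mono) auto
    then show ?thesis using sP True by simp
  qed (auto simp: s_def)
  have s_pos: "s i j > 0 \<longleftrightarrow> S $$ (i, j) \<noteq> 0" if "i < K" "j < K" for i j
    using s0[of i j] that unfolding s_def by (auto simp: order_less_le)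
  \<comment> \<open>Because probabilities are strictly below 1, \<open>P\<close> and
    \<open>S\<close> have the same zero pattern where \<open>P\<close> is positive, and
    irreducibility passes from \<open>P\<close> to \<open>s\<close>.\<close>
  have sP_pos: "s i j > 0" if "i < K" "j < K" "P $$ (i, j) \<noteq> 0" for i j
    using sP[OF that(1,2)] P01[OF that(1,2)] that(3) by simp
  obtain \<pi>1 where p1: "\<pi>1 permutes {..<K}" "Q1 = mat K K (\<lambda>(i, j). if j = \<pi>1 i then 1 else 0)"
    using nf unfolding normal_form_def permutation_mat_def SK by blast
  obtain \<pi>2 where p2: "\<pi>2 permutes {..<K}" "Q2 = mat K K (\<lambda>(i, j). if j = \<pi>2 i then 1 else 0)"
    using nf unfolding normal_form_def permutation_mat_def SK by blast
  define St where "St = Q1 * S * Q2\<^sup>T"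
  have St: "St $$ (a, b) = S $$ (\<pi>1 a, \<pi>2 b)" if "a < K" "b < K" for a b
    unfolding St_def by (rule permutation_product(1)[OF SK(1) p1(1) p2(1) p1(2) p2(2) that])
  have Qt: "(Q1 * Q2\<^sup>T) $$ (a, b) = (if \<pi>1 a = \<pi>2 b then 1 else 0)" if "a < K" "b < K" for a b
    by (rule permutation_product(2)[OF SK(1) p1(1) p2(1) p1(2) p2(2) that])
  have bsK: "sum_list bs = K" using nf unfolding normal_form_def SK by simp
  have tri: "block bs St l k = 0\<^sub>m (bs ! l) (bs ! k)" if "l < length bs" "k < l" for l k
    using nf that unfolding normal_form_def St_def Let_def by blast
  have prim: "primitive_mat (block bs St l l)" "\<And>i. i < bs ! l \<Longrightarrow> block bs St l l $$ (i, i) > 0" if "l < length bs" for l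
    using nf that unfolding normal_form_def St_def Let_def by blast+
  define q1 where "q1 = inv_into UNIV \<pi>1" define q2 where "q2 = inv_into UNIV \<pi>2"
  have q: "\<pi>1 (q1 i) = i" "q1 (\<pi>1 i) = i" "\<pi>2 (q2 i) = i" "q2 (\<pi>2 i) = i" for i
    unfolding q1_def q2_def using permutes_inverses[OF p1(1)] permutes_inverses[OF p2(1)] by auto
  have lt: "\<pi>1 i < K" "\<pi>2 i < K" "q1 i < K" "q2 i < K" if "i < K" for i
    using permutes_in_image[OF p1(1), of i] permutes_in_image[OF p2(1), of i]
      permutes_in_image[OF permutes_inv[OF p1(1)], of i] permutes_in_image[OF permutes_inv[OF p2(1)], of i] that
    unfolding q1_def q2_def by auto
  \<comment> \<open>Diagonal position \<open>a\<close> of the permuted matrix holds the entry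
    \<open>(\<pi>1 a, \<pi>2 a)\<close> of \<open>S\<close>. So \<open>\<pi>\<close> sends a row to
    the column meeting it on the diagonal, and the positive diagonal makes it a support
    permutation.\<close>
  define \<pi> where "\<pi> = \<pi>2 \<circ> q1"
  define rb where "rb = (\<lambda>i. block_of bs (q1 i))"
  define cb where "cb = (\<lambda>i. block_of bs (q2 i))"
  have ib: "in_block bs (block_of bs a) a" if "a < K" for a using block_of_iff that bsK by blast
  have ibK: "a < K \<and> block_of bs a = l" if "in_block bs l a" for a l
    using in_block_less[OF that] block_of_iff that bsK by blast
  have diag: "S $$ (\<pi>1 a, \<pi>2 a) > 0" if a: "a < K" for a
  proof -
    define l where "l = block_of bs a"
    have l: "in_block bs l a" unfolding l_def by (rule ib[OF a])
    define i where "i = a - sum_list (take l bs)"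
    have i: "i < bs ! l" "sum_list (take l bs) + i = a" "l < length bs" using l unfolding i_def in_block_def by auto
    have "block bs St l l $$ (i, i) > 0" using prim(2)[OF i(3) i(1)] .
    then show ?thesis using i St[OF a a] unfolding block_def by simp
  qed
  have vm: "variance_matrix K s" using assms(1) s0 s1 by unfold_locales auto
  have sm: "supported_matrix K s \<pi>"
  proof (intro supported_matrix.intro vm supported_matrix_axioms.intro)
    show "\<pi> permutes {..<K}" unfolding \<pi>_def q1_def by (intro permutes_compose permutes_inv p1 p2)
    show "s i (\<pi> i) > 0" if "i < K" for i
    proof -
      have "S $$ (\<pi>1 (q1 i), \<pi>2 (q1 i)) > 0" by (rule diag) (rule lt[OF that])
      then show ?thesis using that lt unfolding s_def \<pi>_def q by simp
    qed
  qed
  have im: "irreducible_matrix K s \<pi>"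
  proof (intro irreducible_matrix.intro sm irreducible_matrix_axioms.intro)
    fix i j assume ij: "i < K" "j < K"
    then obtain m where "(P ^\<^sub>m m) $$ (i, j) > 0" using irr P unfolding irreducible_mat_def by auto
    then have "(P ^\<^sub>m m) $$ (i, j) \<noteq> 0" by simp
    from pow_mat_path[OF P ij this] have "(i, j) \<in> {(i, j). i < K \<and> j < K \<and> P $$ (i, j) \<noteq> 0}\<^sup>*" .
    moreover have "{(i, j). i < K \<and> j < K \<and> P $$ (i, j) \<noteq> 0} \<subseteq> pos_edges K s"
      unfolding pos_edges_def using sP_pos by auto
    ultimately show "(i, j) \<in> (pos_edges K s)\<^sup>*" using rtrancl_mono by blast
  qed
  obtain \<tau>0 c0 where cm: "controlled_matrix K s \<pi> \<tau>0 c0" using irreducible_matrix.controlled_matrix_exists[OF im] by blast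
  have bst: "block_structure K s \<pi> \<tau>0 c0 (length bs) rb cb"
  proof (intro block_structure.intro cm block_structure_axioms.intro)
    fix i assume i: "i < K"
    show "rb i < length bs" "cb i < length bs" unfolding rb_def cb_def using ib lt[OF i] unfolding in_block_def by auto
    show "cb (\<pi> i) = rb i" unfolding cb_def rb_def \<pi>_def by (simp add: q)
  next
    fix i j assume ij: "i < K" "j < K" "s i j > 0"
    show "rb i \<le> cb j"
    proof (rule ccontr)
      assume "\<not> rb i \<le> cb j"
      then have lt': "cb j < rb i" by simp
      have in_b: "in_block bs (rb i) (q1 i)" "in_block bs (cb j) (q2 j)" unfolding rb_def cb_def using ib lt ij by auto
      have ll: "rb i < length bs" "cb j < length bs" using in_b unfolding in_block_def by auto
      have "St $$ (q1 i, q2 j) \<noteq> 0" using St[OF lt(3)[OF ij(1)] lt(4)[OF ij(2)]] ij s_pos unfolding q by auto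
      then have "block bs St (rb i) (cb j) \<noteq> 0\<^sub>m (bs ! rb i) (bs ! cb j)" using block_nonzero[OF ll] in_b by blast
      then show False using tri[OF ll(1) lt'] by simp
    qed
  next
    fix i i' assume ii: "i < K" "i' < K" "rb i = rb i'"
    define l where "l = rb i"
    have in_b: "in_block bs l (q1 i)" "in_block bs l (q1 i')" unfolding l_def using ii ib lt unfolding rb_def by metis+
    define off where "off = sum_list (take l bs)"
    define d where "d = bs ! l"
    define Bl where "Bl = block bs St l l"
    have ll: "l < length bs" using in_b unfolding in_block_def by auto
    have Bc: "Bl \<in> carrier_mat d d" unfolding Bl_def block_def d_def by simp
    define x where "x = q1 i - off" define x' where "x' = q1 i' - off"
    have x: "x < d" "x' < d" "off + x = q1 i" "off + x' = q1 i'"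
      using in_b unfolding x_def x'_def off_def d_def in_block_def by auto
    obtain m where "(Bl ^\<^sub>m m) $$ (x, x') > 0" using prim(1)[OF ll] x Bc unfolding primitive_mat_def Bl_def[symmetric] by auto
    then have "(Bl ^\<^sub>m m) $$ (x, x') \<noteq> 0" by simp
    from pow_mat_path[OF Bc x(1,2) this] have "(x, x') \<in> {(i, j). i < d \<and> j < d \<and> Bl $$ (i, j) \<noteq> 0}\<^sup>*" .
    \<comment> \<open>A path inside the block is carried to original row indices: as
      \<open>\<pi> (\<pi>1 b) = \<pi>2 b\<close>, the entry at positions \<open>a\<close>,
      \<open>b\<close> is \<open>s (\<pi>1 a) (\<pi> (\<pi>1 b))\<close>.\<close>
    then have "(\<pi>1 (off + x), \<pi>1 (off + x')) \<in> {(i, i'). i < K \<and> i' < K \<and> s i (\<pi> i') > 0}\<^sup>*"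
    proof (induction rule: rtrancl_induct)
      case (step y z)
      then have yz: "y < d" "z < d" "Bl $$ (y, z) \<noteq> 0" by auto
      have oK: "off + y < K" "off + z < K"
        using ibK[of l "off + y"] ibK[of l "off + z"] yz ll unfolding in_block_def off_def d_def by auto
      have "St $$ (off + y, off + z) \<noteq> 0" using yz unfolding Bl_def block_def off_def d_def by simp
      then have "S $$ (\<pi>1 (off + y), \<pi>2 (off + z)) \<noteq> 0" using St[OF oK] by simp
      then have "s (\<pi>1 (off + y)) (\<pi>2 (off + z)) > 0" using s_pos lt oK by auto
      then have "(\<pi>1 (off + y), \<pi>1 (off + z)) \<in> {(i, i'). i < K \<and> i' < K \<and> s i (\<pi> i') > 0}"
        using lt oK unfolding \<pi>_def by (auto simp: q)
      with step.IH show ?case by (rule rtrancl_into_rtrancl)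
    qed auto
    then show "(i, i') \<in> {(i, i'). i < K \<and> i' < K \<and> s i (\<pi> i') > 0}\<^sup>*" unfolding x q .
  qed
  have lhd: "{(l, Lhd, k) | l k. l < length bs \<and> k < length bs \<and> l \<noteq> k \<and> block bs (Q1 * S * Q2\<^sup>T) l k \<noteq> 0\<^sub>m (bs ! l) (bs ! k)} =
      {(rb i, Lhd, cb j) | i j. i < K \<and> j < K \<and> s i j > 0 \<and> rb i \<noteq> cb j}" (is "?A = ?B")
  proof (intro Set.set_eqI iffI)
    fix e assume "e \<in> ?A"
    then obtain l k where e: "e = (l, Lhd, k)" "l < length bs" "k < length bs" "l \<noteq> k" "block bs St l k \<noteq> 0\<^sub>m (bs ! l) (bs ! k)"
      unfolding St_def by blast
    then obtain a b where ab: "in_block bs l a" "in_block bs k b" "St $$ (a, b) \<noteq> 0" using block_nonzero by blast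
    have abK: "a < K" "b < K" "block_of bs a = l" "block_of bs b = k" using ibK ab by auto
    have "s (\<pi>1 a) (\<pi>2 b) > 0" using ab(3) St abK s_pos lt by auto
    moreover have "rb (\<pi>1 a) = l" "cb (\<pi>2 b) = k" unfolding rb_def cb_def q using abK by auto
    ultimately show "e \<in> ?B" using e lt abK by blast
  next
    fix e assume "e \<in> ?B"
    then obtain i j where e: "e = (rb i, Lhd, cb j)" "i < K" "j < K" "s i j > 0" "rb i \<noteq> cb j" by blast
    have in_b: "in_block bs (rb i) (q1 i)" "in_block bs (cb j) (q2 j)" unfolding rb_def cb_def using ib lt e by auto
    have ll: "rb i < length bs" "cb j < length bs" using in_b unfolding in_block_def by auto
    have "St $$ (q1 i, q2 j) \<noteq> 0" using St[OF lt(3)[OF e(2)] lt(4)[OF e(3)]] e s_pos unfolding q by auto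
    then have "block bs St (rb i) (cb j) \<noteq> 0\<^sub>m (bs ! rb i) (bs ! cb j)" using block_nonzero[OF ll] in_b by blast
    then show "e \<in> ?A" using e ll unfolding St_def by blast
  qed
  have prec: "{(l, Prec, k) | l k. l < length bs \<and> k < length bs \<and> block bs (Q1 * Q2\<^sup>T) l k \<noteq> 0\<^sub>m (bs ! l) (bs ! k)} =
      {(rb i, Prec, cb i) | i. i < K}" (is "?A = ?B")
  proof (intro Set.set_eqI iffI)
    fix e assume "e \<in> ?A"
    then obtain l k where e: "e = (l, Prec, k)" "l < length bs" "k < length bs" "block bs (Q1 * Q2\<^sup>T) l k \<noteq> 0\<^sub>m (bs ! l) (bs ! k)"
      by blast
    then obtain a b where ab: "in_block bs l a" "in_block bs k b" "(Q1 * Q2\<^sup>T) $$ (a, b) \<noteq> 0" using block_nonzero by blast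
    have abK: "a < K" "b < K" "block_of bs a = l" "block_of bs b = k" using ibK ab by auto
    \<comment> \<open>A non-zero entry of \<open>Q1 * Q2\<^sup>T\<close> means that row position
      \<open>a\<close> and column position \<open>b\<close> carry the same original index; this is
      the \<open>i\<close> of the arc.\<close>
    have eq: "\<pi>1 a = \<pi>2 b" using ab(3) Qt[OF abK(1,2)] by (auto split: if_splits)
    have "rb (\<pi>1 a) = l" "cb (\<pi>2 b) = k" unfolding rb_def cb_def q using abK by auto
    then show "e \<in> ?B" using e lt(1)[OF abK(1)] eq by auto
  next
    fix e assume "e \<in> ?B"
    then obtain i where e: "e = (rb i, Prec, cb i)" "i < K" by blast
    have in_b: "in_block bs (rb i) (q1 i)" "in_block bs (cb i) (q2 i)" unfolding rb_def cb_def using ib lt e by auto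
    have ll: "rb i < length bs" "cb i < length bs" using in_b unfolding in_block_def by auto
    have "(Q1 * Q2\<^sup>T) $$ (q1 i, q2 i) \<noteq> 0" using Qt[OF lt(3,4)[OF e(2)]] by (simp add: q)
    then have "block bs (Q1 * Q2\<^sup>T) (rb i) (cb i) \<noteq> 0\<^sub>m (bs ! rb i) (bs ! cb i)" using block_nonzero[OF ll] in_b by blast
    then show "e \<in> ?A" using e ll by blast
  qed
  have "block_graph S Q1 Q2 bs = block_structure.gr K s (length bs) rb cb"
    unfolding block_graph_def block_structure.gr_def[OF bst] lhd prec ..
  with bst show ?thesis by blast
qed

theorem corollary2p4:
  fixes K :: nat and P S Q1 Q2 :: "real mat" and bs :: "nat list" and \<kappa> :: real
  assumes "K \<ge> 1" and "P \<in> carrier_mat K K"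
    and "\<And>i j. i < K \<Longrightarrow> j < K \<Longrightarrow> 0 \<le> P $$ (i, j) \<and> P $$ (i, j) < 1"
    and "irreducible_mat P" and "has_support P"
    and "S = variance_profile P"
    and "normal_form S Q1 Q2 bs"
    and "\<kappa> = min_cycle_ratio (block_graph S Q1 Q2 bs)"
  shows "\<exists>c_NS.
    ((\<lambda>t. ln (LINT z:cball 0 t|lborel. scdos S z) / ln t) \<longlongrightarrow> c_NS) (at_right 0) \<and>
    c_NS = 2 * \<kappa> \<and>
    (\<exists>l1 l2 :: nat. c_NS = 2 * ((1 + real l1) / (1 + real l1 + real l2)))"
proof -
  define s where "s = (\<lambda>i j. if i < K \<and> j < K then S $$ (i, j) else 0)"
  obtain \<pi> \<tau>0 c0 rb cb where bst: "block_structure K s \<pi> \<tau>0 c0 (length bs) rb cb"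
    and gr: "block_graph S Q1 Q2 bs = block_structure.gr K s (length bs) rb cb"
    using block_structure_of_normal_form[OF assms(1-4,6,7)] unfolding s_def by blast
  have S: "S \<in> carrier_mat K K" using assms(2) unfolding assms(6) variance_profile_def by simp
  have s: "s i j = S $$ (i, j)" if "i < K" "j < K" for i j using that unfolding s_def by simp
  note me = block_structure.mass_exponent[OF bst S s, folded gr assms(8)]
  from me(2) obtain l1 l2 :: nat where "\<kappa> = (1 + real l1) / (1 + real l1 + real l2)" by blast
  with me(1) show ?thesis by (intro exI[of _ "2 * \<kappa>"]) auto
qed

end
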